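(* Let $p$ be a prime, let $K$ be a finite field extension of $\mathbb{Q}_p$ of degree $d$, ramification index $e$ and inertia degree $f$, let $R$ be the ring of integers of $K$, and let $q=p^f$ be the cardinality of the residue field of $R$. Let $l\geq 1$, $k\geq 1$ and $m\geq e$ be integers. Then the following holds. (1) If $(l^2+2l)d\leq p$, then the compact $p$-adic analytic group $\mathrm{SL}_{l+1}(R)$ is self-similar of index $$q^{lk+(l^2+2l)m}\prod_{i=1}^{l}\left(1-\frac{1}{q^{i+1}}\right).$$ (2) If $(2l^2+l)d\leq p$, then the compact $p$-adic analytic group $\mathrm{Sp}_{2l}(R)$ is self-similar of index $$q^{2lk+(2l^2+l)m}\prod_{i=1}^{l}\left(1-\frac{1}{q^{2i}}\right).$$ (3) If $l\geq 2$ and $(2l^2-l)d\leq p$, then the compact $p$-adic analytic group $\mathrm{SO}_{2l}(R)$ is self-similar of index $$q^{(2l-2)k+(2l^2-l)m}\left(1-\frac{1}{q^{l}}\right)\prod_{i=1}^{l-1}\left(1-\frac{1}{q^{2i}}\right).$$ (4) If $(2l^2+l)d\leq p$, then the compact $p$-adic analytic group $\mathrm{SO}_{2l+1}(R)$ is self-similar of index $$q^{(2l-1)k+(2l^2+l)m}\prod_{i=1}^{l}\left(1-\frac{1}{q^{2i}}\right).$$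
   Context: Self-similarity of groups: for an integer $\delta\geq 1$, a group $G$ is self-similar of index $\delta$ if it admits a faithful self-similar action on a regular rooted $\delta$-ary tree that is transitive on the first level. Equivalently (known fact), $G$ admits a simple virtual endomorphism of index $\delta$: a group homomorphism $\varphi:D\to G$, where $D\leq G$ is a subgroup of index $\delta$, such that there is no nontrivial normal subgroup $N$ of $G$ with $N\subseteq D$ and $\varphi(N)\subseteq N$. Classical groups: $\mathrm{SL}_n(R)=\{x\in \mathrm{M}_n(R): \det x=1\}$. For $n=2l$, $\mathrm{Sp}_{n}(R)=\{x\in \mathrm{M}_{n}(R): x^{\mathrm t}sx=s\}$ with $s=\begin{bmatrix}0&\mathrm{Id}_l\\-\mathrm{Id}_l&0\end{bmatrix}$. $\mathrm{SO}_n(R)=\{x\in \mathrm{SL}_n(R): x^{\mathrm t}sx=s\}$ with $s=\begin{bmatrix}0&\mathrm{Id}_l\\ \mathrm{Id}_l&0\end{bmatrix}$ if $n=2l$, and $s=\begin{bmatrix}1&0&0\\0&0&\mathrm{Id}_l\\0&\mathrm{Id}_l&0\end{bmatrix}$ if $n=2l+1$. *)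

theory Defs
  imports
    "HOL-Algebra.Algebra"
    "HOL-Algebra.Algebraic_Closure_Type"
    "Jordan_Normal_Form.Determinant"
begin

section \<open>The field of p-adic numbers\<close>

definition padic_abs :: "nat \<Rightarrow> rat \<Rightarrow> real" where
  "padic_abs p x = (if x = 0 then 0
     else (case quotient_of x of (a, b) \<Rightarrow>
       real p powi (int (multiplicity (int p) b) - int (multiplicity (int p) a))))"

definition padic_Cauchy :: "nat \<Rightarrow> (nat \<Rightarrow> rat) \<Rightarrow> bool" where
  "padic_Cauchy p s \<longleftrightarrow>
     (\<forall>\<epsilon>>0. \<exists>N. \<forall>i\<ge>N. \<forall>j\<ge>N. padic_abs p (s i - s j) < \<epsilon>)"

definition padic_Cauchy_ring :: "nat \<Rightarrow> (nat \<Rightarrow> rat) ring" where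
  "padic_Cauchy_ring p =
     \<lparr> carrier = {s. padic_Cauchy p s},
       monoid.mult = (\<lambda>s t n. s n * t n),
       one = (\<lambda>n. 1),
       ring.zero = (\<lambda>n. 0),
       add = (\<lambda>s t n. s n + t n) \<rparr>"

definition padic_null :: "nat \<Rightarrow> (nat \<Rightarrow> rat) set" where
  "padic_null p = {s. (\<lambda>n. padic_abs p (s n)) \<longlonglongrightarrow> 0}"

text \<open>The completion of the rationals with respect to the p-adic absolute value.\<close>

definition Qp :: "nat \<Rightarrow> (nat \<Rightarrow> rat) set ring" where
  "Qp p = padic_Cauchy_ring p Quot padic_null p"

definition Qp_abs :: "nat \<Rightarrow> (nat \<Rightarrow> rat) set \<Rightarrow> real" where
  "Qp_abs p a = lim (\<lambda>n. padic_abs p ((SOME s. s \<in> a) n))"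

definition Zp :: "nat \<Rightarrow> (nat \<Rightarrow> rat) set set" where
  "Zp p = {a \<in> carrier (Qp p). Qp_abs p a \<le> 1}"


section \<open>Finite extensions of the p-adic numbers\<close>

text \<open>An extension \<open>K\<close> of the field of p-adic numbers is a type of class \<open>field\<close>
  together with a ring homomorphism \<open>\<iota>\<close> from \<^term>\<open>Qp p\<close> to it.\<close>

definition padic_extension_of_degree ::
    "nat \<Rightarrow> ((nat \<Rightarrow> rat) set \<Rightarrow> 'k::field) \<Rightarrow> nat \<Rightarrow> bool" where
  "padic_extension_of_degree p \<iota> d \<longleftrightarrow>
     \<iota> \<in> Ring.ring_hom (Qp p) ring_of_type_algebra \<and>
     ring.dimension ring_of_type_algebra d (\<iota> ` carrier (Qp p)) (UNIV :: 'k set)"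

text \<open>The ring of integers is the integral closure of the p-adic integers.\<close>

definition integers_of ::
    "nat \<Rightarrow> ((nat \<Rightarrow> rat) set \<Rightarrow> 'k::field) \<Rightarrow> 'k set" where
  "integers_of p \<iota> =
     {x. \<exists>g. lead_coeff g = 1 \<and> (\<forall>i. coeff g i \<in> \<iota> ` Zp p) \<and> poly g x = 0}"

definition integer_ring ::
    "nat \<Rightarrow> ((nat \<Rightarrow> rat) set \<Rightarrow> 'k::field) \<Rightarrow> 'k ring" where
  "integer_ring p \<iota> = ring_of_type_algebra\<lparr>carrier := integers_of p \<iota>\<rparr>"

text \<open>Here \<open>P\<close> is the maximal ideal of the ring of integers. The base field of the
  residue extension is the image of \<^term>\<open>Zp p\<close> in the residue field.\<close>

definition is_ramification_index ::
    "nat \<Rightarrow> ((nat \<Rightarrow> rat) set \<Rightarrow> 'k::field) \<Rightarrow> 'k set \<Rightarrow> nat \<Rightarrow> bool" where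
  "is_ramification_index p \<iota> P e \<longleftrightarrow>
     PIdl\<^bsub>integer_ring p \<iota>\<^esub> (of_nat p) = P [^]\<^bsub>ideals_set (integer_ring p \<iota>)\<^esub> e"

definition is_inertia_degree ::
    "nat \<Rightarrow> ((nat \<Rightarrow> rat) set \<Rightarrow> 'k::field) \<Rightarrow> 'k set \<Rightarrow> nat \<Rightarrow> bool" where
  "is_inertia_degree p \<iota> P f \<longleftrightarrow>
     ring.dimension (integer_ring p \<iota> Quot P) f
       ((\<lambda>z. P +>\<^bsub>integer_ring p \<iota>\<^esub> \<iota> z) ` Zp p)
       (carrier (integer_ring p \<iota> Quot P))"


section \<open>Classical groups\<close>

text \<open>The coefficient ring \<open>R\<close> is a subring of the type \<open>'a\<close>.\<close>

definition SL :: "nat \<Rightarrow> 'a::comm_ring_1 set \<Rightarrow> 'a mat ring" where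
  "SL n R = (ring_mat TYPE('a) n ())\<lparr>carrier :=
     {x \<in> carrier_mat n n. elements_mat x \<subseteq> R \<and> det x = 1}\<rparr>"

definition sp_form :: "nat \<Rightarrow> 'a::comm_ring_1 mat" where
  "sp_form l = four_block_mat (0\<^sub>m l l) (1\<^sub>m l) (- 1\<^sub>m l) (0\<^sub>m l l)"

definition so_even_form :: "nat \<Rightarrow> 'a::comm_ring_1 mat" where
  "so_even_form l = four_block_mat (0\<^sub>m l l) (1\<^sub>m l) (1\<^sub>m l) (0\<^sub>m l l)"

definition so_odd_form :: "nat \<Rightarrow> 'a::comm_ring_1 mat" where
  "so_odd_form l =
     four_block_mat (1\<^sub>m 1) (0\<^sub>m 1 (2 * l)) (0\<^sub>m (2 * l) 1) (so_even_form l)"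

definition Sp_even :: "nat \<Rightarrow> 'a::comm_ring_1 set \<Rightarrow> 'a mat ring" where
  "Sp_even l R = (ring_mat TYPE('a) (2 * l) ())\<lparr>carrier :=
     {x \<in> carrier_mat (2 * l) (2 * l). elements_mat x \<subseteq> R \<and>
        transpose_mat x * sp_form l * x = sp_form l}\<rparr>"

definition SO_even :: "nat \<Rightarrow> 'a::comm_ring_1 set \<Rightarrow> 'a mat ring" where
  "SO_even l R = (SL (2 * l) R)\<lparr>carrier :=
     {x \<in> carrier (SL (2 * l) R). transpose_mat x * so_even_form l * x = so_even_form l}\<rparr>"

definition SO_odd :: "nat \<Rightarrow> 'a::comm_ring_1 set \<Rightarrow> 'a mat ring" where
  "SO_odd l R = (SL (2 * l + 1) R)\<lparr>carrier :=
     {x \<in> carrier (SL (2 * l + 1) R). transpose_mat x * so_odd_form l * x = so_odd_form l}\<rparr>"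


section \<open>Self-similar groups\<close>

text \<open>The vertices of the regular rooted tree are the words over \<open>{..<\<delta>}\<close>, the root is
  the empty word, and edges are directed away from the root. A bijection of the vertices
  preserving and reflecting directed edges automatically fixes the root, the only vertex
  without an incoming edge.\<close>

definition tree_vertices :: "nat \<Rightarrow> nat list set" where
  "tree_vertices \<delta> = lists {..<\<delta>}"

definition tree_edges :: "nat \<Rightarrow> (nat list \<times> nat list) set" where
  "tree_edges \<delta> = {(w, w @ [x]) | w x. w \<in> tree_vertices \<delta> \<and> x < \<delta>}"

definition tree_action ::
    "('g, 'b) monoid_scheme \<Rightarrow> nat \<Rightarrow> ('g \<Rightarrow> nat list \<Rightarrow> nat list) \<Rightarrow> bool" where
  "tree_action G \<delta> \<phi> \<longleftrightarrow>
     group_action G (tree_vertices \<delta>) \<phi> \<and>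
     (\<forall>g\<in>carrier G. \<forall>u\<in>tree_vertices \<delta>. \<forall>v\<in>tree_vertices \<delta>.
        (\<phi> g u, \<phi> g v) \<in> tree_edges \<delta> \<longleftrightarrow> (u, v) \<in> tree_edges \<delta>)"

definition self_similar_action ::
    "('g, 'b) monoid_scheme \<Rightarrow> nat \<Rightarrow> ('g \<Rightarrow> nat list \<Rightarrow> nat list) \<Rightarrow> bool" where
  "self_similar_action G \<delta> \<phi> \<longleftrightarrow>
     tree_action G \<delta> \<phi> \<and>
     (\<forall>g\<in>carrier G. \<forall>x<\<delta>. \<exists>h\<in>carrier G. \<exists>y<\<delta>.
        \<forall>w\<in>tree_vertices \<delta>. \<phi> g (x # w) = y # \<phi> h w)"

definition self_similar_of_index :: "('g, 'b) monoid_scheme \<Rightarrow> nat \<Rightarrow> bool" where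
  "self_similar_of_index G \<delta> \<longleftrightarrow> \<delta> \<ge> 1 \<and>
     (\<exists>\<phi>. self_similar_action G \<delta> \<phi> \<and>
       faithful_action G (tree_vertices \<delta>) \<phi> \<and>
       (\<forall>x<\<delta>. \<forall>y<\<delta>. \<exists>g\<in>carrier G. \<phi> g [x] = [y]))"

end

theory Submission
  imports Defs "HOL-Number_Theory.Cong"
begin

text \<open>Let \<open>\<pi>\<close> be a uniformizer of \<open>R\<close>, let \<open>G\<close> be one of the groups and let \<open>a\<close> be a diagonal similitude
  whose entries are powers of \<open>\<pi>\<close>. On the subgroup \<open>D\<close> of those \<open>x\<close> for which both \<open>x\<close> and \<open>a x a\<^sup>-\<^sup>1\<close> are
  congruent to 1 modulo \<open>\<pi>\<^sup>m\<close>, conjugation by \<open>a\<close> is a virtual endomorphism. An element \<open>x\<close> of a normal subgroup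
  invariant under it has zero entries wherever iterated conjugation would make them non-integral, hence every
  translate of one basis vector is an eigenvector of \<open>x\<close>, so that \<open>x\<close> is a scalar, and being a root of unity
  congruent to 1 it is trivial. The index of \<open>D\<close> is computed modulo a high power of \<open>\<pi>\<close>: congruence subgroups
  are counted through the Cayley transform (or, for the special linear group, through the determinant), and the
  group over the residue field through its action on the columns.\<close>

section \<open>Virtual endomorphisms and self-similar actions\<close>

text \<open>Once \<open>M\<close> is at least \<open>m\<close> plus the largest exponent in
  \<open>a\<close>, the subgroup D contains everything congruent to 1 modulo
  \<open>\<pi> ^ M\<close>; this is why its index is a ratio of two finite cardinalities of residue
  images. Origin of the exponents: the residue group contributes q^dim times the product in the
  statement, passing from level 1 to level m contributes q^((m-1) dim), and conjugation by
  \<open>a\<close> asks of entry (i,j) as much extra divisibility as the j-th exponent exceeds the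
  i-th. For SL the exponents are k,0,...,0, so l entries pay k each. For a form of size n they are
  2k at one index, 0 at its partner and k elsewhere: paired exponents then have constant sum, which
  is what makes \<open>a\<close> a similitude; n-2 independent entries pay k, and in the symplectic
  case one more pays 2k. The largest exponent occurs exactly once, which turns vanishing entries
  into an eigenvector. The bounds on p serve to make 2 and l+1 units: 2 for the Cayley transform and
  reflections, l+1 for scalars in SL.\<close>

primrec tree_act :: "('g \<Rightarrow> nat \<Rightarrow> nat) \<Rightarrow> ('g \<Rightarrow> nat \<Rightarrow> 'g) \<Rightarrow> nat list \<Rightarrow> 'g \<Rightarrow> nat list" where
  "tree_act \<pi> \<sigma> [] g = []"
| "tree_act \<pi> \<sigma> (x # w) g = \<pi> g x # tree_act \<pi> \<sigma> w (\<sigma> g x)"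

lemma length_tree_act [simp]: "length (tree_act \<pi> \<sigma> w g) = length w"
  by (induction w arbitrary: g) auto

lemma take_tree_act: "take n (tree_act \<pi> \<sigma> w g) = tree_act \<pi> \<sigma> (take n w) g"
proof (induction w arbitrary: n g)
  case (Cons a w)
  then show ?case by (cases n) auto
qed simp

text \<open>Edges are described by length and prefix because these are what \<open>tree_act\<close>
  preserves by construction (\<open>length_tree_act\<close>, \<open>take_tree_act\<close>).\<close>

lemma tree_edges_iff:
  "(u, v) \<in> tree_edges \<delta> \<longleftrightarrow>
     u \<in> tree_vertices \<delta> \<and> v \<in> tree_vertices \<delta> \<and> length v = Suc (length u) \<and> take (length u) v = u"
proof
  assume "u \<in> tree_vertices \<delta> \<and> v \<in> tree_vertices \<delta> \<and> length v = Suc (length u) \<and> take (length u) v = u"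
  then have u: "u \<in> tree_vertices \<delta>" and v: "v \<in> tree_vertices \<delta>" "length v = Suc (length u)" "take (length u) v = u"
    by auto
  have "v = u @ [v ! length u]"
    using v by (metis lessI take_Suc_conv_app_nth take_all_iff order_refl)
  moreover have "v ! length u < \<delta>"
    using v by (auto simp: tree_vertices_def in_lists_conv_set)
  ultimately show "(u, v) \<in> tree_edges \<delta>"
    using u unfolding tree_edges_def by blast
qed (auto simp: tree_edges_def tree_vertices_def in_lists_conv_set)

lemma (in group) inv_cancel:
  assumes "a \<in> carrier G" "b \<in> carrier G"
  shows "inv a \<otimes> (a \<otimes> b) = b" "a \<otimes> (inv a \<otimes> b) = b"
  using assms by (simp_all flip: m_assoc)

text \<open>The standard passage from a simple virtual endomorphism to a self-similar action.
  Letters index the left cosets of D, which g permutes; the element of D by which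
  \<open>g \<otimes> t x\<close> differs from its coset representative is sent by
  \<open>\<phi>\<close> to the element acting on the rest of the word. The kernel of the action is
  normal, lies in D and is \<open>\<phi>\<close>-invariant, so simplicity gives
  faithfulness.\<close>

lemma self_similar_of_index_if_virtual_endomorphism:
  fixes G (structure) and t :: "nat \<Rightarrow> 'g"
  assumes G: "group G" and D: "subgroup D G"
    and t: "\<And>x. x < \<delta> \<Longrightarrow> t x \<in> carrier G"
    and t_ex: "\<And>g. g \<in> carrier G \<Longrightarrow> \<exists>x<\<delta>. inv (t x) \<otimes> g \<in> D"
    and t_uniq: "\<And>g x y. \<lbrakk>g \<in> carrier G; x < \<delta>; y < \<delta>; inv (t x) \<otimes> g \<in> D; inv (t y) \<otimes> g \<in> D\<rbrakk> \<Longrightarrow> x = y"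
    and phi: "\<And>g. g \<in> D \<Longrightarrow> \<phi> g \<in> carrier G"
    and phi_mult: "\<And>g h. g \<in> D \<Longrightarrow> h \<in> D \<Longrightarrow> \<phi> (g \<otimes> h) = \<phi> g \<otimes> \<phi> h"
    and simple: "\<And>N. \<lbrakk>N \<lhd> G; N \<subseteq> D; \<phi> ` N \<subseteq> N\<rbrakk> \<Longrightarrow> N = {\<one>}"
  shows "self_similar_of_index G \<delta>"
proof -
  interpret group G by fact
  interpret D: subgroup D G by fact
  \<comment> \<open>\<open>\<pi> g x\<close> is the letter of the coset containing
    \<open>g \<otimes> t x\<close>, and \<open>\<sigma> g x\<close> below is the section of g at
    x.\<close>
  define \<pi> where "\<pi> g x = (SOME y. y < \<delta> \<and> inv (t y) \<otimes> (g \<otimes> t x) \<in> D)" for g x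
  define \<sigma> where "\<sigma> g x = \<phi> (inv (t (\<pi> g x)) \<otimes> (g \<otimes> t x))" for g x
  have pi: "\<pi> g x < \<delta>" "inv (t (\<pi> g x)) \<otimes> (g \<otimes> t x) \<in> D" if "g \<in> carrier G" "x < \<delta>" for g x
    using someI_ex[OF t_ex[of "g \<otimes> t x", unfolded Bex_def]] that t unfolding \<pi>_def by auto
  have pi_eq: "\<pi> g x = y" if "g \<in> carrier G" "x < \<delta>" "y < \<delta>" "inv (t y) \<otimes> (g \<otimes> t x) \<in> D" for g x y
    using t_uniq[of "g \<otimes> t x"] pi[of g x] that t by auto
  have sigma: "\<sigma> g x \<in> carrier G" if "g \<in> carrier G" "x < \<delta>" for g x
    unfolding \<sigma>_def using pi(2)[OF that] phi by blast
  \<comment> \<open>The correction terms of a product telescope; this one identity yields both the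
    permutation law \<open>pi_mult\<close> and the section law \<open>sigma_mult\<close>.\<close>
  have cocycle: "inv (t (\<pi> g (\<pi> h x))) \<otimes> (g \<otimes> h \<otimes> t x) =
      (inv (t (\<pi> g (\<pi> h x))) \<otimes> (g \<otimes> t (\<pi> h x))) \<otimes> (inv (t (\<pi> h x)) \<otimes> (h \<otimes> t x))"
    if "g \<in> carrier G" "h \<in> carrier G" "x < \<delta>" for g h x
  proof -
    let ?b = "t (\<pi> h x)" let ?c = "t (\<pi> g (\<pi> h x))"
    have c: "?b \<in> carrier G" "?c \<in> carrier G" "t x \<in> carrier G" using that pi t by auto
    then show ?thesis using that by (simp add: m_assoc inv_cancel)
  qed
  have pi_mult: "\<pi> (g \<otimes> h) x = \<pi> g (\<pi> h x)" if "g \<in> carrier G" "h \<in> carrier G" "x < \<delta>" for g h x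
    using that pi[of h x] pi[of g "\<pi> h x"] cocycle[OF that] by (intro pi_eq) auto
  have sigma_mult: "\<sigma> (g \<otimes> h) x = \<sigma> g (\<pi> h x) \<otimes> \<sigma> h x" if "g \<in> carrier G" "h \<in> carrier G" "x < \<delta>" for g h x
    unfolding \<sigma>_def pi_mult[OF that] cocycle[OF that]
    using that pi[of h x] pi[of g "\<pi> h x"] by (intro phi_mult) auto
  have phi_one: "\<phi> \<one> = \<one>"
    using phi_mult[of \<one> \<one>] phi[of \<one>] by (metis D.one_closed l_one one_closed r_cancel_one')
  have pi_one: "\<pi> \<one> x = x" if "x < \<delta>" for x
    using that t by (intro pi_eq) auto
  have sigma_one: "\<sigma> \<one> x = \<one>" if "x < \<delta>" for x
    unfolding \<sigma>_def using that t pi_one phi_one by auto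
  let ?V = "tree_vertices \<delta>" and ?a = "tree_act \<pi> \<sigma>"
  have V_Nil: "[] \<in> ?V" by (simp add: tree_vertices_def)
  have V_Cons: "x # w \<in> ?V \<longleftrightarrow> x < \<delta> \<and> w \<in> ?V" for x w by (simp add: tree_vertices_def)
  have V_take: "take n w \<in> ?V" if "w \<in> ?V" for n w
    using that in_set_takeD unfolding tree_vertices_def in_lists_conv_set by fastforce
  have a_V: "?a w g \<in> ?V" if "g \<in> carrier G" "w \<in> ?V" for w g
    using that by (induction w arbitrary: g) (auto simp: V_Cons V_Nil pi sigma)
  have a_mult: "?a w (g \<otimes> h) = ?a (?a w h) g" if "g \<in> carrier G" "h \<in> carrier G" "w \<in> ?V" for w g h
    using that by (induction w arbitrary: g h) (auto simp: V_Cons pi_mult sigma_mult pi sigma)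
  have a_one: "?a w \<one> = w" if "w \<in> ?V" for w
    using that by (induction w) (auto simp: V_Cons pi_one sigma_one)
  define \<Phi> where "\<Phi> g = restrict (\<lambda>w. ?a w g) ?V" for g
  have Phi: "\<Phi> g w = ?a w g" if "w \<in> ?V" for g w using that by (simp add: \<Phi>_def)
  have a_inv: "?a (?a w g) (inv g) = w" "?a (?a w (inv g)) g = w" if "g \<in> carrier G" "w \<in> ?V" for g w
    using a_mult[of "inv g" g w] a_mult[of g "inv g" w] that a_one by auto
  have Bij: "\<Phi> g \<in> Bij ?V" if g: "g \<in> carrier G" for g
  proof -
    have "bij_betw (\<lambda>w. ?a w g) ?V ?V"
      by (rule bij_betwI[where g = "\<lambda>w. ?a w (inv g)"]) (use g a_V a_inv in auto)
    then show ?thesis unfolding Bij_def \<Phi>_def by (auto cong: bij_betw_cong)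
  qed
  have hom: "group_hom G (BijGroup ?V) \<Phi>"
  proof (intro group_hom.intro group_hom_axioms.intro homI)
    fix g h assume gh: "g \<in> carrier G" "h \<in> carrier G"
    have "\<Phi> (g \<otimes> h) = compose ?V (\<Phi> g) (\<Phi> h)"
      unfolding compose_def by (rule ext) (use gh a_V a_mult in \<open>auto simp: \<Phi>_def\<close>)
    then show "\<Phi> (g \<otimes> h) = \<Phi> g \<otimes>\<^bsub>BijGroup ?V\<^esub> \<Phi> h"
      using gh Bij by (simp add: BijGroup_def)
  qed (use Bij group_BijGroup in \<open>auto simp: BijGroup_def\<close>)
  then have act: "group_action G ?V \<Phi>" by (rule group_action.intro)
  have edge: "(\<Phi> g u, \<Phi> g v) \<in> tree_edges \<delta>" if "g \<in> carrier G" "(u, v) \<in> tree_edges \<delta>" for g u v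
    using that by (auto simp: tree_edges_iff Phi a_V take_tree_act)
  have edge': "(\<Phi> g u, \<Phi> g v) \<in> tree_edges \<delta> \<longleftrightarrow> (u, v) \<in> tree_edges \<delta>"
    if "g \<in> carrier G" "u \<in> ?V" "v \<in> ?V" for g u v
    using edge[of g u v] edge[of "inv g" "\<Phi> g u" "\<Phi> g v"] that by (auto simp: Phi a_V a_inv)
  have tree: "tree_action G \<delta> \<Phi>"
    unfolding tree_action_def using act edge' by blast
  have ssa: "self_similar_action G \<delta> \<Phi>"
    unfolding self_similar_action_def
  proof (intro conjI ballI allI impI)
    fix g x assume gx: "g \<in> carrier G" "x < \<delta>"
    show "\<exists>h\<in>carrier G. \<exists>y<\<delta>. \<forall>w\<in>?V. \<Phi> g (x # w) = y # \<Phi> h w"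
      by (rule bexI[of _ "\<sigma> g x"], rule exI[of _ "\<pi> g x"]) (use gx pi sigma Phi V_Cons in auto)
  qed (rule tree)
  define N where "N = {g \<in> carrier G. \<forall>w\<in>?V. ?a w g = w}"
  have "subgroup N G"
  proof (rule subgroupI)
    show "inv g \<in> N" if g: "g \<in> N" for g
    proof -
      have "?a w (inv g) = w" if "w \<in> ?V" for w
        using a_inv(1)[of g w] g that unfolding N_def by auto
      then show ?thesis using g by (auto simp: N_def)
    qed
    show "g \<otimes> h \<in> N" if "g \<in> N" "h \<in> N" for g h
      using that a_mult unfolding N_def by auto
  qed (use a_one in \<open>auto simp: N_def\<close>)
  moreover have Nconj: "x \<otimes> g \<otimes> inv x \<in> N" if "x \<in> carrier G" "g \<in> N" for x g
    using that a_V a_mult a_inv by (auto simp: N_def)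
  ultimately have N_normal: "N \<lhd> G" by (simp add: normal_inv_iff)
  \<comment> \<open>z is the letter of the coset D itself. Its representative \<open>t z\<close>
    lies in D but may differ from the identity, so conjugation by \<open>t z\<close> is carried
    along below.\<close>
  obtain z where z: "z < \<delta>" "inv (t z) \<in> D" using t_ex[of \<one>] t by auto
  then have tz: "t z \<in> D" using D.m_inv_closed t by fastforce
  have N: "g \<in> D \<and> \<phi> g \<in> N" if g: "g \<in> N" for g
  proof -
    have gc: "g \<in> carrier G" using g by (auto simp: N_def)
    have fixz: "\<pi> g z # ?a w (\<sigma> g z) = z # w" if "w \<in> ?V" for w
    proof -
      have "?a (z # w) g = z # w" using g z that V_Cons unfolding N_def by blast
      then show ?thesis by simp
    qed
    then have "\<pi> g z = z" using V_Nil by blast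
    moreover have "\<sigma> g z \<in> N" using fixz sigma[OF gc z(1)] by (auto simp: N_def)
    ultimately have d: "inv (t z) \<otimes> (g \<otimes> t z) \<in> D" "\<phi> (inv (t z) \<otimes> (g \<otimes> t z)) \<in> N"
      using pi(2)[OF gc z(1)] by (auto simp: \<sigma>_def)
    have geq: "t z \<otimes> (inv (t z) \<otimes> (g \<otimes> t z)) \<otimes> inv (t z) = g"
      using gc t[OF z(1)] by (simp add: m_assoc inv_cancel)
    have "t z \<otimes> (inv (t z) \<otimes> (g \<otimes> t z)) \<otimes> inv (t z) \<in> D" using d(1) tz z(2) by auto
    then have gD: "g \<in> D" using geq by simp
    have "\<phi> g = \<phi> (t z \<otimes> (inv (t z) \<otimes> (g \<otimes> t z)) \<otimes> inv (t z))" using geq by simp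
    also have "\<dots> = \<phi> (t z) \<otimes> \<phi> (inv (t z) \<otimes> (g \<otimes> t z)) \<otimes> \<phi> (inv (t z))"
      using d(1) tz z(2) by (simp add: phi_mult)
    also have "\<phi> (inv (t z)) = inv (\<phi> (t z))"
      using phi_mult[of "inv (t z)" "t z"] tz z(2) phi phi_one t[OF z(1)] by (intro inv_equality[symmetric]) auto
    finally have "\<phi> g \<in> N" using Nconj d(2) phi[OF tz] by simp
    then show ?thesis using gD by blast
  qed
  have N1: "N = {\<one>}" by (rule simple[OF N_normal]) (use N in auto)
  have faithful: "faithful_action G ?V \<Phi>"
  proof (intro faithful_action.intro faithful_action_axioms.intro inj_onI act)
    fix g h assume gh: "g \<in> carrier G" "h \<in> carrier G" "\<Phi> g = \<Phi> h"
    have "?a w (inv h \<otimes> g) = w" if w: "w \<in> ?V" for w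
    proof -
      have "?a w g = ?a w h" using gh(3) Phi[OF w] by metis
      then show ?thesis using gh w a_mult[of "inv h" g w] a_inv(1)[of h w] by simp
    qed
    then have "inv h \<otimes> g \<in> N" using gh by (auto simp: N_def)
    then have "inv h \<otimes> g = \<one>" using N1 by blast
    then have "inv (inv g) = inv (inv h)" using gh inv_equality[of "inv h" g] by simp
    then show "g = h" using gh inv_inv by metis
  qed
  have trans: "\<exists>g\<in>carrier G. \<Phi> g [x] = [y]" if "x < \<delta>" "y < \<delta>" for x y
  proof (rule bexI[of _ "t y \<otimes> inv (t x)"])
    have "\<pi> (t y \<otimes> inv (t x)) x = y"
      using that t by (intro pi_eq) (auto simp: m_assoc)
    then show "\<Phi> (t y \<otimes> inv (t x)) [x] = [y]" using that by (simp add: Phi V_Cons V_Nil)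
  qed (use that t in auto)
  have "\<delta> \<ge> 1" using z by simp
  then show ?thesis
    unfolding self_similar_of_index_def using ssa faithful trans by blast
qed

text \<open>f stands for the reduction of matrices modulo a high power: its values carry no group
  structure, only compatibility with left multiplication. By \<open>f_D\<close> every fibre lies in
  one left coset, so distinct cosets have disjoint images, and left translation gives all these
  images the size of the image of D.\<close>

lemma left_transversal_count:
  fixes G (structure) and f :: "'g \<Rightarrow> 'c"
  assumes G: "group G" and D: "subgroup D G"
    and f_fin: "finite (f ` carrier G)"
    and f_left: "\<And>x y z. \<lbrakk>x \<in> carrier G; y \<in> carrier G; z \<in> carrier G; f y = f z\<rbrakk> \<Longrightarrow> f (x \<otimes> y) = f (x \<otimes> z)"
    and f_D: "\<And>x y. \<lbrakk>x \<in> carrier G; y \<in> carrier G; f x = f y\<rbrakk> \<Longrightarrow> inv x \<otimes> y \<in> D"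
  obtains \<delta> :: nat and t :: "nat \<Rightarrow> 'g" where
    "\<And>x. x < \<delta> \<Longrightarrow> t x \<in> carrier G"
    "\<And>g. g \<in> carrier G \<Longrightarrow> \<exists>x<\<delta>. inv (t x) \<otimes> g \<in> D"
    "\<And>g x y. \<lbrakk>g \<in> carrier G; x < \<delta>; y < \<delta>; inv (t x) \<otimes> g \<in> D; inv (t y) \<otimes> g \<in> D\<rbrakk> \<Longrightarrow> x = y"
    "\<delta> * card (f ` D) = card (f ` carrier G)"
proof -
  interpret group G by fact
  interpret D: subgroup D G by fact
  define C where "C g = (\<lambda>d. g \<otimes> d) ` D" for g
  have C_mem: "h \<in> C g \<longleftrightarrow> inv g \<otimes> h \<in> D" if "g \<in> carrier G" "h \<in> carrier G" for g h
  proof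
    assume "inv g \<otimes> h \<in> D"
    then have "g \<otimes> (inv g \<otimes> h) \<in> C g" unfolding C_def by blast
    then show "h \<in> C g" using that by (simp add: inv_cancel)
  qed (use that in \<open>auto simp: C_def inv_cancel\<close>)
  have C_sub: "C g \<subseteq> carrier G" if "g \<in> carrier G" for g using that unfolding C_def by auto
  have C_eq: "C g = C h" if gh: "g \<in> carrier G" "h \<in> carrier G" "inv g \<otimes> h \<in> D" for g h
  proof -
    have "C h \<subseteq> C g" if "g \<in> carrier G" "h \<in> carrier G" "inv g \<otimes> h \<in> D" for g h
    proof
      fix y assume "y \<in> C h"
      then obtain d where d: "d \<in> D" "y = h \<otimes> d" by (auto simp: C_def)
      then have "y = g \<otimes> ((inv g \<otimes> h) \<otimes> d)" using that by (simp add: m_assoc inv_cancel)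
      then show "y \<in> C g" unfolding C_def using d that by blast
    qed
    moreover have "inv h \<otimes> g \<in> D"
      using D.m_inv_closed[OF gh(3)] gh by (simp add: inv_mult_group)
    ultimately show ?thesis using gh by blast
  qed
  have C_self: "g \<in> C g" if "g \<in> carrier G" for g using that C_mem by simp
  let ?\<C> = "C ` carrier G"
  have fD_disj: "f ` A \<inter> f ` B = {}" if "A \<in> ?\<C>" "B \<in> ?\<C>" "A \<noteq> B" for A B
  proof (rule ccontr)
    assume "f ` A \<inter> f ` B \<noteq> {}"
    then obtain a b where ab: "a \<in> A" "b \<in> B" "f a = f b" by blast
    from that obtain g h where gh: "g \<in> carrier G" "A = C g" "h \<in> carrier G" "B = C h" by blast
    have abG: "a \<in> carrier G" "b \<in> carrier G" using ab gh C_sub by blast+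
    have "C g = C a" "C h = C b" using C_eq C_mem ab gh abG by blast+
    moreover have "C a = C b" using C_eq abG f_D ab by blast
    ultimately show False using gh that by simp
  qed
  have img_ne: "f ` A \<noteq> {}" if "A \<in> ?\<C>" for A using that C_self by blast
  have inj: "inj_on (\<lambda>A. f ` A) ?\<C>"
    by (rule inj_onI) (metis fD_disj img_ne inf.idem)
  have "(\<lambda>A. f ` A) ` ?\<C> \<subseteq> Pow (f ` carrier G)" using C_sub by blast
  then have fin: "finite ?\<C>" using inj f_fin by (meson finite_Pow_iff finite_imageD finite_subset)
  have card_img: "card (f ` A) = card (f ` D)" if A: "A \<in> ?\<C>" for A
  proof -
    obtain g where g: "g \<in> carrier G" "A = C g" using A by blast
    have cancel: "f y = f z" if "y \<in> D" "z \<in> D" "f (g \<otimes> y) = f (g \<otimes> z)" for y z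
      using f_left[of "inv g" "g \<otimes> y" "g \<otimes> z"] that g by (simp add: inv_cancel)
    \<comment> \<open>Chosen preimages turn left translation by g into a map on values of f;
      \<open>f_left\<close> makes it independent of the choice.\<close>
    define r where "r v = (SOME y. y \<in> D \<and> f y = v)" for v
    have r: "r v \<in> D" "f (r v) = v" if "v \<in> f ` D" for v
      using someI_ex[of "\<lambda>y. y \<in> D \<and> f y = v"] that unfolding r_def by auto
    have "inj_on (\<lambda>v. f (g \<otimes> r v)) (f ` D)"
    proof (rule inj_onI)
      fix v w assume vw: "v \<in> f ` D" "w \<in> f ` D" "f (g \<otimes> r v) = f (g \<otimes> r w)"
      then have "f (r v) = f (r w)" using cancel[of "r v" "r w"] r by blast
      then show "v = w" using r vw by simp
    qed
    moreover have "f (g \<otimes> r (f d)) = f (g \<otimes> d)" if "d \<in> D" for d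
      using r[of "f d"] that g by (intro f_left) auto
    then have "(\<lambda>v. f (g \<otimes> r v)) ` f ` D = f ` A"
      unfolding g(2) C_def image_image by simp
    ultimately have "bij_betw (\<lambda>v. f (g \<otimes> r v)) (f ` D) (f ` A)" by (simp add: bij_betw_def)
    then show ?thesis by (simp add: bij_betw_same_card)
  qed
  have fin_img: "finite (f ` A)" if "A \<in> ?\<C>" for A
    by (rule finite_subset[OF image_mono f_fin]) (use that C_sub in blast)
  have "card (f ` carrier G) = card (\<Union>A\<in>?\<C>. f ` A)"
    using C_self C_sub by (intro arg_cong[where f = card]) blast
  also have "\<dots> = (\<Sum>A\<in>?\<C>. card (f ` A))"
    by (rule card_UN_disjoint) (use fin fD_disj fin_img in blast)+
  also have "\<dots> = card ?\<C> * card (f ` D)" using card_img by simp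
  finally have count: "card ?\<C> * card (f ` D) = card (f ` carrier G)" ..
  obtain b where b: "bij_betw b {..<card ?\<C>} ?\<C>"
    using ex_bij_betw_nat_finite[OF fin] by (auto simp: atLeast0LessThan)
  define t where "t x = (SOME g. g \<in> carrier G \<and> C g = b x)" for x
  have t: "t x \<in> carrier G \<and> C (t x) = b x" if "x < card ?\<C>" for x
  proof -
    have "b x \<in> ?\<C>" using b that unfolding bij_betw_def by blast
    then have "\<exists>g. g \<in> carrier G \<and> C g = b x" by (smt (verit) imageE)
    then show ?thesis unfolding t_def by (rule someI_ex)
  qed
  show ?thesis
  proof (rule that[of "card ?\<C>" t])
    show "t x \<in> carrier G" if "x < card ?\<C>" for x using t that by blast
    show "\<exists>x<card ?\<C>. inv (t x) \<otimes> g \<in> D" if g: "g \<in> carrier G" for g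
    proof -
      have "C g \<in> b ` {..<card ?\<C>}" using b g by (simp add: bij_betw_def)
      then obtain x where "x < card ?\<C>" "b x = C g" by auto
      then show ?thesis using t[of x] C_self[OF g] C_mem[of "t x" g] g by auto
    qed
    show "x = y" if "g \<in> carrier G" "x < card ?\<C>" "y < card ?\<C>" "inv (t x) \<otimes> g \<in> D" "inv (t y) \<otimes> g \<in> D" for g x y
    proof -
      have "b x = b y" using t[of x] t[of y] C_eq[of "t x" g] C_eq[of "t y" g] that by auto
      then show ?thesis using b that by (auto simp: bij_betw_def inj_on_def)
    qed
  qed (rule count)
qed

section \<open>The p-adic absolute value and the field of p-adic numbers\<close>

text \<open>Allows the valuation to be read off any fraction: cross-multiplying with the reduced one
  equates the sums of multiplicities.\<close>

lemma padic_abs_frac: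
  assumes p: "Factorial_Ring.prime p" and ab: "a \<noteq> 0" "b \<noteq> 0"
  shows "padic_abs p (of_int a / of_int b) = real p powi (int (multiplicity (int p) b) - int (multiplicity (int p) a))"
proof -
  have P: "prime_elem (int p)" using p by simp
  obtain c d where cd: "quotient_of (of_int a / of_int b :: rat) = (c, d)" by fastforce
  have d: "d \<noteq> 0" using quotient_of_denom_pos[OF cd] by simp
  have eq: "(of_int a / of_int b :: rat) = of_int c / of_int d" using quotient_of_div[OF cd] .
  have c: "c \<noteq> 0" using eq ab d by auto
  have "of_int (a * d) = (of_int (c * b) :: rat)" using eq ab d by (simp add: field_simps)
  then have "a * d = c * b" by (simp only: of_int_eq_iff)
  then have "multiplicity (int p) a + multiplicity (int p) d = multiplicity (int p) c + multiplicity (int p) b"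
    using prime_elem_multiplicity_mult_distrib[OF P] ab c d by metis
  then have "int (multiplicity (int p) d) - int (multiplicity (int p) c) =
     int (multiplicity (int p) b) - int (multiplicity (int p) a)" by linarith
  then show ?thesis using ab unfolding padic_abs_def cd by simp
qed

lemma rat_frac: obtains a b :: int where "x = (of_int a / of_int b :: rat)" "b \<noteq> 0"
  by (metis quotient_of_denom_pos quotient_of_div surj_pair less_irrefl)

locale p_adic = fixes p :: nat assumes prime: "Factorial_Ring.prime p"
begin

lemma p_gt_1: "real p > 1" using prime_gt_1_nat[OF prime] by simp

abbreviation "pabs \<equiv> padic_abs p"

lemma pabs_0 [simp]: "pabs 0 = 0" by (simp add: padic_abs_def)

lemma pabs_nonneg [simp]: "pabs x \<ge> 0"
  unfolding padic_abs_def by (auto split: prod.split)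

lemma pabs_powi: assumes "x \<noteq> 0" obtains n :: int where "pabs x = real p powi n"
  using assms unfolding padic_abs_def by (metis (no_types, lifting) case_prod_unfold)

lemma pabs_eq_0_iff [simp]: "pabs x = 0 \<longleftrightarrow> x = 0"
  using p_gt_1 by (cases "x = 0") (auto elim!: pabs_powi)

lemma pabs_mult [simp]: "pabs (x * y) = pabs x * pabs y"
proof (cases "x = 0 \<or> y = 0")
  case False
  obtain a b where x: "x = of_int a / of_int b" "b \<noteq> 0" by (rule rat_frac)
  obtain c d where y: "y = of_int c / of_int d" "d \<noteq> 0" by (rule rat_frac)
  have nz: "a \<noteq> 0" "c \<noteq> 0" using False x y by auto
  have P: "prime_elem (int p)" using prime by simp
  have "x * y = of_int (a * c) / of_int (b * d)" using x y by simp
  then have "pabs (x * y) = real p powi (int (multiplicity (int p) (b * d)) - int (multiplicity (int p) (a * c)))"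
    using padic_abs_frac[OF prime, of "a * c" "b * d"] nz x y by simp
  also have "\<dots> = real p powi ((int (multiplicity (int p) b) - int (multiplicity (int p) a)) +
      (int (multiplicity (int p) d) - int (multiplicity (int p) c)))"
    using prime_elem_multiplicity_mult_distrib[OF P] nz x y by (simp add: algebra_simps)
  also have "\<dots> = pabs x * pabs y"
    using padic_abs_frac[OF prime] nz x y p_gt_1 by (simp add: power_int_add)
  finally show ?thesis .
qed auto

lemma pabs_1 [simp]: "pabs 1 = 1"
  using pabs_mult[of 1 1] by (metis mult_cancel_left1 mult_1 one_neq_zero pabs_eq_0_iff)

lemma pabs_minus [simp]: "pabs (- x) = pabs x"
proof -
  have "pabs (- 1) * pabs (- 1) = 1" using pabs_mult[of "-1" "-1"] by simp
  then have "pabs (- 1) = 1" using pabs_nonneg[of "-1"] by (metis abs_of_nonneg abs_mult_self_eq abs_1 real_sqrt_abs2 real_sqrt_one)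
  then show ?thesis using pabs_mult[of "-1" x] by simp
qed

lemma pabs_inverse [simp]: "pabs (inverse x) = inverse (pabs x)"
proof (cases "x = 0")
  case False
  then have "pabs x * pabs (inverse x) = 1" by (simp flip: pabs_mult)
  then show ?thesis by (metis inverse_unique)
qed auto

lemma pabs_divide [simp]: "pabs (x / y) = pabs x / pabs y"
  by (simp add: divide_inverse)

lemma pabs_p: "pabs (of_nat p) = 1 / real p"
proof -
  have "p \<noteq> 0" using prime by auto
  then have "pabs (of_nat p) = real p powi (- int (multiplicity (int p) (int p)))"
    using padic_abs_frac[OF prime, of "int p" 1] by simp
  also have "multiplicity (int p) (int p) = 1"
    using prime by (intro multiplicity_self) auto
  finally show ?thesis by (simp add: power_int_minus divide_inverse)
qed

lemma pabs_of_int_le: "pabs (of_int a) \<le> 1"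
proof (cases "a = 0")
  case False
  have "pabs (of_int a) = real p powi (- int (multiplicity (int p) a))"
    using padic_abs_frac[OF prime False, of 1] by simp
  also have "\<dots> \<le> 1" using p_gt_1 by (simp add: power_int_minus one_le_power inverse_le_1_iff)
  finally show ?thesis .
qed auto

text \<open>Dividing by the larger term reduces this to 1 + z with z = a / b of absolute value at
  most 1. Then p occurs in b at most as often as in a, so its power in b also divides b + a.\<close>

lemma pabs_add: "pabs (x + y) \<le> max (pabs x) (pabs y)"
proof (cases "x = 0 \<or> y = 0 \<or> x + y = 0")
  case False
  have aux: "pabs (1 + z) \<le> 1" if z: "pabs z \<le> 1" for z
  proof (cases "z = 0 \<or> 1 + z = 0")
    case False
    obtain a b where ab: "z = of_int a / of_int b" "b \<noteq> 0" by (rule rat_frac)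
    have nz: "a \<noteq> 0" "b + a \<noteq> 0" using False ab by (auto simp: field_simps simp flip: of_int_add)
    have "real p powi (int (multiplicity (int p) b) - int (multiplicity (int p) a)) \<le> real p powi 0"
      using z padic_abs_frac[OF prime nz(1) ab(2)] ab(1) by simp
    then have "multiplicity (int p) b \<le> multiplicity (int p) a"
      using p_gt_1 power_int_strict_increasing[of 0 "int (multiplicity (int p) b) - int (multiplicity (int p) a)" "real p"]
      by force
    then have "int p ^ multiplicity (int p) b dvd b + a"
      by (intro dvd_add) (auto intro: multiplicity_dvd multiplicity_dvd')
    then have le: "multiplicity (int p) b \<le> multiplicity (int p) (b + a)"
      using nz(2) prime by (intro multiplicity_geI) auto
    have "1 + z = of_int (b + a) / of_int b" using ab by (simp add: field_simps)
    then have "pabs (1 + z) = real p powi (int (multiplicity (int p) b) - int (multiplicity (int p) (b + a)))"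
      using padic_abs_frac[OF prime nz(2) ab(2)] by simp
    also have "\<dots> \<le> real p powi 0" using le p_gt_1 by (intro power_int_increasing) auto
    finally show ?thesis by simp
  qed auto
  have main: "pabs (x + y) \<le> pabs x" if "x \<noteq> 0" "pabs y \<le> pabs x" for x y
  proof -
    have "x + y = x * (1 + y / x)" using that by (simp add: field_simps)
    moreover have "pabs (y / x) \<le> 1"
      using that pabs_nonneg[of x] pabs_eq_0_iff[of x] by (simp add: divide_le_eq_1 less_le)
    ultimately have "pabs (x + y) = pabs x * pabs (1 + y / x)" by (metis pabs_mult)
    also have "\<dots> \<le> pabs x * 1" using aux[OF \<open>pabs (y / x) \<le> 1\<close>] by (intro mult_left_mono) auto
    finally show ?thesis by simp
  qed
  show ?thesis using main[of x y] main[of y x] False by (auto simp: add.commute max_def)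
qed (auto simp: le_max_iff_disj)

lemma pabs_diff: "pabs (x - y) \<le> max (pabs x) (pabs y)"
  using pabs_add[of x "- y"] by simp

lemma pabs_diff_commute: "pabs (x - y) = pabs (y - x)"
  using pabs_minus[of "x - y"] by simp

lemma pabs_eq_of_close: assumes "pabs (x - y) < pabs y" shows "pabs x = pabs y"
  using assms pabs_add[of "x - y" y] pabs_diff[of x "x - y"] by (auto simp: max_def split: if_splits)

text \<open>Nonzero values are integral powers of p. Hence a limit that is at most 1, which only
  bounds the late terms by p, already bounds them by 1.\<close>

lemma pabs_discrete: assumes "pabs x < real p" shows "pabs x \<le> 1"
proof (cases "x = 0")
  case False
  then obtain n where n: "pabs x = real p powi n" by (rule pabs_powi)
  have "n \<le> 0"
  proof (rule ccontr)
    assume "\<not> n \<le> 0"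
    then have "real p powi 1 \<le> real p powi n" using p_gt_1 by (intro power_int_increasing) auto
    then show False using assms n by simp
  qed
  then have "real p powi n \<le> real p powi 0" using p_gt_1 by (intro power_int_increasing) auto
  then show ?thesis using n by simp
qed auto

lemma pabs_discrete': assumes "pabs x < 1" shows "pabs x \<le> 1 / real p"
proof -
  have "pabs (x / of_nat p) < real p"
    using assms p_gt_1 by (simp add: pabs_p)
  then have "pabs (x / of_nat p) \<le> 1" by (rule pabs_discrete)
  then show ?thesis using p_gt_1 by (simp add: pabs_p field_simps)
qed

text \<open>The residue of a p-adically integral rational, by inverting its denominator modulo p.\<close>

lemma pabs_residue:
  assumes "pabs x \<le> 1" obtains j where "j < p" "pabs (x - of_nat j) < 1"
proof -
  obtain a b where cd: "quotient_of x = (a, b)" by fastforce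
  have x: "x = of_int a / of_int b" and b: "b > 0" and co: "coprime a b"
    using quotient_of_div[OF cd] quotient_of_denom_pos[OF cd] quotient_of_coprime[OF cd] by auto
  have nd: "\<not> int p dvd b"
  proof
    assume d: "int p dvd b"
    then have "\<not> int p dvd a" using co prime
      using coprime_common_divisor[OF co _ d] prime by auto
    then have a0: "a \<noteq> 0" and ma: "multiplicity (int p) a = 0" by (auto simp: not_dvd_imp_multiplicity_0)
    have "multiplicity (int p) b > 0" using d b prime prime_multiplicity_gt_zero_iff[of "int p" b] by simp
    then have "real p powi 0 < real p powi (int (multiplicity (int p) b))"
      using p_gt_1 by (intro power_int_strict_increasing) auto
    then show False using assms padic_abs_frac[OF prime a0, of b] b x ma by simp
  qed
  have cop: "coprime b (int p)"
    using nd prime prime_imp_coprime[of "int p" b] by (simp add: coprime_commute)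
  obtain c where c: "[b * c = 1] (mod int p)"
    using cong_solve_coprime_int[OF cop] by blast
  define j where "j = nat ((a * c) mod int p)"
  have p0: "int p > 0" using prime prime_gt_0_nat by simp
  have j: "int j = (a * c) mod int p" using p0 by (simp add: j_def)
  have "[int j * b = a * c * b] (mod int p)" unfolding j by (simp add: cong_def mod_mult_left_eq)
  moreover have "[a * c * b = a * 1] (mod int p)" using cong_scalar_left[OF c, of a] by (simp add: mult_ac)
  ultimately have "[a = int j * b] (mod int p)" by (metis cong_sym cong_trans mult_1_right)
  then have "int p dvd a - int j * b" by (simp add: cong_iff_dvd_diff)
  then obtain k where k: "a - int j * b = int p * k" by blast
  have bb: "pabs (of_int b) = 1"
    using padic_abs_frac[OF prime, of b 1] b nd by (simp add: not_dvd_imp_multiplicity_0)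
  have "x - of_nat j = of_int (a - int j * b) * inverse (of_int b)" using b x by (simp add: field_simps)
  then have "pabs (x - of_nat j) = pabs (of_nat p * of_int k * inverse (of_int b))" unfolding k by simp
  also have "\<dots> = 1 / real p * pabs (of_int k)" using bb pabs_p by simp
  also have "\<dots> \<le> 1 / real p * 1" using pabs_of_int_le by (intro mult_left_mono) auto
  also have "\<dots> < 1" using p_gt_1 by simp
  finally have "pabs (x - of_nat j) < 1" .
  moreover have "j < p" using j p0 pos_mod_bound[OF p0, of "a * c"] by linarith
  ultimately show ?thesis using that by blast
qed

end

section \<open>Cauchy sequences and null sequences for the p-adic absolute value\<close>

context p_adic
begin

lemma Cauchy_iff: "padic_Cauchy p s \<longleftrightarrow> (\<forall>\<epsilon>>0. \<exists>N. \<forall>i\<ge>N. \<forall>j\<ge>N. pabs (s i - s j) < \<epsilon>)"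
  by (simp add: padic_Cauchy_def)

lemma Cauchy_const [simp]: "padic_Cauchy p (\<lambda>n. c)"
  by (simp add: Cauchy_iff)

lemma Cauchy_add:
  assumes "padic_Cauchy p s" "padic_Cauchy p t" shows "padic_Cauchy p (\<lambda>n. s n + t n)"
  unfolding Cauchy_iff
proof (intro allI impI)
  fix \<epsilon> :: real assume e: "\<epsilon> > 0"
  obtain M where M: "pabs (s i - s j) < \<epsilon>" if "i \<ge> M" "j \<ge> M" for i j
    using assms(1) e unfolding Cauchy_iff by blast
  obtain N where N: "pabs (t i - t j) < \<epsilon>" if "i \<ge> N" "j \<ge> N" for i j
    using assms(2) e unfolding Cauchy_iff by blast
  have "pabs (s i + t i - (s j + t j)) < \<epsilon>" if "i \<ge> max M N" "j \<ge> max M N" for i j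
  proof -
    have eq: "s i + t i - (s j + t j) = (s i - s j) + (t i - t j)" by simp
    show ?thesis unfolding eq using pabs_add[of "s i - s j" "t i - t j"] M[of i j] N[of i j] that by auto
  qed
  then show "\<exists>N. \<forall>i\<ge>N. \<forall>j\<ge>N. pabs (s i + t i - (s j + t j)) < \<epsilon>" by blast
qed

lemma Cauchy_bounded:
  assumes "padic_Cauchy p s" obtains B where "B > 0" "\<And>n. pabs (s n) \<le> B"
proof -
  obtain N where N: "pabs (s i - s j) < 1" if "i \<ge> N" "j \<ge> N" for i j
    using assms[unfolded Cauchy_iff, rule_format, of 1] by auto
  define mx where "mx = Max ((\<lambda>n. pabs (s n)) ` {..N})"
  define B where "B = 1 + mx"
  have M: "pabs (s n) \<le> mx" if "n \<le> N" for n
    using that unfolding mx_def by (intro Max_ge) auto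
  have mx0: "mx \<ge> 0" using order_trans[OF pabs_nonneg M[OF order_refl]] .
  have "pabs (s n) \<le> B" for n
  proof (cases "n \<le> N")
    case True
    then show ?thesis using M[of n] unfolding B_def by linarith
  next
    case False
    then have "pabs (s n) \<le> max (pabs (s n - s N)) (pabs (s N))" "pabs (s n - s N) < 1"
      using pabs_add[of "s n - s N" "s N"] N[of n N] by auto
    then show ?thesis using M[OF order_refl] mx0 unfolding B_def by (auto simp: max_def split: if_splits)
  qed
  moreover have "B > 0" using M[of 0] pabs_nonneg[of "s 0"] unfolding B_def by linarith
  ultimately show ?thesis using that by blast
qed

lemma Cauchy_mult:
  assumes "padic_Cauchy p s" "padic_Cauchy p t" shows "padic_Cauchy p (\<lambda>n. s n * t n)"
  unfolding Cauchy_iff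
proof (intro allI impI)
  fix \<epsilon> :: real assume e: "\<epsilon> > 0"
  obtain A where A: "A > 0" "\<And>n. pabs (s n) \<le> A" using Cauchy_bounded[OF assms(1)] by blast
  obtain B where B: "B > 0" "\<And>n. pabs (t n) \<le> B" using Cauchy_bounded[OF assms(2)] by blast
  obtain M where M: "pabs (s i - s j) < \<epsilon> / B" if "i \<ge> M" "j \<ge> M" for i j
    using assms(1) e B unfolding Cauchy_iff by (meson divide_pos_pos)
  obtain N where N: "pabs (t i - t j) < \<epsilon> / A" if "i \<ge> N" "j \<ge> N" for i j
    using assms(2) e A unfolding Cauchy_iff by (meson divide_pos_pos)
  have "pabs (s i * t i - s j * t j) < \<epsilon>" if "i \<ge> max M N" "j \<ge> max M N" for i j
  proof -
    have eq: "s i * t i - s j * t j = s i * (t i - t j) + (s i - s j) * t j" by (simp add: algebra_simps)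
    have "pabs (s i * (t i - t j)) < \<epsilon>"
    proof -
      have "pabs (s i * (t i - t j)) \<le> A * pabs (t i - t j)" using A by (simp add: mult_right_mono)
      also have "\<dots> < A * (\<epsilon> / A)" using N that A by (intro mult_strict_left_mono) auto
      finally show ?thesis using A by simp
    qed
    moreover have "pabs ((s i - s j) * t j) < \<epsilon>"
    proof -
      have "pabs ((s i - s j) * t j) \<le> pabs (s i - s j) * B" using B by (simp add: mult_left_mono)
      also have "\<dots> < \<epsilon> / B * B" using M that B by (intro mult_strict_right_mono) auto
      finally show ?thesis using B by simp
    qed
    ultimately show ?thesis unfolding eq using pabs_add[of "s i * (t i - t j)" "(s i - s j) * t j"] by (auto simp: max_def split: if_splits)
  qed
  then show "\<exists>N. \<forall>i\<ge>N. \<forall>j\<ge>N. pabs (s i * t i - s j * t j) < \<epsilon>" by blast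
qed

lemma Cauchy_uminus: "padic_Cauchy p s \<Longrightarrow> padic_Cauchy p (\<lambda>n. - s n)"
  using Cauchy_mult[of "\<lambda>n. - 1" s] by simp

lemma null_iff: "s \<in> padic_null p \<longleftrightarrow> (\<forall>\<epsilon>>0. \<exists>N. \<forall>n\<ge>N. pabs (s n) < \<epsilon>)"
  by (simp add: padic_null_def LIMSEQ_iff)

lemma null_Cauchy: assumes "s \<in> padic_null p" shows "padic_Cauchy p s"
  unfolding Cauchy_iff
proof (intro allI impI)
  fix \<epsilon> :: real assume "\<epsilon> > 0"
  then obtain N where N: "\<And>n. n \<ge> N \<Longrightarrow> pabs (s n) < \<epsilon>" using assms unfolding null_iff by blast
  have "pabs (s i - s j) < \<epsilon>" if "i \<ge> N" "j \<ge> N" for i j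
    using pabs_diff[of "s i" "s j"] N[of i] N[of j] that by (auto simp: max_def split: if_splits)
  then show "\<exists>N. \<forall>i\<ge>N. \<forall>j\<ge>N. pabs (s i - s j) < \<epsilon>" by blast
qed

lemma null_add: assumes "s \<in> padic_null p" "t \<in> padic_null p" shows "(\<lambda>n. s n + t n) \<in> padic_null p"
  unfolding null_iff
proof (intro allI impI)
  fix \<epsilon> :: real assume e: "\<epsilon> > 0"
  obtain M where M: "\<And>n. n \<ge> M \<Longrightarrow> pabs (s n) < \<epsilon>" using assms(1) e unfolding null_iff by blast
  obtain N where N: "\<And>n. n \<ge> N \<Longrightarrow> pabs (t n) < \<epsilon>" using assms(2) e unfolding null_iff by blast
  have "pabs (s i + t i) < \<epsilon>" if "i \<ge> max M N" for i
    using pabs_add[of "s i" "t i"] M[of i] N[of i] that by (auto simp: max_def split: if_splits)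
  then show "\<exists>N. \<forall>n\<ge>N. pabs (s n + t n) < \<epsilon>" by blast
qed

lemma null_mult: assumes "s \<in> padic_null p" "padic_Cauchy p t" shows "(\<lambda>n. t n * s n) \<in> padic_null p"
  unfolding null_iff
proof (intro allI impI)
  fix \<epsilon> :: real assume e: "\<epsilon> > 0"
  obtain B where B: "B > 0" "\<And>n. pabs (t n) \<le> B" using Cauchy_bounded[OF assms(2)] by blast
  obtain M where M: "\<And>n. n \<ge> M \<Longrightarrow> pabs (s n) < \<epsilon> / B"
    using assms(1) e B unfolding null_iff by (meson divide_pos_pos)
  have "pabs (t i * s i) < \<epsilon>" if "i \<ge> M" for i
  proof -
    have "pabs (t i * s i) \<le> B * pabs (s i)" using B by (simp add: mult_right_mono)
    also have "\<dots> < B * (\<epsilon> / B)" using M that B by (intro mult_strict_left_mono) auto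
    finally show ?thesis using B by simp
  qed
  then show "\<exists>N. \<forall>n\<ge>N. pabs (t n * s n) < \<epsilon>" by blast
qed

lemma null_eventually_0: assumes "\<And>n. n \<ge> N \<Longrightarrow> s n = 0" shows "s \<in> padic_null p"
  unfolding null_iff using assms by (intro allI impI, intro exI[of _ N]) auto

text \<open>Some term past the Cauchy threshold has size at least \<open>\<epsilon>\<close> while
  all terms past it differ from that one by less, so the ultrametric inequality makes their absolute
  values equal.\<close>

lemma nonnull_Cauchy:
  assumes "padic_Cauchy p s" "s \<notin> padic_null p"
  obtains N c where "c > 0" "\<And>n. n \<ge> N \<Longrightarrow> pabs (s n) = c"
proof -
  obtain \<epsilon> where e0: "\<epsilon> > 0" "\<not> (\<exists>N. \<forall>n\<ge>N. pabs (s n) < \<epsilon>)"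
    using assms(2) unfolding null_iff by auto
  then have e: "\<epsilon> > 0" "\<And>N. \<exists>n\<ge>N. pabs (s n) \<ge> \<epsilon>" by (auto simp: not_less)
  obtain N where N: "pabs (s i - s j) < \<epsilon>" if "i \<ge> N" "j \<ge> N" for i j
    using assms(1) e(1) unfolding Cauchy_iff by blast
  obtain n where n: "n \<ge> N" "pabs (s n) \<ge> \<epsilon>" using e(2) by blast
  have const: "pabs (s i) = pabs (s n)" if "i \<ge> N" for i
    using N[of i n] n that by (intro pabs_eq_of_close) auto
  have "pabs (s n) > 0" using e(1) n by linarith
  then show ?thesis using const by (rule that)
qed

text \<open>The identity 1/s - 1/t = (t - s)/(s t) costs only the constant factor 1/c^2. Terms
  before N are uncontrolled and are overwritten by 0.\<close>

lemma Cauchy_inverse: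
  assumes "padic_Cauchy p s" "c > 0" "\<And>n. n \<ge> N \<Longrightarrow> pabs (s n) = c"
  shows "padic_Cauchy p (\<lambda>n. if n < N then 0 else inverse (s n))"
  unfolding Cauchy_iff
proof (intro allI impI)
  fix \<epsilon> :: real assume e: "\<epsilon> > 0"
  then have "\<epsilon> * (c * c) > 0" using assms(2) by simp
  then obtain M where M: "pabs (s i - s j) < \<epsilon> * (c * c)" if "i \<ge> M" "j \<ge> M" for i j
    using assms(1) unfolding Cauchy_iff by blast
  have "pabs (inverse (s i) - inverse (s j)) < \<epsilon>" if ij: "i \<ge> max M N" "j \<ge> max M N" for i j
  proof -
    have c: "pabs (s i) = c" "pabs (s j) = c" using assms(3) ij by auto
    then have nz: "s i \<noteq> 0" "s j \<noteq> 0" using assms(2) by auto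
    have "inverse (s i) - inverse (s j) = (s j - s i) / (s i * s j)" using nz by (simp add: field_simps)
    then have "pabs (inverse (s i) - inverse (s j)) = pabs (s j - s i) / (c * c)" using c by simp
    also have "\<dots> < \<epsilon>" using M[of j i] ij assms(2) by (simp add: divide_less_eq)
    finally show ?thesis .
  qed
  then show "\<exists>M. \<forall>i\<ge>M. \<forall>j\<ge>M. pabs ((if i < N then 0 else inverse (s i)) - (if j < N then 0 else inverse (s j))) < \<epsilon>"
    by (intro exI[of _ "max M N"]) auto
qed

lemma Cauchy_ring_cring: "cring (padic_Cauchy_ring p)"
proof (rule cringI)
  show "abelian_group (padic_Cauchy_ring p)"
  proof (rule abelian_groupI)
    fix s assume "s \<in> carrier (padic_Cauchy_ring p)"
    then show "\<exists>t\<in>carrier (padic_Cauchy_ring p). t \<oplus>\<^bsub>padic_Cauchy_ring p\<^esub> s = \<zero>\<^bsub>padic_Cauchy_ring p\<^esub>"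
      by (intro bexI[of _ "\<lambda>n. - s n"]) (auto simp: padic_Cauchy_ring_def Cauchy_uminus)
  qed (auto simp: padic_Cauchy_ring_def Cauchy_add algebra_simps)
  show "comm_monoid (padic_Cauchy_ring p)"
    by (rule comm_monoidI) (auto simp: padic_Cauchy_ring_def Cauchy_mult algebra_simps)
qed (auto simp: padic_Cauchy_ring_def algebra_simps)

lemma null_ideal: "ideal (padic_null p) (padic_Cauchy_ring p)"
proof -
  interpret C: cring "padic_Cauchy_ring p" by (rule Cauchy_ring_cring)
  have um: "\<ominus>\<^bsub>padic_Cauchy_ring p\<^esub> s = (\<lambda>n. - s n)" if "padic_Cauchy p s" for s
    by (rule C.minus_equality) (use that in \<open>auto simp: padic_Cauchy_ring_def Cauchy_uminus\<close>)
  have neg: "(\<lambda>n. - s n) \<in> padic_null p" if "s \<in> padic_null p" for s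
    using null_mult[OF that, of "\<lambda>n. - 1"] by simp
  show ?thesis
  proof (rule idealI)
    show "subgroup (padic_null p) (add_monoid (padic_Cauchy_ring p))"
    proof (rule C.add.subgroupI)
      show "padic_null p \<noteq> {}" using null_eventually_0[of 0 "\<lambda>n. 0"] by auto
      show "\<ominus>\<^bsub>padic_Cauchy_ring p\<^esub> s \<in> padic_null p" if "s \<in> padic_null p" for s
        using um[OF null_Cauchy[OF that]] neg[OF that] by simp
    qed (auto simp: padic_Cauchy_ring_def null_Cauchy null_add)
  next
    fix s t assume "s \<in> padic_null p" "t \<in> carrier (padic_Cauchy_ring p)"
    then have "(\<lambda>n. t n * s n) \<in> padic_null p" by (auto simp: padic_Cauchy_ring_def null_mult)
    then show "t \<otimes>\<^bsub>padic_Cauchy_ring p\<^esub> s \<in> padic_null p" "s \<otimes>\<^bsub>padic_Cauchy_ring p\<^esub> t \<in> padic_null p"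
      by (auto simp: padic_Cauchy_ring_def mult.commute)
  qed (rule C.ring_axioms)
qed

text \<open>\<open>Qp_abs\<close> is defined through \<open>lim\<close>, which says something only
  after convergence is known; the absolute value is 1-Lipschitz.\<close>

lemma Cauchy_pabs: assumes "padic_Cauchy p s" shows "convergent (\<lambda>n. pabs (s n))"
proof (rule Cauchy_convergent, rule metric_CauchyI)
  fix \<epsilon> :: real assume "\<epsilon> > 0"
  then obtain N where N: "pabs (s i - s j) < \<epsilon>" if "i \<ge> N" "j \<ge> N" for i j
    using assms unfolding Cauchy_iff by blast
  have max_le: "max a b \<le> a + b" if "0 \<le> a" "0 \<le> b" for a b :: real using that by auto
  have tri: "pabs x \<le> pabs (x - y) + pabs y" for x y
    using order_trans[OF pabs_add[of "x - y" y] max_le[OF pabs_nonneg pabs_nonneg]] by simp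
  have "dist (pabs (s i)) (pabs (s j)) < \<epsilon>" if "i \<ge> N" "j \<ge> N" for i j
    using tri[of "s i" "s j"] tri[of "s j" "s i"] pabs_diff_commute[of "s i" "s j"] N[OF that] by (auto simp: dist_real_def)
  then show "\<exists>M. \<forall>m\<ge>M. \<forall>n\<ge>M. dist (pabs (s m)) (pabs (s n)) < \<epsilon>" by blast
qed

end

text \<open>The only properties of the p-adic numbers \<open>Q\<close> and integers \<open>Z\<close> used below.\<close>

locale padic_pair =
  fixes p :: nat and Z Q :: "'k::field set"
  assumes prime: "Factorial_Ring.prime p" and p_nz: "of_nat p \<noteq> (0 :: 'k)"
    and Z_1: "1 \<in> Z" and Z_add: "x \<in> Z \<Longrightarrow> y \<in> Z \<Longrightarrow> x + y \<in> Z"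
    and Z_mult: "x \<in> Z \<Longrightarrow> y \<in> Z \<Longrightarrow> x * y \<in> Z" and Z_uminus: "x \<in> Z \<Longrightarrow> - x \<in> Z"
    and Z_Q: "Z \<subseteq> Q" and Q_add: "x \<in> Q \<Longrightarrow> y \<in> Q \<Longrightarrow> x + y \<in> Q"
    and Q_mult: "x \<in> Q \<Longrightarrow> y \<in> Q \<Longrightarrow> x * y \<in> Q"
    and Q_uminus: "x \<in> Q \<Longrightarrow> - x \<in> Q" and Q_inverse: "x \<in> Q \<Longrightarrow> inverse x \<in> Q"
    and Q_denom: "x \<in> Q \<Longrightarrow> \<exists>N. of_nat p ^ N * x \<in> Z"
    and Z_residue: "z \<in> Z \<Longrightarrow> \<exists>j<p. \<exists>w\<in>Z. z = of_nat j + of_nat p * w"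
    and Z_unit: "z \<in> Z \<Longrightarrow> 1 + of_nat p * z \<noteq> 0 \<and> inverse (1 + of_nat p * z) \<in> Z"

text \<open>Every property is checked on Cauchy sequences through \<open>\<kappa>\<close>, the coset
  map followed by \<open>\<iota>\<close>. Q becomes the image of all Cauchy sequences, and Z the
  image of those whose terms are all p-adically integral.\<close>

lemma padic_pair_image:
  fixes \<iota> :: "(nat \<Rightarrow> rat) set \<Rightarrow> 'k::field"
  assumes prime: "Factorial_Ring.prime p"
    and hom: "\<iota> \<in> Ring.ring_hom (Qp p) ring_of_type_algebra"
  shows "padic_pair p (\<iota> ` Zp p) (\<iota> ` carrier (Qp p))"
proof -
  interpret p_adic p by unfold_locales fact
  let ?C = "padic_Cauchy_ring p" and ?N = "padic_null p"
  interpret I: ideal ?N ?C by (rule null_ideal)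
  interpret C: cring ?C by (rule Cauchy_ring_cring)
  define \<kappa> where "\<kappa> s = \<iota> (?N +>\<^bsub>?C\<^esub> s)" for s
  have Cc: "s \<in> carrier ?C \<longleftrightarrow> padic_Cauchy p s" for s by (simp add: padic_Cauchy_ring_def)
  have coset: "?N +>\<^bsub>?C\<^esub> s \<in> carrier (Qp p)" if "padic_Cauchy p s" for s
    using ring_hom_closed[OF I.rcos_ring_hom] that unfolding Qp_def Cc[symmetric] .
  have k_mult: "\<kappa> (\<lambda>n. s n * t n) = \<kappa> s * \<kappa> t" if "padic_Cauchy p s" "padic_Cauchy p t" for s t
    using ring_hom_mult[OF I.rcos_ring_hom, of s t] ring_hom_mult[OF hom coset[OF that(1)] coset[OF that(2)]] that
    unfolding \<kappa>_def Qp_def Cc[symmetric] by (simp add: padic_Cauchy_ring_def ring_of_type_algebra_def)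
  have k_add: "\<kappa> (\<lambda>n. s n + t n) = \<kappa> s + \<kappa> t" if "padic_Cauchy p s" "padic_Cauchy p t" for s t
    using ring_hom_add[OF I.rcos_ring_hom, of s t] ring_hom_add[OF hom coset[OF that(1)] coset[OF that(2)]] that
    unfolding \<kappa>_def Qp_def Cc[symmetric] by (simp add: padic_Cauchy_ring_def ring_of_type_algebra_def)
  have k_1: "\<kappa> (\<lambda>n. 1) = 1"
    using ring_hom_one[OF I.rcos_ring_hom] ring_hom_one[OF hom]
    unfolding \<kappa>_def Qp_def by (simp add: padic_Cauchy_ring_def ring_of_type_algebra_def)
  have k_0: "\<kappa> (\<lambda>n. 0) = 0"
  proof -
    have "\<kappa> (\<lambda>n. 0) + 0 = \<kappa> (\<lambda>n. 0) + \<kappa> (\<lambda>n. 0)" using k_add[of "\<lambda>n. 0" "\<lambda>n. 0"] by simp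
    then show ?thesis by (simp only: add_left_cancel)
  qed
  have k_uminus: "\<kappa> (\<lambda>n. - s n) = - \<kappa> s" if "padic_Cauchy p s" for s
    using k_add[OF that Cauchy_uminus[OF that]] k_0 by (simp add: eq_neg_iff_add_eq_0 add.commute)
  have k_null: "\<kappa> s = 0" if "s \<in> ?N" for s
  proof -
    have "?N +>\<^bsub>?C\<^esub> s = ?N +>\<^bsub>?C\<^esub> (\<lambda>n. 0)"
      using that null_eventually_0[of 0 "\<lambda>n. 0"] I.a_rcos_const by simp
    then show ?thesis using k_0 unfolding \<kappa>_def by simp
  qed
  have k_eq: "\<kappa> s = \<kappa> t" if "padic_Cauchy p s" "padic_Cauchy p t" "(\<lambda>n. s n - t n) \<in> ?N" for s t
    using k_add[OF that(1) Cauchy_uminus[OF that(2)]] k_uminus[OF that(2)] k_null[OF that(3)] by simp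
  have k_nat: "\<kappa> (\<lambda>n. of_nat j) = of_nat j" for j
    by (induction j) (simp_all add: k_0 k_1 k_add)
  have Q: "\<iota> ` carrier (Qp p) = \<kappa> ` {s. padic_Cauchy p s}"
    unfolding Qp_def \<kappa>_def FactRing_simps Cc[symmetric] by auto
  have Z: "\<iota> ` Zp p = \<kappa> ` {s. padic_Cauchy p s \<and> (\<forall>n. pabs (s n) \<le> 1)}" (is "?L = ?R")
  proof (intro equalityI subsetI)
    fix x assume "x \<in> ?L"
    then obtain a where a: "a \<in> carrier (Qp p)" "Qp_abs p a \<le> 1" "x = \<iota> a" by (auto simp: Zp_def)
    then obtain s where s: "padic_Cauchy p s" "a = ?N +>\<^bsub>?C\<^esub> s"
      unfolding Qp_def FactRing_simps Cc[symmetric] by auto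
    \<comment> \<open>\<open>Qp_abs\<close> evaluates the representative picked by
      \<open>SOME\<close>, so the argument must run with this r instead of s.\<close>
    define r where "r = (SOME s. s \<in> a)"
    have "s \<in> a" using s I.a_rcos_self[of s] Cc by simp
    then have ra: "r \<in> a" unfolding r_def using someI[of "\<lambda>s. s \<in> a" s] by blast
    then have ar: "a = ?N +>\<^bsub>?C\<^esub> r" using s I.a_repr_independence'[of r s] Cc by simp
    have r: "padic_Cauchy p r" using ra s I.a_elemrcos_carrier Cc by blast
    have "(\<lambda>n. pabs (r n)) \<longlonglongrightarrow> Qp_abs p a"
      using Cauchy_pabs[OF r] unfolding Qp_abs_def r_def by (simp add: convergent_LIMSEQ_iff)
    then have "\<forall>\<^sub>F n in sequentially. pabs (r n) < real p"
      using a(2) p_gt_1 by (intro order_tendstoD) auto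
    then obtain M where M: "\<And>n. n \<ge> M \<Longrightarrow> pabs (r n) \<le> 1"
      using pabs_discrete by (auto simp: eventually_sequentially)
    \<comment> \<open>Replacing the terms before M by 0 changes r by a null sequence and makes every
      term integral.\<close>
    define t where "t n = (if n < M then 0 else r n)" for n
    have "(\<lambda>n. t n - r n) \<in> ?N" by (rule null_eventually_0[of M]) (simp add: t_def)
    moreover from null_Cauchy[OF this] have "padic_Cauchy p t"
      using Cauchy_add[OF _ r, of "\<lambda>n. t n - r n"] by simp
    ultimately have "\<kappa> t = \<kappa> r" using r k_eq by blast
    moreover have "pabs (t n) \<le> 1" for n using M by (simp add: t_def)
    ultimately show "x \<in> ?R" using a(3) ar \<open>padic_Cauchy p t\<close> by (auto simp: \<kappa>_def image_iff)
  next
    fix x assume "x \<in> ?R"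
    then obtain s where s: "padic_Cauchy p s" "\<And>n. pabs (s n) \<le> 1" "x = \<kappa> s" by blast
    define a where "a = ?N +>\<^bsub>?C\<^esub> s"
    define r where "r = (SOME s. s \<in> a)"
    have "s \<in> a" using s I.a_rcos_self[of s] Cc by (simp add: a_def)
    then have ra: "r \<in> a" unfolding r_def using someI[of "\<lambda>s. s \<in> a" s] by blast
    then obtain h where h: "h \<in> ?N" "r = (\<lambda>n. h n + s n)"
      unfolding a_def a_r_coset_def' by (auto simp: padic_Cauchy_ring_def)
    have r: "padic_Cauchy p r" using h null_Cauchy Cauchy_add s by blast
    have lim: "(\<lambda>n. pabs (r n)) \<longlonglongrightarrow> Qp_abs p a"
      using Cauchy_pabs[OF r] unfolding Qp_abs_def r_def by (simp add: convergent_LIMSEQ_iff)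
    obtain M where M: "\<And>n. n \<ge> M \<Longrightarrow> pabs (h n) < 1" using h(1)[unfolded null_iff, rule_format, of 1] by auto
    have "pabs (r n) \<le> 1" if "n \<ge> M" for n
      using pabs_add[of "h n" "s n"] M[OF that] s(2)[of n] h(2) by (auto simp: max_def split: if_splits)
    then have "Qp_abs p a \<le> 1" using LIMSEQ_le_const2[OF lim] by blast
    then have "a \<in> Zp p" using coset[OF s(1)] by (simp add: Zp_def a_def)
    then show "x \<in> ?L" using s(3) by (auto simp: \<kappa>_def a_def)
  qed
  have p_nz: "real p > 0" using p_gt_1 by linarith
  show ?thesis unfolding Q Z
  proof
    show "Factorial_Ring.prime p" by fact
    have "\<kappa> (\<lambda>n. of_nat p) * \<kappa> (\<lambda>n. 1 / of_nat p) = 1"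
      using k_mult[of "\<lambda>n. of_nat p" "\<lambda>n. 1 / of_nat p"] k_1 p_nz by simp
    then show "of_nat p \<noteq> (0 :: 'k)" using k_nat by force
    show "1 \<in> \<kappa> ` {s. padic_Cauchy p s \<and> (\<forall>n. pabs (s n) \<le> 1)}"
      by (rule image_eqI[of _ _ "\<lambda>n. 1"]) (auto simp: k_1)
    show "\<kappa> ` {s. padic_Cauchy p s \<and> (\<forall>n. pabs (s n) \<le> 1)} \<subseteq> \<kappa> ` {s. padic_Cauchy p s}" by blast
  next
    fix x y assume "x \<in> \<kappa> ` {s. padic_Cauchy p s \<and> (\<forall>n. pabs (s n) \<le> 1)}" "y \<in> \<kappa> ` {s. padic_Cauchy p s \<and> (\<forall>n. pabs (s n) \<le> 1)}"
    then obtain s t where st: "padic_Cauchy p s" "\<And>n. pabs (s n) \<le> 1" "x = \<kappa> s" "padic_Cauchy p t" "\<And>n. pabs (t n) \<le> 1" "y = \<kappa> t" by blast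
    have "pabs (s n + t n) \<le> 1" for n using pabs_add[of "s n" "t n"] st(2,5)[of n] by (auto simp: max_def split: if_splits)
    then show "x + y \<in> \<kappa> ` {s. padic_Cauchy p s \<and> (\<forall>n. pabs (s n) \<le> 1)}"
      using st by (intro image_eqI[of _ _ "\<lambda>n. s n + t n"]) (auto simp: k_add Cauchy_add)
    show "x * y \<in> \<kappa> ` {s. padic_Cauchy p s \<and> (\<forall>n. pabs (s n) \<le> 1)}"
      using st by (intro image_eqI[of _ _ "\<lambda>n. s n * t n"]) (auto simp: k_mult Cauchy_mult mult_le_one)
  next
    fix x assume "x \<in> \<kappa> ` {s. padic_Cauchy p s \<and> (\<forall>n. pabs (s n) \<le> 1)}"
    then obtain s where s: "padic_Cauchy p s" "\<And>n. pabs (s n) \<le> 1" "x = \<kappa> s" by blast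
    then show "- x \<in> \<kappa> ` {s. padic_Cauchy p s \<and> (\<forall>n. pabs (s n) \<le> 1)}"
      by (intro image_eqI[of _ _ "\<lambda>n. - s n"]) (auto simp: k_uminus Cauchy_uminus)
    define u where "u n = 1 + of_nat p * s n" for n
    have u: "padic_Cauchy p u" unfolding u_def using s by (intro Cauchy_add Cauchy_mult) auto
    have ku: "\<kappa> u = 1 + of_nat p * x"
      unfolding u_def using s by (simp add: k_add k_mult Cauchy_mult k_1 k_nat)
    have pu: "pabs (u n) = 1" for n
    proof -
      have a: "pabs (u n - 1) \<le> 1 / real p"
        unfolding u_def using s(2)[of n] by (simp add: pabs_p divide_right_mono)
      have b: "1 / real p < 1" using p_gt_1 by simp
      have "pabs (u n - 1) < pabs 1" using order_le_less_trans[OF a b] by (simp only: pabs_1)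
      then show ?thesis using pabs_eq_of_close[of "u n" 1] by simp
    qed
    have t: "padic_Cauchy p (\<lambda>n. inverse (u n))" using Cauchy_inverse[OF u, of 1 0] pu by simp
    have unz: "u n \<noteq> 0" for n using pu[of n] by auto
    have "\<kappa> u * \<kappa> (\<lambda>n. inverse (u n)) = 1" using k_mult[OF u t] k_1 unz by simp
    then have "\<kappa> u \<noteq> 0 \<and> inverse (\<kappa> u) = \<kappa> (\<lambda>n. inverse (u n))" by (metis inverse_unique mult_zero_left zero_neq_one)
    then show "1 + of_nat p * x \<noteq> 0 \<and> inverse (1 + of_nat p * x) \<in> \<kappa> ` {s. padic_Cauchy p s \<and> (\<forall>n. pabs (s n) \<le> 1)}"
      unfolding ku[symmetric] using t pu by auto
    \<comment> \<open>Past N all terms of s agree modulo p, so the residue j of the single rational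
      \<open>s N\<close> serves for all of them.\<close>
    obtain N where N: "pabs (s i - s j) < 1" if "i \<ge> N" "j \<ge> N" for i j
      using s(1)[unfolded Cauchy_iff, rule_format, of 1] by auto
    obtain j where j: "j < p" "pabs (s N - of_nat j) < 1" using pabs_residue[OF s(2)] by blast
    define w where "w n = (if n < N then 0 else (s n - of_nat j) / of_nat p)" for n
    have "padic_Cauchy p (\<lambda>n. (s n - of_nat j) / of_nat p)"
      using Cauchy_mult[OF Cauchy_add[OF s(1) Cauchy_const] Cauchy_const, of "- of_nat j" "1 / of_nat p"]
      by (simp add: divide_inverse)
    moreover have "(\<lambda>n. w n - (s n - of_nat j) / of_nat p) \<in> padic_null p"
      by (rule null_eventually_0[of N]) (simp add: w_def)
    ultimately have "padic_Cauchy p (\<lambda>n. w n - (s n - of_nat j) / of_nat p + (s n - of_nat j) / of_nat p)"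
      using null_Cauchy Cauchy_add by blast
    then have wC: "padic_Cauchy p w" by simp
    have w1: "pabs (w n) \<le> 1" for n
    proof (cases "n < N")
      case False
      have "pabs (s n - of_nat j) < 1"
        using pabs_add[of "s n - s N" "s N - of_nat j"] N[of n N] j(2) False by (auto simp: max_def split: if_splits)
      then have "pabs (s n - of_nat j) \<le> 1 / real p" by (rule pabs_discrete')
      then show ?thesis using False p_nz by (simp add: w_def pabs_p field_simps)
    qed (simp add: w_def)
    have "\<kappa> s = \<kappa> (\<lambda>n. of_nat j + of_nat p * w n)"
    proof (rule k_eq[OF s(1)])
      show "padic_Cauchy p (\<lambda>n. of_nat j + of_nat p * w n)"
        using wC by (intro Cauchy_add Cauchy_mult Cauchy_const)
      show "(\<lambda>n. s n - (of_nat j + of_nat p * w n)) \<in> padic_null p"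
        by (rule null_eventually_0[of N]) (use p_nz in \<open>simp add: w_def\<close>)
    qed
    also have "\<dots> = of_nat j + of_nat p * \<kappa> w"
      using wC by (simp add: k_add k_mult Cauchy_mult k_nat)
    finally show "\<exists>j<p. \<exists>w\<in>\<kappa> ` {s. padic_Cauchy p s \<and> (\<forall>n. pabs (s n) \<le> 1)}. x = of_nat j + of_nat p * w"
      using s(3) j(1) wC w1 by blast
  next
    fix x y assume "x \<in> \<kappa> ` {s. padic_Cauchy p s}" "y \<in> \<kappa> ` {s. padic_Cauchy p s}"
    then obtain s t where st: "padic_Cauchy p s" "x = \<kappa> s" "padic_Cauchy p t" "y = \<kappa> t" by blast
    show "x + y \<in> \<kappa> ` {s. padic_Cauchy p s}"
      using st by (intro image_eqI[of _ _ "\<lambda>n. s n + t n"]) (auto simp: k_add Cauchy_add)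
    show "x * y \<in> \<kappa> ` {s. padic_Cauchy p s}"
      using st by (intro image_eqI[of _ _ "\<lambda>n. s n * t n"]) (auto simp: k_mult Cauchy_mult)
  next
    fix x assume "x \<in> \<kappa> ` {s. padic_Cauchy p s}"
    then obtain s where s: "padic_Cauchy p s" "x = \<kappa> s" by blast
    then show "- x \<in> \<kappa> ` {s. padic_Cauchy p s}"
      by (intro image_eqI[of _ _ "\<lambda>n. - s n"]) (auto simp: k_uminus Cauchy_uminus)
    show "inverse x \<in> \<kappa> ` {s. padic_Cauchy p s}"
    proof (cases "s \<in> ?N")
      case True
      then show ?thesis using s k_null k_0 by (intro image_eqI[of _ _ "\<lambda>n. 0"]) auto
    next
      case False
      obtain N c where c: "c > 0" "\<And>n. n \<ge> N \<Longrightarrow> pabs (s n) = c" using nonnull_Cauchy[OF s(1) False] by blast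
      define t where "t n = (if n < N then 0 else inverse (s n))" for n
      have t: "padic_Cauchy p t" using Cauchy_inverse[OF s(1) c] unfolding t_def by simp
      have snz: "s n \<noteq> 0" if "n \<ge> N" for n using c(1) c(2)[OF that] by auto
      have "\<kappa> (\<lambda>n. s n * t n) = \<kappa> (\<lambda>n. 1)"
      proof (rule k_eq[OF Cauchy_mult[OF s(1) t] Cauchy_const])
        show "(\<lambda>n. s n * t n - 1) \<in> padic_null p"
          by (rule null_eventually_0[of N]) (use snz in \<open>simp add: t_def\<close>)
      qed
      then have "x * \<kappa> t = 1" using k_mult[OF s(1) t] k_1 s(2) by simp
      then have "inverse x = \<kappa> t" by (rule inverse_unique)
      then show ?thesis using t by blast
    qed
    obtain B where B: "B > 0" "\<And>n. pabs (s n) \<le> B" using Cauchy_bounded[OF s(1)] by blast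
    obtain N where N: "B < real p ^ N" using real_arch_pow[OF p_gt_1] by blast
    have k_pow: "\<kappa> (\<lambda>n. of_nat p ^ N) = of_nat p ^ N" using k_nat[of "p ^ N"] by simp
    have pN: "pabs (of_nat p ^ N) = (1 / real p) ^ N" by (induction N) (auto simp: pabs_p)
    have "pabs (of_nat p ^ N * s n) \<le> 1" for n
    proof -
      have "pabs (of_nat p ^ N * s n) \<le> (1 / real p) ^ N * real p ^ N"
        unfolding pabs_mult pN using B(2)[of n] N by (intro mult_left_mono) auto
      also have "\<dots> = 1" using p_nz by (simp flip: power_mult_distrib)
      finally show ?thesis .
    qed
    then have "of_nat p ^ N * x \<in> \<kappa> ` {s. padic_Cauchy p s \<and> (\<forall>n. pabs (s n) \<le> 1)}"
      using s k_pow by (intro image_eqI[of _ _ "\<lambda>n. of_nat p ^ N * s n"]) (auto simp: k_mult Cauchy_mult simp del: pabs_mult)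
    then show "\<exists>N. of_nat p ^ N * x \<in> \<kappa> ` {s. padic_Cauchy p s \<and> (\<forall>n. pabs (s n) \<le> 1)}" by blast
  qed
qed

section \<open>The ring of integers as a discrete valuation ring\<close>

text \<open>The residue field enters only through its cardinality \<open>q\<close>, counted by a system of
  representatives.\<close>

locale dvr =
  fixes R :: "'k::field set" and \<pi> :: 'k and q :: nat
  assumes one_mem: "1 \<in> R" and add_mem: "x \<in> R \<Longrightarrow> y \<in> R \<Longrightarrow> x + y \<in> R"
    and mult_mem: "x \<in> R \<Longrightarrow> y \<in> R \<Longrightarrow> x * y \<in> R" and uminus_mem: "x \<in> R \<Longrightarrow> - x \<in> R"
    and pi_mem: "\<pi> \<in> R" and pi_nz: "\<pi> \<noteq> 0" and pi_nonunit: "inverse \<pi> \<notin> R"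
    and unit_or: "x \<in> R \<Longrightarrow> x / \<pi> \<notin> R \<Longrightarrow> inverse x \<in> R"
    and separated: "(\<And>n. x / \<pi> ^ n \<in> R) \<Longrightarrow> x = 0"
    and residues: "\<exists>T. finite T \<and> T \<subseteq> R \<and> card T = q \<and> (\<forall>x\<in>R. \<exists>!t. t \<in> T \<and> (x - t) / \<pi> \<in> R)"

context padic_pair
begin

lemma Z_0: "0 \<in> Z" using Z_add[OF Z_1 Z_uminus[OF Z_1]] by simp

lemma Z_of_nat: "of_nat n \<in> Z" by (induction n) (auto simp: Z_0 Z_1 Z_add)

lemma Z_power: "x \<in> Z \<Longrightarrow> x ^ n \<in> Z" by (induction n) (auto simp: Z_1 Z_mult)

lemma Z_sum: "(\<And>i. i \<in> A \<Longrightarrow> f i \<in> Z) \<Longrightarrow> sum f A \<in> Z"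
  by (induction A rule: infinite_finite_induct) (auto simp: Z_0 Z_add)

text \<open>Bezout gives a multiple of j of the form 1 + p k, which \<open>Z_unit\<close>
  inverts.\<close>

lemma nat_unit: assumes "0 < j" "j < p" shows "of_nat j \<noteq> (0::'k)" "inverse (of_nat j) \<in> Z"
proof -
  have "\<not> p dvd j" using assms by (auto dest: dvd_imp_le)
  then have "coprime j p" using prime by (metis coprime_commute prime_imp_coprime)
  then have "gcd j p = 1" by simp
  then obtain i k where "i * j = k * p + 1" using bezout_nat[of j p] assms by (metis mult.commute neq0_conv)
  then have "of_nat i * of_nat j = (1 + of_nat p * of_nat k :: 'k)"
    by (metis add.commute mult.commute of_nat_1 of_nat_add of_nat_mult)
  moreover have u: "1 + of_nat p * of_nat k \<noteq> (0::'k)" "inverse (1 + of_nat p * of_nat k) \<in> Z"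
    using Z_unit[OF Z_of_nat] by auto
  ultimately have "of_nat j * (of_nat i * inverse (1 + of_nat p * of_nat k)) = (1::'k)"
    by (metis mult.assoc mult.commute right_inverse)
  then show "of_nat j \<noteq> (0::'k)" and "inverse (of_nat j) \<in> Z"
    using u(2) Z_mult[OF Z_of_nat[of i]] inverse_unique by (force, metis)
qed

end

lemma degree_monic_eq:
  assumes "coeff h n = (1::'a::field)" "\<And>i. i > n \<Longrightarrow> coeff h i = 0" shows "degree h = n" "lead_coeff h = 1"
proof -
  show "degree h = n" using assms by (metis degree_le le_antisym le_degree zero_neq_one)
  then show "lead_coeff h = 1" using assms by simp
qed

text \<open>Closure of the integral closure under sums and products is assumed here; in
  \<open>integers_dvr\<close> it is read off the hypothesis that P is a maximal ideal, which makes R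
  the carrier of a ring.\<close>

locale padic_integral_closure = padic_pair p Z Q for p and Z Q :: "'k::field set" +
  fixes R :: "'k set"
  assumes R_def: "R = {x. \<exists>g. lead_coeff g = 1 \<and> (\<forall>i. coeff g i \<in> Z) \<and> poly g x = 0}"
    and R_add: "x \<in> R \<Longrightarrow> y \<in> R \<Longrightarrow> x + y \<in> R" and R_mult: "x \<in> R \<Longrightarrow> y \<in> R \<Longrightarrow> x * y \<in> R"
begin

lemma Z_R: "z \<in> Z \<Longrightarrow> z \<in> R"
  unfolding R_def by (intro CollectI exI[of _ "[:- z, 1:]"])
    (auto simp: coeff_pCons Z_0 Z_1 Z_uminus split: nat.split)

lemma R_1: "1 \<in> R" and R_0: "0 \<in> R" using Z_R Z_1 Z_0 by auto

lemma R_uminus: "x \<in> R \<Longrightarrow> - x \<in> R"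
  using R_mult[OF Z_R[OF Z_uminus[OF Z_1]], of x] by simp

lemma R_of_nat: "of_nat n \<in> R" using Z_R Z_of_nat by blast

lemma R_power: "x \<in> R \<Longrightarrow> x ^ n \<in> R" by (induction n) (auto simp: R_1 R_mult)

lemma R_sum: "(\<And>i. i \<in> A \<Longrightarrow> f i \<in> R) \<Longrightarrow> sum f A \<in> R"
  by (induction A rule: infinite_finite_induct) (auto simp: R_0 R_add)

text \<open>Substituting \<open>p * r = 1 - w\<close> into an integral equation of \<open>r\<close> exhibits a unit multiple of 1
  as a multiple of \<open>w\<close>, so \<open>p\<close> lies in the Jacobson radical.\<close>

lemma jacobson: assumes r: "r \<in> R" shows "1 - of_nat p * r \<noteq> 0" "inverse (1 - of_nat p * r) \<in> R"
proof -
  obtain g where g: "lead_coeff g = 1" "\<And>i. coeff g i \<in> Z" "poly g r = 0" using r unfolding R_def by blast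
  define n where "n = degree g"
  define w where "w = 1 - of_nat p * r"
  define y where "y i = (\<Sum>j<i. (of_nat p * r) ^ j)" for i
  define P :: 'k where "P = of_nat p"
  have pow: "(P * r) ^ i = 1 - w * y i" for i
    using one_diff_power_eq[of "P * r" i] by (simp add: w_def y_def P_def eq_diff_eq diff_eq_eq add.commute)
  define Y where "Y = (\<Sum>i\<le>n. coeff g i * P ^ (n - i) * y i)"
  define z where "z = (\<Sum>i<n. coeff g i * P ^ (n - i - 1))"
  have "0 = P ^ n * poly g r" using g by simp
  also have "\<dots> = (\<Sum>i\<le>n. coeff g i * P ^ (n - i) * (P * r) ^ i)"
    unfolding poly_altdef n_def[symmetric] sum_distrib_left
    by (intro sum.cong) (auto simp: power_mult_distrib algebra_simps simp flip: power_add)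
  also have "\<dots> = (\<Sum>i\<le>n. coeff g i * P ^ (n - i)) - w * Y"
    unfolding pow Y_def sum_distrib_left sum_subtractf[symmetric] by (intro sum.cong) (auto simp: algebra_simps)
  also have "(\<Sum>i\<le>n. coeff g i * P ^ (n - i)) = (\<Sum>i<n. coeff g i * P ^ (n - i)) + 1"
    using g(1) by (simp add: n_def lessThan_Suc_atMost[symmetric])
  also have "(\<Sum>i<n. coeff g i * P ^ (n - i)) = P * z"
    unfolding z_def sum_distrib_left
  proof (intro sum.cong refl)
    fix i assume "i \<in> {..<n}"
    then have "P ^ (n - i) = P * P ^ (n - i - 1)" by (metis Suc_pred' diff_Suc_eq_diff_pred lessThan_iff power_Suc zero_less_diff)
    then show "coeff g i * P ^ (n - i) = P * (coeff g i * P ^ (n - i - 1))" by simp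
  qed
  finally have wY: "w * Y = 1 + P * z" by (simp add: algebra_simps)
  have "z \<in> Z" unfolding z_def P_def using g by (intro Z_sum Z_mult Z_power Z_of_nat)
  then have u: "1 + P * z \<noteq> 0" "inverse (1 + P * z) \<in> R" using Z_unit Z_R unfolding P_def by auto
  have "Y \<in> R" unfolding Y_def y_def P_def using g Z_R r by (intro R_sum R_mult R_power R_of_nat) auto
  have "w * (Y * inverse (1 + P * z)) = 1" using u(1) wY by (simp flip: mult.assoc)
  then show "1 - of_nat p * r \<noteq> 0" "inverse (1 - of_nat p * r) \<in> R"
    using R_mult[OF \<open>Y \<in> R\<close> u(2)] inverse_unique unfolding w_def by (force, metis)
qed

lemma p_nonunit: "inverse (of_nat p) \<notin> R"
  using jacobson(1)[of "inverse (of_nat p)"] p_nz by auto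

text \<open>Reversing an equation of x gives a monic equation of 1/x over Q, and multiplying the
  root by a large power of p makes all coefficients integral while keeping the equation
  monic.\<close>

lemma denominator:
  assumes x: "x \<noteq> 0" and g: "g \<noteq> 0" "\<And>i. coeff g i \<in> Q" "poly g x = 0"
  shows "\<exists>N. of_nat p ^ N * inverse x \<in> R"
proof -
  have Q0: "0 \<in> Q" using Z_0 Z_Q by blast
  \<comment> \<open>Since x is nonzero, factors X can be divided out until the constant coefficient
    is nonzero; it becomes the leading one after reversal.\<close>
  have "\<exists>h. coeff h 0 \<noteq> 0 \<and> (\<forall>i. coeff h i \<in> Q) \<and> poly h x = 0"
    using g
  proof (induction g)
    case (pCons a g)
    show ?case
    proof (cases "a = 0")
      case True
      have "poly g x = 0" "g \<noteq> 0" using pCons.prems x True by auto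
      moreover have "coeff g i \<in> Q" for i using pCons.prems(2)[of "Suc i"] by simp
      ultimately show ?thesis using pCons.IH by blast
    next
      case False
      then show ?thesis using pCons.prems by (intro exI[of _ "pCons a g"]) auto
    qed
  qed auto
  then obtain h where h: "coeff h 0 \<noteq> 0" "\<And>i. coeff h i \<in> Q" "poly h x = 0" by blast
  define n where "n = degree h"
  define c where "c i = coeff h (n - i) / coeff h 0" for i
  define y where "y = inverse x"
  have cQ: "c i \<in> Q" for i unfolding c_def divide_inverse using h by (intro Q_mult Q_inverse)
  have "(\<Sum>i\<le>n. c i * y ^ i) = y ^ n * poly h x / coeff h 0"
  proof -
    have "(\<Sum>i\<le>n. c i * y ^ i) = (\<Sum>i\<le>n. c (n - i) * y ^ (n - i))"
      by (rule sum.nat_diff_reindex[of _ "Suc n", unfolded lessThan_Suc_atMost diff_Suc_Suc, symmetric])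
    also have "\<dots> = (\<Sum>i\<le>n. y ^ n * (coeff h i * x ^ i) / coeff h 0)"
    proof (intro sum.cong refl)
      fix i assume i: "i \<in> {..n}"
      have "y ^ n = y ^ (n - i) * y ^ i" using i by (simp flip: power_add)
      moreover have "y ^ i * x ^ i = 1" using x by (simp add: y_def flip: power_mult_distrib)
      ultimately have "y ^ n * x ^ i = y ^ (n - i)" by (simp add: mult.assoc)
      then show "c (n - i) * y ^ (n - i) = y ^ n * (coeff h i * x ^ i) / coeff h 0"
        using i by (simp add: c_def algebra_simps)
    qed
    also have "\<dots> = y ^ n * poly h x / coeff h 0"
      by (simp add: poly_altdef n_def sum_distrib_left sum_divide_distrib)
    finally show ?thesis .
  qed
  then have root: "(\<Sum>i\<le>n. c i * y ^ i) = 0" using h by simp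
  have cn: "c n = 1" using h by (simp add: c_def)
  have "\<forall>i. \<exists>N. of_nat p ^ N * c i \<in> Z" using Q_denom cQ by blast
  then obtain M where M: "\<And>i. of_nat p ^ M i * c i \<in> Z" by metis
  define N where "N = (\<Sum>i\<le>n. M i)"
  have N: "of_nat p ^ N * c i \<in> Z" if "i \<le> n" for i
  proof -
    have "M i \<le> N" unfolding N_def using that by (intro member_le_sum) auto
    then have "of_nat p ^ N = (of_nat p ^ (N - M i) * of_nat p ^ M i :: 'k)" by (simp flip: power_add)
    then show ?thesis using Z_mult[OF Z_power[OF Z_of_nat] M] by (simp add: mult.assoc)
  qed
  \<comment> \<open>Scaling the root by p^N multiplies the i-th coefficient by p^(N (n - i)): a
    denominator is cleared for each i < n and the leading 1 is left alone.\<close>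
  define k where "k = (\<Sum>i\<le>n. monom (c i * (of_nat p ^ N) ^ (n - i)) i)"
  have ck: "coeff k i = (if i \<le> n then c i * (of_nat p ^ N) ^ (n - i) else 0)" for i
    unfolding k_def coeff_sum by (simp add: sum.delta' if_distrib cong: if_cong)
  have kZ: "coeff k i \<in> Z" for i
  proof (cases "i < n")
    case True
    then have "(of_nat p ^ N) ^ (n - i) = (of_nat p ^ N * (of_nat p ^ N) ^ (n - i - 1) :: 'k)"
      by (metis Suc_pred' diff_Suc_eq_diff_pred power_Suc zero_less_diff)
    then have "coeff k i = of_nat p ^ N * c i * (of_nat p ^ N) ^ (n - i - 1)" using True ck by simp
    then show ?thesis using N[of i] True by (simp add: Z_mult Z_power Z_of_nat)
  qed (use ck cn Z_0 Z_1 in auto)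
  have "poly k (of_nat p ^ N * y) = (of_nat p ^ N) ^ n * (\<Sum>i\<le>n. c i * y ^ i)"
    unfolding k_def poly_sum poly_monom sum_distrib_left
  proof (intro sum.cong refl)
    fix i assume "i \<in> {..n}"
    then have "(of_nat p ^ N) ^ n = ((of_nat p ^ N) ^ (n - i) * (of_nat p ^ N) ^ i :: 'k)" by (simp flip: power_add)
    then show "c i * (of_nat p ^ N) ^ (n - i) * (of_nat p ^ N * y) ^ i = (of_nat p ^ N) ^ n * (c i * y ^ i)"
      by (simp add: power_mult_distrib mult_ac)
  qed
  then have "poly k (of_nat p ^ N * y) = 0" using root by simp
  moreover have "lead_coeff k = 1" by (rule degree_monic_eq(2)[of k n]) (use ck cn in auto)
  ultimately show ?thesis unfolding R_def y_def using kZ by blast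
qed

end

text \<open>Algebra's polynomials are lists with the leading coefficient first, hence
  \<open>rev\<close>.\<close>

lemma eval_eq_poly:
  fixes x :: "'k::field"
  shows "ring.eval ring_of_type_algebra l x = poly (Poly (rev l)) x"
proof -
  interpret T: ring "ring_of_type_algebra :: 'k ring" by (rule ring_from_type_algebra)
  have pow: "x [^]\<^bsub>ring_of_type_algebra\<^esub> n = x ^ n" for n
    by (induction n) (simp_all add: nat_pow_def ring_of_type_algebra_def)
  show ?thesis
    by (induction l) (simp_all add: pow Poly_append poly_monom, simp_all add: ring_of_type_algebra_def)
qed

text \<open>The ramification equation P^e = (p) produces the uniformizer: some b in P^(e-1) and
  \<open>\<pi>\<close> in P have product p times a unit, so every element of P is a multiple of
  \<open>\<pi>\<close>. The residue cardinality comes from the inertia degree, since Z has p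
  residues.\<close>

theorem integers_dvr:
  fixes \<iota> :: "(nat \<Rightarrow> rat) set \<Rightarrow> 'k::field"
  assumes prime: "Factorial_Ring.prime p"
    and ext: "padic_extension_of_degree p \<iota> d"
    and max: "maximalideal P (integer_ring p \<iota>)"
    and ram: "is_ramification_index p \<iota> P e"
    and inert: "is_inertia_degree p \<iota> P f"
  obtains \<pi> where "dvr (integers_of p \<iota>) \<pi> (p ^ f)"
    "\<And>j. 0 < j \<Longrightarrow> j < p \<Longrightarrow> of_nat j \<noteq> (0 :: 'k) \<and> inverse (of_nat j) \<in> integers_of p \<iota>"
proof -
  let ?T = "ring_of_type_algebra :: 'k ring"
  define R where "R = integers_of p \<iota>"
  define S where "S = integer_ring p \<iota>"
  define Z where "Z = \<iota> ` Zp p"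
  define Q where "Q = \<iota> ` carrier (Qp p)"
  have hom: "\<iota> \<in> Ring.ring_hom (Qp p) ?T" and dim: "ring.dimension ?T d Q UNIV"
    using ext unfolding padic_extension_of_degree_def Q_def by auto
  interpret pp: padic_pair p Z Q unfolding Z_def Q_def by (rule padic_pair_image[OF prime hom])
  have S_simps: "carrier S = R" "x \<otimes>\<^bsub>S\<^esub> y = x * y" "x \<oplus>\<^bsub>S\<^esub> y = x + y" "\<one>\<^bsub>S\<^esub> = 1" "\<zero>\<^bsub>S\<^esub> = 0" for x y
    by (auto simp: S_def R_def integer_ring_def ring_of_type_algebra_def)
  have "ring S" using max ideal.axioms(2) maximalideal.axioms(1) unfolding S_def by blast
  then interpret S: ring S .
  interpret M: maximalideal P S using max by (simp add: S_def)
  have R_def': "R = {x. \<exists>g. lead_coeff g = 1 \<and> (\<forall>i. coeff g i \<in> Z) \<and> poly g x = 0}"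
    unfolding R_def integers_of_def Z_def by simp
  interpret R: padic_integral_closure p Z Q R
    by unfold_locales (use R_def' S.m_closed S.a_closed in \<open>auto simp: S_simps\<close>)
  interpret S: cring S
    by (intro cring.intro S.ring_axioms comm_monoidI) (auto simp: S_simps R.R_mult R.R_1)
  have S_uminus: "\<ominus>\<^bsub>S\<^esub> x = - x" if "x \<in> R" for x
    by (rule S.minus_equality) (use that R.R_uminus in \<open>auto simp: S_simps\<close>)
  have S_minus: "x \<ominus>\<^bsub>S\<^esub> y = x - y" if "x \<in> R" "y \<in> R" for x y
    using that by (simp add: a_minus_def S_uminus S_simps)
  have PR: "P \<subseteq> R" using M.a_subset by (simp add: S_simps)
  have P_add: "a + b \<in> P" if "a \<in> P" "b \<in> P" for a b using M.a_closed[OF that] by (simp add: S_simps)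
  have P_mult: "x * a \<in> P" "a * x \<in> P" if "a \<in> P" "x \<in> R" for a x
    using M.I_l_closed[OF that(1)] M.I_r_closed[OF that(1)] that by (auto simp: S_simps)
  have P0: "0 \<in> P" using M.zero_closed by (simp add: S_simps)
  have P1: "1 \<notin> P" using M.one_imp_carrier M.I_notcarr by (auto simp: S_simps)
  define Pw where "Pw n = P [^]\<^bsub>ideals_set S\<^esub> n" for n :: nat
  have Pw_0: "Pw 0 = R" and Pw_Suc: "Pw (Suc n) = ideal_prod S (Pw n) P" for n
    by (simp_all add: Pw_def nat_pow_def ideals_set_def S_simps)
  have Pw_pow: "t ^ n \<in> Pw n" if "t \<in> P" for t n
  proof (induction n)
    case (Suc n)
    show ?case unfolding Pw_Suc using ideal_prod.prod[OF Suc that, of S] by (simp add: S_simps mult.commute)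
  qed (simp add: Pw_0 R.R_1)
  have Pw_e: "Pw e = {r * of_nat p | r. r \<in> R}"
  proof -
    have "Pw e = PIdl\<^bsub>S\<^esub> (of_nat p)"
      using ram unfolding is_ramification_index_def Pw_def S_def by simp
    also have "\<dots> = {r * of_nat p | r. r \<in> R}"
      unfolding cgenideal_def by (auto simp: S_simps)
    finally show ?thesis .
  qed
  have e0: "e \<noteq> 0"
  proof
    assume "e = 0"
    then have "1 \<in> Pw e" using Pw_0 R.R_1 by simp
    then obtain r where "r \<in> R" "1 = r * of_nat p" unfolding Pw_e by blast
    then have "inverse (of_nat p) = r" using inverse_unique[of "of_nat p" r] by (simp add: mult.commute)
    then show False using R.p_nonunit \<open>r \<in> R\<close> by simp
  qed
  \<comment> \<open>By maximality 1 = a + r x with a in P. As a^e lies in (p), the factor 1 - a = r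
    x of 1 - a^e divides a unit by \<open>R.jacobson\<close>.\<close>
  have unit_P: "inverse x \<in> R \<and> x \<noteq> 0" if x: "x \<in> R" "x \<notin> P" for x
  proof -
    let ?J = "P <+>\<^bsub>S\<^esub> PIdl\<^bsub>S\<^esub> x"
    have J: "?J = {a + r * x | a r. a \<in> P \<and> r \<in> R}"
      unfolding set_add_def' cgenideal_def by (auto simp: S_simps)
    have "ideal ?J S" using S.add_ideals M.is_ideal S.cgenideal_ideal x by (simp add: S_simps)
    moreover have "P \<subseteq> ?J"
    proof
      fix a assume "a \<in> P"
      then have "a = a + 0 * x \<and> a \<in> P \<and> 0 \<in> R" using R.R_0 by simp
      then show "a \<in> ?J" unfolding J by blast
    qed
    moreover have "x \<in> ?J"
    proof -
      have "x = 0 + 1 * x \<and> 0 \<in> P \<and> 1 \<in> R" using P0 R.R_1 by simp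
      then show ?thesis unfolding J by blast
    qed
    moreover have "?J \<subseteq> carrier S" unfolding J S_simps using PR x R.R_add R.R_mult by blast
    ultimately have "?J = carrier S" using M.I_maximal x by blast
    then obtain a r where ar: "a \<in> P" "r \<in> R" "1 = a + r * x" using R.R_1 unfolding J S_simps by blast
    have "a ^ e \<in> Pw e" using Pw_pow ar by blast
    then obtain s where s: "s \<in> R" "a ^ e = s * of_nat p" unfolding Pw_e by blast
    have j: "1 - of_nat p * s \<noteq> 0" "inverse (1 - of_nat p * s) \<in> R" using R.jacobson[OF s(1)] by auto
    have "1 - of_nat p * s = (1 - a) * (\<Sum>i<e. a ^ i)" using one_diff_power_eq[of a e] s by (simp add: mult.commute)
    also have "1 - a = r * x" using ar(3) by (metis add_diff_cancel_left')
    finally have "x * (r * (\<Sum>i<e. a ^ i) * inverse (1 - of_nat p * s)) = 1"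
      using j(1) by (simp add: field_simps)
    moreover have "(\<Sum>i<e. a ^ i) \<in> R" using ar PR by (intro R.R_sum R.R_power) auto
    then have "r * (\<Sum>i<e. a ^ i) * inverse (1 - of_nat p * s) \<in> R" using ar j R.R_mult by blast
    ultimately show ?thesis using inverse_unique[of x] by auto
  qed
  obtain e' where e': "e = Suc e'" using e0 not0_implies_Suc by blast
  \<comment> \<open>Otherwise P^e would be contained in pP; but p itself lies in P^e, which would
    put 1 into P.\<close>
  have "\<exists>a\<in>P. \<exists>b\<in>Pw e'. \<not> (\<exists>y\<in>P. b * a = y * of_nat p)"
  proof (rule ccontr)
    assume "\<not> (\<exists>a\<in>P. \<exists>b\<in>Pw e'. \<not> (\<exists>y\<in>P. b * a = y * of_nat p))"
    then have c: "\<And>a b. a \<in> P \<Longrightarrow> b \<in> Pw e' \<Longrightarrow> \<exists>y\<in>P. b * a = y * of_nat p" by blast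
    have "\<exists>y\<in>P. x = y * of_nat p" if "x \<in> ideal_prod S (Pw e') P" for x
      using that
    proof (induction rule: ideal_prod.induct)
      case (sum s1 s2)
      then obtain y1 y2 where "y1 \<in> P" "s1 = y1 * of_nat p" "y2 \<in> P" "s2 = y2 * of_nat p" by blast
      then show ?case using P_add[of y1 y2] by (intro bexI[of _ "y1 + y2"]) (auto simp: S_simps algebra_simps)
    qed (use c in \<open>auto simp: S_simps\<close>)
    moreover have "of_nat p \<in> Pw e" unfolding Pw_e using R.R_1 by (intro CollectI exI[of _ 1]) auto
    ultimately obtain y where "y \<in> P" "of_nat p = y * of_nat p" unfolding e' Pw_Suc by blast
    then show False using P1 pp.p_nz by (metis mult_cancel_right2)
  qed
  then obtain \<pi> b where ab: "\<pi> \<in> P" "b \<in> Pw e'" "\<not> (\<exists>y\<in>P. b * \<pi> = y * of_nat p)" by blast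
  have bx: "\<exists>r\<in>R. b * x = r * of_nat p" if "x \<in> P" for x
  proof -
    have "b * x \<in> Pw e" using ideal_prod.prod[OF ab(2) that, of S] e' Pw_Suc by (simp add: S_simps)
    then show ?thesis unfolding Pw_e by blast
  qed
  obtain u where u: "u \<in> R" "b * \<pi> = u * of_nat p" using bx ab(1) by blast
  then have u': "inverse u \<in> R" "u \<noteq> 0" using ab(3) unit_P[of u] by auto
  have nz: "b \<noteq> 0" "\<pi> \<noteq> 0" using u(2) u'(2) pp.p_nz by auto
  \<comment> \<open>x / \<open>\<pi>\<close> is computed as (b x) / (b \<open>\<pi>\<close>), where
    both products are multiples of p and the second one is a unit multiple.\<close>
  have P_pi: "x / \<pi> \<in> R \<longleftrightarrow> x \<in> P" for x
  proof
    assume "x \<in> P"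
    then obtain r where r: "r \<in> R" "b * x = r * of_nat p" using bx by blast
    have "x / \<pi> = (b * x) / (b * \<pi>)" using nz by simp
    also have "\<dots> = r * inverse u" unfolding r u using pp.p_nz by (simp add: divide_inverse)
    finally show "x / \<pi> \<in> R" using r u' R.R_mult by simp
  next
    assume "x / \<pi> \<in> R"
    then have "x / \<pi> * \<pi> \<in> P" using P_mult ab by blast
    then show "x \<in> P" using nz by simp
  qed
  have "\<pi> ^ e \<in> Pw e" using Pw_pow ab by blast
  then obtain s where s: "s \<in> R" "\<pi> ^ e = s * of_nat p" unfolding Pw_e by blast
  \<comment> \<open>x is algebraic over Q, so p^N / x is integral for some N. If x were divisible by
    all powers of \<open>\<pi>\<close>, in particular by the one that contains p^(N+1), then 1/p
    would be integral.\<close>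
  have sep: "x = 0" if x: "\<And>n. x / \<pi> ^ n \<in> R" for x
  proof (rule ccontr)
    assume x0: "x \<noteq> 0"
    interpret T: field ?T by (rule field_from_type_algebra)
    have T_simps: "carrier ?T = UNIV" "a \<otimes>\<^bsub>?T\<^esub> b = a * b" "a \<oplus>\<^bsub>?T\<^esub> b = a + b" "\<one>\<^bsub>?T\<^esub> = 1" "\<zero>\<^bsub>?T\<^esub> = 0" for a b
      by (auto simp: ring_of_type_algebra_def)
    have T_uminus: "\<ominus>\<^bsub>?T\<^esub> a = - a" for a by (rule T.minus_equality) (auto simp: T_simps)
    have T_inv: "inv\<^bsub>?T\<^esub> a = inverse a" if "a \<noteq> 0" for a
      by (rule T.comm_inv_char) (use that in \<open>auto simp: T_simps\<close>)
    have sub: "subfield Q ?T"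
    proof (rule T.subfieldI'[OF T.subringI])
      show "inv\<^bsub>?T\<^esub> a \<in> Q" if "a \<in> Q - {\<zero>\<^bsub>?T\<^esub>}" for a
        using that pp.Q_inverse T_inv by (auto simp: T_simps)
    qed (use pp.Q_add pp.Q_mult pp.Q_uminus pp.Z_Q pp.Z_1 in \<open>auto simp: T_simps T_uminus\<close>)
    have "ring.algebraic ?T Q x"
      using T.finite_dimension_imp_algebraic[OF sub T.carrier_is_subring, unfolded over_def] T.finite_dimensionI dim
      by (simp add: T_simps)
    then obtain l where l: "l \<in> carrier (Q[X]\<^bsub>?T\<^esub>)" "l \<noteq> []" "ring.eval ?T l x = \<zero>\<^bsub>?T\<^esub>"
      using T.algebraicE[OF subfieldE(1)[OF sub], of x] unfolding over_def by (auto simp: T_simps)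
    then have lQ: "set l \<subseteq> Q" "hd l \<noteq> 0" unfolding univ_poly_carrier[symmetric] polynomial_def by (auto simp: T_simps)
    define g where "g = Poly (rev l)"
    have "poly g x = 0" using l(3) eval_eq_poly[of l x] by (simp add: g_def T_simps)
    moreover have "coeff g i \<in> Q" for i
    proof (cases "i < length l")
      case True
      then have "coeff g i = rev l ! i" by (simp add: g_def coeff_Poly_eq nth_default_def)
      also have "\<dots> \<in> set l" using True by (metis length_rev nth_mem set_rev)
      finally show ?thesis using lQ by blast
    next
      case False
      then have "coeff g i = 0" by (simp add: g_def coeff_Poly_eq nth_default_def)
      then show ?thesis using pp.Z_0 pp.Z_Q by auto
    qed
    moreover have "coeff g (length l - 1) = hd l"
      using l(2) by (simp add: g_def coeff_Poly_eq nth_default_def rev_nth hd_conv_nth)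
    then have "g \<noteq> 0" using lQ by auto
    ultimately obtain N where N: "of_nat p ^ N * inverse x \<in> R" using R.denominator[OF x0] by blast
    have "x / \<pi> ^ (e * Suc N) * s ^ Suc N * (of_nat p ^ N * inverse x) \<in> R"
      by (rule R.R_mult[OF R.R_mult[OF x R.R_power[OF s(1)]] N])
    moreover have "x / \<pi> ^ (e * Suc N) * s ^ Suc N * (of_nat p ^ N * inverse x) = inverse (of_nat p)"
    proof -
      have "s \<noteq> 0" using s nz by auto
      then show ?thesis using x0 pp.p_nz unfolding power_mult s by (simp add: field_simps)
    qed
    ultimately show False using R.p_nonunit by simp
  qed
  define F where "F = S Quot P"
  interpret F: field F unfolding F_def by (rule M.quotient_is_field) (rule S.is_cring)
  interpret h: ring_hom_ring S F "(+>\<^bsub>S\<^esub>) P" unfolding F_def by (rule M.rcos_ring_hom_ring)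
  have coset_eq: "P +>\<^bsub>S\<^esub> x = P +>\<^bsub>S\<^esub> y \<longleftrightarrow> x - y \<in> P" if "x \<in> R" "y \<in> R" for x y
    using S.quotient_eq_iff_same_a_r_cos[OF M.is_ideal, of x y] that S_minus by (simp add: S_simps)
  have F_carrier: "carrier F = (\<lambda>x. P +>\<^bsub>S\<^esub> x) ` R"
    unfolding F_def FactRing_simps by (auto simp: S_simps)
  define K where "K = (\<lambda>x. P +>\<^bsub>S\<^esub> x) ` Z"
  have natP: "of_nat j \<notin> P" if "0 < j" "j < p" for j
  proof
    assume "of_nat j \<in> P"
    then have "of_nat j * inverse (of_nat j) \<in> P" using P_mult R.Z_R pp.nat_unit[OF that] by blast
    then show False using P1 pp.nat_unit[OF that] by simp
  qed
  have pP: "of_nat p * z \<in> P" if "z \<in> R" for z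
  proof -
    have "of_nat p \<in> Pw e" unfolding Pw_e using R.R_1 by (intro CollectI exI[of _ 1]) auto
    moreover have "Pw e \<subseteq> P"
    proof
      fix y assume "y \<in> Pw e"
      then show "y \<in> P" unfolding e' Pw_Suc
      proof (induction rule: ideal_prod.induct)
        case (prod i j)
        have "Pw e' \<subseteq> R"
        proof (cases e')
          case (Suc k)
          have id: "ideal (Pw n) S" for n
          proof (induction n)
            case 0
            show ?case unfolding Pw_0 using S.oneideal by (simp add: S_simps)
          next
            case (Suc n)
            show ?case unfolding Pw_Suc by (rule S.ideal_prod_is_ideal[OF Suc M.is_ideal])
          qed
          show ?thesis using ideal.Icarr[OF id] by (auto simp: S_simps)
        qed (simp add: Pw_0)
        then show ?case using prod P_mult by (auto simp: S_simps)
      qed (auto simp: S_simps P_add)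
    qed
    ultimately show ?thesis using P_mult that by blast
  qed
  \<comment> \<open>The prime field of the residue field is represented by 0,...,p-1, because p lies
    in P.\<close>
  have K_nat: "K = (\<lambda>j. P +>\<^bsub>S\<^esub> of_nat j) ` {..<p}"
  proof (intro equalityI subsetI)
    fix y assume "y \<in> K"
    then obtain z where z: "z \<in> Z" "y = P +>\<^bsub>S\<^esub> z" unfolding K_def by blast
    obtain j w where j: "j < p" "w \<in> Z" "z = of_nat j + of_nat p * w" using pp.Z_residue[OF z(1)] by blast
    have "P +>\<^bsub>S\<^esub> z = P +>\<^bsub>S\<^esub> of_nat j"
      using coset_eq[of z "of_nat j"] z j R.Z_R R.R_of_nat pP by simp
    then show "y \<in> (\<lambda>j. P +>\<^bsub>S\<^esub> of_nat j) ` {..<p}" using z j by blast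
  qed (use K_def pp.Z_of_nat in blast)
  have inj: "inj_on (\<lambda>j. P +>\<^bsub>S\<^esub> of_nat j) {..<p}"
  proof (rule linorder_inj_onI')
    fix i j assume ij: "i \<in> {..<p}" "j \<in> {..<p}" "i < j"
    have "of_nat j - of_nat i = (of_nat (j - i) :: 'k)" using ij by (simp add: of_nat_diff)
    then have "P +>\<^bsub>S\<^esub> of_nat j \<noteq> P +>\<^bsub>S\<^esub> of_nat i"
      using coset_eq[of "of_nat j" "of_nat i"] R.R_of_nat natP[of "j - i"] ij by auto
    then show "P +>\<^bsub>S\<^esub> of_nat i \<noteq> P +>\<^bsub>S\<^esub> of_nat j" by simp
  qed
  have K_card: "card K = p" "finite K" unfolding K_nat using card_image[OF inj] by auto
  have F_one: "\<one>\<^bsub>F\<^esub> = P +>\<^bsub>S\<^esub> 1" using h.hom_one by (simp add: S_simps)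
  have F_zero: "\<zero>\<^bsub>F\<^esub> = P +>\<^bsub>S\<^esub> 0" using h.hom_zero by (simp add: S_simps)
  have F_mult: "(P +>\<^bsub>S\<^esub> x) \<otimes>\<^bsub>F\<^esub> (P +>\<^bsub>S\<^esub> y) = P +>\<^bsub>S\<^esub> (x * y)" if "x \<in> R" "y \<in> R" for x y
    using h.hom_mult[of x y] that by (simp add: S_simps)
  have subK: "subfield K F"
  proof (rule F.subfieldI')
    have "subring Z S"
      by (rule S.subringI) (use R.Z_R pp.Z_1 pp.Z_add pp.Z_mult pp.Z_uminus S_uminus in \<open>auto simp: S_simps\<close>)
    then show "subring K F" unfolding K_def by (rule h.img_is_subring)
    fix k assume "k \<in> K - {\<zero>\<^bsub>F\<^esub>}"
    then have "k \<in> (\<lambda>j. P +>\<^bsub>S\<^esub> of_nat j) ` {..<p}" "k \<noteq> P +>\<^bsub>S\<^esub> 0" using K_nat F_zero by auto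
    then obtain j where j: "j < p" "k = P +>\<^bsub>S\<^esub> of_nat j" "k \<noteq> P +>\<^bsub>S\<^esub> 0" by blast
    then have j0: "j \<noteq> 0" by (metis of_nat_0)
    have unit: "of_nat j \<noteq> (0::'k)" "inverse (of_nat j) \<in> Z" using pp.nat_unit[of j] j(1) j0 by auto
    have "k \<in> carrier F" "P +>\<^bsub>S\<^esub> inverse (of_nat j) \<in> carrier F"
      using j unit R.Z_R R.R_of_nat F_carrier by auto
    moreover have "k \<otimes>\<^bsub>F\<^esub> (P +>\<^bsub>S\<^esub> inverse (of_nat j)) = \<one>\<^bsub>F\<^esub>"
      using F_mult[of "of_nat j" "inverse (of_nat j)"] unit R.Z_R R.R_of_nat F_one j by simp
    ultimately have "inv\<^bsub>F\<^esub> k = P +>\<^bsub>S\<^esub> inverse (of_nat j)" by (intro F.comm_inv_char)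
    then show "inv\<^bsub>F\<^esub> k \<in> K" unfolding K_def using unit by blast
  qed
  have "ring.dimension F f K (carrier F)"
    using inert unfolding is_inertia_degree_def F_def S_def K_def Z_def by (simp add: image_image)
  then obtain Us where Us: "ring.independent F K Us" "length Us = f" "ring.Span F K Us = carrier F"
    using F.exists_base[OF subK] by blast
  \<comment> \<open>Coordinates in the basis \<open>Us\<close> identify the residue field with the
    lists of length f over the p-element field K.\<close>
  have "bij_betw (\<lambda>Ks. ring.combine F Ks Us) {Ks. set Ks \<subseteq> K \<and> length Ks = f} (carrier F)"
    unfolding bij_betw_def
  proof
    have Span: "ring.combine F Ks Us \<in> carrier F" if "set Ks \<subseteq> K" for Ks
      using F.combine_in_carrier[of Ks Us] that subfieldE(3)[OF subK] F.independent_in_carrier[OF Us(1)] by auto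
    have uniq: "\<exists>!Ks. set Ks \<subseteq> K \<and> length Ks = length Us \<and> a = ring.combine F Ks Us" if "a \<in> carrier F" for a
      using F.unique_decomposition[OF subK Us(1)] that Us(3) by simp
    show "inj_on (\<lambda>Ks. ring.combine F Ks Us) {Ks. set Ks \<subseteq> K \<and> length Ks = f}"
    proof (rule inj_onI)
      fix A B assume AB: "A \<in> {Ks. set Ks \<subseteq> K \<and> length Ks = f}" "B \<in> {Ks. set Ks \<subseteq> K \<and> length Ks = f}"
        "ring.combine F A Us = ring.combine F B Us"
      have "\<exists>!Ks. set Ks \<subseteq> K \<and> length Ks = length Us \<and> ring.combine F A Us = ring.combine F Ks Us"
        using AB by (intro uniq Span) auto
      then show "A = B" using AB Us(2) by auto
    qed
    show "(\<lambda>Ks. ring.combine F Ks Us) ` {Ks. set Ks \<subseteq> K \<and> length Ks = f} = carrier F"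
    proof (intro equalityI subsetI)
      fix a assume "a \<in> carrier F"
      then obtain Ks where "set Ks \<subseteq> K" "length Ks = length Us" "a = ring.combine F Ks Us" using uniq by blast
      then show "a \<in> (\<lambda>Ks. ring.combine F Ks Us) ` {Ks. set Ks \<subseteq> K \<and> length Ks = f}" using Us(2) by auto
    qed (use Span in auto)
  qed
  then have F_card: "card (carrier F) = p ^ f"
    using bij_betw_same_card card_lists_length_eq[OF K_card(2), of f] K_card(1) by fastforce
  have F_fin: "finite (carrier F)" using F_card prime_gt_0_nat[OF prime] by (intro card_ge_0_finite) simp
  define rep where "rep C = (SOME x. x \<in> R \<and> C = P +>\<^bsub>S\<^esub> x)" for C
  have rep: "rep C \<in> R \<and> C = P +>\<^bsub>S\<^esub> rep C" if "C \<in> carrier F" for C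
    unfolding rep_def by (rule someI_ex) (use that F_carrier in auto)
  have rep_inj: "inj_on rep (carrier F)"
  proof (rule inj_onI)
    fix C D assume "C \<in> carrier F" "D \<in> carrier F" "rep C = rep D"
    then show "C = D" using rep[of C] rep[of D] by simp
  qed
  show ?thesis
  proof (rule that[of \<pi>], fold R_def)
    show "dvr R \<pi> (p ^ f)"
    proof
      show "\<exists>T. finite T \<and> T \<subseteq> R \<and> card T = p ^ f \<and> (\<forall>x\<in>R. \<exists>!t. t \<in> T \<and> (x - t) / \<pi> \<in> R)"
      proof (intro exI[of _ "rep ` carrier F"] conjI ballI)
        fix x assume x: "x \<in> R"
        have cF: "P +>\<^bsub>S\<^esub> x \<in> carrier F" using x F_carrier by blast
        show "\<exists>!t. t \<in> rep ` carrier F \<and> (x - t) / \<pi> \<in> R"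
        proof (rule ex1I[of _ "rep (P +>\<^bsub>S\<^esub> x)"])
          show "rep (P +>\<^bsub>S\<^esub> x) \<in> rep ` carrier F \<and> (x - rep (P +>\<^bsub>S\<^esub> x)) / \<pi> \<in> R"
            unfolding P_pi using cF rep[OF cF] coset_eq x by blast
          fix t assume "t \<in> rep ` carrier F \<and> (x - t) / \<pi> \<in> R"
          then obtain C where C: "C \<in> carrier F" "t = rep C" "x - t \<in> P" unfolding P_pi by blast
          then have "P +>\<^bsub>S\<^esub> x = C" using coset_eq x rep[OF C(1)] by blast
          then show "t = rep (P +>\<^bsub>S\<^esub> x)" using C by simp
        qed
      qed (use rep F_fin rep_inj F_card in \<open>auto simp: card_image\<close>)
      show "inverse \<pi> \<notin> R" using P_pi[of 1] P1 by (simp add: divide_inverse)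
      show "inverse x \<in> R" if "x \<in> R" "x / \<pi> \<notin> R" for x using unit_P that P_pi by blast
      show "x = 0" if "\<And>n. x / \<pi> ^ n \<in> R" for x by (rule sep) (rule that)
    qed (use R.R_1 R.R_add R.R_mult R.R_uminus ab PR nz in auto)
    show "of_nat j \<noteq> (0 :: 'k) \<and> inverse (of_nat j) \<in> R" if "0 < j" "j < p" for j
      using pp.nat_unit[OF that] R.Z_R by blast
  qed
qed

section \<open>Congruences in a discrete valuation ring\<close>

declare One_nat_def [simp del]

text \<open>Cardinalities of residue sets are compared through maps that respect the congruences.\<close>

lemma card_image_eqI:
  assumes "\<And>x. x \<in> A \<Longrightarrow> h x \<in> B" "\<And>y. y \<in> B \<Longrightarrow> \<exists>x\<in>A. g (h x) = g y"
    "\<And>x x'. x \<in> A \<Longrightarrow> x' \<in> A \<Longrightarrow> f x = f x' \<longleftrightarrow> g (h x) = g (h x')"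
  shows "card (f ` A) = card (g ` B)"
proof -
  define c where "c v = (SOME x. x \<in> A \<and> f x = v)" for v
  have c: "c v \<in> A" "f (c v) = v" if "v \<in> f ` A" for v
    using someI_ex[of "\<lambda>x. x \<in> A \<and> f x = v"] that unfolding c_def by auto
  have "bij_betw (\<lambda>v. g (h (c v))) (f ` A) (g ` B)"
    unfolding bij_betw_def
  proof
    show "inj_on (\<lambda>v. g (h (c v))) (f ` A)"
    proof (rule inj_onI)
      fix v w assume "v \<in> f ` A" "w \<in> f ` A" "g (h (c v)) = g (h (c w))"
      then show "v = w" using assms(3)[of "c v" "c w"] c by simp
    qed
    show "(\<lambda>v. g (h (c v))) ` f ` A = g ` B"
    proof (intro equalityI subsetI)
      fix w assume "w \<in> g ` B"
      then obtain y where y: "y \<in> B" "w = g y" by blast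
      then obtain x where x: "x \<in> A" "g (h x) = g y" using assms(2) by blast
      have "g (h (c (f x))) = g (h x)" using assms(3)[of "c (f x)" x] c[of "f x"] x by simp
      then show "w \<in> (\<lambda>v. g (h (c v))) ` f ` A" using x y by (intro image_eqI[of _ _ "f x"]) auto
    qed (use c assms(1) in auto)
  qed
  then show ?thesis by (rule bij_betw_same_card)
qed

context dvr
begin

lemma zero_mem [simp]: "0 \<in> R"
  using add_mem[OF one_mem uminus_mem[OF one_mem]] by simp

lemma diff_mem: "x \<in> R \<Longrightarrow> y \<in> R \<Longrightarrow> x - y \<in> R"
  using add_mem[of x "- y"] uminus_mem by simp

lemma power_mem: "x \<in> R \<Longrightarrow> x ^ n \<in> R" by (induction n) (auto simp: one_mem mult_mem)

lemma sum_mem: "(\<And>i. i \<in> A \<Longrightarrow> f i \<in> R) \<Longrightarrow> sum f A \<in> R"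
  by (induction A rule: infinite_finite_induct) (auto simp: add_mem)

lemma prod_mem: "(\<And>i. i \<in> A \<Longrightarrow> f i \<in> R) \<Longrightarrow> prod f A \<in> R"
  by (induction A rule: infinite_finite_induct) (auto simp: mult_mem one_mem)

text \<open>The ideal generated by \<open>\<pi> ^ M\<close>, encoded by a division so that no
  cofactor is carried along; \<open>idl_iff\<close> recovers the cofactor.\<close>

definition idl :: "nat \<Rightarrow> 'k set" where "idl M = {x. x / \<pi> ^ M \<in> R}"

lemma idl_0: "idl 0 = R" by (simp add: idl_def)

lemma idl_iff: "x \<in> idl M \<longleftrightarrow> (\<exists>r\<in>R. x = \<pi> ^ M * r)"
proof
  assume "x \<in> idl M"
  then show "\<exists>r\<in>R. x = \<pi> ^ M * r"
    using pi_nz by (intro bexI[of _ "x / \<pi> ^ M"]) (auto simp: idl_def)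
qed (use pi_nz in \<open>auto simp: idl_def\<close>)

lemma idl_zero [simp]: "0 \<in> idl M" by (simp add: idl_def)

lemma idl_add: "x \<in> idl M \<Longrightarrow> y \<in> idl M \<Longrightarrow> x + y \<in> idl M"
  by (simp add: idl_def add_divide_distrib add_mem)

lemma idl_uminus: "x \<in> idl M \<Longrightarrow> - x \<in> idl M"
  using uminus_mem[of "x / \<pi> ^ M"] by (simp add: idl_def)

lemma idl_diff: "x \<in> idl M \<Longrightarrow> y \<in> idl M \<Longrightarrow> x - y \<in> idl M"
  using idl_add[of x M "- y"] idl_uminus by simp

lemma idl_commute: "x - y \<in> idl M \<longleftrightarrow> y - x \<in> idl M"
  using idl_uminus[of "x - y" M] idl_uminus[of "y - x" M] by auto

lemma idl_trans: "x - y \<in> idl M \<Longrightarrow> y - z \<in> idl M \<Longrightarrow> x - z \<in> idl M"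
  using idl_add[of "x - y" M "y - z"] by simp

lemma idl_mult: "x \<in> idl M \<Longrightarrow> y \<in> idl N \<Longrightarrow> x * y \<in> idl (M + N)"
  using mult_mem[of "x / \<pi> ^ M" "y / \<pi> ^ N"] by (simp add: idl_def power_add)

lemma idl_mult_right: "x \<in> idl M \<Longrightarrow> y \<in> R \<Longrightarrow> x * y \<in> idl M"
  and idl_mult_left: "x \<in> R \<Longrightarrow> y \<in> idl M \<Longrightarrow> x * y \<in> idl M"
  using idl_mult[of x M y 0] idl_mult[of x 0 y M] by (auto simp: idl_0)

lemma idl_sum: "(\<And>i. i \<in> A \<Longrightarrow> f i \<in> idl M) \<Longrightarrow> sum f A \<in> idl M"
  by (induction A rule: infinite_finite_induct) (auto simp: idl_add)

lemma pi_power_idl: "\<pi> ^ M \<in> idl M" using pi_nz one_mem by (simp add: idl_def)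

lemma idl_mono: assumes "M \<le> N" "x \<in> idl N" shows "x \<in> idl M"
proof -
  have "\<pi> ^ N = \<pi> ^ M * \<pi> ^ (N - M)" using assms(1) by (simp flip: power_add)
  then have "x / \<pi> ^ M = x / \<pi> ^ N * \<pi> ^ (N - M)" using pi_nz by simp
  moreover have "x / \<pi> ^ N * \<pi> ^ (N - M) \<in> R"
    using assms(2) by (intro mult_mem power_mem pi_mem) (simp add: idl_def)
  ultimately show ?thesis by (simp add: idl_def)
qed

lemma idl_R: "x \<in> idl M \<Longrightarrow> x \<in> R" using idl_mono[of 0 M x] by (simp add: idl_0)

lemma idl_shift: "x * \<pi> ^ a \<in> idl (M + a) \<longleftrightarrow> x \<in> idl M"
  using pi_nz by (simp add: idl_def power_add)

lemma one_not_idl: "1 \<notin> idl 1" using pi_nonunit by (simp add: idl_def divide_inverse)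

definition unit :: "'k \<Rightarrow> bool" where "unit x \<longleftrightarrow> x \<in> R \<and> inverse x \<in> R \<and> x \<noteq> 0"

lemma unit_iff: "x \<in> R \<Longrightarrow> unit x \<longleftrightarrow> x \<notin> idl 1"
proof
  assume "unit x"
  show "x \<notin> idl 1"
  proof
    assume "x \<in> idl 1"
    then have "x * inverse x \<in> idl 1" using \<open>unit x\<close> idl_mult_right[of x 1 "inverse x"] by (simp only: unit_def)
    moreover have "x * inverse x = 1" using \<open>unit x\<close> by (simp add: unit_def)
    ultimately show False using one_not_idl by simp
  qed
next
  assume "x \<in> R" "x \<notin> idl 1"
  then show "unit x" using unit_or idl_zero[of 1] by (auto simp: unit_def idl_def)
qed

lemma unit_R: "unit x \<Longrightarrow> x \<in> R" and unit_nz: "unit x \<Longrightarrow> x \<noteq> 0" and unit_inv: "unit x \<Longrightarrow> inverse x \<in> R"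
  by (simp_all add: unit_def)

lemma unit_1: "unit 1" by (simp add: unit_def one_mem)

lemma unit_mult: "unit x \<Longrightarrow> unit y \<Longrightarrow> unit (x * y)"
  by (simp add: unit_def mult_mem)

lemma unit_inverse: "unit x \<Longrightarrow> unit (inverse x)" by (simp add: unit_def)

lemma unit_uminus: "unit x \<Longrightarrow> unit (- x)"
  using uminus_mem by (simp add: unit_def)

lemma unit_divide_mem: "x \<in> R \<Longrightarrow> unit y \<Longrightarrow> x / y \<in> R"
  by (simp add: unit_def divide_inverse mult_mem)

lemma unit_cong: "unit x \<Longrightarrow> y \<in> R \<Longrightarrow> x - y \<in> idl 1 \<Longrightarrow> unit y"
  using idl_add[of "x - y" 1 y] unit_iff unit_R by auto

lemma unit_multD: "x \<in> R \<Longrightarrow> y \<in> R \<Longrightarrow> unit (x * y) \<Longrightarrow> unit x"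
  using unit_iff mult_mem idl_mult_right by blast

lemma idl_prime: "x \<in> R \<Longrightarrow> y \<in> R \<Longrightarrow> x * y \<in> idl 1 \<Longrightarrow> x \<in> idl 1 \<or> y \<in> idl 1"
  using unit_iff mult_mem unit_mult by blast

lemma idl_unit_cancel: assumes "unit x" "x * y \<in> idl M" shows "y \<in> idl M"
  using idl_mult_left[OF unit_inv[OF assms(1)] assms(2)] unit_nz[OF assms(1)] by (simp flip: mult.assoc)

lemma mult_cong:
  assumes "a \<in> R" "b' \<in> R" "a - a' \<in> idl M" "b - b' \<in> idl M" shows "a * b - a' * b' \<in> idl M"
proof -
  have "a * b - a' * b' = a * (b - b') + (a - a') * b'" by (simp add: algebra_simps)
  then show ?thesis using idl_add idl_mult_left[OF assms(1,4)] idl_mult_right[OF assms(3,2)] by simp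
qed

lemma sum_cong_idl: "(\<And>i. i \<in> A \<Longrightarrow> f i - g i \<in> idl M) \<Longrightarrow> sum f A - sum g A \<in> idl M"
  unfolding sum_subtractf[symmetric] by (rule idl_sum)

lemma prod_cong_idl:
  "(\<And>i. i \<in> A \<Longrightarrow> f i \<in> R \<and> g i \<in> R \<and> f i - g i \<in> idl M) \<Longrightarrow> prod f A - prod g A \<in> idl M"
proof (induction A rule: infinite_finite_induct)
  case (insert x A)
  have "f x * prod f A - g x * prod g A \<in> idl M"
    using insert by (intro mult_cong prod_mem) auto
  then show ?case using insert by simp
qed auto

subsection \<open>Canonical representatives\<close>

text \<open>\<open>SOME\<close> returns the same value on congruent arguments, because its predicate
  depends on the class only. Residue rings are thus replaced by images of \<open>red M\<close>, and
  counting classes means counting such an image.\<close>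

definition red :: "nat \<Rightarrow> 'k \<Rightarrow> 'k" where "red M x = (SOME y. y \<in> R \<and> x - y \<in> idl M)"

lemma red: assumes "x \<in> R" shows red_mem: "red M x \<in> R" and red_cong: "x - red M x \<in> idl M"
proof -
  have "red M x \<in> R \<and> x - red M x \<in> idl M"
    unfolding red_def by (rule someI[of _ x]) (use assms in auto)
  then show "red M x \<in> R" "x - red M x \<in> idl M" by auto
qed

lemma red_eq_iff: assumes "x \<in> R" "y \<in> R" shows "red M x = red M y \<longleftrightarrow> x - y \<in> idl M"
proof
  assume "red M x = red M y"
  then show "x - y \<in> idl M"
    using idl_diff[OF red_cong[OF assms(1)] red_cong[OF assms(2)], of M] by simp
next
  assume xy: "x - y \<in> idl M"
  have "z \<in> R \<and> x - z \<in> idl M \<longleftrightarrow> z \<in> R \<and> y - z \<in> idl M" for z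
    using idl_trans[OF xy, of z] idl_trans[of y x M z] xy idl_commute[of x y] by blast
  then show "red M x = red M y" by (simp add: red_def)
qed

lemma red_red: "x \<in> R \<Longrightarrow> red M (red M x) = red M x"
  using red_eq_iff[of "red M x" x M] red_mem red_cong idl_commute by blast

lemma red_1_card: "card (red 1 ` R) = q" "finite (red 1 ` R)"
proof -
  obtain T where T: "finite T" "T \<subseteq> R" "card T = q" "\<And>x. x \<in> R \<Longrightarrow> \<exists>!t. t \<in> T \<and> (x - t) / \<pi> \<in> R"
    using residues by auto
  have T': "\<exists>!t. t \<in> T \<and> x - t \<in> idl 1" if "x \<in> R" for x using T(4)[OF that] by (simp add: idl_def)
  have img: "red 1 ` R = red 1 ` T"
  proof (intro equalityI subsetI)
    fix y assume "y \<in> red 1 ` R"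
    then obtain x where x: "x \<in> R" "y = red 1 x" by blast
    obtain t where t: "t \<in> T" "x - t \<in> idl 1" using T'[OF x(1)] by blast
    then have "red 1 x = red 1 t" using red_eq_iff x T by blast
    then show "y \<in> red 1 ` T" using t x by blast
  qed (use T in auto)
  have "inj_on (red 1) T"
  proof (rule inj_onI)
    fix s t assume st: "s \<in> T" "t \<in> T" "red 1 s = red 1 t"
    then have "s - t \<in> idl 1" "s - s \<in> idl 1" using red_eq_iff T by (auto simp: subset_iff)
    then show "s = t" using T'[of s] st T(2) by blast
  qed
  then show "card (red 1 ` R) = q" "finite (red 1 ` R)" unfolding img using T card_image[of "red 1" T] by simp_all
qed

text \<open>Expansion in base \<open>\<pi>\<close>: a class modulo \<open>\<pi> ^ (M+1)\<close> is a
  digit modulo \<open>\<pi>\<close> plus \<open>\<pi>\<close> times a class modulo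
  \<open>\<pi> ^ M\<close>.\<close>

lemma red_card: "card (red M ` R) = q ^ M \<and> finite (red M ` R)"
proof (induction M)
  case 0
  have "red 0 x = red 0 0" if "x \<in> R" for x using red_eq_iff[of x 0 0] that by (simp add: idl_0)
  moreover have "red 0 0 \<in> red 0 ` R" by (rule imageI[OF zero_mem])
  ultimately have "red 0 ` R = {red 0 0}" by blast
  then show ?case by simp
next
  case (Suc M)
  let ?f = "\<lambda>(t, s). red (Suc M) (t + \<pi> * s)"
  have "bij_betw ?f ((red 1 ` R) \<times> (red M ` R)) (red (Suc M) ` R)"
    unfolding bij_betw_def
  proof
    show "inj_on ?f ((red 1 ` R) \<times> (red M ` R))"
    proof (rule inj_onI, clarify)
      fix a b a' b' assume m: "a \<in> R" "b \<in> R" "a' \<in> R" "b' \<in> R"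
        and eq: "red (Suc M) (red 1 a + \<pi> * red M b) = red (Suc M) (red 1 a' + \<pi> * red M b')"
      let ?a = "red 1 a" let ?b = "red M b" let ?a' = "red 1 a'" let ?b' = "red M b'"
      have mm: "?a \<in> R" "?b \<in> R" "?a' \<in> R" "?b' \<in> R" using m red_mem by auto
      have d: "(?a + \<pi> * ?b) - (?a' + \<pi> * ?b') \<in> idl (Suc M)"
        using eq mm by (subst red_eq_iff[symmetric]) (auto intro: add_mem mult_mem pi_mem)
      have "\<pi> * (?b - ?b') \<in> idl 1" using pi_power_idl[of 1] mm by (auto intro: idl_mult_right diff_mem)
      moreover have e: "?a - ?a' = ((?a + \<pi> * ?b) - (?a' + \<pi> * ?b')) - \<pi> * (?b - ?b')" by (simp add: algebra_simps)
      ultimately have "?a - ?a' \<in> idl 1"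
        unfolding e using idl_diff[OF idl_mono[OF _ d, of 1]] by simp
      then have "red 1 ?a = red 1 ?a'" using red_eq_iff mm by blast
      then have aa: "?a = ?a'" using red_red m by simp
      then have e': "(?b - ?b') * \<pi> ^ 1 = (?a + \<pi> * ?b) - (?a' + \<pi> * ?b')" by (simp add: algebra_simps)
      have "(?b - ?b') * \<pi> ^ 1 \<in> idl (M + 1)" unfolding e' using d by (simp only: Suc_eq_plus1)
      then have "?b - ?b' \<in> idl M" by (simp only: idl_shift)
      then have "red M ?b = red M ?b'" using red_eq_iff mm by blast
      then show "red 1 a = red 1 a' \<and> red M b = red M b'" using red_red m aa by simp
    qed
    show "?f ` ((red 1 ` R) \<times> (red M ` R)) = red (Suc M) ` R"
    proof (intro equalityI subsetI)
      fix y assume "y \<in> ?f ` ((red 1 ` R) \<times> (red M ` R))"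
      then obtain a b where "a \<in> R" "b \<in> R" "y = red (Suc M) (red 1 a + \<pi> * red M b)" by auto
      moreover from this have "red 1 a + \<pi> * red M b \<in> R" using add_mem mult_mem pi_mem red_mem by simp
      ultimately show "y \<in> red (Suc M) ` R" by blast
    next
      fix y assume "y \<in> red (Suc M) ` R"
      then obtain x where x: "x \<in> R" "y = red (Suc M) x" by blast
      obtain r where r: "r \<in> R" "x - red 1 x = \<pi> * r" using red_cong[OF x(1), of 1] idl_iff by auto
      have "x - (red 1 x + \<pi> * red M r) = (r - red M r) * \<pi> ^ 1" using r(2) by (simp add: algebra_simps)
      also have "\<dots> \<in> idl (M + 1)" using red_cong[OF r(1)] by (simp only: idl_shift)
      finally have "x - (red 1 x + \<pi> * red M r) \<in> idl (Suc M)" by (simp only: Suc_eq_plus1)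
      then have "y = red (Suc M) (red 1 x + \<pi> * red M r)"
        unfolding x(2) using x r by (subst red_eq_iff) (auto intro!: add_mem mult_mem pi_mem red_mem)
      then show "y \<in> ?f ` ((red 1 ` R) \<times> (red M ` R))" using x r by (intro image_eqI[of _ _ "(red 1 x, red M r)"]) auto
    qed
  qed
  from bij_betw_same_card[OF this] bij_betw_finite[OF this]
  have "card (red (Suc M) ` R) = card ((red 1 ` R) \<times> (red M ` R))" "finite (red (Suc M) ` R)"
    using Suc red_1_card by auto
  then show ?case using Suc red_1_card by (simp add: card_cartesian_product)
qed

lemma red_idl_card: assumes "L \<le> M" shows "card (red M ` idl L) = q ^ (M - L)"
proof -
  have "card (red (M - L) ` R) = card (red M ` idl L)"
  proof (rule card_image_eqI[where h = "\<lambda>r. \<pi> ^ L * r"])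
    show "\<pi> ^ L * r \<in> idl L" if "r \<in> R" for r using that idl_iff by blast
    show "\<exists>r\<in>R. red M (\<pi> ^ L * r) = red M y" if "y \<in> idl L" for y using that idl_iff by auto
    show "red (M - L) r = red (M - L) r' \<longleftrightarrow> red M (\<pi> ^ L * r) = red M (\<pi> ^ L * r')" if "r \<in> R" "r' \<in> R" for r r'
    proof -
      have m: "\<pi> ^ L * r \<in> R" "\<pi> ^ L * r' \<in> R" using that by (auto intro: mult_mem power_mem pi_mem)
      have "\<pi> ^ L * r - \<pi> ^ L * r' = (r - r') * \<pi> ^ L" by (simp add: algebra_simps)
      then show ?thesis
        using red_eq_iff[OF that] red_eq_iff[OF m] idl_shift[of "r - r'" L "M - L"] assms by simp
    qed
  qed
  then show ?thesis using red_card by simp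
qed

lemma q_gt_1: "q > 1"
proof -
  have "red 1 0 \<noteq> red 1 1" using red_eq_iff[of 0 1 1] one_mem one_not_idl idl_commute[of 0 1 1] by simp
  moreover have "{red 1 0, red 1 1} \<subseteq> red 1 ` R" using one_mem by auto
  ultimately have "card {red 1 0, red 1 1} \<le> q" using red_1_card card_mono by metis
  then show ?thesis using \<open>red 1 0 \<noteq> red 1 1\<close> by simp
qed

lemma red_units_card: "card (red 1 ` {x. unit x}) = q - 1"
proof -
  have "red 1 ` {x. unit x} = red 1 ` R - {red 1 0}"
  proof (intro equalityI subsetI)
    fix y assume "y \<in> red 1 ` {x. unit x}"
    then obtain x where x: "unit x" "y = red 1 x" by blast
    then have "x - 0 \<notin> idl 1" using unit_iff[OF unit_R] by simp
    then have "red 1 x \<noteq> red 1 0" using red_eq_iff[of x 0 1] unit_R[OF x(1)] by simp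
    then show "y \<in> red 1 ` R - {red 1 0}" using x(2) unit_R[OF x(1)] by simp
  next
    fix y assume "y \<in> red 1 ` R - {red 1 0}"
    then obtain x where x: "x \<in> R" "y = red 1 x" "red 1 x \<noteq> red 1 0" by blast
    then have "unit x" using red_eq_iff[of x 0 1] unit_iff by simp
    then show "y \<in> red 1 ` {x. unit x}" using x by blast
  qed
  then show ?thesis using red_1_card by (simp add: card_Diff_singleton)
qed

lemma separatedI: assumes "x \<in> R" "\<And>t. x \<in> idl t" shows "x = 0"
  using separated[of x] assms by (simp add: idl_def)

text \<open>The sum 1 + x + ... + x^(n-1) is congruent to the unit n, so it is a unit, while its
  product with 1 - x vanishes.\<close>

lemma unipotent_root_of_unity:
  assumes "x - 1 \<in> idl 1" "x ^ n = 1" "unit (of_nat n)" shows "x = 1"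
proof (rule ccontr)
  assume x: "x \<noteq> 1"
  have xR: "x \<in> R" using idl_R[OF assms(1)] add_mem[of "x - 1" 1] one_mem by simp
  have "x ^ i - 1 \<in> idl 1" for i
    using prod_cong_idl[of "{..<i}" "\<lambda>_. x" "\<lambda>_. 1" 1] assms(1) xR one_mem by simp
  then have "(\<Sum>i<n. x ^ i) - (\<Sum>i<n. 1) \<in> idl 1" by (intro sum_cong_idl)
  then have "of_nat n - (\<Sum>i<n. x ^ i) \<in> idl 1" using idl_commute[of "of_nat n"] by simp
  moreover have "(\<Sum>i<n. x ^ i) \<in> R" using power_mem[OF xR] by (intro sum_mem)
  ultimately have "unit (\<Sum>i<n. x ^ i)" using unit_cong[OF assms(3)] by blast
  moreover have "(1 - x) * (\<Sum>i<n. x ^ i) = 0" using one_diff_power_eq[of x n] assms(2) by simp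
  ultimately show False using x unit_nz by simp
qed

end

section \<open>Matrix groups and their congruence subgroups\<close>

text \<open>Counts values of f along a coarser invariant g; the constant fibre size is later
  supplied by translation in a group.\<close>

lemma card_fibers:
  assumes fin: "finite (f ` A)" and finer: "\<And>x y. x \<in> A \<Longrightarrow> y \<in> A \<Longrightarrow> f x = f y \<Longrightarrow> g x = g y"
    and fiber: "\<And>a. a \<in> A \<Longrightarrow> card (f ` {x \<in> A. g x = g a}) = c"
  shows "card (f ` A) = card (g ` A) * c"
proof -
  have "g ` A = (\<lambda>v. g (SOME x. x \<in> A \<and> f x = v)) ` f ` A"
  proof -
    have "g (SOME x. x \<in> A \<and> f x = f a) = g a" if "a \<in> A" for a
      using someI[of "\<lambda>x. x \<in> A \<and> f x = f a" a] that finer by blast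
    then show ?thesis by (simp add: image_image)
  qed
  then have fin_g: "finite (g ` A)" using fin by (metis finite_imageI)
  have "card (f ` A) = card (\<Union>v\<in>g ` A. f ` {x \<in> A. g x = v})"
    by (rule arg_cong[where f = card]) auto
  also have "\<dots> = (\<Sum>v\<in>g ` A. card (f ` {x \<in> A. g x = v}))"
  proof (rule card_UN_disjoint[OF fin_g])
    show "\<forall>v\<in>g ` A. finite (f ` {x \<in> A. g x = v})" by (auto intro: finite_subset[OF _ fin])
    show "\<forall>v\<in>g ` A. \<forall>w\<in>g ` A. v \<noteq> w \<longrightarrow> f ` {x \<in> A. g x = v} \<inter> f ` {x \<in> A. g x = w} = {}"
      using finer by blast
  qed
  also have "\<dots> = (\<Sum>v\<in>g ` A. c)" by (rule sum.cong) (use fiber in auto)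
  finally show ?thesis by simp
qed

lemma mat_mult_index:
  assumes "A \<in> carrier_mat n n" "B \<in> carrier_mat n n" "i < n" "j < n"
  shows "(A * B) $$ (i, j) = (\<Sum>k<n. A $$ (i, k) * B $$ (k, j))"
  using assms by (simp add: scalar_prod_def atLeast0LessThan)

section \<open>Integral matrices, their congruences and conjugation by a diagonal matrix\<close>

context dvr
begin

definition RM :: "nat \<Rightarrow> 'k mat set" where
  "RM n = {A \<in> carrier_mat n n. \<forall>i<n. \<forall>j<n. A $$ (i, j) \<in> R}"

lemma RM_carrier: "A \<in> RM n \<Longrightarrow> A \<in> carrier_mat n n" by (simp add: RM_def)

lemma RM_entry: "A \<in> RM n \<Longrightarrow> i < n \<Longrightarrow> j < n \<Longrightarrow> A $$ (i, j) \<in> R" by (simp add: RM_def)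

lemma RM_iff_elements: "A \<in> RM n \<longleftrightarrow> A \<in> carrier_mat n n \<and> elements_mat A \<subseteq> R"
proof (cases "A \<in> carrier_mat n n")
  case True
  have "A $$ (i, j) \<in> R" if "elements_mat A \<subseteq> R" "i < n" "j < n" for i j
    using that(1) elements_matI[OF True that(2,3) refl] by (rule subsetD)
  moreover have "a \<in> R" if "\<forall>i<n. \<forall>j<n. A $$ (i, j) \<in> R" "a \<in> elements_mat A" for a
    using elements_matD[OF that(2)] that(1) True by auto
  ultimately show ?thesis using True unfolding RM_def by blast
qed (simp add: RM_def)

lemma RM_one: "1\<^sub>m n \<in> RM n" by (auto simp: RM_def one_mem)

lemma RM_mult: "A \<in> RM n \<Longrightarrow> B \<in> RM n \<Longrightarrow> A * B \<in> RM n"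
  by (auto simp: RM_def mat_mult_index[of A n B] simp del: index_mult_mat intro!: sum_mem mult_mem)

definition mcong :: "nat \<Rightarrow> nat \<Rightarrow> 'k mat \<Rightarrow> 'k mat \<Rightarrow> bool" where
  "mcong n M A B \<longleftrightarrow> (\<forall>i<n. \<forall>j<n. A $$ (i, j) - B $$ (i, j) \<in> idl M)"

lemma mcong_refl: "mcong n M A A" by (simp add: mcong_def)

lemma mcong_sym: "mcong n M A B \<Longrightarrow> mcong n M B A" using idl_commute by (simp add: mcong_def)

text \<open>The asymmetric hypotheses come from AB - A'B' = A (B - B') + (A - A') B'.\<close>

lemma mcong_mult:
  assumes "A \<in> RM n" "B' \<in> RM n" "A' \<in> carrier_mat n n" "B \<in> carrier_mat n n" "mcong n M A A'" "mcong n M B B'"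
  shows "mcong n M (A * B) (A' * B')"
  unfolding mcong_def
proof (intro allI impI)
  fix i j assume ij: "i < n" "j < n"
  have "(\<Sum>k<n. A $$ (i, k) * B $$ (k, j)) - (\<Sum>k<n. A' $$ (i, k) * B' $$ (k, j)) \<in> idl M"
  proof (rule sum_cong_idl)
    fix k assume "k \<in> {..<n}"
    then show "A $$ (i, k) * B $$ (k, j) - A' $$ (i, k) * B' $$ (k, j) \<in> idl M"
      using assms ij by (intro mult_cong) (auto simp: RM_entry mcong_def)
  qed
  then show "(A * B) $$ (i, j) - (A' * B') $$ (i, j) \<in> idl M"
    using mat_mult_index[of A n B i j] mat_mult_index[of A' n B' i j] assms ij RM_carrier by simp
qed

lemma mcong_one_RM: assumes "A \<in> carrier_mat n n" "mcong n M A (1\<^sub>m n)" shows "A \<in> RM n"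
  unfolding RM_def
proof (intro CollectI conjI allI impI)
  fix i j assume ij: "i < n" "j < n"
  have "A $$ (i, j) - 1\<^sub>m n $$ (i, j) \<in> R"
    using assms ij idl_R unfolding mcong_def by blast
  from add_mem[OF this RM_entry[OF RM_one ij]] show "A $$ (i, j) \<in> R" by (simp only: diff_add_cancel)
qed (rule assms)

definition redm :: "nat \<Rightarrow> 'k mat \<Rightarrow> 'k mat" where "redm M = map_mat (red M)"

lemma redm_eq_iff:
  assumes "A \<in> RM n" "B \<in> RM n" shows "redm M A = redm M B \<longleftrightarrow> mcong n M A B"
proof -
  have "redm M A = redm M B \<longleftrightarrow> (\<forall>i<n. \<forall>j<n. red M (A $$ (i, j)) = red M (B $$ (i, j)))"
    using RM_carrier[OF assms(1)] RM_carrier[OF assms(2)] unfolding redm_def mat_eq_iff by auto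
  then show ?thesis using assms red_eq_iff by (simp add: mcong_def RM_entry)
qed

lemma redm_finite: assumes "A \<subseteq> RM n" shows "finite (redm M ` A)"
proof -
  let ?I = "{..<n} \<times> {..<n}"
  have "redm M B \<in> mat n n ` (?I \<rightarrow>\<^sub>E red M ` R)" if "B \<in> RM n" for B
  proof (rule image_eqI)
    show "redm M B = mat n n (restrict (\<lambda>ij. red M (B $$ ij)) ?I)"
      using RM_carrier[OF that] by (intro eq_matI) (auto simp: redm_def)
    show "restrict (\<lambda>ij. red M (B $$ ij)) ?I \<in> ?I \<rightarrow>\<^sub>E red M ` R"
      using RM_entry[OF that] by auto
  qed
  then have "redm M ` A \<subseteq> mat n n ` (?I \<rightarrow>\<^sub>E red M ` R)" using assms by blast
  moreover have "finite (?I \<rightarrow>\<^sub>E red M ` R)"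
    by (rule finite_PiE) (use red_card in auto)
  then have "finite (mat n n ` (?I \<rightarrow>\<^sub>E red M ` R))" by (rule finite_imageI)
  ultimately show ?thesis by (rule finite_subset)
qed

text \<open>Conjugation by the diagonal matrix with entries \<open>\<pi> ^ h i\<close>.\<close>

definition conj :: "nat \<Rightarrow> (nat \<Rightarrow> nat) \<Rightarrow> 'k mat \<Rightarrow> 'k mat" where
  "conj n h A = mat n n (\<lambda>(i, j). \<pi> ^ h i * A $$ (i, j) / \<pi> ^ h j)"

lemma conj_carrier: "conj n h A \<in> carrier_mat n n" by (simp add: conj_def)

lemma conj_index: "i < n \<Longrightarrow> j < n \<Longrightarrow> conj n h A $$ (i, j) = \<pi> ^ h i * A $$ (i, j) / \<pi> ^ h j"
  by (simp add: conj_def)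

lemma conj_one: "conj n h (1\<^sub>m n) = 1\<^sub>m n"
  by (rule eq_matI) (use pi_nz in \<open>auto simp: conj_def\<close>)

lemma conj_mult:
  assumes "A \<in> carrier_mat n n" "B \<in> carrier_mat n n"
  shows "conj n h (A * B) = conj n h A * conj n h B"
proof (rule eq_matI)
  fix i j assume "i < dim_row (conj n h A * conj n h B)" "j < dim_col (conj n h A * conj n h B)"
  then have ij: "i < n" "j < n" by (auto simp: conj_def)
  have "(conj n h A * conj n h B) $$ (i, j) = (\<Sum>k<n. \<pi> ^ h i * (A $$ (i, k) * B $$ (k, j)) / \<pi> ^ h j)"
    unfolding mat_mult_index[OF conj_carrier conj_carrier ij]
    by (intro sum.cong) (use pi_nz ij in \<open>auto simp: conj_index\<close>)
  also have "\<dots> = conj n h (A * B) $$ (i, j)"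
    unfolding conj_index[OF ij] mat_mult_index[OF assms ij] by (simp add: sum_distrib_left sum_divide_distrib)
  finally show "conj n h (A * B) $$ (i, j) = (conj n h A * conj n h B) $$ (i, j)" by simp
qed (auto simp: conj_def)

text \<open>A congruence before and after conjugation becomes one congruence at a higher level. The
  truncated difference \<open>b - a\<close> hides the case distinction: if a exceeds b, conjugation
  multiplies by a power of \<open>\<pi>\<close> and demands nothing new.\<close>

lemma conj_idl_iff: "x \<in> idl (m + (b - a)) \<longleftrightarrow> x \<in> idl m \<and> \<pi> ^ a * x / \<pi> ^ b \<in> idl m"
proof (cases "a \<le> b")
  case True
  have "\<pi> ^ b = \<pi> ^ a * \<pi> ^ (b - a)" using True by (simp flip: power_add)
  then have e: "\<pi> ^ a * x / \<pi> ^ b * \<pi> ^ (b - a) = x" using pi_nz by simp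
  show ?thesis
    using idl_shift[of "\<pi> ^ a * x / \<pi> ^ b" "b - a" m] idl_mono[of m "m + (b - a)" x] unfolding e by auto
next
  case False
  have "\<pi> ^ a = \<pi> ^ (a - b) * \<pi> ^ b" using False by (simp flip: power_add)
  then have "\<pi> ^ a * x / \<pi> ^ b = \<pi> ^ (a - b) * x" using pi_nz by simp
  moreover have "b - a = 0" using False by simp
  ultimately show ?thesis using idl_mult_left[OF power_mem[OF pi_mem], of x m "a - b"] by auto
qed

end

section \<open>Groups of integral matrices and the sizes of their reductions\<close>

locale matgrp = dvr +
  fixes n :: nat and G :: "'a mat set"
  assumes G_RM: "G \<subseteq> RM n" and G_one: "1\<^sub>m n \<in> G" and G_mult: "x \<in> G \<Longrightarrow> y \<in> G \<Longrightarrow> x * y \<in> G"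
    and G_inv: "x \<in> G \<Longrightarrow> \<exists>y\<in>G. x * y = 1\<^sub>m n \<and> y * x = 1\<^sub>m n"
begin

text \<open>Built by updating the carrier of \<open>ring_mat\<close>, as in \<open>SL\<close> and
  \<open>Sp_even\<close>, so that the classical groups are literally of this form.\<close>

definition GG :: "'a mat ring" where "GG = (ring_mat TYPE('a) n ())\<lparr>carrier := G\<rparr>"

lemma GG_simps [simp]: "carrier GG = G" "x \<otimes>\<^bsub>GG\<^esub> y = x * y" "\<one>\<^bsub>GG\<^esub> = 1\<^sub>m n"
  by (simp_all add: GG_def ring_mat_def)

lemma G_carrier: "x \<in> G \<Longrightarrow> x \<in> carrier_mat n n" using G_RM RM_carrier by blast

lemma G_in_RM: "x \<in> G \<Longrightarrow> x \<in> RM n" using G_RM by blast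

lemma group_GG: "group GG"
proof (rule groupI)
  show "x \<otimes>\<^bsub>GG\<^esub> y \<otimes>\<^bsub>GG\<^esub> z = x \<otimes>\<^bsub>GG\<^esub> (y \<otimes>\<^bsub>GG\<^esub> z)" if "x \<in> carrier GG" "y \<in> carrier GG" "z \<in> carrier GG" for x y z
    using that assoc_mult_mat[OF G_carrier G_carrier G_carrier] by simp
  show "\<one>\<^bsub>GG\<^esub> \<otimes>\<^bsub>GG\<^esub> x = x" if "x \<in> carrier GG" for x using that left_mult_one_mat[OF G_carrier] by simp
  show "\<exists>y\<in>carrier GG. y \<otimes>\<^bsub>GG\<^esub> x = \<one>\<^bsub>GG\<^esub>" if "x \<in> carrier GG" for x using that G_inv by fastforce
qed (use G_one G_mult in auto)

lemma GG_inv: assumes "x \<in> G" "y \<in> G" "x * y = 1\<^sub>m n" shows "inv\<^bsub>GG\<^esub> y = x"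
  by (rule group.inv_equality[OF group_GG]) (use assms in auto)

lemma mcong_left_cancel:
  assumes "x \<in> G" "A \<in> RM n" "B \<in> RM n" "mcong n M (x * A) (x * B)" shows "mcong n M A B"
proof -
  obtain y where y: "y \<in> G" "y * x = 1\<^sub>m n" using G_inv assms(1) by blast
  have c: "x \<in> carrier_mat n n" "y \<in> carrier_mat n n" "A \<in> carrier_mat n n" "B \<in> carrier_mat n n"
    using assms y RM_carrier G_carrier by auto
  have "mcong n M (y * (x * A)) (y * (x * B))"
    by (rule mcong_mult[OF G_in_RM[OF y(1)] _ c(2) _ mcong_refl assms(4)])
      (use assms RM_mult G_in_RM RM_carrier in auto)
  moreover have e: "y * (x * C) = C" if "C \<in> carrier_mat n n" for C
    using assoc_mult_mat[OF c(2) c(1) that] y(2) that by simp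
  ultimately show ?thesis using e[OF c(3)] e[OF c(4)] by simp
qed

lemma mcong_one_inv:
  assumes "x \<in> G" "y \<in> G" "y * x = 1\<^sub>m n" "mcong n M x (1\<^sub>m n)" shows "mcong n M y (1\<^sub>m n)"
proof -
  have "mcong n M (y * 1\<^sub>m n) (y * x)"
    using assms mcong_sym G_in_RM G_carrier by (intro mcong_mult mcong_refl) auto
  then show ?thesis using assms G_carrier[of y] by simp
qed

definition G1 :: "'a mat set" where "G1 = {x \<in> G. mcong n 1 x (1\<^sub>m n)}"

text \<open>The fibre over the residue of a is the translate of \<open>G1\<close> by a, and left
  multiplication by a is a bijection on residues modulo \<open>\<pi> ^ M\<close>.\<close>

lemma card_residue_split:
  assumes "M \<ge> 1" shows "card (redm M ` G) = card (redm 1 ` G) * card (redm M ` G1)"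
proof (rule card_fibers)
  show "finite (redm M ` G)" using redm_finite G_RM by blast
  have mono: "mcong n M x y \<Longrightarrow> mcong n 1 x y" for x y
    using idl_mono[OF assms] by (simp add: mcong_def)
  show "redm 1 x = redm 1 y" if "x \<in> G" "y \<in> G" "redm M x = redm M y" for x y
    using that redm_eq_iff[of _ n] G_in_RM mono by simp
  show "card (redm M ` {x \<in> G. redm 1 x = redm 1 a}) = card (redm M ` G1)" if a: "a \<in> G" for a
  proof (rule card_image_eqI[symmetric, where h = "\<lambda>y. a * y"])
    show "a * y \<in> {x \<in> G. redm 1 x = redm 1 a}" if y: "y \<in> G1" for y
    proof -
      have "mcong n 1 (a * y) (a * 1\<^sub>m n)"
        using a y G_in_RM G_carrier RM_one by (intro mcong_mult mcong_refl) (auto simp: G1_def)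
      then have "mcong n 1 (a * y) a" using G_carrier[OF a] by simp
      then show ?thesis using a y G_mult redm_eq_iff[of _ n] G_in_RM by (auto simp: G1_def)
    qed
    show "\<exists>x\<in>G1. redm M (a * x) = redm M y" if y: "y \<in> {x \<in> G. redm 1 x = redm 1 a}" for y
    proof -
      obtain b where b: "b \<in> G" "a * b = 1\<^sub>m n" "b * a = 1\<^sub>m n" using G_inv a by blast
      have c: "a \<in> carrier_mat n n" "b \<in> carrier_mat n n" "y \<in> carrier_mat n n" using a b y G_carrier by auto
      have "mcong n 1 (b * y) (b * a)"
        using y a b c redm_eq_iff[of _ n] G_in_RM by (intro mcong_mult mcong_refl) auto
      then have "b * y \<in> G1" using b y G_mult by (simp add: G1_def)
      moreover have "a * (b * y) = y" using assoc_mult_mat[OF c] b c by simp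
      ultimately show ?thesis by (intro bexI[of _ "b * y"]) auto
    qed
    show "redm M x = redm M x' \<longleftrightarrow> redm M (a * x) = redm M (a * x')" if x: "x \<in> G1" "x' \<in> G1" for x x'
    proof -
      have g: "x \<in> G" "x' \<in> G" using x by (auto simp: G1_def)
      have "mcong n M x x' \<Longrightarrow> mcong n M (a * x) (a * x')"
        using a g G_in_RM G_carrier by (intro mcong_mult mcong_refl) auto
      then show ?thesis
        using mcong_left_cancel[of a x x' M] redm_eq_iff[of _ n] G_in_RM G_mult a g by blast
    qed
  qed
qed

text \<open>Counts the residue image column by column; \<open>c\<close> is the order of the columns.\<close>

definition orb :: "(nat \<Rightarrow> nat) \<Rightarrow> nat \<Rightarrow> 'a vec set" where
  "orb c j = (\<lambda>x. map_vec (red 1) (col x (c j))) `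
     {x \<in> G. \<forall>i<j. \<forall>r<n. x $$ (r, c i) - 1\<^sub>m n $$ (r, c i) \<in> idl 1}"

lemma redcol_eq_iff:
  assumes "x \<in> RM n" "y \<in> RM n" "k < n"
  shows "map_vec (red 1) (col x k) = map_vec (red 1) (col y k) \<longleftrightarrow> (\<forall>r<n. x $$ (r, k) - y $$ (r, k) \<in> idl 1)"
proof -
  have "map_vec (red 1) (col x k) = map_vec (red 1) (col y k) \<longleftrightarrow>
      (\<forall>r<n. red 1 (x $$ (r, k)) = red 1 (y $$ (r, k)))"
    using RM_carrier[OF assms(1)] RM_carrier[OF assms(2)] assms(3) unfolding vec_eq_iff by auto
  then show ?thesis using assms red_eq_iff by (simp add: RM_entry)
qed

text \<open>Orbit counting along a chain of stabilisers: \<open>F j x\<close> records the first j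
  columns in the order c. Multiplying by the inverse of a moves the elements sharing these columns
  with a to those whose first j columns are standard, so every fibre has the size of
  \<open>orb c j\<close>.\<close>

lemma card_residue_chain:
  assumes c: "bij_betw c {..<n} {..<n}" shows "card (redm 1 ` G) = (\<Prod>j<n. card (orb c j))"
proof -
  define F where "F j x = map (\<lambda>i. map_vec (red 1) (col x (c i))) [0..<j]" for j x
  have cn: "c i < n" if "i < n" for i using bij_betwE[OF c] that by auto
  have F_iff: "F j x = F j y \<longleftrightarrow> (\<forall>i<j. \<forall>r<n. x $$ (r, c i) - y $$ (r, c i) \<in> idl 1)"
    if "x \<in> RM n" "y \<in> RM n" "j \<le> n" for j x y
    unfolding F_def using redcol_eq_iff[OF that(1,2)] that(3) cn by auto
  have fin: "finite (F j ` G)" if "j \<le> n" for j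
  proof -
    have "redm 1 x = redm 1 y \<Longrightarrow> F j x = F j y" if "x \<in> G" "y \<in> G" for x y
      using that F_iff[OF G_in_RM G_in_RM \<open>j \<le> n\<close>] redm_eq_iff[OF G_in_RM G_in_RM] \<open>j \<le> n\<close> cn by (auto simp: mcong_def)
    then have "F j (SOME y. y \<in> G \<and> redm 1 y = redm 1 x) = F j x" if "x \<in> G" for x
      using someI[of "\<lambda>y. y \<in> G \<and> redm 1 y = redm 1 x" x] that by blast
    then have "F j ` G = (\<lambda>v. F j (SOME y. y \<in> G \<and> redm 1 y = v)) ` redm 1 ` G" by (simp add: image_image)
    then show ?thesis using redm_finite[OF G_RM] by simp
  qed
  have col_mult: "(a * y) $$ (r, k) - (a * y') $$ (r, k) \<in> idl 1"
    if a: "a \<in> G" and y: "y \<in> RM n" "y' \<in> RM n" and k: "k < n" "r < n" and d: "\<And>r. r < n \<Longrightarrow> y $$ (r, k) - y' $$ (r, k) \<in> idl 1" for a y y' k r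
  proof -
    have "(\<Sum>i<n. a $$ (r, i) * y $$ (i, k)) - (\<Sum>i<n. a $$ (r, i) * y' $$ (i, k)) \<in> idl 1"
      unfolding sum_subtractf[symmetric] right_diff_distrib[symmetric]
      using RM_entry[OF G_in_RM[OF a]] k d by (intro idl_sum idl_mult_left) auto
    then show ?thesis using mat_mult_index[OF G_carrier[OF a] RM_carrier] y k by simp
  qed
  have step: "card (F (Suc j) ` G) = card (F j ` G) * card (orb c j)" if j: "j < n" for j
  proof (rule card_fibers)
    show "finite (F (Suc j) ` G)" using fin j by simp
    show "F j x = F j y" if "F (Suc j) x = F (Suc j) y" for x y using that by (simp add: F_def)
    show "card (F (Suc j) ` {x \<in> G. F j x = F j a}) = card (orb c j)" if a: "a \<in> G" for a
      unfolding orb_def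
    proof (rule card_image_eqI[symmetric, where h = "\<lambda>y. a * y"])
      let ?S = "{x \<in> G. \<forall>i<j. \<forall>r<n. x $$ (r, c i) - 1\<^sub>m n $$ (r, c i) \<in> idl 1}"
      show in_fib: "a * y \<in> {x \<in> G. F j x = F j a}" if y: "y \<in> ?S" for y
      proof -
        have "(a * y) $$ (r, c i) - (a * 1\<^sub>m n) $$ (r, c i) \<in> idl 1" if "i < j" "r < n" for i r
          using y that a j cn G_in_RM RM_one by (intro col_mult) auto
        then have "F j (a * y) = F j a"
          using F_iff[of "a * y" a j] a y j G_carrier[OF a] G_mult G_in_RM by simp
        then show ?thesis using a y G_mult by simp
      qed
      show "\<exists>x\<in>?S. F (Suc j) (a * x) = F (Suc j) y" if y: "y \<in> {x \<in> G. F j x = F j a}" for y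
      proof -
        obtain b where b: "b \<in> G" "a * b = 1\<^sub>m n" "b * a = 1\<^sub>m n" using G_inv a by blast
        have cc: "a \<in> carrier_mat n n" "b \<in> carrier_mat n n" "y \<in> carrier_mat n n" using a b y G_carrier by auto
        have "y $$ (r, c i) - a $$ (r, c i) \<in> idl 1" if "i < j" "r < n" for i r
          using y a j F_iff[of y a j] G_in_RM that by simp
        then have "(b * y) $$ (r, c i) - (b * a) $$ (r, c i) \<in> idl 1" if "i < j" "r < n" for i r
          using y that a b j cn G_in_RM by (intro col_mult) auto
        then have "b * y \<in> ?S" using b y G_mult by simp
        moreover have "a * (b * y) = y" using assoc_mult_mat[OF cc] b cc by simp
        ultimately show ?thesis by (intro bexI[of _ "b * y"]) auto
      qed
      show "map_vec (red 1) (col x (c j)) = map_vec (red 1) (col x' (c j)) \<longleftrightarrow> F (Suc j) (a * x) = F (Suc j) (a * x')"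
        if x: "x \<in> ?S" "x' \<in> ?S" for x x'
      proof -
        have g: "x \<in> G" "x' \<in> G" using x by auto
        have Fj: "F j (a * x) = F j (a * x')" using in_fib[OF x(1)] in_fib[OF x(2)] by simp
        have "F (Suc j) (a * x) = F (Suc j) (a * x') \<longleftrightarrow>
            map_vec (red 1) (col (a * x) (c j)) = map_vec (red 1) (col (a * x') (c j))"
          using Fj by (simp add: F_def)
        also have "\<dots> \<longleftrightarrow> (\<forall>r<n. (a * x) $$ (r, c j) - (a * x') $$ (r, c j) \<in> idl 1)"
          using a g G_mult G_in_RM cn j by (intro redcol_eq_iff) auto
        also have "\<dots> \<longleftrightarrow> (\<forall>r<n. x $$ (r, c j) - x' $$ (r, c j) \<in> idl 1)"
        proof
          assume d: "\<forall>r<n. (a * x) $$ (r, c j) - (a * x') $$ (r, c j) \<in> idl 1"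
          obtain b where b: "b \<in> G" "b * a = 1\<^sub>m n" using G_inv a by blast
          have e: "b * (a * z) = z" if "z \<in> G" for z
            using assoc_mult_mat[OF G_carrier[OF b(1)] G_carrier[OF a] G_carrier[OF that]] b G_carrier[OF that] by simp
          have "(b * (a * x)) $$ (r, c j) - (b * (a * x')) $$ (r, c j) \<in> idl 1" if "r < n" for r
            by (rule col_mult) (use a b g d that j cn G_mult G_in_RM in auto)
          then show "\<forall>r<n. x $$ (r, c j) - x' $$ (r, c j) \<in> idl 1" using e g by simp
        next
          assume d: "\<forall>r<n. x $$ (r, c j) - x' $$ (r, c j) \<in> idl 1"
          have "(a * x) $$ (r, c j) - (a * x') $$ (r, c j) \<in> idl 1" if "r < n" for r
            by (rule col_mult) (use a g d that j cn G_in_RM in auto)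
          then show "\<forall>r<n. (a * x) $$ (r, c j) - (a * x') $$ (r, c j) \<in> idl 1" by blast
        qed
        also have "\<dots> \<longleftrightarrow> map_vec (red 1) (col x (c j)) = map_vec (red 1) (col x' (c j))"
          using g G_in_RM cn j by (intro redcol_eq_iff[symmetric]) auto
        finally show ?thesis by simp
      qed
    qed
  qed
  have "card (F j ` G) = (\<Prod>i<j. card (orb c i))" if "j \<le> n" for j
    using that
  proof (induction j)
    case 0
    have "F 0 ` G = {[]}" using G_one by (auto simp: F_def)
    then show ?case by simp
  qed (use step in auto)
  moreover have "card (redm 1 ` G) = card (F n ` G)"
  proof (rule card_image_eqI[where h = "\<lambda>x. x"])
    show "redm 1 x = redm 1 y \<longleftrightarrow> F n x = F n y" if "x \<in> G" "y \<in> G" for x y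
    proof -
      have img: "c ` {..<n} = {..<n}" using c by (simp add: bij_betw_def)
      have "F n x = F n y \<longleftrightarrow> (\<forall>k\<in>c ` {..<n}. \<forall>r<n. x $$ (r, k) - y $$ (r, k) \<in> idl 1)"
        using F_iff[OF G_in_RM G_in_RM, of x y n] that by auto
      also have "\<dots> \<longleftrightarrow> mcong n 1 x y" unfolding img mcong_def by auto
      finally show ?thesis using redm_eq_iff[OF G_in_RM G_in_RM, of x y 1] that by simp
    qed
  qed auto
  ultimately show ?thesis by simp
qed

end

text \<open>Conjugation by \<open>\<pi> ^ h\<close> as a virtual endomorphism with domain \<open>D\<close>.\<close>

locale matgrp_conj = matgrp +
  fixes h :: "nat \<Rightarrow> nat" and m :: nat
  assumes m1: "m \<ge> 1" and conj_G: "x \<in> G \<Longrightarrow> conj n h x \<in> RM n \<Longrightarrow> conj n h x \<in> G"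
begin

definition D :: "'a mat set" where
  "D = {x \<in> G. mcong n m x (1\<^sub>m n) \<and> mcong n m (conj n h x) (1\<^sub>m n)}"

text \<open>Conjugation fixes the identity, so both congruences defining D concern the same entry of
  x - 1 and merge; this shows the level at which each entry is to be counted.\<close>

lemma D_iff: "x \<in> D \<longleftrightarrow> x \<in> G \<and> (\<forall>i<n. \<forall>j<n. x $$ (i, j) - 1\<^sub>m n $$ (i, j) \<in> idl (m + (h j - h i)))"
proof -
  have "conj n h x $$ (i, j) - 1\<^sub>m n $$ (i, j) = \<pi> ^ h i * (x $$ (i, j) - 1\<^sub>m n $$ (i, j)) / \<pi> ^ h j"
    if "i < n" "j < n" for i j
    using that pi_nz by (simp add: conj_index field_simps)
  then show ?thesis unfolding D_def mcong_def by (auto simp: conj_idl_iff)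
qed

lemma D_conj: "x \<in> D \<Longrightarrow> conj n h x \<in> G"
  using conj_G mcong_one_RM[OF conj_carrier] by (auto simp: D_def)

lemma D_subgroup: "subgroup D GG"
proof (rule group.subgroupI[OF group_GG])
  show "D \<subseteq> carrier GG" by (auto simp: D_def)
  have "1\<^sub>m n \<in> D" by (simp add: D_def G_one conj_one mcong_refl)
  then show "D \<noteq> {}" by blast
  fix x assume x: "x \<in> D"
  then have xG: "x \<in> G" "mcong n m x (1\<^sub>m n)" "mcong n m (conj n h x) (1\<^sub>m n)" by (auto simp: D_def)
  obtain y where y: "y \<in> G" "x * y = 1\<^sub>m n" "y * x = 1\<^sub>m n" using G_inv xG by blast
  obtain z where z: "z \<in> G" "conj n h x * z = 1\<^sub>m n" "z * conj n h x = 1\<^sub>m n" using G_inv D_conj[OF x] by blast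
  have "conj n h x * conj n h y = 1\<^sub>m n"
    using conj_mult[of x n y h] y conj_one G_carrier xG by simp
  then have "z = conj n h y"
    using assoc_mult_mat[OF G_carrier[OF z(1)] conj_carrier[of n h x] conj_carrier[of n h y]] z
      G_carrier[OF z(1)] conj_carrier[of n h y] by simp
  then have "mcong n m (conj n h y) (1\<^sub>m n)"
    using mcong_one_inv[OF D_conj[OF x] z(1) z(3) xG(3)] by simp
  moreover have "mcong n m y (1\<^sub>m n)" using mcong_one_inv[OF xG(1) y(1) y(3) xG(2)] .
  ultimately have "y \<in> D" using y by (simp add: D_def)
  then show "inv\<^bsub>GG\<^esub> x \<in> D" using GG_inv[OF y(1) xG(1) y(3)] by simp
next
  fix x y assume xy: "x \<in> D" "y \<in> D"
  then have g: "x \<in> G" "y \<in> G" by (auto simp: D_def)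
  have "mcong n m (x * y) (1\<^sub>m n * 1\<^sub>m n)"
    using xy g G_in_RM G_carrier RM_one by (intro mcong_mult) (auto simp: D_def)
  moreover have "mcong n m (conj n h x * conj n h y) (1\<^sub>m n * 1\<^sub>m n)"
    using xy D_conj G_in_RM conj_carrier RM_one by (intro mcong_mult) (auto simp: D_def)
  ultimately show "x \<otimes>\<^bsub>GG\<^esub> y \<in> D"
    using g G_mult conj_mult[of x n y h] G_carrier by (simp add: D_def)
qed

text \<open>K bounds the exponents, so D contains all of G that is congruent to 1 modulo
  \<open>\<pi> ^ M\<close>, which is the condition of \<open>left_transversal_count\<close>. The
  hypothesis \<open>core\<close> isolates what depends on the group: an element all of whose
  conjugates vanish at the places with h i < h j must be 1.\<close>

lemma self_similar:
  assumes h: "\<And>i. i < n \<Longrightarrow> h i \<le> K" and M: "M \<ge> m + K"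
    and core: "\<And>x. \<lbrakk>x \<in> D; \<And>g g' i j. \<lbrakk>g \<in> G; g' \<in> G; g * g' = 1\<^sub>m n; g' * g = 1\<^sub>m n; i < n; j < n; h i < h j\<rbrakk>
      \<Longrightarrow> (g' * x * g) $$ (i, j) = 0\<rbrakk> \<Longrightarrow> x = 1\<^sub>m n"
  obtains \<delta> where "\<delta> * card (redm M ` D) = card (redm M ` G)" "self_similar_of_index GG \<delta>"
proof -
  have D_G: "D \<subseteq> G" by (auto simp: D_def)
  have near_D: "x \<in> D" if "x \<in> G" "mcong n M x (1\<^sub>m n)" for x
    unfolding D_iff
  proof (intro conjI allI impI)
    fix i j assume ij: "i < n" "j < n"
    have "m + (h j - h i) \<le> M" using h[OF ij(2)] M by simp
    then show "x $$ (i, j) - 1\<^sub>m n $$ (i, j) \<in> idl (m + (h j - h i))"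
      using that(2) ij idl_mono unfolding mcong_def by blast
  qed (rule that)
  have cong_left: "mcong n M (x * y) (x * z)" if "x \<in> G" "y \<in> G" "z \<in> G" "mcong n M y z" for x y z
    using that G_in_RM G_carrier by (intro mcong_mult mcong_refl) auto
  obtain \<delta> t where t: "\<And>x. x < \<delta> \<Longrightarrow> t x \<in> carrier GG"
    "\<And>g. g \<in> carrier GG \<Longrightarrow> \<exists>x<\<delta>. inv\<^bsub>GG\<^esub> (t x) \<otimes>\<^bsub>GG\<^esub> g \<in> D"
    "\<And>g x y. \<lbrakk>g \<in> carrier GG; x < \<delta>; y < \<delta>; inv\<^bsub>GG\<^esub> (t x) \<otimes>\<^bsub>GG\<^esub> g \<in> D; inv\<^bsub>GG\<^esub> (t y) \<otimes>\<^bsub>GG\<^esub> g \<in> D\<rbrakk> \<Longrightarrow> x = y"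
    "\<delta> * card (redm M ` D) = card (redm M ` carrier GG)"
  proof (rule left_transversal_count[OF group_GG D_subgroup, of "redm M"])
    show "finite (redm M ` carrier GG)" using redm_finite[OF G_RM] by simp
    show "redm M (x \<otimes>\<^bsub>GG\<^esub> y) = redm M (x \<otimes>\<^bsub>GG\<^esub> z)"
      if "x \<in> carrier GG" "y \<in> carrier GG" "z \<in> carrier GG" "redm M y = redm M z" for x y z
      using that cong_left redm_eq_iff[of _ n] G_in_RM G_mult by simp
    show "inv\<^bsub>GG\<^esub> x \<otimes>\<^bsub>GG\<^esub> y \<in> D" if xy: "x \<in> carrier GG" "y \<in> carrier GG" "redm M x = redm M y" for x y
    proof -
      obtain z where z: "z \<in> G" "z * x = 1\<^sub>m n" using G_inv xy by auto
      have "mcong n M (z * y) (z * x)"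
        using cong_left[of z y x] xy z redm_eq_iff[of _ n] G_in_RM mcong_sym by auto
      then have "z * y \<in> D" using near_D[of "z * y"] z xy G_mult by simp
      then show ?thesis using GG_inv[of z x] z xy by simp
    qed
  qed (use that in blast)
  have "self_similar_of_index GG \<delta>"
  proof (rule self_similar_of_index_if_virtual_endomorphism[where t = t and \<phi> = "conj n h", OF group_GG D_subgroup])
    show "t x \<in> carrier GG" if "x < \<delta>" for x using t(1) that by blast
    show "\<exists>x<\<delta>. inv\<^bsub>GG\<^esub> (t x) \<otimes>\<^bsub>GG\<^esub> g \<in> D" if "g \<in> carrier GG" for g using t(2) that by blast
    show "x = y" if "g \<in> carrier GG" "x < \<delta>" "y < \<delta>" "inv\<^bsub>GG\<^esub> (t x) \<otimes>\<^bsub>GG\<^esub> g \<in> D" "inv\<^bsub>GG\<^esub> (t y) \<otimes>\<^bsub>GG\<^esub> g \<in> D" for g x y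
      using t(3) that by blast
    show "conj n h g \<in> carrier GG" if "g \<in> D" for g using D_conj that by simp
    show "conj n h (g \<otimes>\<^bsub>GG\<^esub> k) = conj n h g \<otimes>\<^bsub>GG\<^esub> conj n h k" if "g \<in> D" "k \<in> D" for g k
      using that D_G G_carrier conj_mult[of g n k h] by auto
    fix N assume N: "N \<lhd> GG" "N \<subseteq> D" "conj n h ` N \<subseteq> N"
    \<comment> \<open>The t-th iterate of conjugation divides this entry by the t-th power of a
      positive power of \<open>\<pi>\<close> and stays integral; hence the entry is divisible by
      every power of \<open>\<pi>\<close>.\<close>
    have zero: "x $$ (i, j) = 0" if x: "x \<in> N" and ij: "i < n" "j < n" "h i < h j" for x i j
    proof (rule separatedI)
      have "(conj n h ^^ t) x \<in> N \<and> (conj n h ^^ t) x $$ (i, j) = \<pi> ^ (t * h i) * x $$ (i, j) / \<pi> ^ (t * h j)" for t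
      proof (induction t)
        case (Suc t)
        then show ?case using N(3) ij by (auto simp: conj_index power_add mult_ac)
      qed (use x in simp)
      then have "\<pi> ^ (t * h i) * x $$ (i, j) / \<pi> ^ (t * h j) \<in> R" for t
        using N(2) D_G G_in_RM RM_entry ij by (metis subsetD)
      then have "\<pi> ^ (t * h i) * x $$ (i, j) / \<pi> ^ (t * h j) \<in> idl 0" for t by (simp add: idl_0)
      moreover show xR: "x $$ (i, j) \<in> R" using x N(2) D_G G_in_RM RM_entry ij by blast
      ultimately have "x $$ (i, j) \<in> idl (0 + (t * h j - t * h i))" for t
        unfolding conj_idl_iff by (simp add: idl_0)
      moreover have "t \<le> 0 + (t * h j - t * h i)" for t
        using mult_le_mono2[of "Suc (h i)" "h j" t] ij(3) by simp
      ultimately show "x $$ (i, j) \<in> idl t" for t using idl_mono by blast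
    qed
    show "N = {\<one>\<^bsub>GG\<^esub>}"
    proof
      show "{\<one>\<^bsub>GG\<^esub>} \<subseteq> N" using subgroup.one_closed[OF normal_imp_subgroup[OF N(1)]] by simp
      show "N \<subseteq> {\<one>\<^bsub>GG\<^esub>}"
      proof
        fix x assume x: "x \<in> N"
        have "x = 1\<^sub>m n"
        proof (rule core)
          show "x \<in> D" using x N by blast
          fix g g' i j assume g: "g \<in> G" "g' \<in> G" "g * g' = 1\<^sub>m n" "g' * g = 1\<^sub>m n" and ij: "i < n" "j < n" "h i < h j"
          have "inv\<^bsub>GG\<^esub> g' = g" using GG_inv[of g g'] g by simp
          then have "g' * x * g \<in> N"
            using normal.inv_op_closed2[OF N(1), of g' x] g x by simp
          then show "(g' * x * g) $$ (i, j) = 0" using zero ij by blast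
        qed
        then show "x \<in> {\<one>\<^bsub>GG\<^esub>}" by simp
      qed
    qed
  qed
  then show ?thesis using t(4) that by simp
qed

end

section \<open>The special linear group\<close>

context dvr
begin

lemma det_mem: assumes "A \<in> RM n" shows "det A \<in> R"
proof -
  have "signof p * (\<Prod>i = 0..<n. A $$ (i, p i)) \<in> R" if "p permutes {0..<n}" for p
  proof -
    have "A $$ (i, p i) \<in> R" if "i \<in> {0..<n}" for i
      using RM_entry[OF assms, of i "p i"] permutes_in_image[OF \<open>p permutes {0..<n}\<close>, of i] that by auto
    then have "(\<Prod>i = 0..<n. A $$ (i, p i)) \<in> R" by (rule prod_mem)
    then show ?thesis using uminus_mem by (auto simp: sign_def)
  qed
  then show ?thesis unfolding det_def'[OF RM_carrier[OF assms]] by (intro sum_mem) auto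
qed

lemma det_cong: assumes "A \<in> RM n" "B \<in> RM n" "mcong n M A B" shows "det A - det B \<in> idl M"
  unfolding det_def'[OF RM_carrier[OF assms(1)]] det_def'[OF RM_carrier[OF assms(2)]]
proof (rule sum_cong_idl)
  fix p assume "p \<in> {p. p permutes {0..<n}}"
  then have p: "p i < n" if "i < n" for i using permutes_in_image[of p "{0..<n}" i] that by simp
  have "(\<Prod>i = 0..<n. A $$ (i, p i)) - (\<Prod>i = 0..<n. B $$ (i, p i)) \<in> idl M"
    using assms p RM_entry by (intro prod_cong_idl) (auto simp: mcong_def)
  then have "signof p * ((\<Prod>i = 0..<n. A $$ (i, p i)) - (\<Prod>i = 0..<n. B $$ (i, p i))) \<in> idl M"
    using idl_commute by (auto simp: sign_def)
  then show "signof p * (\<Prod>i = 0..<n. A $$ (i, p i)) - signof p * (\<Prod>i = 0..<n. B $$ (i, p i)) \<in> idl M"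
    by (simp only: right_diff_distrib)
qed

text \<open>Obtained from conj x times a = a times x for the diagonal matrix a, by cancelling the
  nonzero determinant of a.\<close>

lemma det_conj: assumes "x \<in> carrier_mat n n" shows "det (conj n h x) = det x"
proof -
  define a where "a = mat n n (\<lambda>(i, j). if i = j then \<pi> ^ h i else 0)"
  have c: "a \<in> carrier_mat n n" by (simp add: a_def)
  have "conj n h x * a = a * x"
  proof (rule eq_matI)
    fix i j assume "i < dim_row (a * x)" "j < dim_col (a * x)"
    then have ij: "i < n" "j < n" using assms by (auto simp: a_def)
    have "(conj n h x * a) $$ (i, j) = (\<Sum>k<n. if k = j then \<pi> ^ h i * x $$ (i, j) else 0)"
      unfolding mat_mult_index[OF conj_carrier c ij]
      by (intro sum.cong) (use ij pi_nz in \<open>auto simp: conj_index a_def\<close>)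
    moreover have "(a * x) $$ (i, j) = (\<Sum>k<n. if k = i then \<pi> ^ h i * x $$ (i, j) else 0)"
      unfolding mat_mult_index[OF c assms ij] by (intro sum.cong) (use ij in \<open>auto simp: a_def\<close>)
    ultimately show "(conj n h x * a) $$ (i, j) = (a * x) $$ (i, j)" using ij by simp
  qed (use assms in \<open>auto simp: a_def conj_def\<close>)
  then have "det (conj n h x) * det a = det a * det x"
    using det_mult[OF conj_carrier c] det_mult[OF c assms] by metis
  moreover have "det a \<noteq> 0"
  proof -
    have "upper_triangular a" by (auto simp: a_def upper_triangular_def)
    then have "det a = prod_list (diag_mat a)" by (rule det_upper_triangular[OF _ c])
    also have "\<dots> \<noteq> 0" using pi_nz by (auto simp: diag_mat_def a_def prod_list_zero_iff)
    finally show ?thesis .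
  qed
  ultimately show ?thesis by simp
qed

lemma adj_mat_RM: assumes "A \<in> RM n" shows "adj_mat A \<in> RM n"
proof -
  have "cofactor A j i \<in> R" if "i < n" "j < n" for i j
  proof -
    have "mat_delete A j i \<in> RM (n - 1)"
      using assms that unfolding RM_def mat_delete_def by auto
    then show ?thesis unfolding cofactor_def
      using det_mem by (intro mult_mem power_mem uminus_mem one_mem) auto
  qed
  then show ?thesis using assms by (auto simp: RM_def adj_mat_def)
qed

lemma RM_smult: "a \<in> R \<Longrightarrow> A \<in> RM n \<Longrightarrow> a \<cdot>\<^sub>m A \<in> RM n" by (auto simp: RM_def mult_mem)

lemma inverse_exists:
  assumes A: "A \<in> RM n" and u: "unit (det A)"
  obtains B where "B \<in> RM n" "A * B = 1\<^sub>m n" "B * A = 1\<^sub>m n"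
proof -
  let ?B = "inverse (det A) \<cdot>\<^sub>m adj_mat A"
  note adj = adj_mat[OF RM_carrier[OF A]]
  have e: "inverse (det A) \<cdot>\<^sub>m (det A \<cdot>\<^sub>m 1\<^sub>m n) = 1\<^sub>m n"
    using unit_nz[OF u] by (intro eq_matI) auto
  have "A * ?B = 1\<^sub>m n" using mult_smult_distrib[OF RM_carrier[OF A] adj(1)] adj(2) e by simp
  moreover have "?B * A = 1\<^sub>m n" using mult_smult_assoc_mat[OF adj(1) RM_carrier[OF A]] adj(3) e by simp
  ultimately have "A * ?B = 1\<^sub>m n" "?B * A = 1\<^sub>m n" by auto
  then show ?thesis using that RM_smult[OF unit_inv[OF u] adj_mat_RM[OF A]] by blast
qed

lemma unit_det_if_inverse: assumes "A \<in> RM n" "B \<in> RM n" "A * B = 1\<^sub>m n" shows "unit (det A)"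
proof -
  have "det A * det B = 1" using det_mult[OF RM_carrier[OF assms(1)] RM_carrier[OF assms(2)]] assms(3) by simp
  then show ?thesis using unit_multD[OF det_mem[OF assms(1)] det_mem[OF assms(2)]] unit_1 by simp
qed

lemma inverse_unique_mat:
  assumes "A \<in> RM n" "B \<in> RM n" "A * B = 1\<^sub>m n" shows "B * A = 1\<^sub>m n"
proof -
  obtain C where C: "C \<in> RM n" "C * A = 1\<^sub>m n"
    using inverse_exists[OF assms(1) unit_det_if_inverse[OF assms]] by blast
  then have "C = B"
    using assoc_mult_mat[of C n n A n B n] assms RM_carrier[of C n] RM_carrier[of A n] RM_carrier[of B n] by simp
  then show ?thesis using C by simp
qed

definition GL :: "nat \<Rightarrow> 'k mat set" where "GL n = {x \<in> RM n. unit (det x)}"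

definition SLR :: "nat \<Rightarrow> 'k mat set" where "SLR n = {x \<in> RM n. det x = 1}"

lemma GL_matgrp: "matgrp R \<pi> q n (GL n)"
proof (intro matgrp.intro matgrp_axioms.intro dvr_axioms)
  show "\<exists>y\<in>GL n. x * y = 1\<^sub>m n \<and> y * x = 1\<^sub>m n" if x: "x \<in> GL n" for x
  proof -
    obtain y where "y \<in> RM n" "x * y = 1\<^sub>m n" "y * x = 1\<^sub>m n" using x inverse_exists by (auto simp: GL_def)
    then show ?thesis using unit_det_if_inverse[of y n x] x by (auto simp: GL_def)
  qed
  show "x * y \<in> GL n" if "x \<in> GL n" "y \<in> GL n" for x y
    using that RM_mult det_mult[OF RM_carrier RM_carrier] unit_mult by (auto simp: GL_def)
qed (auto simp: GL_def RM_one unit_1)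

lemma SLR_matgrp: "matgrp R \<pi> q n (SLR n)"
proof (intro matgrp.intro matgrp_axioms.intro dvr_axioms)
  show "\<exists>y\<in>SLR n. x * y = 1\<^sub>m n \<and> y * x = 1\<^sub>m n" if x: "x \<in> SLR n" for x
  proof -
    obtain y where y: "y \<in> RM n" "x * y = 1\<^sub>m n" "y * x = 1\<^sub>m n"
      using x inverse_exists[of x n] unit_1 by (auto simp: SLR_def)
    then have "det x * det y = 1" using det_mult[of x n y] x RM_carrier by (simp add: SLR_def)
    then show ?thesis using x y by (auto simp: SLR_def)
  qed
  show "x * y \<in> SLR n" if "x \<in> SLR n" "y \<in> SLR n" for x y
    using that RM_mult det_mult[OF RM_carrier RM_carrier] by (auto simp: SLR_def)
qed (auto simp: SLR_def RM_one)

text \<open>A matrix of A is uniquely a matrix of determinant 1 with its first row scaled by the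
  determinant, and this respects congruences both ways. It is applied with U the units congruent to
  1 and with U all units.\<close>

lemma card_scale_first_row:
  assumes n: "n \<ge> 1" and A: "A \<subseteq> RM n" and U: "\<And>u. u \<in> U \<Longrightarrow> unit u \<and> inverse u \<in> U"
    and det: "\<And>y. y \<in> A \<Longrightarrow> det y \<in> U" and scale: "\<And>u y. u \<in> U \<Longrightarrow> y \<in> A \<Longrightarrow> multrow 0 u y \<in> A"
  shows "card (redm M ` A) = card (redm M ` {y \<in> A. det y = 1}) * card (red M ` U)"
proof -
  let ?S = "{y \<in> A. det y = 1}"
  have UR: "u \<in> R" if "u \<in> U" for u using U[OF that] unit_R by blast
  have idx: "multrow 0 u y $$ (i, j) = (if i = 0 then u * y $$ (i, j) else y $$ (i, j))"
    if "y \<in> A" "i < n" "j < n" for u y i j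
    using that A RM_carrier[of y n] by (auto simp: subset_iff)
  have "card ((\<lambda>(y, u). (redm M y, red M u)) ` (?S \<times> U)) = card (redm M ` A)"
  proof (rule card_image_eqI[where h = "\<lambda>(y, u). multrow 0 u y"])
    show "(case x of (y, u) \<Rightarrow> multrow 0 u y) \<in> A" if "x \<in> ?S \<times> U" for x using that scale by auto
    show "\<exists>x\<in>?S \<times> U. redm M (case x of (y, u) \<Rightarrow> multrow 0 u y) = redm M y" if y: "y \<in> A" for y
    proof -
      have u: "det y \<in> U" "inverse (det y) \<in> U" "det y \<noteq> 0" using det U y unit_nz by blast+
      let ?s = "multrow 0 (inverse (det y)) y"
      have c: "y \<in> carrier_mat n n" using A y RM_carrier by blast
      have s: "?s \<in> A" using scale u y by blast
      have "det ?s = 1" using det_multrow[of 0 n y "inverse (det y)"] n c u by simp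
      moreover have "multrow 0 (det y) ?s = y"
        by (rule eq_matI) (use idx[OF s] idx[OF y] u c in auto)
      ultimately show ?thesis using s u by (intro bexI[of _ "(?s, det y)"]) auto
    qed
    fix x x' assume "x \<in> ?S \<times> U" "x' \<in> ?S \<times> U"
    then obtain y u y' u' where x: "x = (y, u)" "y \<in> A" "det y = 1" "u \<in> U" and x': "x' = (y', u')" "y' \<in> A" "det y' = 1" "u' \<in> U"
      by auto
    have yR: "y \<in> RM n" "y' \<in> RM n" using x x' A by auto
    have mR: "multrow 0 u y \<in> RM n" "multrow 0 u' y' \<in> RM n" using scale x x' A by blast+
    have "(mcong n M y y' \<and> u - u' \<in> idl M) \<longleftrightarrow> mcong n M (multrow 0 u y) (multrow 0 u' y')"
    proof
      assume d: "mcong n M y y' \<and> u - u' \<in> idl M"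
      show "mcong n M (multrow 0 u y) (multrow 0 u' y')"
        unfolding mcong_def
      proof (intro allI impI)
        fix i j assume ij: "i < n" "j < n"
        have "u * y $$ (i, j) - u' * y' $$ (i, j) \<in> idl M"
          using d ij yR RM_entry UR x x' by (intro mult_cong) (auto simp: mcong_def)
        then show "multrow 0 u y $$ (i, j) - multrow 0 u' y' $$ (i, j) \<in> idl M"
          using idx[OF x(2) ij] idx[OF x'(2) ij] d ij by (auto simp: mcong_def)
      qed
    next
      assume d: "mcong n M (multrow 0 u y) (multrow 0 u' y')"
      have "det (multrow 0 u y) - det (multrow 0 u' y') \<in> idl M" using det_cong[OF mR d] .
      then have uu: "u - u' \<in> idl M"
        using det_multrow[of 0 n y u] det_multrow[of 0 n y' u'] n yR RM_carrier x x' by simp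
      have "y $$ (i, j) - y' $$ (i, j) \<in> idl M" if ij: "i < n" "j < n" for i j
      proof (cases "i = 0")
        case True
        have "u * y $$ (i, j) - u' * y' $$ (i, j) \<in> idl M"
          using d[unfolded mcong_def, rule_format, OF ij] idx[OF x(2) ij] idx[OF x'(2) ij] True by simp
        moreover have "(u' - u) * y' $$ (i, j) \<in> idl M"
          using uu idl_commute yR RM_entry ij by (intro idl_mult_right) auto
        ultimately have "(u * y $$ (i, j) - u' * y' $$ (i, j)) + (u' - u) * y' $$ (i, j) \<in> idl M" by (rule idl_add)
        then have "u * (y $$ (i, j) - y' $$ (i, j)) \<in> idl M" by (simp add: algebra_simps)
        then show ?thesis using idl_unit_cancel U x by blast
      next
        case False
        then show ?thesis using d[unfolded mcong_def, rule_format, OF ij] idx[OF x(2) ij] idx[OF x'(2) ij] by simp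
      qed
      then show "mcong n M y y' \<and> u - u' \<in> idl M" using uu by (simp add: mcong_def)
    qed
    then show "(case x of (y, u) \<Rightarrow> (redm M y, red M u)) = (case x' of (y, u) \<Rightarrow> (redm M y, red M u)) \<longleftrightarrow>
      redm M (case x of (y, u) \<Rightarrow> multrow 0 u y) = redm M (case x' of (y, u) \<Rightarrow> multrow 0 u y)"
      using redm_eq_iff[OF yR] redm_eq_iff[OF mR] red_eq_iff[OF UR UR] x x' by simp
  qed
  moreover have "(\<lambda>(y, u). (redm M y, red M u)) ` (?S \<times> U) = redm M ` ?S \<times> red M ` U" by auto
  ultimately show ?thesis by (simp add: card_cartesian_product)
qed

lemma card_PiE_idl:
  assumes "finite I" "\<And>i. i \<in> I \<Longrightarrow> lev i \<le> M"
  shows "card ((\<lambda>\<phi>. \<lambda>i\<in>I. red M (\<phi> i)) ` (PiE I (\<lambda>i. idl (lev i)))) = (\<Prod>i\<in>I. q ^ (M - lev i))"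
proof -
  have "(\<lambda>\<phi>. \<lambda>i\<in>I. red M (\<phi> i)) ` (PiE I (\<lambda>i. idl (lev i))) = PiE I (\<lambda>i. red M ` idl (lev i))"
  proof (intro equalityI subsetI)
    fix \<psi> assume p: "\<psi> \<in> PiE I (\<lambda>i. red M ` idl (lev i))"
    define \<phi> where "\<phi> = (\<lambda>i\<in>I. SOME x. x \<in> idl (lev i) \<and> red M x = \<psi> i)"
    have phi: "\<phi> i \<in> idl (lev i) \<and> red M (\<phi> i) = \<psi> i" if "i \<in> I" for i
    proof -
      have "\<psi> i \<in> red M ` idl (lev i)" using p that by auto
      then have "\<exists>x. x \<in> idl (lev i) \<and> red M x = \<psi> i" by auto
      from someI_ex[OF this] show ?thesis using that by (simp add: \<phi>_def)
    qed
    have "\<psi> = (\<lambda>i\<in>I. red M (\<phi> i))"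
      using phi PiE_arb[OF p] by (auto simp: fun_eq_iff)
    moreover have "\<phi> \<in> PiE I (\<lambda>i. idl (lev i))" using phi by (auto simp: \<phi>_def)
    ultimately show "\<psi> \<in> (\<lambda>\<phi>. \<lambda>i\<in>I. red M (\<phi> i)) ` (PiE I (\<lambda>i. idl (lev i)))" by blast
  qed auto
  then show ?thesis using assms red_idl_card by (simp add: card_PiE)
qed

lemma card_level_mats:
  assumes E: "E \<in> RM n" and lev: "\<And>i j. i < n \<Longrightarrow> j < n \<Longrightarrow> lev i j \<le> M"
  shows "card (redm M ` {x \<in> RM n. \<forall>i<n. \<forall>j<n. x $$ (i, j) - E $$ (i, j) \<in> idl (lev i j)}) =
     (\<Prod>i<n. \<Prod>j<n. q ^ (M - lev i j))"
proof -
  let ?I = "{..<n} \<times> {..<n}"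
  let ?A = "{x \<in> RM n. \<forall>i<n. \<forall>j<n. x $$ (i, j) - E $$ (i, j) \<in> idl (lev i j)}"
  have "card (redm M ` ?A) = card ((\<lambda>\<phi>. \<lambda>ij\<in>?I. red M (\<phi> ij)) ` (PiE ?I (\<lambda>ij. idl (case_prod lev ij))))"
  proof (rule card_image_eqI[where h = "\<lambda>x. \<lambda>ij\<in>?I. x $$ ij - E $$ ij"])
    show "(\<lambda>ij\<in>?I. x $$ ij - E $$ ij) \<in> PiE ?I (\<lambda>ij. idl (case_prod lev ij))" if "x \<in> ?A" for x
      using that by auto
    show "\<exists>x\<in>?A. (\<lambda>ij\<in>?I. red M ((\<lambda>ij\<in>?I. x $$ ij - E $$ ij) ij)) = (\<lambda>ij\<in>?I. red M (\<phi> ij))"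
      if phi: "\<phi> \<in> PiE ?I (\<lambda>ij. idl (case_prod lev ij))" for \<phi>
    proof (intro bexI[of _ "mat n n (\<lambda>ij. \<phi> ij + E $$ ij)"])
      have "\<phi> (i, j) \<in> idl (lev i j)" if "i < n" "j < n" for i j using PiE_mem[OF phi, of "(i, j)"] that by simp
      then show "mat n n (\<lambda>ij. \<phi> ij + E $$ ij) \<in> ?A"
        using RM_entry[OF E] by (auto simp: RM_def intro!: add_mem intro: idl_R)
    qed (auto simp: fun_eq_iff)
    fix x y assume xy: "x \<in> ?A" "y \<in> ?A"
    have d: "x $$ (i, j) - E $$ (i, j) - (y $$ (i, j) - E $$ (i, j)) = x $$ (i, j) - y $$ (i, j)" for i j by simp
    have "redm M x = redm M y \<longleftrightarrow> (\<forall>i<n. \<forall>j<n. x $$ (i, j) - y $$ (i, j) \<in> idl M)"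
      using redm_eq_iff[of x n y M] xy by (auto simp: mcong_def)
    also have "\<dots> \<longleftrightarrow> (\<forall>i<n. \<forall>j<n. red M (x $$ (i, j) - E $$ (i, j)) = red M (y $$ (i, j) - E $$ (i, j)))"
    proof -
      have "red M (x $$ (i, j) - E $$ (i, j)) = red M (y $$ (i, j) - E $$ (i, j)) \<longleftrightarrow> x $$ (i, j) - y $$ (i, j) \<in> idl M"
        if "i < n" "j < n" for i j
      proof -
        have "x $$ (i, j) - E $$ (i, j) \<in> R" "y $$ (i, j) - E $$ (i, j) \<in> R"
          using that xy RM_entry E by (auto intro!: diff_mem)
        then show ?thesis using red_eq_iff d by simp
      qed
      then show ?thesis by simp
    qed
    also have "\<dots> \<longleftrightarrow> (\<lambda>ij\<in>?I. red M ((\<lambda>ij\<in>?I. x $$ ij - E $$ ij) ij)) = (\<lambda>ij\<in>?I. red M ((\<lambda>ij\<in>?I. y $$ ij - E $$ ij) ij))"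
      by (auto simp: fun_eq_iff)
    finally show "redm M x = redm M y \<longleftrightarrow> (\<lambda>ij\<in>?I. red M ((\<lambda>ij\<in>?I. x $$ ij - E $$ ij) ij)) = (\<lambda>ij\<in>?I. red M ((\<lambda>ij\<in>?I. y $$ ij - E $$ ij) ij))" .
  qed
  also have "\<dots> = (\<Prod>ij\<in>?I. q ^ (M - case_prod lev ij))" by (rule card_PiE_idl) (use lev in auto)
  also have "\<dots> = (\<Prod>i<n. \<Prod>j<n. q ^ (M - lev i j))" by (simp add: prod.cartesian_product case_prod_unfold)
  finally show ?thesis .
qed

text \<open>All matrices of the given levels are counted freely and the determinants, which fill 1 +
  \<open>\<pi> ^ m\<close> R, are split off. The condition \<open>lev 0 0 = m\<close> makes the set
  stable under scaling the first row by such a determinant: entry (0,0) is the one where the scaling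
  meets the 1 of the identity.\<close>

lemma card_SLR_level:
  assumes n: "n \<ge> 1" and lev: "\<And>i j. i < n \<Longrightarrow> j < n \<Longrightarrow> m \<le> lev i j \<and> lev i j \<le> M" "lev 0 0 = m" and m: "m \<ge> 1" "m \<le> M"
  shows "card (redm M ` {x \<in> SLR n. \<forall>i<n. \<forall>j<n. x $$ (i, j) - 1\<^sub>m n $$ (i, j) \<in> idl (lev i j)}) * q ^ (M - m) =
     (\<Prod>i<n. \<Prod>j<n. q ^ (M - lev i j))"
proof -
  let ?A = "{x \<in> RM n. \<forall>i<n. \<forall>j<n. x $$ (i, j) - 1\<^sub>m n $$ (i, j) \<in> idl (lev i j)}"
  let ?U = "{u. u - 1 \<in> idl m}"
  have UR: "u \<in> R" if "u \<in> ?U" for u using that idl_R[of "u - 1" m] add_mem[of "u - 1" 1] one_mem by simp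
  have unitU: "unit u" if "u \<in> ?U" for u
    using that unit_cong[OF unit_1 UR[OF that]] idl_mono[OF m(1)] idl_commute by blast
  have "card (redm M ` ?A) = card (redm M ` {y \<in> ?A. det y = 1}) * card (red M ` ?U)"
  proof (rule card_scale_first_row[OF n])
    show "unit u \<and> inverse u \<in> ?U" if u: "u \<in> ?U" for u
    proof -
      have "inverse u - 1 = inverse u * (1 - u)" using unit_nz[OF unitU[OF u]] by (simp add: algebra_simps)
      moreover have "inverse u * (1 - u) \<in> idl m"
        using u unit_inv[OF unitU[OF u]] idl_commute by (intro idl_mult_left) auto
      ultimately show ?thesis using unitU[OF u] by simp
    qed
    show "det y \<in> ?U" if y: "y \<in> ?A" for y
    proof -
      have "mcong n m y (1\<^sub>m n)"
        unfolding mcong_def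
      proof (intro allI impI)
        fix i j assume ij: "i < n" "j < n"
        then have "y $$ (i, j) - 1\<^sub>m n $$ (i, j) \<in> idl (lev i j)" using y by blast
        then show "y $$ (i, j) - 1\<^sub>m n $$ (i, j) \<in> idl m" using idl_mono lev(1)[OF ij] by blast
      qed
      then show ?thesis using det_cong[of y n "1\<^sub>m n" m] y RM_one by simp
    qed
    show "multrow 0 u y \<in> ?A" if u: "u \<in> ?U" and y: "y \<in> ?A" for u y
    proof -
      have c: "y \<in> carrier_mat n n" using y RM_carrier by blast
      have yij: "y $$ (i, j) \<in> R" "y $$ (i, j) - 1\<^sub>m n $$ (i, j) \<in> idl (lev i j)" if "i < n" "j < n" for i j
        using y that RM_entry by auto
      have "multrow 0 u y $$ (i, j) - 1\<^sub>m n $$ (i, j) \<in> idl (lev i j)" if ij: "i < n" "j < n" for i j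
      proof (cases "i = 0")
        case True
        have e: "u * y $$ (i, j) - 1\<^sub>m n $$ (i, j) = u * (y $$ (i, j) - 1\<^sub>m n $$ (i, j)) + (u - 1) * 1\<^sub>m n $$ (i, j)"
          by (simp add: algebra_simps)
        have "(u - 1) * 1\<^sub>m n $$ (i, j) \<in> idl (lev i j)" using u True lev(2) ij by auto
        then have "u * y $$ (i, j) - 1\<^sub>m n $$ (i, j) \<in> idl (lev i j)"
          unfolding e by (rule idl_add[OF idl_mult_left[OF UR[OF u] yij(2)[OF ij]]])
        then show ?thesis using True ij c by simp
      qed (use yij[OF ij] ij c in simp)
      moreover have "multrow 0 u y \<in> RM n"
        using c yij(1) UR[OF u] by (auto simp: RM_def mult_mem)
      ultimately show ?thesis by blast
    qed
  qed auto
  also have "{y \<in> ?A. det y = 1} = {x \<in> SLR n. \<forall>i<n. \<forall>j<n. x $$ (i, j) - 1\<^sub>m n $$ (i, j) \<in> idl (lev i j)}"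
    by (auto simp: SLR_def)
  also have "card (red M ` ?U) = q ^ (M - m)"
  proof -
    have "card (red M ` ?U) = card (red M ` idl m)"
    proof (rule card_image_eqI[where h = "\<lambda>u. u - 1"])
      show "\<exists>u\<in>?U. red M (u - 1) = red M y" if "y \<in> idl m" for y using that by (intro bexI[of _ "y + 1"]) auto
      show "red M u = red M u' \<longleftrightarrow> red M (u - 1) = red M (u' - 1)" if "u \<in> ?U" "u' \<in> ?U" for u u'
        using red_eq_iff[OF UR[OF that(1)] UR[OF that(2)]] red_eq_iff[of "u - 1" "u' - 1" M] that idl_R by simp
    qed auto
    then show ?thesis using red_idl_card[OF m(2)] by simp
  qed
  also have "card (redm M ` ?A) = (\<Prod>i<n. \<Prod>j<n. q ^ (M - lev i j))"
    by (rule card_level_mats[OF RM_one]) (use lev in auto)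
  finally show ?thesis by simp
qed

text \<open>The matrix of v \<mapsto> v + \<open>\<phi>\<close>(v) u. Column changes, transvections
  and reflections are all of this shape.\<close>

definition rank1 :: "nat \<Rightarrow> (nat \<Rightarrow> 'k) \<Rightarrow> (nat \<Rightarrow> 'k) \<Rightarrow> 'k mat" where
  "rank1 n u \<phi> = mat n n (\<lambda>(i, j). (if i = j then 1 else 0) + u i * \<phi> j)"

lemma rank1_RM: "(\<And>i. i < n \<Longrightarrow> u i \<in> R) \<Longrightarrow> (\<And>i. i < n \<Longrightarrow> \<phi> i \<in> R) \<Longrightarrow> rank1 n u \<phi> \<in> RM n"
  unfolding RM_def rank1_def by (auto intro!: add_mem mult_mem simp: one_mem)

lemma rank1_mult:
  "rank1 n u \<phi> * rank1 n u \<psi> = rank1 n u (\<lambda>j. \<phi> j + \<psi> j + (\<Sum>k<n. \<phi> k * u k) * \<psi> j)"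
proof (rule eq_matI)
  let ?d = "\<lambda>i j. if i = j then 1 else 0 :: 'k"
  fix i j assume "i < dim_row (rank1 n u (\<lambda>j. \<phi> j + \<psi> j + (\<Sum>k<n. \<phi> k * u k) * \<psi> j))"
    "j < dim_col (rank1 n u (\<lambda>j. \<phi> j + \<psi> j + (\<Sum>k<n. \<phi> k * u k) * \<psi> j))"
  then have ij: "i < n" "j < n" by (auto simp: rank1_def)
  have "(rank1 n u \<phi> * rank1 n u \<psi>) $$ (i, j) = (\<Sum>k<n. (?d i k + u i * \<phi> k) * (?d k j + u k * \<psi> j))"
    using ij by (subst mat_mult_index[of _ n]) (auto simp: rank1_def)
  also have "\<dots> = (\<Sum>k<n. ?d i k * ?d k j + ?d i k * (u k * \<psi> j) + ?d k j * (u i * \<phi> k) + u i * (\<phi> k * u k) * \<psi> j)"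
    by (intro sum.cong) (auto simp: algebra_simps)
  also have "\<dots> = (\<Sum>k<n. ?d i k * ?d k j) + (\<Sum>k<n. ?d i k * (u k * \<psi> j)) + (\<Sum>k<n. ?d k j * (u i * \<phi> k)) + u i * (\<Sum>k<n. \<phi> k * u k) * \<psi> j"
    by (simp add: sum.distrib sum_distrib_left sum_distrib_right)
  also have "(\<Sum>k<n. ?d i k * ?d k j) = ?d i j"
    using ij by (subst sum.cong[OF refl, of _ _ "\<lambda>k. if k = i then ?d i j else 0"]) auto
  also have "(\<Sum>k<n. ?d i k * (u k * \<psi> j)) = u i * \<psi> j"
    using ij by (subst sum.cong[OF refl, of _ _ "\<lambda>k. if k = i then u i * \<psi> j else 0"]) auto
  also have "(\<Sum>k<n. ?d k j * (u i * \<phi> k)) = u i * \<phi> j"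
    using ij by (subst sum.cong[OF refl, of _ _ "\<lambda>k. if k = j then u i * \<phi> j else 0"]) auto
  finally show "(rank1 n u \<phi> * rank1 n u \<psi>) $$ (i, j) =
      rank1 n u (\<lambda>j. \<phi> j + \<psi> j + (\<Sum>k<n. \<phi> k * u k) * \<psi> j) $$ (i, j)"
    using ij by (simp add: rank1_def algebra_simps)
qed (auto simp: rank1_def)

lemma rank1_zero: "rank1 n u (\<lambda>j. 0) = 1\<^sub>m n"
  by (rule eq_matI) (auto simp: rank1_def)

lemma rank1_GL:
  assumes u: "\<And>i. i < n \<Longrightarrow> u i \<in> R" and phi: "\<And>i. i < n \<Longrightarrow> \<phi> i \<in> R" and s: "unit (1 + (\<Sum>k<n. \<phi> k * u k))"
  shows "rank1 n u \<phi> \<in> GL n"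
proof -
  let ?s = "1 + (\<Sum>k<n. \<phi> k * u k)"
  \<comment> \<open>The inverse of a rank-one perturbation: by \<open>rank1_mult\<close> the
    functional is negated and divided by 1 + \<open>\<phi>\<close>(u).\<close>
  let ?\<psi> = "\<lambda>j. - \<phi> j / ?s"
  have z: "\<phi> j + ?\<psi> j + (\<Sum>k<n. \<phi> k * u k) * ?\<psi> j = 0" for j
  proof -
    have "\<phi> j + ?\<psi> j + (?s - 1) * ?\<psi> j = 0" using unit_nz[OF s] by (simp add: divide_simps) (simp add: algebra_simps)
    then show ?thesis by simp
  qed
  have "rank1 n u \<phi> * rank1 n u ?\<psi> = 1\<^sub>m n" unfolding rank1_mult z rank1_zero ..
  moreover have "?\<psi> i \<in> R" if "i < n" for i using phi that s by (intro unit_divide_mem uminus_mem)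
  ultimately show ?thesis
    unfolding GL_def
    using unit_det_if_inverse[of "rank1 n u \<phi>" n "rank1 n u ?\<psi>"] rank1_RM[of n u \<phi>] rank1_RM[of n u ?\<psi>] u phi by simp
qed

lemma red_zero_iff: assumes "x \<in> red 1 ` R" shows "x \<in> idl 1 \<longleftrightarrow> x = red 1 0"
proof -
  obtain y where y: "y \<in> R" "x = red 1 y" using assms by blast
  then have "x \<in> R" "red 1 x = x" using red_mem red_red by auto
  then show ?thesis using red_eq_iff[of x 0 1] by simp
qed

lemma red_fixed: "x \<in> red M ` R \<Longrightarrow> red M x = x" and red_in_R: "x \<in> red M ` R \<Longrightarrow> x \<in> R"
  using red_red red_mem by auto

lemma card_vec_prod:
  assumes "\<And>i. i < n \<Longrightarrow> finite (S i)"
  shows "card {w \<in> carrier_vec n. \<forall>i<n. w $ i \<in> S i} = (\<Prod>i<n. card (S i))"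
    and "finite {w \<in> carrier_vec n. \<forall>i<n. w $ i \<in> S i}"
proof -
  have b: "bij_betw (vec n) (PiE {..<n} S) {w \<in> carrier_vec n. \<forall>i<n. w $ i \<in> S i}"
  proof (rule bij_betwI[where g = "\<lambda>w. \<lambda>i\<in>{..<n}. vec_index w i"])
    show "(\<lambda>i\<in>{..<n}. vec n \<phi> $ i) = \<phi>" if "\<phi> \<in> PiE {..<n} S" for \<phi>
    proof
      fix i show "(\<lambda>i\<in>{..<n}. vec n \<phi> $ i) i = \<phi> i"
        using PiE_arb[OF that, of i] by (cases "i < n") simp_all
    qed
    show "vec n (\<lambda>i\<in>{..<n}. vec_index w i) = w" if "w \<in> {w \<in> carrier_vec n. \<forall>i<n. w $ i \<in> S i}" for w
    proof -
      have "dim_vec w = n" using that by auto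
      then show ?thesis by (intro eq_vecI) simp_all
    qed
    show "vec n \<in> PiE {..<n} S \<rightarrow> {w \<in> carrier_vec n. \<forall>i<n. w $ i \<in> S i}"
      by (rule Pi_I) (simp add: PiE_mem)
    show "(\<lambda>w. \<lambda>i\<in>{..<n}. vec_index w i) \<in> {w \<in> carrier_vec n. \<forall>i<n. w $ i \<in> S i} \<rightarrow> PiE {..<n} S"
      by (rule Pi_I, rule PiE_I) simp_all
  qed
  show "card {w \<in> carrier_vec n. \<forall>i<n. w $ i \<in> S i} = (\<Prod>i<n. card (S i))"
    using bij_betw_same_card[OF b] by (simp add: card_PiE)
  have "finite (PiE {..<n} S)" by (rule finite_PiE) (use assms in auto)
  then show "finite {w \<in> carrier_vec n. \<forall>i<n. w $ i \<in> S i}" using bij_betw_finite[OF b] by simp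
qed

text \<open>Complementary counting: vectors that vanish modulo \<open>\<pi>\<close> on I, minus
  those that vanish on J as well.\<close>

lemma card_primitive:
  assumes J: "J \<subseteq> {..<n}"
  shows "card {w \<in> carrier_vec n. (\<forall>i<n. w $ i \<in> (if i \<in> I then {red 1 0} else red 1 ` R)) \<and> (\<exists>i\<in>J. w $ i \<notin> idl 1)} =
    q ^ card ({..<n} - I) - q ^ card ({..<n} - (I \<union> J))"
proof -
  let ?S = "\<lambda>I i. if i \<in> I then {red 1 0} else red 1 ` R"
  let ?V = "\<lambda>I. {w \<in> carrier_vec n. \<forall>i<n. w $ i \<in> ?S I i}"
  have fin: "finite (?S I i)" for I i using red_1_card by simp
  have z: "red 1 0 \<in> red 1 ` R" "red 1 0 \<in> idl 1" using red_zero_iff[of "red 1 0"] by auto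
  have cV: "card (?V I) = q ^ card ({..<n} - I)" for I
  proof -
    have "card (?V I) = (\<Prod>i<n. if i \<in> I then 1 else q)"
      unfolding card_vec_prod(1)[OF fin] using red_1_card by (intro prod.cong) auto
    also have "\<dots> = q ^ card ({..<n} - I)"
      by (simp add: prod.If_cases Diff_eq)
    finally show ?thesis .
  qed
  have "{w \<in> carrier_vec n. (\<forall>i<n. w $ i \<in> ?S I i) \<and> (\<exists>i\<in>J. w $ i \<notin> idl 1)} = ?V I - ?V (I \<union> J)"
  proof (intro equalityI subsetI)
    fix w assume w: "w \<in> {w \<in> carrier_vec n. (\<forall>i<n. w $ i \<in> ?S I i) \<and> (\<exists>i\<in>J. w $ i \<notin> idl 1)}"
    then obtain i where "i \<in> J" "w $ i \<notin> idl 1" by blast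
    then have "i < n" "w $ i \<noteq> red 1 0" "i \<in> I \<union> J" using J z by auto
    then have "w \<notin> ?V (I \<union> J)" by force
    then show "w \<in> ?V I - ?V (I \<union> J)" using w by blast
  next
    fix w assume w: "w \<in> ?V I - ?V (I \<union> J)"
    then obtain i where i: "i < n" "w $ i \<notin> ?S (I \<union> J) i" "w $ i \<in> ?S I i" by blast
    then have "i \<in> J" "w $ i \<in> red 1 ` R" "w $ i \<noteq> red 1 0" by (auto split: if_splits)
    then have "w $ i \<notin> idl 1" using red_zero_iff by simp
    then show "w \<in> {w \<in> carrier_vec n. (\<forall>i<n. w $ i \<in> ?S I i) \<and> (\<exists>i\<in>J. w $ i \<notin> idl 1)}" using w \<open>i \<in> J\<close> by blast
  qed
  moreover have "?V (I \<union> J) \<subseteq> ?V I" using z by auto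
  then have "card (?V I - ?V (I \<union> J)) = card (?V I) - card (?V (I \<union> J))"
    by (rule card_Diff_subset[OF card_vec_prod(2)[OF fin]])
  ultimately show ?thesis by (simp only: cV)
qed

text \<open>With the first j columns standard, column j may be any residue vector whose part from
  row j on is nonzero: q^n vectors minus the q^j whose lower part vanishes.\<close>

lemma card_GL_residue: "card (redm 1 ` GL n) = (\<Prod>j<n. q ^ n - q ^ j)"
proof -
  interpret matgrp R \<pi> q n "GL n" by (rule GL_matgrp)
  have "card (orb (\<lambda>i. i) j) = q ^ n - q ^ j" if j: "j < n" for j
  proof -
    have "orb (\<lambda>i. i) j = {w \<in> carrier_vec n. (\<forall>i<n. w $ i \<in> (if i \<in> {} then {red 1 0} else red 1 ` R)) \<and> (\<exists>i\<in>{j..<n}. w $ i \<notin> idl 1)}"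
      (is "_ = ?V")
    proof (intro equalityI subsetI)
      fix w assume "w \<in> orb (\<lambda>i. i) j"
      then obtain x where x: "x \<in> GL n" "w = map_vec (red 1) (col x j)"
        "\<And>i r. i < j \<Longrightarrow> r < n \<Longrightarrow> x $$ (r, i) - 1\<^sub>m n $$ (r, i) \<in> idl 1" unfolding orb_def by blast
      have c: "x \<in> carrier_mat n n" using G_carrier x by blast
      have w: "w $ i = red 1 (x $$ (i, j))" if "i < n" for i using x(2) c that j by simp
      have "\<exists>i\<in>{j..<n}. w $ i \<notin> idl 1"
      proof (rule ccontr)
        assume "\<not> (\<exists>i\<in>{j..<n}. w $ i \<notin> idl 1)"
        then have low: "x $$ (i, j) \<in> idl 1" if "i \<in> {j..<n}" for i
        proof -
          have "w $ i \<in> idl 1" using that \<open>\<not> (\<exists>i\<in>{j..<n}. w $ i \<notin> idl 1)\<close> by blast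
          moreover have "x $$ (i, j) - w $ i \<in> idl 1"
            using w[of i] red_cong[OF RM_entry[OF G_in_RM[OF x(1)]], of i j 1] j that by simp
          ultimately show ?thesis using idl_add[of "x $$ (i, j) - w $ i" 1 "w $ i"] by simp
        qed
        obtain y where y: "y \<in> GL n" "y * x = 1\<^sub>m n" using G_inv x(1) by blast
        have yR: "y $$ (j, k) \<in> R" if "k < n" for k using RM_entry[OF G_in_RM[OF y(1)]] that j by blast
        have yx: "(\<Sum>k<n. y $$ (j, k) * x $$ (k, i)) = 1\<^sub>m n $$ (j, i)" if "i < n" for i
          using mat_mult_index[OF G_carrier[OF y(1)] c j that] y(2) by simp
        \<comment> \<open>Column k of x is the k-th unit vector modulo \<open>\<pi>\<close>, so
          entry (j,k) of y x = 1 says that \<open>y $$ (j, k)\<close> is congruent to 0.\<close>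
        have yj: "y $$ (j, k) \<in> idl 1" if k: "k < j" for k
        proof -
          have "(\<Sum>r<n. y $$ (j, r) * x $$ (r, k)) - (\<Sum>r<n. y $$ (j, r) * 1\<^sub>m n $$ (r, k)) \<in> idl 1"
            unfolding sum_subtractf[symmetric] right_diff_distrib[symmetric]
            using yR x(3)[OF k] by (intro idl_sum idl_mult_left) auto
          moreover have "(\<Sum>r<n. y $$ (j, r) * 1\<^sub>m n $$ (r, k)) = y $$ (j, k)"
            using k j by (subst sum.cong[OF refl, of _ _ "\<lambda>r. if r = k then y $$ (j, k) else 0"]) auto
          ultimately have "0 - y $$ (j, k) \<in> idl 1" using yx[of k] k j by simp
          then show ?thesis using idl_commute[of 0 "y $$ (j, k)" 1] by simp
        qed
        have "(\<Sum>k<n. y $$ (j, k) * x $$ (k, j)) \<in> idl 1"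
        proof (rule idl_sum)
          fix k assume k: "k \<in> {..<n}"
          show "y $$ (j, k) * x $$ (k, j) \<in> idl 1"
          proof (cases "k < j")
            case True
            then show ?thesis using yj RM_entry[OF G_in_RM[OF x(1)]] k j by (intro idl_mult_right) auto
          next
            case False
            then show ?thesis using low k yR by (intro idl_mult_left) auto
          qed
        qed
        then show False using yx[OF j] one_not_idl j by simp
      qed
      moreover have "w \<in> carrier_vec n" using x(2) c by auto
      ultimately show "w \<in> ?V" using w RM_entry[OF G_in_RM[OF x(1)]] j by auto
    next
      fix w assume w: "w \<in> ?V"
      then obtain i where i: "j \<le> i" "i < n" "w $ i \<notin> idl 1" by auto
      have wT: "w $ i \<in> red 1 ` R" if "i < n" for i using w that by auto
      have wR: "w $ i \<in> R" if "i < n" for i using wT[OF that] red_in_R by blast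
      \<comment> \<open>The matrix sought is v \<mapsto> v + \<open>\<phi>\<close>(v)(w - e_j) with
        \<open>\<phi>\<close>(e_j) = 1 and \<open>\<phi>\<close> zero on earlier basis vectors. It
        is invertible if w_j + t w_k is a unit: t = 0 serves if w_j is one, otherwise t = 1 adds a
        unit entry of w.\<close>
      obtain k t where kt: "j \<le> k" "k < n" "t = 0 \<or> t = 1 \<and> k \<noteq> j" "unit (w $ j + t * w $ k)"
      proof (cases "unit (w $ j)")
        case True
        then show ?thesis using that[of j 0] j by simp
      next
        case False
        then have "w $ j \<in> idl 1" "i \<noteq> j" using unit_iff wR i j by auto
        moreover have "unit (w $ i)" using unit_iff wR i by blast
        ultimately have "unit (w $ j + 1 * w $ i)"
          using unit_cong[of "w $ i" "w $ j + w $ i"] idl_uminus add_mem wR i j by simp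
        then show ?thesis using that[of i 1] i \<open>i \<noteq> j\<close> by simp
      qed
      define u where "u a = w $ a - (if a = j then 1 else 0)" for a
      define \<phi> where "\<phi> a = (if a = j then 1 else if a = k then t else 0)" for a
      have "(\<Sum>a<n. \<phi> a * u a) = w $ j - 1 + t * w $ k"
      proof (cases "k = j")
        case True
        then have "(\<Sum>a<n. \<phi> a * u a) = (\<Sum>a<n. if a = j then w $ j - 1 else 0)"
          by (intro sum.cong) (auto simp: \<phi>_def u_def)
        then show ?thesis using kt True j by simp
      next
        case False
        then have "(\<Sum>a<n. \<phi> a * u a) = (\<Sum>a<n. (if a = j then w $ j - 1 else 0) + (if a = k then t * w $ k else 0))"
          by (intro sum.cong) (auto simp: \<phi>_def u_def)
        then show ?thesis using kt j by (simp add: sum.distrib)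
      qed
      then have s: "unit (1 + (\<Sum>a<n. \<phi> a * u a))" using kt(4) by (simp add: algebra_simps)
      have g: "rank1 n u \<phi> \<in> GL n"
        by (rule rank1_GL[OF _ _ s]) (use wR kt(3) one_mem in \<open>auto simp: u_def \<phi>_def intro: diff_mem\<close>)
      have "map_vec (red 1) (col (rank1 n u \<phi>) j) = w"
      proof (rule eq_vecI)
        have rw: "red 1 (w $ i) = w $ i" if "i < n" for i using red_fixed[OF wT[OF that]] .
        fix i assume "i < dim_vec w"
        then have "i < n" using w by auto
        then show "map_vec (red 1) (col (rank1 n u \<phi>) j) $ i = w $ i"
          using rw j by (simp add: rank1_def u_def \<phi>_def)
      qed (use w in \<open>auto simp: rank1_def\<close>)
      moreover have "rank1 n u \<phi> $$ (r, b) - 1\<^sub>m n $$ (r, b) \<in> idl 1" if "b < j" "r < n" for b r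
        using that j kt(1) by (auto simp: rank1_def \<phi>_def)
      ultimately show "w \<in> orb (\<lambda>i. i) j" unfolding orb_def using g by (intro image_eqI[of _ _ "rank1 n u \<phi>"]) auto
    qed
    moreover have "{..<n} - ({} \<union> {j..<n}) = {..<j}" using j by auto
    moreover have "{j..<n} \<subseteq> {..<n}" by auto
    ultimately show ?thesis using card_primitive[of "{j..<n}" n "{}"] by simp
  qed
  then show ?thesis using card_residue_chain[of "\<lambda>i. i"] by (simp add: bij_betw_def)
qed

text \<open>The determinant splits off the q - 1 residues of units; stated as a product to avoid a
  division of naturals.\<close>

lemma card_SLR_residue: assumes "n \<ge> 1" shows "(\<Prod>j<n. q ^ n - q ^ j) = card (redm 1 ` SLR n) * (q - 1)"
proof -
  have "card (redm 1 ` GL n) = card (redm 1 ` {y \<in> GL n. det y = 1}) * card (red 1 ` {x. unit x})"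
  proof (rule card_scale_first_row[OF assms])
    show "multrow 0 u y \<in> GL n" if "u \<in> {x. unit x}" "y \<in> GL n" for u y
      using that assms det_multrow[of 0 n y u] unit_R[of u] unit_mult
      by (auto simp: GL_def RM_def mult_mem)
  qed (auto simp: GL_def unit_inverse)
  moreover have "{y \<in> GL n. det y = 1} = SLR n" by (auto simp: GL_def SLR_def unit_1)
  ultimately show ?thesis using card_GL_residue red_units_card by simp
qed

end

section \<open>Isometry groups of monomial forms\<close>

text \<open>The Gram matrix has the unit \<open>sg i\<close> in position \<open>(i, star i)\<close> and zeros elsewhere; it is
  symmetric for \<open>\<epsilon> = 1\<close> and alternating for \<open>\<epsilon> = - 1\<close>. Vectors are functions on indices.\<close>

locale sform = dvr R \<pi> q for R :: "'k::field set" and \<pi> q +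
  fixes n :: nat and star :: "nat \<Rightarrow> nat" and sg :: "nat \<Rightarrow> 'k" and \<epsilon> :: 'k
  assumes star_lt: "i < n \<Longrightarrow> star i < n" and star_star: "i < n \<Longrightarrow> star (star i) = i"
    and sg_unit: "i < n \<Longrightarrow> unit (sg i)" and sg_star: "i < n \<Longrightarrow> sg (star i) = \<epsilon> * sg i"
    and eps: "\<epsilon> = 1 \<or> \<epsilon> = - 1" and two: "unit 2"
begin

definition B :: "(nat \<Rightarrow> 'k) \<Rightarrow> (nat \<Rightarrow> 'k) \<Rightarrow> 'k" where
  "B u v = (\<Sum>k<n. sg k * u k * v (star k))"

definition e :: "nat \<Rightarrow> nat \<Rightarrow> 'k" where "e j i = (if i = j then 1 else 0)"

definition cf :: "'k mat \<Rightarrow> nat \<Rightarrow> nat \<Rightarrow> 'k" where "cf x j i = x $$ (i, j)"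

definition act :: "'k mat \<Rightarrow> (nat \<Rightarrow> 'k) \<Rightarrow> nat \<Rightarrow> 'k" where
  "act x v i = (\<Sum>j<n. x $$ (i, j) * v j)"

lemma sg_R: "i < n \<Longrightarrow> sg i \<in> R" using sg_unit unit_R by blast

lemma star_eq_iff: "i < n \<Longrightarrow> j < n \<Longrightarrow> star i = j \<longleftrightarrow> i = star j"
  using star_star by metis

lemma e_R: "e j i \<in> R" by (simp add: e_def one_mem)

lemma B_eq: "(\<And>i. i < n \<Longrightarrow> u i = u' i) \<Longrightarrow> (\<And>i. i < n \<Longrightarrow> v i = v' i) \<Longrightarrow> B u v = B u' v'"
  unfolding B_def using star_lt by (intro sum.cong) auto

lemma B_left: "B (\<lambda>i. a i + t * b i) v = B a v + t * B b v"
  unfolding B_def sum_distrib_left sum.distrib[symmetric] by (intro sum.cong) (auto simp: algebra_simps)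

lemma B_right: "B v (\<lambda>i. a i + t * b i) = B v a + t * B v b"
  unfolding B_def sum_distrib_left sum.distrib[symmetric] by (intro sum.cong) (auto simp: algebra_simps)

lemma B_diff_left: "B (\<lambda>i. a i - b i) v = B a v - B b v"
  using B_left[of a "- 1" b v] by simp

lemma B_diff_right: "B v (\<lambda>i. a i - b i) = B v a - B v b"
  using B_right[of v a "- 1" b] by simp

lemma B_sym: "B v u = \<epsilon> * B u v"
proof -
  have "B v u = (\<Sum>k<n. sg (star k) * v (star k) * u k)"
    unfolding B_def by (rule sum.reindex_bij_witness[of _ star star]) (use star_lt star_star in auto)
  also have "\<dots> = \<epsilon> * B u v"
    unfolding B_def sum_distrib_left by (intro sum.cong) (use sg_star in auto)
  finally show ?thesis .
qed

lemma B_e_left: "j < n \<Longrightarrow> B (e j) v = sg j * v (star j)"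
proof -
  assume j: "j < n"
  have "B (e j) v = (\<Sum>k<n. if k = j then sg j * v (star j) else 0)"
    unfolding B_def by (intro sum.cong) (auto simp: e_def)
  then show ?thesis using j by simp
qed

lemma B_e_right: "j < n \<Longrightarrow> B u (e j) = sg (star j) * u (star j)"
  using B_sym[of u "e j"] B_e_left[of j u] sg_star by simp

lemma B_e_e: "i < n \<Longrightarrow> j < n \<Longrightarrow> B (e i) (e j) = (if j = star i then sg i else 0)"
  by (auto simp: B_e_left e_def)

lemma B_mem: "(\<And>i. i < n \<Longrightarrow> u i \<in> R) \<Longrightarrow> (\<And>i. i < n \<Longrightarrow> v i \<in> R) \<Longrightarrow> B u v \<in> R"
  unfolding B_def using sg_R star_lt by (intro sum_mem mult_mem) auto

lemma B_cong:
  assumes "\<And>i. i < n \<Longrightarrow> u i \<in> R" "\<And>i. i < n \<Longrightarrow> v' i \<in> R"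
    "\<And>i. i < n \<Longrightarrow> u i - u' i \<in> idl M" "\<And>i. i < n \<Longrightarrow> v i - v' i \<in> idl M"
  shows "B u v - B u' v' \<in> idl M"
  unfolding B_def
proof (rule sum_cong_idl)
  fix k assume "k \<in> {..<n}"
  then have k: "k < n" "star k < n" using star_lt by auto
  have "sg k * (u k * v (star k) - u' k * v' (star k)) \<in> idl M"
    using assms k sg_R by (intro idl_mult_left mult_cong) auto
  then show "sg k * u k * v (star k) - sg k * u' k * v' (star k) \<in> idl M" by (simp add: algebra_simps)
qed

lemma B_sum_left: "B (\<lambda>i. \<Sum>j<n. f j i * c j) v = (\<Sum>j<n. c j * B (f j) v)"
  unfolding B_def sum_distrib_left sum_distrib_right
  by (subst sum.swap) (intro sum.cong refl, auto simp: algebra_simps)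

lemma B_sum_right: "B v (\<lambda>i. \<Sum>j<n. f j i * c j) = (\<Sum>j<n. c j * B v (f j))"
  unfolding B_def sum_distrib_left sum_distrib_right
  by (subst sum.swap) (intro sum.cong refl, auto simp: algebra_simps)

definition iso :: "'k mat set" where
  "iso = {x \<in> RM n. \<forall>i<n. \<forall>j<n. B (cf x i) (cf x j) = B (e i) (e j)}"

lemma iso_RM: "x \<in> iso \<Longrightarrow> x \<in> RM n" by (simp add: iso_def)

lemma B_expand: "B u v = (\<Sum>i<n. u i * (\<Sum>j<n. v j * B (e i) (e j)))"
proof -
  have "B u v = B (\<lambda>i. \<Sum>j<n. e j i * u j) (\<lambda>i. \<Sum>j<n. e j i * v j)"
  proof (rule B_eq)
    have "(\<Sum>j<n. e j i * w j) = (\<Sum>j<n. if j = i then w i else 0)" for w :: "nat \<Rightarrow> 'k" and i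
      by (intro sum.cong) (auto simp: e_def)
    then show "u i = (\<Sum>j<n. e j i * u j)" "v i = (\<Sum>j<n. e j i * v j)" if "i < n" for i
      using that by simp_all
  qed
  then show ?thesis by (simp only: B_sum_left B_sum_right)
qed

lemma B_act: assumes "x \<in> iso" shows "B (act x u) (act x v) = B u v"
proof -
  have "B (act x u) (act x v) = B (\<lambda>i. \<Sum>j<n. cf x j i * u j) (\<lambda>i. \<Sum>j<n. cf x j i * v j)"
    by (rule B_eq) (simp_all add: act_def cf_def)
  also have "\<dots> = (\<Sum>i<n. u i * (\<Sum>j<n. v j * B (cf x i) (cf x j)))" by (simp only: B_sum_left B_sum_right)
  also have "\<dots> = B u v" unfolding B_expand[of u v] using assms by (simp add: iso_def)
  finally show ?thesis .
qed

lemma cf_mult: "x \<in> RM n \<Longrightarrow> y \<in> RM n \<Longrightarrow> i < n \<Longrightarrow> j < n \<Longrightarrow> cf (x * y) j i = act x (cf y j) i"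
  unfolding cf_def act_def by (intro mat_mult_index RM_carrier)

lemma act_e: "j < n \<Longrightarrow> act x (e j) i = cf x j i"
proof -
  assume j: "j < n"
  have "act x (e j) i = (\<Sum>k<n. if k = j then x $$ (i, j) else 0)"
    unfolding act_def by (intro sum.cong) (auto simp: e_def)
  then show ?thesis using j by (simp add: cf_def)
qed

lemma act_mult: assumes "x \<in> RM n" "y \<in> RM n" "i < n" shows "act (x * y) v i = act x (act y v) i"
proof -
  have "act (x * y) v i = (\<Sum>j<n. (\<Sum>k<n. x $$ (i, k) * y $$ (k, j)) * v j)"
    unfolding act_def using mat_mult_index[OF RM_carrier RM_carrier] assms by simp
  also have "\<dots> = (\<Sum>k<n. x $$ (i, k) * (\<Sum>j<n. y $$ (k, j) * v j))"
    unfolding sum_distrib_left sum_distrib_right by (subst sum.swap) (simp add: mult.assoc)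
  finally show ?thesis by (simp add: act_def)
qed

lemma act_eq: "(\<And>j. j < n \<Longrightarrow> v j = v' j) \<Longrightarrow> act x v i = act x v' i"
  unfolding act_def by (intro sum.cong) auto

lemma act_cong_idl:
  "x \<in> RM n \<Longrightarrow> i < n \<Longrightarrow> (\<And>j. j < n \<Longrightarrow> v j - v' j \<in> idl M) \<Longrightarrow> act x v i - act x v' i \<in> idl M"
  unfolding act_def sum_subtractf[symmetric] right_diff_distrib[symmetric]
  by (intro idl_sum idl_mult_left RM_entry) auto

lemma cf_one: "i < n \<Longrightarrow> j < n \<Longrightarrow> cf (1\<^sub>m n) j i = e j i" by (simp add: cf_def e_def)

lemma iso_matgrp: "matgrp R \<pi> q n iso"
proof (intro matgrp.intro matgrp_axioms.intro dvr_axioms)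
  show "iso \<subseteq> RM n" by (auto simp: iso_def)
  have "B (cf (1\<^sub>m n) i) (cf (1\<^sub>m n) j) = B (e i) (e j)" if "i < n" "j < n" for i j
    using that cf_one by (intro B_eq) auto
  then show "1\<^sub>m n \<in> iso" by (simp add: iso_def RM_one)
  show "x * y \<in> iso" if xy: "x \<in> iso" "y \<in> iso" for x y
  proof -
    have "B (cf (x * y) i) (cf (x * y) j) = B (e i) (e j)" if ij: "i < n" "j < n" for i j
    proof -
      have "B (cf (x * y) i) (cf (x * y) j) = B (act x (cf y i)) (act x (cf y j))"
        by (rule B_eq) (use cf_mult xy iso_RM ij in auto)
      then show ?thesis using B_act[OF xy(1)] xy(2) ij by (simp add: iso_def)
    qed
    then show ?thesis using RM_mult xy by (simp add: iso_def)
  qed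
  show "\<exists>y\<in>iso. x * y = 1\<^sub>m n \<and> y * x = 1\<^sub>m n" if x: "x \<in> iso" for x
  proof -
    \<comment> \<open>The adjoint of x with respect to B: the transpose of x conjugated by the Gram
      matrix, written out in entries.\<close>
    define y where "y = mat n n (\<lambda>(i, j). inverse (sg (star i)) * x $$ (star j, star i) * sg (star j))"
    have yR: "y \<in> RM n"
      using star_lt sg_R unit_inv[OF sg_unit] RM_entry[OF iso_RM[OF x]] unfolding RM_def y_def
      by (auto intro!: mult_mem)
    have yx: "y * x = 1\<^sub>m n"
    proof (rule eq_matI)
      fix i j assume "i < dim_row (1\<^sub>m n :: 'k mat)" "j < dim_col (1\<^sub>m n :: 'k mat)"
      then have ij: "i < n" "j < n" by auto
      have "(y * x) $$ (i, j) = (\<Sum>k<n. inverse (sg (star i)) * (sg (star k) * x $$ (star k, star i) * x $$ (k, j)))"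
        unfolding mat_mult_index[OF RM_carrier[OF yR] RM_carrier[OF iso_RM[OF x]] ij]
        by (intro sum.cong) (use ij in \<open>auto simp: y_def\<close>)
      also have "\<dots> = inverse (sg (star i)) * (\<Sum>k<n. sg (star k) * x $$ (star k, star i) * x $$ (k, j))"
        by (simp add: sum_distrib_left)
      also have "(\<Sum>k<n. sg (star k) * x $$ (star k, star i) * x $$ (k, j)) = B (cf x (star i)) (cf x j)"
        unfolding B_def cf_def by (rule sum.reindex_bij_witness[of _ star star]) (use star_lt star_star in auto)
      also have "B (cf x (star i)) (cf x j) = B (e (star i)) (e j)" using x ij star_lt by (simp add: iso_def)
      also have "\<dots> = (if i = j then sg (star i) else 0)" using B_e_e[of "star i" j] ij star_lt star_star by auto
      finally show "(y * x) $$ (i, j) = 1\<^sub>m n $$ (i, j)"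
        using unit_nz[OF sg_unit[OF star_lt[OF ij(1)]]] ij by (cases "i = j") simp_all
    qed (use yR x in \<open>auto simp: iso_def RM_def\<close>)
    have xy: "x * y = 1\<^sub>m n" using inverse_unique_mat[OF yR iso_RM[OF x] yx] .
    have "B (cf y i) (cf y j) = B (e i) (e j)" if ij: "i < n" "j < n" for i j
    proof -
      have "B (cf y i) (cf y j) = B (act x (cf y i)) (act x (cf y j))" using B_act[OF x] by simp
      also have "\<dots> = B (cf (x * y) i) (cf (x * y) j)"
        by (rule B_eq) (use cf_mult iso_RM[OF x] yR ij in auto)
      also have "\<dots> = B (e i) (e j)" unfolding xy by (rule B_eq) (use cf_one ij in auto)
      finally show ?thesis .
    qed
    then show ?thesis using xy yx yR by (intro bexI[of _ y]) (auto simp: iso_def)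
  qed
qed

text \<open>A constant sum h i + h (star i) makes the diagonal matrix a similitude with multiplier
  \<open>\<pi> ^ H\<close>, and conjugation by a similitude preserves isometries.\<close>

lemma conj_iso:
  assumes h: "\<And>i. i < n \<Longrightarrow> h i + h (star i) = H" and x: "x \<in> iso" "conj n h x \<in> RM n"
  shows "conj n h x \<in> iso"
proof -
  have "B (cf (conj n h x) i) (cf (conj n h x) j) = B (e i) (e j)" if ij: "i < n" "j < n" for i j
  proof -
    have "B (cf (conj n h x) i) (cf (conj n h x) j) =
      (\<Sum>k<n. \<pi> ^ H / (\<pi> ^ h i * \<pi> ^ h j) * (sg k * cf x i k * cf x j (star k)))"
      unfolding B_def
    proof (rule sum.cong[OF refl])
      fix k assume "k \<in> {..<n}"
      then have k: "k < n" "star k < n" using star_lt by auto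
      have "\<pi> ^ h k * \<pi> ^ h (star k) = \<pi> ^ H" using h[OF k(1)] by (simp flip: power_add)
      then show "sg k * cf (conj n h x) i k * cf (conj n h x) j (star k) =
          \<pi> ^ H / (\<pi> ^ h i * \<pi> ^ h j) * (sg k * cf x i k * cf x j (star k))"
        using k ij by (simp add: cf_def conj_index mult_ac)
    qed
    also have "\<dots> = \<pi> ^ H / (\<pi> ^ h i * \<pi> ^ h j) * B (cf x i) (cf x j)" by (simp add: B_def sum_distrib_left)
    also have "B (cf x i) (cf x j) = B (e i) (e j)" using x ij by (simp add: iso_def)
    also have "\<pi> ^ H / (\<pi> ^ h i * \<pi> ^ h j) * B (e i) (e j) = B (e i) (e j)"
    proof (cases "j = star i")
      case True
      then have "\<pi> ^ h i * \<pi> ^ h j = \<pi> ^ H" using h[OF ij(1)] by (simp flip: power_add)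
      then show ?thesis using pi_nz by simp
    qed (use B_e_e[OF ij] in simp)
    finally show ?thesis .
  qed
  then show ?thesis using x by (simp add: iso_def)
qed

subsection \<open>Transvections and reflections\<close>

text \<open>The map v \<mapsto> v + c B(u,v) u: a symplectic transvection if B is alternating, the
  reflection along u if B is symmetric and c = -2 / B(u,u).\<close>

definition tau :: "(nat \<Rightarrow> 'k) \<Rightarrow> 'k \<Rightarrow> 'k mat" where
  "tau u c = rank1 n u (\<lambda>j. c * B u (e j))"

lemma cf_tau: "i < n \<Longrightarrow> j < n \<Longrightarrow> cf (tau u c) j i = e j i + c * B u (e j) * u i"
  by (simp add: cf_def tau_def rank1_def e_def)

lemma act_tau: assumes "i < n" shows "act (tau u c) v i = v i + c * B u v * u i"
proof -
  have "act (tau u c) v i = (\<Sum>j<n. (if j = i then v i else 0) + c * u i * (v j * B u (e j)))"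
    unfolding act_def by (intro sum.cong) (use assms in \<open>auto simp: tau_def rank1_def algebra_simps\<close>)
  also have "\<dots> = v i + c * u i * (\<Sum>j<n. v j * B u (e j))"
    using assms by (simp add: sum.distrib sum_distrib_left)
  also have "(\<Sum>j<n. v j * B u (e j)) = B u (\<lambda>i. \<Sum>j<n. e j i * v j)" by (simp only: B_sum_right)
  also have "\<dots> = B u v"
  proof (rule B_eq)
    fix i assume "i < n"
    moreover have "(\<Sum>j<n. e j i * v j) = (\<Sum>j<n. if j = i then v i else 0)"
      by (intro sum.cong) (auto simp: e_def)
    ultimately show "(\<Sum>j<n. e j i * v j) = v i" by simp
  qed simp
  finally show ?thesis by (simp add: mult_ac)
qed

text \<open>The change of B on the images of e_i and e_j is B(u,e_i) B(u,e_j) times the left side of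
  \<open>eq\<close>. That side vanishes for every c in the alternating case, and for c = -2 / B(u,u)
  in the symmetric one.\<close>

lemma tau_iso:
  assumes u: "\<And>i. i < n \<Longrightarrow> u i \<in> R" and c: "c \<in> R" and eq: "c * (\<epsilon> + 1 + c * B u u) = 0"
  shows "tau u c \<in> iso"
proof -
  have "tau u c \<in> RM n"
    unfolding tau_def using u c B_mem[OF u e_R] by (intro rank1_RM mult_mem) auto
  moreover have "B (cf (tau u c) i) (cf (tau u c) j) = B (e i) (e j)" if ij: "i < n" "j < n" for i j
  proof -
    let ?a = "c * B u (e i)" and ?b = "c * B u (e j)"
    have "B (cf (tau u c) i) (cf (tau u c) j) = B (\<lambda>k. e i k + ?a * u k) (\<lambda>k. e j k + ?b * u k)"
      by (rule B_eq) (use cf_tau ij in auto)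
    also have "\<dots> = B (e i) (e j) + ?b * B (e i) u + ?a * (B u (e j) + ?b * B u u)"
      unfolding B_left B_right ..
    also have "B (e i) u = \<epsilon> * B u (e i)" by (rule B_sym)
    also have "B (e i) (e j) + ?b * (\<epsilon> * B u (e i)) + ?a * (B u (e j) + ?b * B u u) =
        B (e i) (e j) + B u (e i) * B u (e j) * (c * (\<epsilon> + 1 + c * B u u))"
      by (simp add: algebra_simps)
    finally show ?thesis using eq by simp
  qed
  ultimately show ?thesis by (simp add: iso_def)
qed

lemma reflection_iso:
  assumes "\<epsilon> = 1" "\<And>i. i < n \<Longrightarrow> u i \<in> R" "unit (B u u)" shows "tau u (- 2 / B u u) \<in> iso"
proof (rule tau_iso)
  show "- 2 / B u u \<in> R" using two assms by (intro unit_divide_mem uminus_mem unit_R) auto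
  show "- 2 / B u u * (\<epsilon> + 1 + - 2 / B u u * B u u) = 0" using assms unit_nz by simp
qed (use assms in auto)

lemma transvection_iso:
  assumes "\<epsilon> = - 1" "\<And>i. i < n \<Longrightarrow> u i \<in> R" "c \<in> R" shows "tau u c \<in> iso"
proof (rule tau_iso)
  have "B u u = - 1 * B u u" using B_sym[of u u] unfolding assms(1) .
  then have "B u u + B u u = 0" by (metis add.right_inverse mult_minus1)
  then have "2 * B u u = 0" by (simp only: mult_2)
  then have "B u u = 0" using unit_nz[OF two] by simp
  then show "c * (\<epsilon> + 1 + c * B u u) = 0" using assms by simp
qed (use assms in auto)

text \<open>If g fixes e_s modulo \<open>\<pi>\<close>, then B(e_s, g e_k) is congruent to B(e_s,
  e_k), and B(e_s, -) reads off coordinate \<open>star s\<close>. These are the constraints that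
  earlier columns put on later ones.\<close>

lemma fixed_column:
  assumes g: "g \<in> iso" and s: "s < n" "k < n" and fx: "\<And>i. i < n \<Longrightarrow> g $$ (i, s) - 1\<^sub>m n $$ (i, s) \<in> idl 1"
  shows "g $$ (star s, k) - 1\<^sub>m n $$ (star s, k) \<in> idl 1"
proof -
  have R: "cf g j i \<in> R" if "i < n" "j < n" for i j using RM_entry[OF iso_RM[OF g]] that by (simp add: cf_def)
  have "B (cf g s) (cf g k) - B (e s) (cf g k) \<in> idl 1"
  proof (rule B_cong)
    show "cf g s i - e s i \<in> idl 1" if "i < n" for i using fx[OF that] that s by (simp add: cf_def e_def)
  qed (use R s in auto)
  moreover have "B (cf g s) (cf g k) = B (e s) (e k)" using g s by (simp add: iso_def)
  ultimately have "sg s * (e k (star s) - cf g k (star s)) \<in> idl 1" using s by (simp add: B_e_left right_diff_distrib)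
  then have "e k (star s) - cf g k (star s) \<in> idl 1" using idl_unit_cancel sg_unit s by blast
  then show ?thesis using idl_commute[of "e k (star s)"] star_lt s by (simp add: cf_def e_def)
qed

text \<open>Otherwise the pairing of columns k and \<open>star k\<close>, which is the unit
  \<open>sg k\<close>, would be divisible by \<open>\<pi>\<close>.\<close>

lemma column_primitive:
  assumes g: "g \<in> iso" and k: "k < n" shows "\<exists>i<n. g $$ (i, k) \<notin> idl 1"
proof (rule ccontr)
  assume "\<not> (\<exists>i<n. g $$ (i, k) \<notin> idl 1)"
  then have low: "cf g k i \<in> idl 1" if "i < n" for i using that by (auto simp: cf_def)
  have "B (cf g k) (cf g (star k)) \<in> idl 1"
    unfolding B_def
  proof (rule idl_sum)
    fix i assume "i \<in> {..<n}"
    then have i: "i < n" "star i < n" using star_lt by auto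
    have "sg i * (cf g k i * cf g (star k) (star i)) \<in> idl 1"
      using low i sg_R RM_entry[OF iso_RM[OF g]] star_lt[OF k]
      by (intro idl_mult_left idl_mult_right) (auto simp: cf_def)
    then show "sg i * cf g k i * cf g (star k) (star i) \<in> idl 1" by (simp add: mult.assoc)
  qed
  moreover have "B (cf g k) (cf g (star k)) = sg k" using g k star_lt B_e_e[of k "star k"] by (simp add: iso_def)
  ultimately show False using sg_unit[OF k] unit_iff unit_R by auto
qed

lemma orb_memI:
  fixes w :: "'k vec"
  assumes g: "g \<in> iso" and cj: "c j < n" and c: "\<And>i. i < j \<Longrightarrow> c i < n"
    and w: "w \<in> carrier_vec n" "\<And>i. i < n \<Longrightarrow> w $ i \<in> red 1 ` R"
    and gw: "\<And>i. i < n \<Longrightarrow> act g (e (c j)) i - w $ i \<in> idl 1"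
    and fx: "\<And>s i. s < j \<Longrightarrow> i < n \<Longrightarrow> act g (e (c s)) i - e (c s) i \<in> idl 1"
  shows "w \<in> matgrp.orb R \<pi> n iso c j"
proof -
  interpret G: matgrp R \<pi> q n iso by (rule iso_matgrp)
  have gR: "g $$ (i, k) \<in> R" if "i < n" "k < n" for i k using RM_entry[OF iso_RM[OF g]] that .
  have "map_vec (red 1) (col g (c j)) = w"
  proof (rule eq_vecI)
    fix i assume "i < dim_vec w"
    then have i: "i < n" using w by auto
    have "red 1 (g $$ (i, c j)) = red 1 (w $ i)"
      using gw[OF i] act_e[OF cj] gR[OF i cj] red_in_R[OF w(2)[OF i]] red_eq_iff by (simp add: cf_def)
    then show "map_vec (red 1) (col g (c j)) $ i = w $ i"
      using red_fixed[OF w(2)[OF i]] i cj RM_carrier[OF iso_RM[OF g]] by simp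
  qed (use w RM_carrier[OF iso_RM[OF g]] in auto)
  moreover have "g $$ (r, c i) - 1\<^sub>m n $$ (r, c i) \<in> idl 1" if "i < j" "r < n" for i r
    using fx[OF that] act_e[OF c[OF that(1)]] that c by (simp add: cf_def e_def)
  ultimately show ?thesis unfolding G.orb_def using g by (intro image_eqI[of _ _ g]) auto
qed

lemma orb_memD:
  fixes w :: "'k vec"
  assumes w: "w \<in> matgrp.orb R \<pi> n iso c j" and cj: "c j < n"
  obtains g where "g \<in> iso" "w \<in> carrier_vec n" "\<And>i. i < n \<Longrightarrow> w $ i \<in> red 1 ` R"
    "\<And>i. i < n \<Longrightarrow> g $$ (i, c j) - w $ i \<in> idl 1"
    "\<And>s i. s < j \<Longrightarrow> i < n \<Longrightarrow> g $$ (i, c s) - 1\<^sub>m n $$ (i, c s) \<in> idl 1"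
proof -
  interpret G: matgrp R \<pi> q n iso by (rule iso_matgrp)
  obtain g where g: "g \<in> iso" "w = map_vec (red 1) (col g (c j))"
    "\<And>s i. s < j \<Longrightarrow> i < n \<Longrightarrow> g $$ (i, c s) - 1\<^sub>m n $$ (i, c s) \<in> idl 1"
    using w unfolding G.orb_def by blast
  have c: "g \<in> carrier_mat n n" using RM_carrier[OF iso_RM[OF g(1)]] .
  have wi: "w $ i = red 1 (g $$ (i, c j))" if "i < n" for i using g(2) c that cj by simp
  have gR: "g $$ (i, c j) \<in> R" if "i < n" for i using RM_entry[OF iso_RM[OF g(1)] that cj] .
  show ?thesis
  proof (rule that[OF g(1)])
    show "w \<in> carrier_vec n" using g(2) c by auto
    show "w $ i \<in> red 1 ` R" if "i < n" for i using wi[OF that] gR[OF that] by simp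
    show "g $$ (i, c j) - w $ i \<in> idl 1" if "i < n" for i using wi[OF that] red_cong[OF gR[OF that]] by simp
  qed (use g(3) in blast)
qed

end

subsection \<open>The Cayley transform\<close>

context dvr
begin

definition minv :: "nat \<Rightarrow> 'k mat \<Rightarrow> 'k mat" where
  "minv n z = (SOME w. w \<in> RM n \<and> (1\<^sub>m n + z) * w = 1\<^sub>m n \<and> w * (1\<^sub>m n + z) = 1\<^sub>m n)"

text \<open>The transform is its own inverse, respects congruences and commutes with conjugation by
  diagonal matrices. It trades isometries near 1 for skew-adjoint matrices near 0, whose entries
  obey linear conditions and can be counted.\<close>

definition cay :: "nat \<Rightarrow> 'k mat \<Rightarrow> 'k mat" where "cay n z = (1\<^sub>m n - z) * minv n z"

definition cay_dom :: "nat \<Rightarrow> 'k mat set" where "cay_dom n = {z \<in> RM n. unit (det (1\<^sub>m n + z))}"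

lemma RM_add: assumes "A \<in> RM n" "C \<in> RM n" shows "A + C \<in> RM n"
proof -
  have "(A + C) $$ (i, j) \<in> R" if ij: "i < n" "j < n" for i j
    using add_mem[OF RM_entry[OF assms(1) ij] RM_entry[OF assms(2) ij]] RM_carrier[OF assms(1)] RM_carrier[OF assms(2)] ij by simp
  moreover have "A + C \<in> carrier_mat n n" by (rule add_carrier_mat[OF RM_carrier[OF assms(2)]])
  ultimately show ?thesis by (simp add: RM_def)
qed

lemma RM_minus: assumes "A \<in> RM n" "C \<in> RM n" shows "A - C \<in> RM n"
proof -
  have "(A - C) $$ (i, j) \<in> R" if ij: "i < n" "j < n" for i j
    using diff_mem[OF RM_entry[OF assms(1) ij] RM_entry[OF assms(2) ij]] RM_carrier[OF assms(1)] RM_carrier[OF assms(2)] ij by simp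
  moreover have "A - C \<in> carrier_mat n n" by (rule minus_carrier_mat[OF RM_carrier[OF assms(2)]])
  ultimately show ?thesis by (simp add: RM_def)
qed

lemma minv:
  assumes "z \<in> cay_dom n"
  shows "minv n z \<in> RM n" "(1\<^sub>m n + z) * minv n z = 1\<^sub>m n" "minv n z * (1\<^sub>m n + z) = 1\<^sub>m n"
proof -
  have "\<exists>w. w \<in> RM n \<and> (1\<^sub>m n + z) * w = 1\<^sub>m n \<and> w * (1\<^sub>m n + z) = 1\<^sub>m n"
  proof -
    have z: "z \<in> RM n" "unit (det (1\<^sub>m n + z))" using assms by (auto simp: cay_dom_def)
    obtain w where "w \<in> RM n" "(1\<^sub>m n + z) * w = 1\<^sub>m n" "w * (1\<^sub>m n + z) = 1\<^sub>m n"
      by (rule inverse_exists[OF RM_add[OF RM_one z(1)] z(2)])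
    then show ?thesis by blast
  qed
  from someI_ex[OF this]
  show "minv n z \<in> RM n" "(1\<^sub>m n + z) * minv n z = 1\<^sub>m n" "minv n z * (1\<^sub>m n + z) = 1\<^sub>m n"
    unfolding minv_def by auto
qed

lemma minv_eqI:
  assumes "z \<in> cay_dom n" "w \<in> carrier_mat n n" "(1\<^sub>m n + z) * w = 1\<^sub>m n" shows "minv n z = w"
proof -
  have c: "minv n z \<in> carrier_mat n n" "1\<^sub>m n + z \<in> carrier_mat n n"
    using minv[OF assms(1)] RM_carrier assms(1) by (auto simp: cay_dom_def)
  have "minv n z * ((1\<^sub>m n + z) * w) = minv n z * (1\<^sub>m n + z) * w"
    by (rule assoc_mult_mat[symmetric, OF c assms(2)])
  then show ?thesis using assms minv(3)[OF assms(1)] c by simp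
qed

lemma cay_RM: "z \<in> cay_dom n \<Longrightarrow> cay n z \<in> RM n"
  unfolding cay_def using minv(1) by (intro RM_mult RM_minus RM_one) (auto simp: cay_dom_def)

text \<open>The first equation shows 1 + cay z to be invertible with inverse (1 + z)/2, and the
  quotient of the two is z: this is the involution property.\<close>

lemma cay_one_add:
  assumes z: "z \<in> cay_dom n"
  shows "1\<^sub>m n + cay n z = 2 \<cdot>\<^sub>m minv n z" "1\<^sub>m n - cay n z = 2 \<cdot>\<^sub>m (z * minv n z)"
proof -
  have c: "z \<in> carrier_mat n n" "minv n z \<in> carrier_mat n n"
    using minv[OF z] RM_carrier z by (auto simp: cay_dom_def)
  have c': "1\<^sub>m n + z \<in> carrier_mat n n" "1\<^sub>m n - z \<in> carrier_mat n n" using c by (auto intro: minus_carrier_mat)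
  have e: "1\<^sub>m n + z + (1\<^sub>m n - z) = 2 \<cdot>\<^sub>m 1\<^sub>m n" "1\<^sub>m n + z - (1\<^sub>m n - z) = 2 \<cdot>\<^sub>m z"
    by (intro eq_matI; use c in simp)+
  have "1\<^sub>m n + cay n z = (1\<^sub>m n + z) * minv n z + (1\<^sub>m n - z) * minv n z"
    using minv(2)[OF z] by (simp add: cay_def)
  also have "\<dots> = (1\<^sub>m n + z + (1\<^sub>m n - z)) * minv n z" by (rule add_mult_distrib_mat[symmetric, OF c' c(2)])
  finally show "1\<^sub>m n + cay n z = 2 \<cdot>\<^sub>m minv n z"
    unfolding e using mult_smult_assoc_mat[OF one_carrier_mat c(2)] c(2) by simp
  have "1\<^sub>m n - cay n z = (1\<^sub>m n + z) * minv n z - (1\<^sub>m n - z) * minv n z"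
    using minv(2)[OF z] by (simp add: cay_def)
  also have "\<dots> = (1\<^sub>m n + z - (1\<^sub>m n - z)) * minv n z" by (rule minus_mult_distrib_mat[symmetric, OF c' c(2)])
  finally show "1\<^sub>m n - cay n z = 2 \<cdot>\<^sub>m (z * minv n z)"
    unfolding e using mult_smult_assoc_mat[OF c] by simp
qed

lemma cay_involution:
  assumes two: "unit 2" and z: "z \<in> cay_dom n" shows "cay n z \<in> cay_dom n" "cay n (cay n z) = z"
proof -
  have c: "z \<in> carrier_mat n n" "minv n z \<in> carrier_mat n n" "1\<^sub>m n + z \<in> carrier_mat n n"
    using minv[OF z] RM_carrier z by (auto simp: cay_dom_def)
  let ?w = "inverse 2 \<cdot>\<^sub>m (1\<^sub>m n + z)"
  have wR: "?w \<in> RM n" using z RM_add[OF RM_one] RM_smult[OF unit_inv[OF two]] by (auto simp: cay_dom_def)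
  have half: "(2 \<cdot>\<^sub>m A) * (inverse 2 \<cdot>\<^sub>m (1\<^sub>m n + z)) = A * (1\<^sub>m n + z)" if A: "A \<in> carrier_mat n n" for A
  proof -
    have "(2 \<cdot>\<^sub>m A) * (inverse 2 \<cdot>\<^sub>m (1\<^sub>m n + z)) = 2 \<cdot>\<^sub>m (inverse 2 \<cdot>\<^sub>m (A * (1\<^sub>m n + z)))"
      using mult_smult_assoc_mat[OF A, of ?w n 2] mult_smult_distrib[OF A c(3), of "inverse 2"] wR RM_carrier by simp
    also have "\<dots> = A * (1\<^sub>m n + z)" using A c unit_nz[OF two] by (intro eq_matI) simp_all
    finally show ?thesis .
  qed
  have "(1\<^sub>m n + cay n z) * ?w = 1\<^sub>m n"
    unfolding cay_one_add(1)[OF z] using half[OF c(2)] minv(3)[OF z] by simp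
  then have "unit (det (1\<^sub>m n + cay n z))"
    using unit_det_if_inverse[OF RM_add[OF RM_one cay_RM[OF z]] wR] by blast
  then show d: "cay n z \<in> cay_dom n" using cay_RM[OF z] by (simp add: cay_dom_def)
  have "minv n (cay n z) = ?w"
    by (rule minv_eqI[OF d]) (use \<open>(1\<^sub>m n + cay n z) * ?w = 1\<^sub>m n\<close> wR RM_carrier in auto)
  then have "cay n (cay n z) = (2 \<cdot>\<^sub>m (z * minv n z)) * ?w"
    unfolding cay_def[of n "cay n z"] using cay_one_add(2)[OF z] by simp
  also have "\<dots> = z * minv n z * (1\<^sub>m n + z)" by (rule half[OF mult_carrier_mat[OF c(1,2)]])
  also have "\<dots> = z * (minv n z * (1\<^sub>m n + z))" by (rule assoc_mult_mat[OF c])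
  also have "\<dots> = z" unfolding minv(3)[OF z] using c(1) by simp
  finally show "cay n (cay n z) = z" .
qed

lemma cay_cong:
  assumes z: "z \<in> cay_dom n" "z' \<in> cay_dom n" and d: "mcong n M z z'" shows "mcong n M (cay n z) (cay n z')"
proof -
  have R: "z \<in> RM n" "z' \<in> RM n" using z by (auto simp: cay_dom_def)
  let ?w = "minv n z" and ?w' = "minv n z'"
  note w = minv[OF z(1)] and w' = minv[OF z(2)]
  have c: "z \<in> carrier_mat n n" "z' \<in> carrier_mat n n" "?w \<in> carrier_mat n n" "?w' \<in> carrier_mat n n"
    "1\<^sub>m n + z \<in> carrier_mat n n" "1\<^sub>m n + z' \<in> carrier_mat n n"
    using R w w' RM_carrier by auto
  have dp: "mcong n M (1\<^sub>m n + z') (1\<^sub>m n + z)" "mcong n M (1\<^sub>m n - z) (1\<^sub>m n - z')"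
    using d c idl_commute unfolding mcong_def by auto
  have "mcong n M ((1\<^sub>m n + z') * ?w') ((1\<^sub>m n + z) * ?w')"
    using c R w' RM_add[OF RM_one] dp by (intro mcong_mult mcong_refl) auto
  then have "mcong n M (?w * ((1\<^sub>m n + z') * ?w')) (?w * ((1\<^sub>m n + z) * ?w'))"
    using c R w w' RM_add[OF RM_one] RM_mult by (intro mcong_mult[OF w(1) _ c(3) _ mcong_refl]) (auto simp: w'(2))
  moreover have "?w * ((1\<^sub>m n + z) * ?w') = ?w'" using assoc_mult_mat[OF c(3) c(5) c(4)] w(3) c(4) by simp
  ultimately have "mcong n M ?w ?w'" using w'(2) c(3) by simp
  then show ?thesis
    unfolding cay_def using w w' dp R c RM_minus[OF RM_one] by (intro mcong_mult) (auto intro: minus_carrier_mat)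
qed

text \<open>1 + z is congruent to the scalar matrix 1 + a, of determinant 1 or 2^n. The case a = 1
  covers group elements, a = 0 their transforms.\<close>

lemma cay_dom_near:
  assumes two: "unit 2" and z: "z \<in> RM n" and a: "a = 0 \<or> a = 1" "mcong n 1 z (a \<cdot>\<^sub>m 1\<^sub>m n)"
  shows "z \<in> cay_dom n"
proof -
  have aR: "1 + a \<in> R" "unit (1 + a)" using a two unit_1 unit_R[OF two] one_mem by auto
  have "mcong n 1 (1\<^sub>m n + z) ((1 + a) \<cdot>\<^sub>m 1\<^sub>m n)"
    unfolding mcong_def
  proof (intro allI impI)
    fix i j assume ij: "i < n" "j < n"
    have "(1\<^sub>m n + z) $$ (i, j) - ((1 + a) \<cdot>\<^sub>m 1\<^sub>m n) $$ (i, j) = z $$ (i, j) - (a \<cdot>\<^sub>m 1\<^sub>m n) $$ (i, j)"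
      using ij RM_carrier[OF z] by auto
    then show "(1\<^sub>m n + z) $$ (i, j) - ((1 + a) \<cdot>\<^sub>m 1\<^sub>m n) $$ (i, j) \<in> idl 1"
      using a(2) ij by (simp only: mcong_def)
  qed
  then have "det (1\<^sub>m n + z) - det ((1 + a) \<cdot>\<^sub>m 1\<^sub>m n) \<in> idl 1"
    using z RM_add[OF RM_one] RM_smult[OF aR(1) RM_one] by (intro det_cong) auto
  moreover have "det ((1 + a) \<cdot>\<^sub>m 1\<^sub>m n) = (1 + a) ^ n" by simp
  moreover have "unit ((1 + a) ^ n)" using aR(2) by (induction n) (auto intro: unit_1 unit_mult)
  ultimately have "unit (det (1\<^sub>m n + z))"
    using unit_cong[of "(1 + a) ^ n"] idl_commute det_mem[OF RM_add[OF RM_one z]] by simp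
  then show ?thesis using z by (simp add: cay_dom_def)
qed

lemma cay_dom_one: "unit 2 \<Longrightarrow> 1\<^sub>m n \<in> cay_dom n"
  by (rule cay_dom_near[where a = 1]) (auto simp: RM_one mcong_def)

lemma RM_zero: "0\<^sub>m n n \<in> RM n" by (simp add: RM_def)

lemma cay_dom_zero: "unit 2 \<Longrightarrow> 0\<^sub>m n n \<in> cay_dom n"
  by (rule cay_dom_near[where a = 0]) (auto simp: RM_zero mcong_def)

lemma cay_one: assumes "unit 2" shows "cay n (1\<^sub>m n) = 0\<^sub>m n n"
proof -
  have z: "1\<^sub>m n - 1\<^sub>m n = (0\<^sub>m n n :: 'k mat)" by (rule eq_matI) auto
  show ?thesis
    unfolding cay_def z by (rule left_mult_zero_mat[OF RM_carrier[OF minv(1)[OF cay_dom_one[OF assms]]]])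
qed

lemma cay_zero: assumes "unit 2" shows "cay n (0\<^sub>m n n) = 1\<^sub>m n"
  using cay_involution(2)[OF assms cay_dom_one[OF assms]] cay_one[OF assms] by simp

lemma conj_cay:
  assumes z: "z \<in> cay_dom n" "conj n h z \<in> cay_dom n" shows "conj n h (cay n z) = cay n (conj n h z)"
proof -
  have c: "z \<in> carrier_mat n n" "minv n z \<in> carrier_mat n n"
    using minv[OF z(1)] RM_carrier z by (auto simp: cay_dom_def)
  have p: "conj n h (1\<^sub>m n + z) = 1\<^sub>m n + conj n h z" "conj n h (1\<^sub>m n - z) = 1\<^sub>m n - conj n h z"
    by (intro eq_matI; use c pi_nz in \<open>auto simp: conj_def field_simps\<close>)+
  have "(1\<^sub>m n + conj n h z) * conj n h (minv n z) = conj n h ((1\<^sub>m n + z) * minv n z)"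
    unfolding p(1)[symmetric] by (rule conj_mult[symmetric]) (use c in auto)
  then have "(1\<^sub>m n + conj n h z) * conj n h (minv n z) = 1\<^sub>m n" by (simp add: minv(2)[OF z(1)] conj_one)
  then have "minv n (conj n h z) = conj n h (minv n z)" by (intro minv_eqI z(2) conj_carrier)
  then show ?thesis unfolding cay_def using conj_mult[of "1\<^sub>m n - z" n "minv n z" h] p(2) c by (auto intro: minus_carrier_mat)
qed

end

context sform
begin

definition Lie :: "'k mat set" where
  "Lie = {A \<in> RM n. \<forall>u v. B (act A u) v + B u (act A v) = 0}"

lemma act_minv:
  assumes "z \<in> cay_dom n" "i < n" shows "act (1\<^sub>m n + z) (act (minv n z) u) i = u i"
proof -
  have "act (1\<^sub>m n + z) (act (minv n z) u) i = act (1\<^sub>m n) u i"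
    using act_mult[of "1\<^sub>m n + z" "minv n z" i u] minv[OF assms(1)] assms RM_add[OF RM_one] by (simp add: cay_dom_def)
  also have "\<dots> = (\<Sum>j<n. if j = i then u i else 0)"
    unfolding act_def by (intro sum.cong) (use assms in auto)
  finally show ?thesis using assms by simp
qed

lemma act_one_add: assumes "z \<in> RM n" "i < n"
  shows "act (1\<^sub>m n + z) u i = u i + act z u i" "act (1\<^sub>m n - z) u i = u i - act z u i"
proof -
  have "act (1\<^sub>m n + z) u i = (\<Sum>j<n. (if j = i then u i else 0) + z $$ (i, j) * u j)"
    unfolding act_def by (intro sum.cong) (use assms RM_carrier[OF assms(1)] in \<open>auto simp: algebra_simps\<close>)
  then show "act (1\<^sub>m n + z) u i = u i + act z u i" using assms by (simp add: sum.distrib act_def)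
  have "act (1\<^sub>m n - z) u i = (\<Sum>j<n. (if j = i then u i else 0) - z $$ (i, j) * u j)"
    unfolding act_def by (intro sum.cong) (use assms RM_carrier[OF assms(1)] in \<open>auto simp: algebra_simps\<close>)
  then show "act (1\<^sub>m n - z) u i = u i - act z u i" using assms by (simp add: sum_subtractf act_def)
qed

lemma act_cay:
  assumes "z \<in> cay_dom n" "i < n"
  shows "act (cay n z) u i = act (minv n z) u i - act z (act (minv n z) u) i"
    "u i = act (minv n z) u i + act z (act (minv n z) u) i"
proof -
  have zR: "z \<in> RM n" using assms by (simp add: cay_dom_def)
  show "act (cay n z) u i = act (minv n z) u i - act z (act (minv n z) u) i"
    unfolding cay_def using act_mult[of "1\<^sub>m n - z" "minv n z" i u] minv[OF assms(1)] assms zR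
      RM_minus[OF RM_one] act_one_add(2)[OF zR assms(2)] by simp
  show "u i = act (minv n z) u i + act z (act (minv n z) u) i"
    using act_minv[OF assms] act_one_add(1)[OF zR assms(2)] by simp
qed

lemma iso_iff_act: "x \<in> iso \<longleftrightarrow> x \<in> RM n \<and> (\<forall>u v. B (act x u) (act x v) = B u v)"
proof
  assume r: "x \<in> RM n \<and> (\<forall>u v. B (act x u) (act x v) = B u v)"
  have "B (cf x i) (cf x j) = B (e i) (e j)" if "i < n" "j < n" for i j
  proof -
    have "B (cf x i) (cf x j) = B (act x (e i)) (act x (e j))" using act_e that by (intro B_eq) auto
    then show ?thesis using r by simp
  qed
  then show "x \<in> iso" using r by (simp add: iso_def)
qed (use B_act iso_RM in auto)

text \<open>With u' = (1 + x)^(-1) u one has u = u' + x u' and cay x u = u' - x u'. On expansion the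
  mixed terms cancel in pairs and the rest cancels because x preserves B. \<open>cay_Lie_iso\<close>
  runs the same expansion with skewness in place of invariance.\<close>

lemma cay_iso_Lie: assumes x: "x \<in> iso" "x \<in> cay_dom n" shows "cay n x \<in> Lie"
proof -
  have "B (act (cay n x) u) v + B u (act (cay n x) v) = 0" for u v
  proof -
    let ?u = "act (minv n x) u" and ?v = "act (minv n x) v"
    have 1: "B (act (cay n x) u) v = B (\<lambda>i. ?u i - act x ?u i) (\<lambda>i. ?v i + 1 * act x ?v i)"
      by (rule B_eq) (use act_cay[OF x(2)] in auto)
    have 2: "B u (act (cay n x) v) = B (\<lambda>i. ?u i + 1 * act x ?u i) (\<lambda>i. ?v i - act x ?v i)"
      by (rule B_eq) (use act_cay[OF x(2)] in auto)
    have 3: "B (act x ?u) (act x ?v) = B ?u ?v" by (rule B_act[OF x(1)])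
    show ?thesis
      unfolding 1 2 B_left B_right B_diff_left B_diff_right 3 by (simp add: algebra_simps)
  qed
  then show ?thesis using cay_RM[OF x(2)] by (simp add: Lie_def)
qed

lemma cay_Lie_iso: assumes A: "A \<in> Lie" "A \<in> cay_dom n" shows "cay n A \<in> iso"
proof -
  have "B (act (cay n A) u) (act (cay n A) v) = B u v" for u v
  proof -
    let ?u = "act (minv n A) u" and ?v = "act (minv n A) v"
    have 1: "B (act (cay n A) u) (act (cay n A) v) = B (\<lambda>i. ?u i - act A ?u i) (\<lambda>i. ?v i - act A ?v i)"
      by (rule B_eq) (use act_cay[OF A(2)] in auto)
    have 2: "B u v = B (\<lambda>i. ?u i + 1 * act A ?u i) (\<lambda>i. ?v i + 1 * act A ?v i)"
      by (rule B_eq) (use act_cay[OF A(2)] in auto)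
    have 3: "B (act A ?u) ?v = - B ?u (act A ?v)"
      using A(1) by (simp add: Lie_def eq_neg_iff_add_eq_0)
    show ?thesis
      unfolding 1 2 B_left B_right B_diff_left B_diff_right 3 by (simp add: algebra_simps)
  qed
  then show ?thesis unfolding iso_iff_act using cay_RM[OF A(2)] by blast
qed

lemma Lie_iff:
  "A \<in> Lie \<longleftrightarrow> A \<in> RM n \<and> (\<forall>i<n. \<forall>j<n. sg (star j) * A $$ (star j, i) + sg i * A $$ (star i, j) = 0)"
proof -
  have el: "B (cf A i) (e j) + B (e i) (cf A j) = sg (star j) * A $$ (star j, i) + sg i * A $$ (star i, j)"
    if "i < n" "j < n" for i j using that by (simp add: B_e_left B_e_right cf_def)
  have "B (act A u) v + B u (act A v) = 0" if b: "\<forall>i<n. \<forall>j<n. B (cf A i) (e j) + B (e i) (cf A j) = 0" for u v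
  proof -
    have ex: "B a (\<lambda>i. \<Sum>j<n. e j i * w j) = B a w" "B (\<lambda>i. \<Sum>j<n. e j i * w j) a = B w a" for a w
    proof -
      have s: "(\<Sum>j<n. e j i * w j) = w i" if "i < n" for i
      proof -
        have "(\<Sum>j<n. e j i * w j) = (\<Sum>j<n. if j = i then w i else 0)"
          by (intro sum.cong) (auto simp: e_def)
        then show ?thesis using that by simp
      qed
      show "B a (\<lambda>i. \<Sum>j<n. e j i * w j) = B a w" "B (\<lambda>i. \<Sum>j<n. e j i * w j) a = B w a"
        by (rule B_eq; use s in simp)+
    qed
    have "B (act A u) v = B (\<lambda>i. \<Sum>j<n. cf A j i * u j) (\<lambda>i. \<Sum>j<n. e j i * v j)"
      unfolding ex by (rule B_eq) (simp_all add: act_def cf_def)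
    then have 1: "B (act A u) v = (\<Sum>i<n. u i * (\<Sum>j<n. v j * B (cf A i) (e j)))" by (simp only: B_sum_left B_sum_right)
    have "B u (act A v) = B (\<lambda>i. \<Sum>j<n. e j i * u j) (\<lambda>i. \<Sum>j<n. cf A j i * v j)"
      unfolding ex by (rule B_eq) (simp_all add: act_def cf_def)
    then have 2: "B u (act A v) = (\<Sum>i<n. u i * (\<Sum>j<n. v j * B (e i) (cf A j)))" by (simp only: B_sum_left B_sum_right)
    show ?thesis
      unfolding 1 2 sum.distrib[symmetric] distrib_left[symmetric] using b by simp
  qed
  moreover have "B (cf A i) (e j) + B (e i) (cf A j) = 0" if "A \<in> Lie" "i < n" "j < n" for i j
  proof -
    have "B (act A (e i)) (e j) + B (e i) (act A (e j)) = 0" using that by (simp add: Lie_def)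
    moreover have "B (act A (e i)) (e j) = B (cf A i) (e j)" "B (e i) (act A (e j)) = B (e i) (cf A j)"
      by (rule B_eq; use act_e that in simp)+
    ultimately show ?thesis by simp
  qed
  ultimately show ?thesis using el unfolding Lie_def by auto
qed

text \<open>Positions (i,j) for which entry (star i, j) of a skew-adjoint matrix may be chosen
  freely; the diagonal is free exactly in the alternating case. Its cardinality is the dimension of
  the group.\<close>

definition Fr :: "(nat \<times> nat) set" where
  "Fr = {(i, j). i < n \<and> j < n \<and> (i < j \<or> \<epsilon> \<noteq> 1 \<and> i = j)}"

lemma Fr_finite: "finite Fr"
  by (rule finite_subset[of _ "{..<n} \<times> {..<n}"]) (auto simp: Fr_def)

text \<open>By \<open>Lie_iff\<close> the entries (star i, j) and (star j, i) determine each other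
  up to a unit. The symmetry of \<open>lev\<close> says that both are subject to the same level, so
  only the free ones are counted.\<close>

lemma card_Lie_level:
  assumes lev: "\<And>i j. i < n \<Longrightarrow> j < n \<Longrightarrow> lev (star i) j = lev (star j) i" "\<And>i j. i < n \<Longrightarrow> j < n \<Longrightarrow> lev i j \<le> M"
  shows "card (redm M ` {A \<in> Lie. \<forall>i<n. \<forall>j<n. A $$ (i, j) \<in> idl (lev i j)}) =
     (\<Prod>(i, j)\<in>Fr. q ^ (M - lev (star i) j))"
proof -
  let ?A = "{A \<in> Lie. \<forall>i<n. \<forall>j<n. A $$ (i, j) \<in> idl (lev i j)}"
  let ?l = "\<lambda>(i, j). lev (star i) j"
  have FrD: "fst ij < n" "snd ij < n" if "ij \<in> Fr" for ij using that by (auto simp: Fr_def)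
  have R: "A $$ (i, j) \<in> R" if "A \<in> Lie" "i < n" "j < n" for A i j
    using that RM_entry by (auto simp: Lie_def)
  have "card (redm M ` ?A) = card ((\<lambda>\<phi>. \<lambda>ij\<in>Fr. red M (\<phi> ij)) ` (PiE Fr (\<lambda>ij. idl (?l ij))))"
  proof (rule card_image_eqI[where h = "\<lambda>A. \<lambda>ij\<in>Fr. A $$ (star (fst ij), snd ij)"])
    show "(\<lambda>ij\<in>Fr. A $$ (star (fst ij), snd ij)) \<in> PiE Fr (\<lambda>ij. idl (?l ij))" if "A \<in> ?A" for A
      using that FrD star_lt by (intro restrict_PiE_iff[THEN iffD2]) (auto simp: case_prod_unfold)
    show "\<exists>A\<in>?A. (\<lambda>ij\<in>Fr. red M ((\<lambda>ij\<in>Fr. A $$ (star (fst ij), snd ij)) ij)) = (\<lambda>ij\<in>Fr. red M (\<phi> ij))"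
      if phi: "\<phi> \<in> PiE Fr (\<lambda>ij. idl (?l ij))" for \<phi>
    proof -
      \<comment> \<open>The matrix rebuilt from its free entries; the factor is the one that
        \<open>Lie_iff\<close> imposes on the dependent entry.\<close>
      define S where "S i j = (if (i, j) \<in> Fr then \<phi> (i, j) else if (j, i) \<in> Fr then - (sg j / sg (star i)) * \<phi> (j, i) else 0)" for i j
      have p: "\<phi> (i, j) \<in> idl (lev (star i) j)" if "(i, j) \<in> Fr" for i j using PiE_mem[OF phi that] by simp
      have S_lev: "S i j \<in> idl (lev (star i) j)" if ij: "i < n" "j < n" for i j
      proof -
        have "- (sg j / sg (star i)) \<in> R" by (intro uminus_mem unit_divide_mem sg_unit sg_R star_lt ij)
        then have "- (sg j / sg (star i)) * \<phi> (j, i) \<in> idl (lev (star i) j)" if "(j, i) \<in> Fr"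
          using p[OF that] lev(1)[OF ij] by (intro idl_mult_left) auto
        then show ?thesis using p by (simp add: S_def)
      qed
      define A where "A = mat n n (\<lambda>(i, j). S (star i) j)"
      have A: "A $$ (star i, j) = S i j" if "i < n" "j < n" for i j using that star_lt star_star by (simp add: A_def)
      have A_lev: "A $$ (i, j) \<in> idl (lev i j)" if "i < n" "j < n" for i j
        using that S_lev[of "star i" j] star_lt star_star by (simp add: A_def)
      have rel: "sg (star j) * S j i + sg i * S i j = 0" if ij: "i < n" "j < n" for i j
      proof -
        have nz: "sg i \<noteq> 0" "sg j \<noteq> 0" "\<epsilon> \<noteq> 0" using unit_nz[OF sg_unit] ij eps by auto
        have e2: "\<epsilon> * \<epsilon> = 1" using eps by auto
        consider "i < j" | "j < i" | "i = j" by linarith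
        then show ?thesis
        proof cases
          case 1
          then have "(i, j) \<in> Fr" "(j, i) \<notin> Fr" using ij by (auto simp: Fr_def)
          then show ?thesis using nz ij by (simp add: S_def sg_star)
        next
          case 2
          then have "(j, i) \<in> Fr" "(i, j) \<notin> Fr" using ij by (auto simp: Fr_def)
          then show ?thesis using nz ij e2 by (simp add: S_def sg_star field_simps)
        next
          case 3
          show ?thesis
          proof (cases "\<epsilon> = 1")
            case True
            then have "(i, i) \<notin> Fr" unfolding Fr_def by simp
            then show ?thesis using 3 by (simp add: S_def)
          next
            case False
            then show ?thesis using 3 eps ij by (simp add: sg_star)
          qed
        qed
      qed
      have "A \<in> RM n" using A_lev idl_R unfolding RM_def A_def by auto
      then have "A \<in> Lie" unfolding Lie_iff using A rel by simp
      moreover have "A $$ (star (fst ij), snd ij) = \<phi> ij" if "ij \<in> Fr" for ij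
        using A[OF FrD[OF that]] that by (simp add: S_def)
      then have "(\<lambda>ij\<in>Fr. red M ((\<lambda>ij\<in>Fr. A $$ (star (fst ij), snd ij)) ij)) = (\<lambda>ij\<in>Fr. red M (\<phi> ij))"
        by (intro restrict_ext) simp
      ultimately show ?thesis using A_lev by blast
    qed
    fix A A' assume AA: "A \<in> ?A" "A' \<in> ?A"
    then have L: "A \<in> Lie" "A' \<in> Lie" by auto
    have "redm M A = redm M A' \<longleftrightarrow> mcong n M A A'" using L redm_eq_iff by (auto simp: Lie_def)
    also have "\<dots> \<longleftrightarrow> (\<forall>ij\<in>Fr. A $$ (star (fst ij), snd ij) - A' $$ (star (fst ij), snd ij) \<in> idl M)"
    proof
      assume "mcong n M A A'"
      then show "\<forall>ij\<in>Fr. A $$ (star (fst ij), snd ij) - A' $$ (star (fst ij), snd ij) \<in> idl M"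
        using FrD star_lt by (auto simp: mcong_def)
    next
      assume d: "\<forall>ij\<in>Fr. A $$ (star (fst ij), snd ij) - A' $$ (star (fst ij), snd ij) \<in> idl M"
      have dFr: "A $$ (star i, j) - A' $$ (star i, j) \<in> idl M" if "(i, j) \<in> Fr" for i j using bspec[OF d that] by simp
      have rel: "sg (star j) * C $$ (star j, i) = - (sg i * C $$ (star i, j))" if "C \<in> Lie" "i < n" "j < n" for C i j
        using that by (simp add: Lie_iff eq_neg_iff_add_eq_0)
      have dd: "A $$ (star i, j) - A' $$ (star i, j) \<in> idl M" if ij: "i < n" "j < n" for i j
      proof -
        have "(i, j) \<in> Fr \<or> (j, i) \<in> Fr \<or> i = j \<and> \<epsilon> = 1" using ij unfolding Fr_def by auto
        then consider "(i, j) \<in> Fr" | "(j, i) \<in> Fr" | "i = j" "\<epsilon> = 1" by blast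
        then show ?thesis
        proof cases
          case 2
          have "sg (star i) * (A $$ (star i, j) - A' $$ (star i, j)) = - (sg j * (A $$ (star j, i) - A' $$ (star j, i)))"
            using rel[OF L(1) ij(2,1)] rel[OF L(2) ij(2,1)] by (simp add: algebra_simps)
          also have "\<dots> \<in> idl M" using dFr[OF 2] sg_R[OF ij(2)] by (intro idl_uminus idl_mult_left)
          finally show ?thesis using idl_unit_cancel sg_unit star_lt ij by blast
        next
          case 3
          \<comment> \<open>In the symmetric case the relation at i = j says that twice the entry
            vanishes.\<close>
          have "2 * (sg i * C $$ (star i, i)) = 0" if "C \<in> Lie" for C
            using that ij 3 by (simp add: Lie_iff sg_star mult_2)
          then have "C $$ (star i, i) = 0" if "C \<in> Lie" for C
            using that unit_nz[OF two] unit_nz[OF sg_unit[OF ij(1)]] by simp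
          then show ?thesis using L 3 by simp
        qed (use dFr in blast)
      qed
      have "A $$ (i, j) - A' $$ (i, j) \<in> idl M" if "i < n" "j < n" for i j
        using dd[OF star_lt[OF that(1)] that(2)] star_star[OF that(1)] by simp
      then show "mcong n M A A'" by (simp add: mcong_def)
    qed
    also have "\<dots> \<longleftrightarrow> (\<forall>ij\<in>Fr. red M (A $$ (star (fst ij), snd ij)) = red M (A' $$ (star (fst ij), snd ij)))"
    proof (rule ball_cong[OF refl])
      fix ij assume "ij \<in> Fr"
      then show "(A $$ (star (fst ij), snd ij) - A' $$ (star (fst ij), snd ij) \<in> idl M) \<longleftrightarrow>
          (red M (A $$ (star (fst ij), snd ij)) = red M (A' $$ (star (fst ij), snd ij)))"
        using red_eq_iff R L FrD star_lt by simp
    qed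
    also have "\<dots> \<longleftrightarrow> (\<lambda>ij\<in>Fr. red M ((\<lambda>ij\<in>Fr. A $$ (star (fst ij), snd ij)) ij)) =
        (\<lambda>ij\<in>Fr. red M ((\<lambda>ij\<in>Fr. A' $$ (star (fst ij), snd ij)) ij))"
      by (simp add: fun_eq_iff restrict_def Ball_def) 
    finally show "redm M A = redm M A' \<longleftrightarrow> (\<lambda>ij\<in>Fr. red M ((\<lambda>ij\<in>Fr. A $$ (star (fst ij), snd ij)) ij)) =
        (\<lambda>ij\<in>Fr. red M ((\<lambda>ij\<in>Fr. A' $$ (star (fst ij), snd ij)) ij))" .
  qed
  also have "\<dots> = (\<Prod>ij\<in>Fr. q ^ (M - ?l ij))"
    by (rule card_PiE_idl[OF Fr_finite]) (use FrD lev(2) star_lt in \<open>auto simp: case_prod_unfold\<close>)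
  also have "\<dots> = (\<Prod>(i, j)\<in>Fr. q ^ (M - lev (star i) j))" by (simp add: case_prod_unfold)
  finally show ?thesis .
qed

text \<open>The Cayley transform matches the subgroup with the skew-adjoint matrices of level m + (h
  j - h i). At the free entry (star i, j) this excess is h j - h (star i) = h i + h j - H, truncated
  at 0.\<close>

lemma card_iso_level:
  assumes m: "m \<ge> 1" and h: "\<And>i. i < n \<Longrightarrow> h i + h (star i) = H" and M: "M \<ge> m + H"
  shows "card (redm M ` {x \<in> iso. mcong n m x (1\<^sub>m n) \<and> mcong n m (conj n h x) (1\<^sub>m n)}) =
    (\<Prod>(i, j)\<in>Fr. q ^ (M - (m + (h i + h j - H))))"
proof -
  let ?X = "{x \<in> iso. mcong n m x (1\<^sub>m n) \<and> mcong n m (conj n h x) (1\<^sub>m n)}"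
  let ?A = "{A \<in> Lie. \<forall>i<n. \<forall>j<n. A $$ (i, j) \<in> idl (m + (h j - h i))}"
  have down: "mcong n 1 x y" if "mcong n m x y" for x y using that idl_mono[OF m] by (simp add: mcong_def)
  have one_s: "1 \<cdot>\<^sub>m 1\<^sub>m n = (1\<^sub>m n :: 'k mat)" "0 \<cdot>\<^sub>m 1\<^sub>m n = (0\<^sub>m n n :: 'k mat)" by (auto intro!: eq_matI)
  have near1: "x \<in> cay_dom n" if "x \<in> carrier_mat n n" "mcong n m x (1\<^sub>m n)" for x
    by (rule cay_dom_near[OF two, where a = 1]) (use that down mcong_one_RM one_s in auto)
  have near0: "x \<in> cay_dom n" if "x \<in> RM n" "mcong n m x (0\<^sub>m n n)" for x
    by (rule cay_dom_near[OF two, where a = 0]) (use that down one_s in auto)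
  have A_iff: "A \<in> ?A \<longleftrightarrow> A \<in> Lie \<and> mcong n m A (0\<^sub>m n n) \<and> mcong n m (conj n h A) (0\<^sub>m n n)" for A
    unfolding mcong_def by (auto simp: conj_idl_iff conj_index)
  have A_conj: "conj n h A \<in> RM n" if "A \<in> ?A" for A
    unfolding RM_def
  proof (intro CollectI conjI allI impI conj_carrier)
    fix i j assume ij: "i < n" "j < n"
    then have "conj n h A $$ (i, j) - 0\<^sub>m n n $$ (i, j) \<in> idl m" using that unfolding A_iff mcong_def by blast
    then show "conj n h A $$ (i, j) \<in> R" using idl_R ij by simp
  qed
  have X_dom: "x \<in> cay_dom n" "conj n h x \<in> cay_dom n" if "x \<in> ?X" for x
    using that near1 conj_carrier iso_RM RM_carrier by auto
  have A_dom: "A \<in> cay_dom n" "conj n h A \<in> cay_dom n" if "A \<in> ?A" for A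
    using that near0 A_conj[OF that] unfolding A_iff by (auto simp: Lie_def)
  have toA: "cay n x \<in> ?A" if x: "x \<in> ?X" for x
    unfolding A_iff
  proof (intro conjI)
    show "cay n x \<in> Lie" using x X_dom[OF x] by (intro cay_iso_Lie) auto
    show "mcong n m (cay n x) (0\<^sub>m n n)"
      using cay_cong[OF X_dom(1)[OF x] cay_dom_one[OF two], of m] x cay_one[OF two] by simp
    show "mcong n m (conj n h (cay n x)) (0\<^sub>m n n)"
      using cay_cong[OF X_dom(2)[OF x] cay_dom_one[OF two], of m] x cay_one[OF two] conj_cay[OF X_dom[OF x]] by simp
  qed
  have toX: "cay n A \<in> ?X" if A: "A \<in> ?A" for A
  proof -
    have "cay n A \<in> iso" using A A_dom[OF A] by (intro cay_Lie_iso) auto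
    moreover have "mcong n m (cay n A) (1\<^sub>m n)"
      using cay_cong[OF A_dom(1)[OF A] cay_dom_zero[OF two], of m] A[unfolded A_iff] cay_zero[OF two] by simp
    moreover have "mcong n m (conj n h (cay n A)) (1\<^sub>m n)"
      using cay_cong[OF A_dom(2)[OF A] cay_dom_zero[OF two], of m] A[unfolded A_iff] cay_zero[OF two] conj_cay[OF A_dom[OF A]] by simp
    ultimately show ?thesis by simp
  qed
  have "card (redm M ` ?X) = card (redm M ` ?A)"
  proof (rule card_image_eqI[where h = "cay n"])
    show "\<exists>x\<in>?X. redm M (cay n x) = redm M A" if A: "A \<in> ?A" for A
      by (intro bexI[of _ "cay n A"] toX[OF A]) (simp add: cay_involution(2)[OF two A_dom(1)[OF A]])
    show "redm M x = redm M x' \<longleftrightarrow> redm M (cay n x) = redm M (cay n x')" if x: "x \<in> ?X" "x' \<in> ?X" for x x'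
    proof -
      note d = X_dom(1)[OF x(1)] X_dom(1)[OF x(2)]
      have "mcong n M x x' \<longleftrightarrow> mcong n M (cay n x) (cay n x')"
        using cay_cong[OF d, of M] cay_cong[OF cay_involution(1)[OF two d(1)] cay_involution(1)[OF two d(2)], of M]
          cay_involution(2)[OF two d(1)] cay_involution(2)[OF two d(2)] by auto
      then show ?thesis using redm_eq_iff[of _ n] cay_RM d by (simp add: cay_dom_def)
    qed
  qed (rule toA)
  also have "\<dots> = (\<Prod>(i, j)\<in>Fr. q ^ (M - (m + (h j - h (star i)))))"
  proof (rule card_Lie_level)
    show "m + (h j - h (star i)) = m + (h i - h (star j))" if "i < n" "j < n" for i j
      using h[OF that(1)] h[OF that(2)] by linarith
    show "m + (h j - h i) \<le> M" if "i < n" "j < n" for i j using h[OF that(2)] M by linarith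
  qed
  also have "\<dots> = (\<Prod>(i, j)\<in>Fr. q ^ (M - (m + (h i + h j - H))))"
  proof (rule prod.cong[OF refl], clarify)
    fix i j assume "(i, j) \<in> Fr"
    then have "h i + h (star i) = H" using h by (auto simp: Fr_def)
    then have "h j - h (star i) = h i + h j - H" by linarith
    then show "q ^ (M - (m + (h j - h (star i)))) = q ^ (M - (m + (h i + h j - H)))" by simp
  qed
  finally show ?thesis .
qed

end

subsection \<open>Virtual endomorphisms of isometry groups\<close>

text \<open>Adding the equations for v + tu and v - tu expresses 2 Av. Coordinate i, where v
  vanishes, shows that the two eigenvalues agree; coordinate j identifies them with that of v;
  subtracting v then leaves u.\<close>

lemma two_translates_eigen:
  fixes v u Av Au :: "nat \<Rightarrow> 'k::field"
  assumes two: "(2::'k) \<noteq> 0" and t: "t \<noteq> 0" and i: "i < n" "v i = 0" "u i \<noteq> 0" and j: "j < n" "v j \<noteq> 0"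
    and v: "\<And>k. k < n \<Longrightarrow> Av k = \<kappa> * v k"
    and p: "\<And>k. k < n \<Longrightarrow> Av k + t * Au k = \<mu> * (v k + t * u k)"
    and m: "\<And>k. k < n \<Longrightarrow> Av k - t * Au k = \<nu> * (v k - t * u k)"
    and k: "k < n"
  shows "Au k = \<kappa> * u k"
proof -
  have s: "2 * (\<kappa> * v k) = \<mu> * (v k + t * u k) + \<nu> * (v k - t * u k)" if "k < n" for k
  proof -
    have "2 * Av k = (Av k + t * Au k) + (Av k - t * Au k)" by simp
    then have "2 * Av k = \<mu> * (v k + t * u k) + \<nu> * (v k - t * u k)" unfolding p[OF that] m[OF that] .
    then show ?thesis unfolding v[OF that] .
  qed
  have "0 = (\<mu> - \<nu>) * (t * u i)" using s[OF i(1)] i(2) by (simp add: algebra_simps)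
  then have mn: "\<mu> = \<nu>" using t i(3) by simp
  then have "2 * (\<kappa> * v j) = 2 * (\<mu> * v j)" using s[OF j(1)] by (simp add: algebra_simps)
  then have "\<kappa> = \<mu>" using two j(2) by simp
  then have "t * Au k = t * (\<kappa> * u k)" using p[OF k] v[OF k] by (simp add: algebra_simps)
  then show ?thesis using t by simp
qed

section \<open>Determinants, weights and the index formula for isometry groups\<close>

context sform
begin

text \<open>Matches \<open>iso\<close> with the groups cut out by \<open>sp_form\<close>,
  \<open>so_even_form\<close> and \<open>so_odd_form\<close>.\<close>

definition gram :: "'k mat" where "gram = mat n n (\<lambda>(i, j). if j = star i then sg i else 0)"

lemma gram_index: "i < n \<Longrightarrow> j < n \<Longrightarrow> gram $$ (i, j) = B (e i) (e j)"
  by (simp add: gram_def B_e_e)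

lemma transpose_gram_mult:
  assumes x: "x \<in> carrier_mat n n" and ij: "i < n" "j < n"
  shows "(transpose_mat x * gram * x) $$ (i, j) = B (cf x i) (cf x j)"
proof -
  have g: "gram \<in> carrier_mat n n" by (simp add: gram_def)
  have "(transpose_mat x * gram) $$ (i, k) = sg (star k) * x $$ (star k, i)" if k: "k < n" for k
  proof -
    have "(transpose_mat x * gram) $$ (i, k) = (\<Sum>r<n. if r = star k then sg (star k) * x $$ (star k, i) else 0)"
      unfolding mat_mult_index[OF transpose_carrier_mat[THEN iffD2, OF x] g ij(1) k]
    proof (rule sum.cong[OF refl])
      fix r assume "r \<in> {..<n}"
      then have "k = star r \<longleftrightarrow> r = star k" using star_eq_iff[of r k] k by auto
      then show "transpose_mat x $$ (i, r) * gram $$ (r, k) = (if r = star k then sg (star k) * x $$ (star k, i) else 0)"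
        using x ij k \<open>r \<in> {..<n}\<close> by (auto simp: gram_def)
    qed
    then show ?thesis using star_lt[OF k] by simp
  qed
  then have "(transpose_mat x * gram * x) $$ (i, j) = (\<Sum>k<n. sg (star k) * x $$ (star k, i) * x $$ (k, j))"
    using mat_mult_index[of "transpose_mat x * gram" n x i j] x g ij by simp
  also have "\<dots> = B (cf x i) (cf x j)"
    unfolding B_def cf_def by (rule sum.reindex_bij_witness[of _ star star]) (use star_lt star_star in auto)
  finally show ?thesis .
qed

lemma iso_iff_gram: "x \<in> iso \<longleftrightarrow> x \<in> RM n \<and> transpose_mat x * gram * x = gram"
proof (cases "x \<in> RM n")
  case True
  have c: "x \<in> carrier_mat n n" "gram \<in> carrier_mat n n" using RM_carrier[OF True] by (auto simp: gram_def)
  have "transpose_mat x * gram * x = gram \<longleftrightarrow> (\<forall>i<n. \<forall>j<n. B (cf x i) (cf x j) = B (e i) (e j))"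
  proof
    assume g: "transpose_mat x * gram * x = gram"
    then show "\<forall>i<n. \<forall>j<n. B (cf x i) (cf x j) = B (e i) (e j)"
      by (intro allI impI) (metis transpose_gram_mult[OF c(1)] gram_index)
  next
    assume b: "\<forall>i<n. \<forall>j<n. B (cf x i) (cf x j) = B (e i) (e j)"
    show "transpose_mat x * gram * x = gram"
    proof (rule eq_matI)
      fix i j assume "i < dim_row gram" "j < dim_col gram"
      then have ij: "i < n" "j < n" using c by auto
      show "(transpose_mat x * gram * x) $$ (i, j) = gram $$ (i, j)"
        unfolding transpose_gram_mult[OF c(1) ij] gram_index[OF ij] using b ij by blast
    next
      show "dim_row (transpose_mat x * gram * x) = dim_row gram" using c by (simp only: index_mult_mat index_transpose_mat carrier_matD)
      show "dim_col (transpose_mat x * gram * x) = dim_col gram" using c by (simp only: index_mult_mat index_transpose_mat carrier_matD)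
    qed
  qed
  then show ?thesis using True by (simp add: iso_def)
qed (simp add: iso_def)

lemma det_iso: assumes "x \<in> iso" shows "det x = 1 \<or> det x = - 1"
proof -
  have c: "x \<in> carrier_mat n n" "gram \<in> carrier_mat n n" using RM_carrier iso_RM assms by (auto simp: gram_def)
  define g' where "g' = mat n n (\<lambda>(i, j). if j = star i then inverse (sg j) else 0)"
  have c': "g' \<in> carrier_mat n n" by (simp add: g'_def)
  have "gram * g' = 1\<^sub>m n"
  proof (rule eq_matI)
    fix i j assume "i < dim_row (1\<^sub>m n :: 'k mat)" "j < dim_col (1\<^sub>m n :: 'k mat)"
    then have ij: "i < n" "j < n" by auto
    have "(gram * g') $$ (i, j) = (\<Sum>k<n. if k = star i then sg i * g' $$ (star i, j) else 0)"
      unfolding mat_mult_index[OF c(2) c' ij] by (intro sum.cong) (use ij in \<open>auto simp: gram_def\<close>)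
    also have "\<dots> = sg i * g' $$ (star i, j)" using star_lt[OF ij(1)] by simp
    also have "g' $$ (star i, j) = (if j = i then inverse (sg j) else 0)"
      using ij star_lt[OF ij(1)] star_star[OF ij(1)] by (simp add: g'_def)
    finally show "(gram * g') $$ (i, j) = 1\<^sub>m n $$ (i, j)" using ij unit_nz[OF sg_unit[OF ij(1)]] by auto
  qed (auto simp: gram_def g'_def)
  then have "det gram * det g' = 1" using det_mult[OF c(2) c'] by simp
  then have nz: "det gram \<noteq> 0" by auto
  have "det (transpose_mat x * gram * x) = det gram" using assms by (simp add: iso_iff_gram)
  moreover have "det (transpose_mat x * gram * x) = det x * det gram * det x"
    using c det_mult[of "transpose_mat x * gram" n x] det_mult[of "transpose_mat x" n gram] det_transpose[OF c(1)] by simp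
  ultimately have "det gram * ((det x - 1) * (det x + 1)) = 0" by (simp add: algebra_simps)
  then have "det x - 1 = 0 \<or> det x + 1 = 0" using nz by simp
  then show ?thesis by (simp add: eq_neg_iff_add_eq_0)
qed

definition SOg :: "'k mat set" where "SOg = {x \<in> iso. det x = 1}"

lemma SOg_matgrp: "matgrp R \<pi> q n SOg"
proof -
  interpret G: matgrp R \<pi> q n iso by (rule iso_matgrp)
  show ?thesis
  proof (intro matgrp.intro matgrp_axioms.intro dvr_axioms)
    show "\<exists>y\<in>SOg. x * y = 1\<^sub>m n \<and> y * x = 1\<^sub>m n" if x: "x \<in> SOg" for x
    proof -
      obtain y where y: "y \<in> iso" "x * y = 1\<^sub>m n" "y * x = 1\<^sub>m n" using x G.G_inv by (auto simp: SOg_def)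
      then have "det x * det y = 1" using det_mult[of x n y] x G.G_carrier by (simp add: SOg_def)
      then show ?thesis using x y by (auto simp: SOg_def)
    qed
    show "x * y \<in> SOg" if "x \<in> SOg" "y \<in> SOg" for x y
      using that det_mult[of x n y] G.G_carrier G.G_mult by (auto simp: SOg_def)
  qed (use G.G_RM G.G_one in \<open>auto simp: SOg_def\<close>)
qed

text \<open>The determinant is 1 or -1 and congruent to 1, and these two are incongruent because 2
  is a unit.\<close>

lemma near_SOg: assumes "x \<in> iso" "mcong n 1 x (1\<^sub>m n)" shows "x \<in> SOg"
proof -
  have "det x - 1 \<in> idl 1" using det_cong[OF iso_RM[OF assms(1)] RM_one assms(2)] by simp
  moreover have "- 1 - 1 \<notin> idl 1"
    using unit_iff[OF unit_R[OF unit_uminus[OF two]]] unit_uminus[OF two] by simp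
  ultimately have "det x \<noteq> - 1" by auto
  then show ?thesis using det_iso[OF assms(1)] assms(1) by (simp add: SOg_def)
qed

text \<open>Exponents of the similitude: the partner of i0 compensates the value 2k, and for k > 0
  the maximum is attained at i0 alone.\<close>

definition wt :: "nat \<Rightarrow> nat \<Rightarrow> nat \<Rightarrow> nat" where
  "wt i0 k i = (if i = i0 then 2 * k else if i = star i0 then 0 else k)"

lemma wt_star: assumes "i0 < n" "star i0 \<noteq> i0" "i < n" shows "wt i0 k i + wt i0 k (star i) = 2 * k"
proof -
  have "star i = i0 \<longleftrightarrow> i = star i0" "star i = star i0 \<longleftrightarrow> i = i0"
    using star_eq_iff[of i i0] star_star assms by metis+
  then show ?thesis using assms by (auto simp: wt_def)
qed

definition wsum :: "nat \<Rightarrow> nat" where "wsum k = (n - 2) * k + (if \<epsilon> = 1 then 0 else 2 * k)"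

text \<open>The excess is k on the pairs that join i0 to an index other than i0 and
  \<open>star i0\<close>, it is 2k at (i0,i0), which is a free position only in the alternating
  case, and it is 0 elsewhere.\<close>

lemma sum_wt:
  assumes i0: "i0 < n" "star i0 \<noteq> i0"
  shows "(\<Sum>(i, j)\<in>Fr. wt i0 k i + wt i0 k j - 2 * k) = wsum k"
proof -
  let ?f = "\<lambda>(i, j). wt i0 k i + wt i0 k j - 2 * k"
  define S where "S = {(i, j). i < n \<and> j < n \<and> i < j}"
  define D where "D = (\<lambda>i. (i, i)) ` {..<n}"
  \<comment> \<open>Sorting by min and max puts the unordered pair of x and i0 into the increasing
    form required of the pairs in S.\<close>
  define E where "E = (\<lambda>x. (min x i0, max x i0)) ` ({..<n} - {i0, star i0})"
  have fin: "finite S" "finite D" "finite E"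
    by (auto simp: S_def D_def E_def intro: finite_subset[of _ "{..<n} \<times> {..<n}"])
  have "inj_on (\<lambda>x. (min x i0, max x i0)) ({..<n} - {i0, star i0})"
    by (auto simp: inj_on_def min_def max_def split: if_splits)
  then have cE: "card E = n - 2"
    unfolding E_def using i0 star_lt[OF i0(1)] by (simp add: card_image card_Diff_subset)
  have ES: "E \<subseteq> S" using i0 by (auto simp: E_def S_def min_def max_def)
  have fE: "?f p = k" if "p \<in> E" for p
  proof -
    obtain x where x: "p = (min x i0, max x i0)" "x \<noteq> i0" "x \<noteq> star i0" using \<open>p \<in> E\<close> by (auto simp: E_def)
    show ?thesis
    proof (cases "x < i0")
      case True
      then have "p = (x, i0)" using x(1) by simp
      then show ?thesis using x by (simp add: wt_def)
    next
      case False
      then have "p = (i0, x)" using x(1) by simp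
      then show ?thesis using x by (simp add: wt_def)
    qed
  qed
  have fS: "?f p = 0" if "p \<in> S - E" for p
  proof -
    obtain i j where pij: "p = (i, j)" by (cases p)
    then have p: "p = (i, j)" "i < n" "j < n" "i < j" using that unfolding S_def by simp_all
    have "(i, j) \<in> E" if "i = i0" "j \<noteq> star i0"
      using that p unfolding E_def by (intro image_eqI[of _ _ j]) (auto simp: min_def max_def)
    moreover have "(i, j) \<in> E" if "j = i0" "i \<noteq> star i0"
      using that p unfolding E_def by (intro image_eqI[of _ _ i]) (auto simp: min_def max_def)
    ultimately have "(i = i0 \<longrightarrow> j = star i0) \<and> (j = i0 \<longrightarrow> i = star i0)" using that p by auto
    then show ?thesis using p i0 by (auto simp: wt_def)
  qed
  have "sum ?f S = sum ?f E" by (rule sum.mono_neutral_right[OF fin(1) ES]) (use fS in blast)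
  also have "\<dots> = (n - 2) * k" using fE cE by simp
  finally have sS: "sum ?f S = (n - 2) * k" .
  have "sum ?f D = (\<Sum>i<n. wt i0 k i + wt i0 k i - 2 * k)"
    unfolding D_def by (subst sum.reindex) (auto simp: inj_on_def)
  also have "\<dots> = (\<Sum>i<n. if i = i0 then 2 * k else 0)"
    by (intro sum.cong) (auto simp: wt_def)
  finally have sD: "sum ?f D = 2 * k" using i0 by simp
  show ?thesis
  proof (cases "\<epsilon> = 1")
    case True
    then have "Fr = S" unfolding Fr_def S_def by auto
    show ?thesis unfolding \<open>Fr = S\<close> wsum_def using sS True by simp
  next
    case False
    then have "Fr = S \<union> D" unfolding Fr_def S_def D_def by auto
    moreover have "S \<inter> D = {}" by (auto simp: S_def D_def)
    ultimately show ?thesis using sS sD False fin by (simp add: wsum_def sum.union_disjoint)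
  qed
qed

text \<open>Doubled, so that the triangular number needs no division of naturals.\<close>

lemma card_Fr: "2 * card Fr = n * (n - 1) + (if \<epsilon> = 1 then 0 else 2 * n)"
proof -
  define S where "S = {(i, j). i < n \<and> j < n \<and> i < j}"
  define D where "D = (\<lambda>i. (i, i)) ` {..<n}"
  have fin: "finite S" "finite D"
    by (auto simp: S_def D_def intro: finite_subset[of _ "{..<n} \<times> {..<n}"])
  have "S = (\<lambda>(j, i). (i, j)) ` (SIGMA j:{..<n}. {..<j})" by (auto simp: S_def image_iff)
  moreover have "inj_on (\<lambda>(j, i). (i, j)) (SIGMA j:{..<n}. {..<j})" by (auto simp: inj_on_def)
  ultimately have "card S = (\<Sum>j<n. j)" by (simp add: card_image)
  moreover have "2 * (\<Sum>j<n. j) = n * (n - 1)" for n :: nat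
  proof (induction n)
    case (Suc n)
    then show ?case by (cases n) (auto simp: algebra_simps)
  qed simp
  ultimately have cS: "2 * card S = n * (n - 1)" by simp
  have cD: "card D = n" unfolding D_def by (subst card_image) (auto simp: inj_on_def)
  show ?thesis
  proof (cases "\<epsilon> = 1")
    case True
    then have "Fr = S" unfolding Fr_def S_def by auto
    then show ?thesis using cS True by simp
  next
    case False
    then have "Fr = S \<union> D" unfolding Fr_def S_def D_def by auto
    moreover have "S \<inter> D = {}" by (auto simp: S_def D_def)
    ultimately show ?thesis using cS cD False fin by (simp add: card_Un_disjoint)
  qed
qed

text \<open>The three factors of the index are the residue group, the step from level 1 to level m,
  and the extra divisibility \<open>wsum k\<close> caused by the weights. G may be all isometries or
  those of determinant 1: \<open>near\<close> makes both have the same congruence subgroups, and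
  \<open>core\<close> is left to each case.\<close>

lemma form_self_similar:
  assumes G: "matgrp R \<pi> q n G" "G \<subseteq> iso" and near: "\<And>x. x \<in> iso \<Longrightarrow> mcong n 1 x (1\<^sub>m n) \<Longrightarrow> x \<in> G"
    and G_conj: "\<And>x h. x \<in> G \<Longrightarrow> conj n h x \<in> iso \<Longrightarrow> conj n h x \<in> G"
    and i0: "i0 < n" "star i0 \<noteq> i0" and mk: "m \<ge> 1" "k \<ge> 1"
    and core: "\<And>x. \<lbrakk>x \<in> iso; mcong n 1 x (1\<^sub>m n);
      \<And>g. g \<in> G \<Longrightarrow> \<exists>\<mu>. \<forall>i<n. act x (cf g i0) i = \<mu> * cf g i0 i\<rbrakk> \<Longrightarrow> x = 1\<^sub>m n"
  shows "self_similar_of_index (matgrp.GG n G) (card (redm 1 ` G) * q ^ ((m - 1) * card Fr + wsum k))"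
proof -
  let ?h = "wt i0 k"
  have hs: "?h i + ?h (star i) = 2 * k" if "i < n" for i using wt_star[OF i0 that] .
  interpret G: matgrp R \<pi> q n G by (rule G(1))
  interpret G: matgrp_conj R \<pi> q n G ?h m
  proof
    show "conj n ?h x \<in> G" if "x \<in> G" "conj n ?h x \<in> RM n" for x
      by (rule G_conj[OF that(1) conj_iso[where h="?h" and H="2 * k", OF hs]]) (use that G(2) in auto)
  qed (rule mk)
  define M where "M = m + 2 * k"
  have M: "M \<ge> 1" using mk by (simp add: M_def)
  have down: "mcong n 1 x y" if "mcong n m x y" for x y using that idl_mono[OF mk(1)] by (simp add: mcong_def)
  have D: "G.D = {x \<in> iso. mcong n m x (1\<^sub>m n) \<and> mcong n m (conj n ?h x) (1\<^sub>m n)}"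
    unfolding G.D_def using G(2) near down by blast
  obtain \<delta> where \<delta>: "\<delta> * card (redm M ` G.D) = card (redm M ` G)" "self_similar_of_index G.GG \<delta>"
  proof (rule G.self_similar[where M = M and K = "2 * k"])
    show "?h i \<le> 2 * k" if "i < n" for i by (simp add: wt_def)
    show "m + 2 * k \<le> M" by (simp add: M_def)
    fix x assume x: "x \<in> G.D" and zero: "\<And>g g' i j. \<lbrakk>g \<in> G; g' \<in> G; g * g' = 1\<^sub>m n; g' * g = 1\<^sub>m n; i < n; j < n; ?h i < ?h j\<rbrakk>
      \<Longrightarrow> (g' * x * g) $$ (i, j) = 0"
    show "x = 1\<^sub>m n"
    proof (rule core)
      show "x \<in> iso" "mcong n 1 x (1\<^sub>m n)" using x down unfolding D by auto
      fix g assume g: "g \<in> G"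
      obtain g' where g': "g' \<in> G" "g * g' = 1\<^sub>m n" "g' * g = 1\<^sub>m n" using G.G_inv g by blast
      have xG: "x \<in> G" using x by (simp add: G.D_def)
      have c: "g \<in> carrier_mat n n" "g' \<in> carrier_mat n n" "x \<in> carrier_mat n n" using G.G_carrier g g' xG by auto
      let ?y = "g' * x * g"
      have yG: "?y \<in> G" using G.G_mult g g' xG by blast
      have "g * ?y = g * (g' * (x * g))" using assoc_mult_mat[OF c(2) c(3) c(1)] by simp
      also have "\<dots> = g * g' * (x * g)" by (rule assoc_mult_mat[symmetric, OF c(1) c(2)]) (use c in auto)
      also have "\<dots> = x * g" unfolding g'(2) using c by simp
      finally have gy: "g * ?y = x * g" .
      \<comment> \<open>i0 alone carries the largest weight, so column i0 of g' x g vanishes off the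
        diagonal: g e_i0 is an eigenvector of x.\<close>
      have z: "?y $$ (i, i0) = 0" if "i < n" "i \<noteq> i0" for i
      proof (rule zero[OF g g'(1) g'(2) g'(3) that(1) i0(1)])
        show "?h i < ?h i0" using that mk by (simp add: wt_def)
      qed
      have "act x (cf g i0) i = ?y $$ (i0, i0) * cf g i0 i" if i: "i < n" for i
      proof -
        have "act x (cf g i0) i = cf (x * g) i0 i" using cf_mult[OF G.G_in_RM[OF xG] G.G_in_RM[OF g] i i0(1)] by simp
        also have "\<dots> = (\<Sum>r<n. g $$ (i, r) * ?y $$ (r, i0))"
          unfolding gy[symmetric] cf_def by (rule mat_mult_index[OF c(1) G.G_carrier[OF yG] i i0(1)])
        also have "\<dots> = (\<Sum>r<n. if r = i0 then g $$ (i, i0) * ?y $$ (i0, i0) else 0)"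
          by (intro sum.cong) (use z in auto)
        finally show ?thesis using i0 by (simp add: cf_def)
      qed
      then show "\<exists>\<mu>. \<forall>i<n. act x (cf g i0) i = \<mu> * cf g i0 i" by blast
    qed
  qed
  let ?f = "\<lambda>(i, j). ?h i + ?h j - 2 * k"
  have fM: "m + ?f p \<le> M" for p by (cases p) (simp add: M_def wt_def)
  have "card (redm M ` G.D) = (\<Prod>p\<in>Fr. q ^ (M - (m + ?f p)))"
    unfolding D by (subst card_iso_level[where h="?h" and H="2 * k", OF mk(1) hs]) (auto simp: M_def case_prod_unfold)
  then have cD: "card (redm M ` G.D) * q ^ wsum k = q ^ ((M - m) * card Fr)"
  proof -
    have "q ^ wsum k = (\<Prod>p\<in>Fr. q ^ ?f p)"
      unfolding sum_wt[OF i0, symmetric] power_sum by (simp add: case_prod_unfold)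
    then have "card (redm M ` G.D) * q ^ wsum k = (\<Prod>p\<in>Fr. q ^ (M - (m + ?f p)) * q ^ ?f p)"
      using \<open>card (redm M ` G.D) = _\<close> by (simp add: prod.distrib)
    also have "\<dots> = (\<Prod>p\<in>Fr. q ^ (M - m))"
    proof (rule prod.cong[OF refl])
      fix p
      have "M - (m + ?f p) + ?f p = M - m" using fM[of p] by linarith
      then show "q ^ (M - (m + ?f p)) * q ^ ?f p = q ^ (M - m)" by (metis power_add)
    qed
    also have "\<dots> = q ^ ((M - m) * card Fr)" by (simp add: power_mult)
    finally show ?thesis .
  qed
  \<comment> \<open>With zero weights the second congruence repeats the first, so
    \<open>card_iso_level\<close> also counts the first congruence subgroup.\<close>
  have conj0: "conj n (\<lambda>i. 0) x = x" if "x \<in> carrier_mat n n" for x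
    by (rule eq_matI) (use that in \<open>auto simp: conj_def\<close>)
  have "G.G1 = {x \<in> iso. mcong n 1 x (1\<^sub>m n) \<and> mcong n 1 (conj n (\<lambda>i. 0) x) (1\<^sub>m n)}"
    unfolding G.G1_def using G(2) near conj0[OF RM_carrier[OF iso_RM]] by auto
  then have "card (redm M ` G.G1) = (\<Prod>(i, j)\<in>Fr. q ^ (M - (1 + (0 + 0 - 0))))"
    using card_iso_level[of 1 "\<lambda>i. 0" 0 M] M by simp
  then have c1: "card (redm M ` G.G1) = q ^ ((M - 1) * card Fr)" by (simp add: power_mult case_prod_unfold)
  have "\<delta> * q ^ ((M - m) * card Fr) = \<delta> * card (redm M ` G.D) * q ^ wsum k" using cD by simp
  also have "\<dots> = card (redm 1 ` G) * q ^ ((M - 1) * card Fr) * q ^ wsum k"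
    using \<delta>(1) G.card_residue_split[OF M] c1 by simp
  also have "(M - 1) * card Fr = (M - m) * card Fr + (m - 1) * card Fr"
  proof -
    have "M - 1 = (M - m) + (m - 1)" using mk by (simp add: M_def)
    then show ?thesis by (simp only: add_mult_distrib)
  qed
  finally have "\<delta> * q ^ ((M - m) * card Fr) =
      card (redm 1 ` G) * q ^ ((m - 1) * card Fr + wsum k) * q ^ ((M - m) * card Fr)"
    by (simp add: power_add mult_ac)
  then have "\<delta> = card (redm 1 ` G) * q ^ ((m - 1) * card Fr + wsum k)" using q_gt_1 by simp
  then show ?thesis using \<delta>(2) by simp
qed

lemma act_add: "act x (\<lambda>i. a i + t * b i) k = act x a k + t * act x b k"
  unfolding act_def sum_distrib_left sum.distrib[symmetric] by (intro sum.cong) (auto simp: algebra_simps)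

text \<open>Pairing e_i0 with its partner gives \<open>\<mu>\<close> squared = 1, and
  \<open>\<mu>\<close> is congruent to 1.\<close>

lemma scalar_one:
  assumes x: "x \<in> iso" "mcong n 1 x (1\<^sub>m n)" and i0: "i0 < n"
    and sc: "\<And>r i. r < n \<Longrightarrow> i < n \<Longrightarrow> act x (e r) i = \<mu> * e r i"
  shows "x = 1\<^sub>m n"
proof -
  have xe: "x $$ (i, r) = \<mu> * e r i" if "r < n" "i < n" for r i
    using sc[OF that] act_e[OF that(1)] by (simp add: cf_def)
  have "B (cf x i0) (cf x (star i0)) = B (\<lambda>i. 0 + \<mu> * e i0 i) (\<lambda>i. 0 + \<mu> * e (star i0) i)"
    by (rule B_eq) (use xe i0 star_lt in \<open>auto simp: cf_def\<close>)
  also have "\<dots> = \<mu> * (\<mu> * B (e i0) (e (star i0)))"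
    unfolding B_left B_right by (simp add: B_def)
  finally have "sg i0 * \<mu> ^ 2 = sg i0"
    using x(1) i0 star_lt[OF i0] B_e_e[of i0 "star i0"] by (simp add: iso_def power2_eq_square mult_ac)
  then have "\<mu> ^ 2 = 1" using unit_nz[OF sg_unit[OF i0]] by simp
  moreover have "x $$ (i0, i0) - 1\<^sub>m n $$ (i0, i0) \<in> idl 1" using x(2) i0 unfolding mcong_def by blast
  then have "\<mu> - 1 \<in> idl 1" using xe[OF i0 i0] i0 by (simp add: e_def)
  ultimately have "\<mu> = 1" using unipotent_root_of_unity[of \<mu> 2] two by simp
  then show ?thesis using xe RM_carrier[OF iso_RM[OF x(1)]] by (intro eq_matI) (auto simp: e_def)
qed

text \<open>The transvections along u with parameters 1 and -1 move e_i0 to e_i0 + t u and e_i0 - t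
  u with t = B(u,e_i0), so \<open>two_translates_eigen\<close> applies whenever t is nonzero, that
  is, whenever u has a nonzero coordinate at \<open>star i0\<close>.\<close>

lemma symplectic_core:
  assumes eps: "\<epsilon> = - 1" and x: "x \<in> iso" "mcong n 1 x (1\<^sub>m n)" and i0: "i0 < n" "star i0 \<noteq> i0"
    and eig: "\<And>g. g \<in> iso \<Longrightarrow> \<exists>\<mu>. \<forall>i<n. act x (cf g i0) i = \<mu> * cf g i0 i"
  shows "x = 1\<^sub>m n"
proof -
  obtain \<mu> where \<mu>: "\<And>i. i < n \<Longrightarrow> act x (e i0) i = \<mu> * e i0 i"
  proof -
    obtain \<mu> where m: "\<forall>i<n. act x (cf (1\<^sub>m n) i0) i = \<mu> * cf (1\<^sub>m n) i0 i"
      using eig matgrp.G_one[OF iso_matgrp] by blast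
    have "act x (e i0) i = \<mu> * e i0 i" if "i < n" for i
    proof -
      have "act x (e i0) i = act x (cf (1\<^sub>m n) i0) i" by (rule act_eq) (use cf_one i0 in simp)
      then show ?thesis using m that cf_one i0 by simp
    qed
    then show ?thesis using that by blast
  qed
  have main: "act x u k = \<mu> * u k" if u: "\<And>i. i < n \<Longrightarrow> u i \<in> R" "u (star i0) \<noteq> 0" and k: "k < n" for u k
  proof -
    let ?t = "B u (e i0)"
    have t: "?t \<noteq> 0" using u(2) i0 star_lt unit_nz[OF sg_unit] by (simp add: B_e_right)
    have ex: "\<exists>\<nu>. \<forall>i<n. act x (e i0) i + (c * ?t) * act x u i = \<nu> * (e i0 i + (c * ?t) * u i)" if c: "c \<in> R" for c
    proof -
      obtain \<nu> where n: "\<forall>i<n. act x (cf (tau u c) i0) i = \<nu> * cf (tau u c) i0 i"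
      proof -
        have "tau u c \<in> iso" by (rule transvection_iso[OF eps _ c]) (rule u(1))
        then show ?thesis using eig that by blast
      qed
      have "act x (e i0) i + (c * ?t) * act x u i = \<nu> * (e i0 i + (c * ?t) * u i)" if "i < n" for i
      proof -
        have "act x (e i0) i + (c * ?t) * act x u i = act x (cf (tau u c) i0) i"
          unfolding act_add[symmetric] by (rule act_eq) (use cf_tau i0 in simp)
        then show ?thesis using n that cf_tau i0 by simp
      qed
      then show ?thesis by blast
    qed
    obtain \<nu>1 where n1: "\<forall>i<n. act x (e i0) i + (1 * ?t) * act x u i = \<nu>1 * (e i0 i + (1 * ?t) * u i)"
      using ex[OF one_mem] by blast
    obtain \<nu>2 where n2: "\<forall>i<n. act x (e i0) i + (- 1 * ?t) * act x u i = \<nu>2 * (e i0 i + (- 1 * ?t) * u i)"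
      using ex[OF uminus_mem[OF one_mem]] by blast
    show ?thesis
      by (rule two_translates_eigen[where v = "e i0" and Av = "act x (e i0)" and t = ?t and i = "star i0" and j = i0 and n = n
            and \<mu> = \<nu>1 and \<nu> = \<nu>2])
        (use unit_nz[OF two] t i0 star_lt u(2) \<mu> n1 n2 k in \<open>auto simp: e_def\<close>)
  qed
  show ?thesis
  proof (rule scalar_one[OF x i0(1)])
    fix r i assume ri: "r < n" "i < n"
    have f: "act x (e (star i0)) i = \<mu> * e (star i0) i" by (rule main) (use ri e_R in \<open>auto simp: e_def\<close>)
    show "act x (e r) i = \<mu> * e r i"
    proof (cases "r = i0 \<or> r = star i0")
      case False
      \<comment> \<open>e_r has coordinate 0 at \<open>star i0\<close>; the vector e_(star i0) is
        added to reach the case of \<open>main\<close> and subtracted afterwards.\<close>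
      have "act x (\<lambda>i. e (star i0) i + 1 * e r i) i = \<mu> * (e (star i0) i + 1 * e r i)"
        by (rule main) (use ri e_R False in \<open>auto simp: e_def intro: add_mem one_mem\<close>)
      then show ?thesis unfolding act_add using f by (simp add: algebra_simps)
    qed (use \<mu> f ri in auto)
  qed
qed

text \<open>Only isotropic vectors are translates of e = e_i0, so
  \<open>two_translates_eigen\<close> is out of reach. Instead e, its partner f and the isotropic
  vectors e + w - Q f, with w orthogonal to e and f and Q = B(w,w)/2, are shown to be eigenvectors,
  and orthogonality separates their components.\<close>

lemma orthogonal_core:
  assumes eps: "\<epsilon> = 1" and sg1: "\<And>i. i < n \<Longrightarrow> sg i = 1"
    and x: "x \<in> iso" "mcong n 1 x (1\<^sub>m n)" and i0: "i0 < n" "star i0 \<noteq> i0" and n3: "n \<ge> 3"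
    and rho: "\<rho> \<in> iso" "det \<rho> = - 1" "\<And>i. i < n \<Longrightarrow> cf \<rho> i0 i = e i0 i"
    and eig: "\<And>g. g \<in> SOg \<Longrightarrow> \<exists>\<mu>. \<forall>i<n. act x (cf g i0) i = \<mu> * cf g i0 i"
  shows "x = 1\<^sub>m n"
proof -
  interpret G: matgrp R \<pi> q n iso by (rule iso_matgrp)
  let ?e = "e i0" and ?f = "e (star i0)"
  have si: "star i0 < n" "star (star i0) = i0" using i0 star_lt star_star by auto
  have Bef: "B ?e ?f = 1" "B ?f ?e = 1" "B ?e ?e = 0" "B ?f ?f = 0"
    using i0 si sg1 by (auto simp: B_e_e)
  have Bsym: "B u v = B v u" for u v using B_sym[of u v] eps by simp
  have eig': "\<exists>\<nu>. \<forall>i<n. act x v i = \<nu> * v i"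
    if u: "\<And>i. i < n \<Longrightarrow> u i \<in> R" "unit (B u u)" and v: "\<And>i. i < n \<Longrightarrow> v i = ?e i + (- 2 / B u u) * B u ?e * u i" for u v
  proof -
    let ?r = "tau u (- 2 / B u u)"
    have r: "?r \<in> iso" by (rule reflection_iso[OF eps u])
    \<comment> \<open>Reflections have determinant -1 as a rule; composing with
      \<open>\<rho>\<close>, which fixes e_i0, corrects the determinant and keeps the image of
      e_i0.\<close>
    define g where "g = (if det ?r = 1 then ?r else ?r * \<rho>)"
    have "det (?r * \<rho>) = det ?r * det \<rho>" by (rule det_mult[OF G.G_carrier[OF r] G.G_carrier[OF rho(1)]])
    then have g: "g \<in> SOg" unfolding g_def SOg_def using det_iso[OF r] r rho G.G_mult by auto
    have "cf (?r * \<rho>) i0 i = cf ?r i0 i" if "i < n" for i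
    proof -
      have "cf (?r * \<rho>) i0 i = act ?r (cf \<rho> i0) i" by (rule cf_mult[OF iso_RM[OF r] iso_RM[OF rho(1)] that i0(1)])
      also have "\<dots> = act ?r ?e i" by (rule act_eq) (rule rho(3))
      finally show ?thesis using act_e[OF i0(1)] by simp
    qed
    then have cg: "cf g i0 i = v i" if "i < n" for i
      using that cf_tau[OF that i0(1)] v[OF that] by (simp add: g_def)
    obtain \<nu> where \<nu>: "\<forall>i<n. act x (cf g i0) i = \<nu> * cf g i0 i" using eig[OF g] by blast
    have "act x v i = \<nu> * v i" if "i < n" for i
      using \<nu> that cg act_eq[of "cf g i0" v x i] by simp
    then show ?thesis by blast
  qed
  have two': "2 / 2 = (1 :: 'k)" "(2 :: 'k) \<noteq> 0" using unit_nz[OF two] by auto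
  obtain \<mu> where \<mu>: "\<And>i. i < n \<Longrightarrow> act x ?f i = \<mu> * ?f i"
  proof -
    \<comment> \<open>The reflection along e - f exchanges e and f.\<close>
    let ?u = "\<lambda>i. ?e i + (- 1) * ?f i"
    have Bu: "B ?u ?u = - 2" "B ?u ?e = - 1" unfolding B_left B_right using Bef by auto
    have "\<exists>\<nu>. \<forall>i<n. act x ?f i = \<nu> * ?f i"
    proof (rule eig'[of ?u])
      show "?u i \<in> R" for i by (intro add_mem mult_mem uminus_mem one_mem e_R)
      show "unit (B ?u ?u)" unfolding Bu using unit_uminus[OF two] .
      show "?f i = ?e i + (- 2 / B ?u ?u) * B ?u ?e * ?u i" for i unfolding Bu using two' by simp
    qed
    then show ?thesis using that by blast
  qed
  obtain \<nu> where \<nu>: "\<And>i. i < n \<Longrightarrow> act x ?e i = \<nu> * ?e i"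
  proof -
    obtain \<nu> where n: "\<forall>i<n. act x (cf (1\<^sub>m n) i0) i = \<nu> * cf (1\<^sub>m n) i0 i"
      using eig matgrp.G_one[OF SOg_matgrp] by blast
    have "act x ?e i = \<nu> * ?e i" if "i < n" for i
    proof -
      have "act x ?e i = act x (cf (1\<^sub>m n) i0) i" by (rule act_eq) (use cf_one i0 in simp)
      then show ?thesis using n that cf_one i0 by simp
    qed
    then show ?thesis using that by blast
  qed
  have "B (act x ?e) (act x ?f) = B (\<lambda>i. 0 + \<nu> * ?e i) (\<lambda>i. 0 + \<mu> * ?f i)"
    by (rule B_eq) (use \<nu> \<mu> in auto)
  also have "\<dots> = \<nu> * \<mu>" unfolding B_left B_right using Bef by (simp add: B_def)
  finally have nm: "\<nu> * \<mu> = 1" using B_act[OF x(1)] Bef by simp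
  have main: "act x w k = \<nu> * w k \<and> \<nu> = \<mu>"
    if w: "\<And>i. i < n \<Longrightarrow> w i \<in> R" "unit (B w w)" "B w ?e = 0" "B w ?f = 0" and k: "k < n" for w k
  proof -
    define Q where "Q = B w w / 2"
    have Q: "Q \<in> R" "B w w = 2 * Q" "Q \<noteq> 0"
      using unit_divide_mem[OF unit_R[OF w(2)] two] two' unit_nz[OF w(2)] by (auto simp: Q_def)
    \<comment> \<open>B(u,u) = 2Q and B(u,e) = -Q, so the reflection along u sends e to e +
      u.\<close>
    let ?u = "\<lambda>i. w i + (- Q) * ?f i"
    let ?v = "\<lambda>i. ?e i + 1 * ?u i"
    have wf: "B ?f w = 0" "B ?e w = 0" using Bsym w(3,4) by metis+
    have Bu: "B ?u ?u = 2 * Q" "B ?u ?e = - Q" unfolding B_left B_right using Bef w(3,4) wf Q by auto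
    have "\<exists>\<kappa>. \<forall>i<n. act x ?v i = \<kappa> * ?v i"
    proof (rule eig'[of ?u])
      show "?u i \<in> R" if "i < n" for i using w(1)[OF that] Q(1) by (intro add_mem mult_mem uminus_mem e_R)
      show "unit (B ?u ?u)" using w(2) Bu Q by simp
      show "?v i = ?e i + (- 2 / B ?u ?u) * B ?u ?e * ?u i" for i unfolding Bu using two' Q(3) by simp
    qed
    then obtain \<kappa> where \<kappa>: "\<And>i. i < n \<Longrightarrow> act x ?v i = \<kappa> * ?v i" by blast
    \<comment> \<open>x w has a priori components along e and f. They vanish because x w is
      orthogonal to x e and x f, which are nonzero multiples of e and f; this forces the eigenvalue
      to equal both \<open>\<nu>\<close> and \<open>\<mu>\<close>.\<close>
    have X: "act x w i = (\<kappa> - \<nu>) * ?e i + 1 * (\<kappa> * w i + (Q * \<mu> - \<kappa> * Q) * ?f i)" if "i < n" for i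
      using \<kappa>[OF that] \<nu>[OF that] \<mu>[OF that] unfolding act_add by (simp add: algebra_simps)
    have BX: "B (act x w) z = (\<kappa> - \<nu>) * B ?e z + 1 * (\<kappa> * B w z + (Q * \<mu> - \<kappa> * Q) * B ?f z)" for z
    proof -
      have "B (act x w) z = B (\<lambda>i. (0 + (\<kappa> - \<nu>) * ?e i) + 1 * ((0 + \<kappa> * w i) + (Q * \<mu> - \<kappa> * Q) * ?f i)) z"
        by (rule B_eq) (use X in auto)
      then show ?thesis unfolding B_left by (simp add: B_def)
    qed
    have nz: "\<nu> \<noteq> 0" "\<mu> \<noteq> 0" using nm by auto
    have "B (act x w) (act x ?e) = 0" "B (act x w) (act x ?f) = 0" using B_act[OF x(1)] w(3,4) by auto
    moreover have "B (act x w) (act x ?e) = \<nu> * B (act x w) ?e"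
    proof -
      have "B (act x w) (act x ?e) = B (act x w) (\<lambda>i. 0 + \<nu> * ?e i)" by (rule B_eq) (use \<nu> in auto)
      then show ?thesis unfolding B_right by (simp add: B_def)
    qed
    moreover have "B (act x w) (act x ?f) = \<mu> * B (act x w) ?f"
    proof -
      have "B (act x w) (act x ?f) = B (act x w) (\<lambda>i. 0 + \<mu> * ?f i)" by (rule B_eq) (use \<mu> in auto)
      then show ?thesis unfolding B_right by (simp add: B_def)
    qed
    ultimately have "B (act x w) ?e = 0" "B (act x w) ?f = 0" using nz by auto
    then have "Q * \<mu> - \<kappa> * Q = 0" "\<kappa> - \<nu> = 0" using BX[of ?e] BX[of ?f] Bef w(3,4) by simp_all
    then have "\<kappa> = \<nu>" "\<mu> = \<kappa>" using Q(3) by (auto simp: mult.commute)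
    then show ?thesis using X[OF k] by simp
  qed
  have wB: "B (e a) ?e = 0" "B (e a) ?f = 0" if "a < n" "a \<noteq> i0" "a \<noteq> star i0" for a
    using that i0 si star_eq_iff[of a i0] star_eq_iff[of a "star i0"] by (auto simp: B_e_e)
  have basis: "act x (e a) i = \<nu> * e a i \<and> \<nu> = \<mu>" if a: "a < n" "a \<noteq> i0" "a \<noteq> star i0" and i: "i < n" for a i
  proof (cases "star a = a")
    case True
    have "B (e a) (e a) = 1" using a True sg1 by (simp add: B_e_e)
    then show ?thesis using main[of "e a", OF e_R _ wB[OF a] i] unit_1 by simp
  next
    case False
    have a': "star a < n" "star a \<noteq> i0" "star a \<noteq> star i0" "star (star a) = a"
      using star_lt[OF a(1)] star_star[OF a(1)] a i0 si star_eq_iff[of a i0] star_eq_iff[of a "star i0"] by auto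
    have Baa: "B (e a) (e a) = 0" "B (e (star a)) (e (star a)) = 0" "B (e a) (e (star a)) = 1" "B (e (star a)) (e a) = 1"
      using a a' False sg1 by (auto simp: B_e_e)
    \<comment> \<open>e_a is isotropic when a is not fixed by \<open>star\<close>; its sum and
      difference with its partner have the unit norms 2 and -2, and adding the two results isolates
      e_a.\<close>
    have w: "act x (\<lambda>i. e a i + t * e (star a) i) i = \<nu> * (e a i + t * e (star a) i) \<and> \<nu> = \<mu>" if t: "t = 1 \<or> t = - 1" for t
    proof (rule main[OF _ _ _ _ i])
      show "e a i + t * e (star a) i \<in> R" for i using t by (auto intro!: add_mem mult_mem e_R one_mem uminus_mem)
      show "unit (B (\<lambda>i. e a i + t * e (star a) i) (\<lambda>i. e a i + t * e (star a) i))"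
        unfolding B_left B_right Baa using t two unit_uminus[OF two] by auto
      show "B (\<lambda>i. e a i + t * e (star a) i) ?e = 0" "B (\<lambda>i. e a i + t * e (star a) i) ?f = 0"
        unfolding B_left using wB[OF a] wB[OF a'(1-3)] by simp_all
    qed
    have "2 * act x (e a) i = 2 * (\<nu> * e a i)"
    proof -
      have "act x (e a) i + 1 * act x (e (star a)) i = \<nu> * (e a i + 1 * e (star a) i)"
        "act x (e a) i + - 1 * act x (e (star a)) i = \<nu> * (e a i + - 1 * e (star a) i)"
        using w[of 1] w[of "- 1"] unfolding act_add by blast+
      then have "(act x (e a) i + 1 * act x (e (star a)) i) + (act x (e a) i + - 1 * act x (e (star a)) i) =
          \<nu> * (e a i + 1 * e (star a) i) + \<nu> * (e a i + - 1 * e (star a) i)" by (simp only:)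
      then show ?thesis by (simp add: algebra_simps)
    qed
    then show ?thesis using two' w[of 1] by simp
  qed
  \<comment> \<open>A third index is what links the eigenvalues of e and f, whose product alone is
    known to be 1.\<close>
  have "card ({..<n} - {i0, star i0}) = n - 2" using i0 si by (simp add: card_Diff_subset)
  then have "card ({..<n} - {i0, star i0}) \<noteq> 0" using n3 by simp
  then have "{..<n} - {i0, star i0} \<noteq> {}" by (metis card.empty)
  then obtain a where "a < n" "a \<noteq> i0" "a \<noteq> star i0" by blast
  then have "\<nu> = \<mu>" using basis i0(1) by blast
  then show ?thesis using scalar_one[OF x i0(1), of \<nu>] basis \<nu> \<mu> by metis
qed

end

subsection \<open>The symplectic group over the residue field\<close>

text \<open>The index set consists of \<open>s\<close> fixed points of the involution, followed by \<open>l\<close> indices and their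
  \<open>l\<close> partners; \<open>hord\<close> lists each index next to its partner, and \<open>hpos\<close> is its inverse.\<close>

definition hstar :: "nat \<Rightarrow> nat \<Rightarrow> nat \<Rightarrow> nat" where
  "hstar s l x = (if x < s then x else if x < s + l then x + l else x - l)"

definition hord :: "nat \<Rightarrow> nat \<Rightarrow> nat \<Rightarrow> nat" where
  "hord s l j = (if j < s then j else s + (j - s) div 2 + (if even (j - s) then 0 else l))"

definition hpos :: "nat \<Rightarrow> nat \<Rightarrow> nat \<Rightarrow> nat" where
  "hpos s l x = (if x < s then x else if x < s + l then s + 2 * (x - s) else s + 2 * (x - s - l) + 1)"

lemma hpos_lt: "x < s + 2 * l \<Longrightarrow> hpos s l x < s + 2 * l"
  by (auto simp: hpos_def)

lemma hord_hpos: "x < s + 2 * l \<Longrightarrow> hord s l (hpos s l x) = x"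
  by (auto simp: hpos_def hord_def)

lemma hord_lt: assumes "j < s + 2 * l" shows "hord s l j < s + 2 * l"
proof -
  have "(j - s) div 2 < l" if "\<not> j < s" using assms that by linarith
  then show ?thesis by (auto simp: hord_def)
qed

lemma hpos_hord: assumes "j < s + 2 * l" shows "hpos s l (hord s l j) = j"
proof (cases "j < s")
  case False
  then obtain t where j: "j = s + t" using le_Suc_ex[of s j] by auto
  then have t: "t < 2 * l" using assms by simp
  show ?thesis
  proof (cases "even t")
    case True
    then obtain i where "t = 2 * i" by blast
    then show ?thesis using j t by (simp add: hord_def hpos_def)
  next
    case False
    then obtain i where "t = 2 * i + 1" by (rule oddE)
    then show ?thesis using j t by (simp add: hord_def hpos_def)
  qed
qed (simp add: hord_def hpos_def)

lemma hord_even: "hord s l (s + 2 * i) = s + i" and hord_odd: "hord s l (s + 2 * i + 1) = s + l + i"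
  by (auto simp: hord_def)

lemma hord_bij: "bij_betw (hord s l) {..<s + 2 * l} {..<s + 2 * l}"
  by (rule bij_betw_byWitness[where f' = "hpos s l"]) (use hord_lt hpos_lt hord_hpos hpos_hord in auto)

text \<open>Partners occupy adjacent positions, so the involution preserves initial segments that
  consist of the fixed points and whole pairs.\<close>

lemma hpos_hstar: "x < s + 2 * l \<Longrightarrow> hpos s l (hstar s l x) < s + 2 * i \<longleftrightarrow> hpos s l x < s + 2 * i"
  unfolding hpos_def hstar_def by auto

lemma prod_pairs: "(\<Prod>j<s + 2 * l. f j) = (\<Prod>j<s. f j) * (\<Prod>i<l. f (s + 2 * i) * f (s + 2 * i + 1 :: nat))"
  for f :: "nat \<Rightarrow> nat"
proof (induction l)
  case (Suc l)
  have "s + 2 * Suc l = Suc (Suc (s + 2 * l))" by simp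
  then have "(\<Prod>j<s + 2 * Suc l. f j) = (\<Prod>j<Suc (Suc (s + 2 * l)). f j)" by (simp only:)
  also have "\<dots> = (\<Prod>j<s + 2 * l. f j) * f (s + 2 * l) * f (s + 2 * l + 1)"
    unfolding prod.lessThan_Suc by (simp only: Suc_eq_plus1)
  finally show ?case unfolding Suc prod.lessThan_Suc by (simp only: mult.assoc)
qed simp

lemma card_hpos_ge: assumes "j \<le> s + 2 * l" shows "card {x. x < s + 2 * l \<and> j \<le> hpos s l x} = s + 2 * l - j"
proof -
  have "bij_betw (hpos s l) {x. x < s + 2 * l \<and> j \<le> hpos s l x} {j..<s + 2 * l}"
    by (rule bij_betw_byWitness[where f' = "hord s l"]) (use hord_lt hpos_lt hord_hpos hpos_hord in \<open>simp_all add: image_subset_iff\<close>)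
  from bij_betw_same_card[OF this] show ?thesis by simp
qed

section \<open>Transitivity of symplectic transvections and the order of the residue group\<close>

context sform
begin

text \<open>For u = z - v and c = 1 / B(z,v) one has c B(u,v) = 1, as B(v,v) = 0, so
  \<open>tau u c\<close> sends v to v + u = z. It fixes modulo \<open>\<pi>\<close> every x whose
  pairings with z and v agree.\<close>

lemma act_tau_transvection:
  assumes eps: "\<epsilon> = - 1" and R: "\<And>i. i < n \<Longrightarrow> v i \<in> R" "\<And>i. i < n \<Longrightarrow> z i \<in> R" and u: "unit (B z v)"
  obtains g where "g \<in> iso" "\<And>i. i < n \<Longrightarrow> act g v i = z i"
    "\<And>x i. (\<And>i. i < n \<Longrightarrow> x i \<in> R) \<Longrightarrow> B z x - B v x \<in> idl 1 \<Longrightarrow> i < n \<Longrightarrow> act g x i - x i \<in> idl 1"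
proof -
  let ?u = "\<lambda>i. z i - v i" and ?c = "1 / B z v"
  have uR: "?u i \<in> R" if "i < n" for i using R that diff_mem by blast
  have c: "?c \<in> R" by (rule unit_divide_mem[OF one_mem u])
  have "B v v = - B v v" using B_sym[of v v] unfolding eps by simp
  then have "B v v + B v v = 0" by (metis add.right_inverse)
  then have "2 * B v v = 0" by (simp only: mult_2)
  then have vv: "B v v = 0" using unit_nz[OF two] by simp
  show ?thesis
  proof (rule that)
    show "tau ?u ?c \<in> iso" by (rule transvection_iso[OF eps uR c])
    show "act (tau ?u ?c) v i = z i" if "i < n" for i
      unfolding act_tau[OF that] B_diff_left vv using unit_nz[OF u] by simp
    show "act (tau ?u ?c) x i - x i \<in> idl 1" if x: "B z x - B v x \<in> idl 1" "i < n" for x i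
      unfolding act_tau[OF x(2)] B_diff_left
      using idl_mult_right[OF idl_mult_left[OF c x(1)] uR[OF x(2)]] by simp
  qed
qed

text \<open>For v and w whose pairing may fail to be a unit: v goes to w by way of z.\<close>

lemma act_tau_two_transvections:
  assumes eps: "\<epsilon> = - 1" and R: "\<And>i. i < n \<Longrightarrow> v i \<in> R" "\<And>i. i < n \<Longrightarrow> z i \<in> R" "\<And>i. i < n \<Longrightarrow> w i \<in> R"
    and u: "unit (B z v)" "unit (B w z)"
  obtains g where "g \<in> iso" "\<And>i. i < n \<Longrightarrow> act g v i = w i"
    "\<And>x i. (\<And>i. i < n \<Longrightarrow> x i \<in> R) \<Longrightarrow> B z x - B v x \<in> idl 1 \<Longrightarrow> B w x - B z x \<in> idl 1 \<Longrightarrow> i < n \<Longrightarrow> act g x i - x i \<in> idl 1"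
proof -
  obtain g where g: "g \<in> iso" "\<And>i. i < n \<Longrightarrow> act g v i = z i"
    "\<And>x i. (\<And>i. i < n \<Longrightarrow> x i \<in> R) \<Longrightarrow> B z x - B v x \<in> idl 1 \<Longrightarrow> i < n \<Longrightarrow> act g x i - x i \<in> idl 1"
    by (rule act_tau_transvection[OF eps R(1,2) u(1)]) blast+
  obtain g' where g': "g' \<in> iso" "\<And>i. i < n \<Longrightarrow> act g' z i = w i"
    "\<And>x i. (\<And>i. i < n \<Longrightarrow> x i \<in> R) \<Longrightarrow> B w x - B z x \<in> idl 1 \<Longrightarrow> i < n \<Longrightarrow> act g' x i - x i \<in> idl 1"
    by (rule act_tau_transvection[OF eps R(2,3) u(2)]) blast+
  show ?thesis
  proof (rule that)
    show "g' * g \<in> iso" using matgrp.G_mult[OF iso_matgrp g'(1) g(1)] .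
    show "act (g' * g) v i = w i" if "i < n" for i
      unfolding act_mult[OF iso_RM[OF g'(1)] iso_RM[OF g(1)] that] using act_eq[of "act g v" z g' i] g(2) g'(2)[OF that] by simp
    show "act (g' * g) x i - x i \<in> idl 1"
      if x: "\<And>i. i < n \<Longrightarrow> x i \<in> R" "B z x - B v x \<in> idl 1" "B w x - B z x \<in> idl 1" and i: "i < n" for x i
    proof -
      have "act g' (act g x) i - act g' x i \<in> idl 1"
        by (rule act_cong_idl[OF iso_RM[OF g'(1)] i]) (rule g(3)[OF x(1,2)])
      then show ?thesis
        unfolding act_mult[OF iso_RM[OF g'(1)] iso_RM[OF g(1)] i] using g'(3)[OF x(1,3) i] idl_trans by blast
    qed
  qed
qed

text \<open>The unit vector \<open>e c\<close> is moved to \<open>w\<close> through an intermediate vector pairing with both to a unit,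
  unless \<open>w\<close> itself already pairs with \<open>e c\<close> to a unit.\<close>

lemma symplectic_transitive:
  assumes eps: "\<epsilon> = - 1" and c: "c < n" and wR: "\<And>i. i < n \<Longrightarrow> w i \<in> R"
    and F: "\<And>x. x \<in> F \<Longrightarrow> x < n" "\<And>x. x \<in> F \<Longrightarrow> w (star x) - e c (star x) \<in> idl 1"
    and cs: "unit (w (star c)) \<or> (\<exists>z. (\<forall>i<n. z i \<in> R) \<and> unit (z (star c)) \<and> unit (B w z) \<and>
      (\<forall>x\<in>F. z (star x) - e c (star x) \<in> idl 1))"
  obtains g where "g \<in> iso" "\<And>i. i < n \<Longrightarrow> act g (e c) i = w i"
    "\<And>x i. x \<in> F \<Longrightarrow> i < n \<Longrightarrow> act g (e x) i - e x i \<in> idl 1"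
proof -
  have un: "unit (B v (e c))" if "unit (v (star c))" for v
    unfolding B_e_right[OF c] using unit_mult[OF sg_unit[OF star_lt[OF c]] that] .
  have fx: "B v (e x) - B v' (e x) \<in> idl 1" if "x \<in> F" "v (star x) - v' (star x) \<in> idl 1" for v v' x
    unfolding B_e_right[OF F(1)[OF that(1)]] right_diff_distrib[symmetric]
    by (rule idl_mult_left[OF sg_R[OF star_lt[OF F(1)[OF that(1)]]] that(2)])
  have w0: "B w (e x) - B (e c) (e x) \<in> idl 1" if "x \<in> F" for x using fx[where v = w and v' = "e c", OF that F(2)[OF that]] .
  show ?thesis
  proof (cases "unit (w (star c))")
    case True
    obtain g where g: "g \<in> iso" "\<And>i. i < n \<Longrightarrow> act g (e c) i = w i"
      "\<And>x i. (\<And>i. i < n \<Longrightarrow> x i \<in> R) \<Longrightarrow> B w x - B (e c) x \<in> idl 1 \<Longrightarrow> i < n \<Longrightarrow> act g x i - x i \<in> idl 1"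
      by (rule act_tau_transvection[OF eps e_R wR un[where v = w, OF True]]) blast+
    show ?thesis
    proof (rule that)
      show "act g (e x) i - e x i \<in> idl 1" if "x \<in> F" "i < n" for x i by (rule g(3)[OF e_R w0[OF that(1)] that(2)])
    qed (use g in blast)+
  next
    case False
    then obtain z where z: "\<And>i. i < n \<Longrightarrow> z i \<in> R" "unit (z (star c))" "unit (B w z)"
        "\<And>x. x \<in> F \<Longrightarrow> z (star x) - e c (star x) \<in> idl 1"
      using cs by blast
    obtain g where g: "g \<in> iso" "\<And>i. i < n \<Longrightarrow> act g (e c) i = w i"
      "\<And>x i. (\<And>i. i < n \<Longrightarrow> x i \<in> R) \<Longrightarrow> B z x - B (e c) x \<in> idl 1 \<Longrightarrow> B w x - B z x \<in> idl 1 \<Longrightarrow> i < n \<Longrightarrow> act g x i - x i \<in> idl 1"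
      by (rule act_tau_two_transvections[OF eps e_R z(1) wR un[where v = z, OF z(2)] z(3)]) blast+
    have z0: "B z (e x) - B (e c) (e x) \<in> idl 1" if "x \<in> F" for x using fx[where v = z and v' = "e c", OF that z(4)[OF that]] .
    have wz: "B w (e x) - B z (e x) \<in> idl 1" if "x \<in> F" for x
      using idl_diff[OF w0[OF that] z0[OF that]] by simp
    show ?thesis
    proof (rule that)
      show "act g (e x) i - e x i \<in> idl 1" if "x \<in> F" "i < n" for x i
        by (rule g(3)[OF e_R z0[OF that(1)] wz[OF that(1)] that(2)])
    qed (use g in blast)+
  qed
qed

lemma symplectic_orb_memI:
  fixes w :: "'k vec"
  assumes eps: "\<epsilon> = - 1" and n: "n = 2 * l" and st: "\<And>x. star x = hstar 0 l x" and j: "j < n"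
    and w: "w \<in> carrier_vec n" "\<And>r. r < n \<Longrightarrow> w $ r \<in> red 1 ` R"
    and F: "\<And>x. x < n \<Longrightarrow> hpos 0 l x < j \<Longrightarrow> w $ star x - e (hord 0 l j) (star x) \<in> idl 1"
    and cs: "unit (w $ star (hord 0 l j)) \<or> (\<exists>z. (\<forall>i<n. z i \<in> R) \<and> unit (z (star (hord 0 l j))) \<and> unit (B (vec_index w) z) \<and>
      (\<forall>x<n. hpos 0 l x < j \<longrightarrow> z (star x) - e (hord 0 l j) (star x) \<in> idl 1))"
  shows "w \<in> matgrp.orb R \<pi> n iso (hord 0 l) j"
proof -
  let ?c = "hord 0 l j"
  have cn: "hord 0 l r < n" "hpos 0 l (hord 0 l r) = r" if "r < n" for r
    using hord_lt[of r 0 l] hpos_hord[of r 0 l] that n by simp_all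
  have wR: "vec_index w r \<in> R" if "r < n" for r using red_in_R[OF w(2)[OF that]] .
  obtain g where g: "g \<in> iso" "\<And>i. i < n \<Longrightarrow> act g (e ?c) i = w $ i"
    "\<And>x i. x \<in> {x. x < n \<and> hpos 0 l x < j} \<Longrightarrow> i < n \<Longrightarrow> act g (e x) i - e x i \<in> idl 1"
    by (rule symplectic_transitive[OF eps cn(1)[OF j], of "vec_index w" "{x. x < n \<and> hpos 0 l x < j}"])
      (use wR F cs in auto)
  show ?thesis
  proof (rule orb_memI[where g = g and c = "hord 0 l" and j = j and w = w])
    show "g \<in> iso" "hord 0 l j < n" "w \<in> carrier_vec n" using g(1) cn j w by auto
    show "w $ i \<in> red 1 ` R" if "i < n" for i by (rule w(2)[OF that])
    show "hord 0 l i < n" if "i < j" for i using that j cn by simp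
    show "act g (e ?c) i - w $ i \<in> idl 1" if "i < n" for i using g(2)[OF that] by simp
    show "act g (e (hord 0 l s)) i - e (hord 0 l s) i \<in> idl 1" if "s < j" "i < n" for s i
      by (rule g(3)) (use cn[of s] that j in auto)
  qed
qed

text \<open>Necessity: earlier columns being standard prescribe, by \<open>fixed_column\<close>, the
  entries of column j in the partner rows.\<close>

lemma symplectic_orb_low:
  fixes w :: "'k vec"
  assumes n: "n = 2 * l" and st: "\<And>x. star x = hstar 0 l x" and j: "j < n"
    and w: "w \<in> matgrp.orb R \<pi> n iso (hord 0 l) j" and x: "x < n" "hpos 0 l x < j"
  shows "w $ star x - e (hord 0 l j) (star x) \<in> idl 1"
proof -
  have cn: "hord 0 l r < n" if "r < n" for r using hord_lt[of r 0 l] that n by simp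
  obtain g where g: "g \<in> iso" "\<And>i. i < n \<Longrightarrow> g $$ (i, hord 0 l j) - w $ i \<in> idl 1"
    "\<And>s i. s < j \<Longrightarrow> i < n \<Longrightarrow> g $$ (i, hord 0 l s) - 1\<^sub>m n $$ (i, hord 0 l s) \<in> idl 1"
    by (rule orb_memD[OF w cn[OF j]]) blast
  have hx: "hord 0 l (hpos 0 l x) = x" using hord_hpos[of x 0 l] x n by simp
  have "g $$ (star x, hord 0 l j) - 1\<^sub>m n $$ (star x, hord 0 l j) \<in> idl 1"
    by (rule fixed_column[OF g(1) x(1) cn[OF j]]) (use g(3)[OF x(2)] hx in simp)
  moreover have "1\<^sub>m n $$ (star x, hord 0 l j) = e (hord 0 l j) (star x)"
    using star_lt[OF x(1)] cn[OF j] by (simp add: e_def)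
  ultimately show ?thesis
    using g(2)[OF star_lt[OF x(1)]] idl_trans idl_commute by metis
qed

text \<open>The earlier positions form whole pairs, so the constraints annihilate exactly their
  rows; the other 2(l - i) coordinates form an arbitrary nonzero vector.\<close>

lemma card_symplectic_orb_even:
  assumes eps: "\<epsilon> = - 1" and n: "n = 2 * l" and st: "\<And>x. star x = hstar 0 l x" and i: "i < l"
  shows "card (matgrp.orb R \<pi> n iso (hord 0 l) (2 * i)) = q ^ (2 * (l - i)) - 1"
proof -
  let ?I = "{r. r < n \<and> hpos 0 l r < 2 * i}" and ?J = "{r. r < n \<and> 2 * i \<le> hpos 0 l r}"
  let ?O = "matgrp.orb R \<pi> n iso (hord 0 l) (2 * i)"
  let ?W = "{w :: 'k vec. w \<in> carrier_vec n \<and> (\<forall>r<n. w $ r \<in> (if r \<in> ?I then {red 1 0} else red 1 ` R)) \<and> (\<exists>r\<in>?J. w $ r \<notin> idl 1)}"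
  have c: "hord 0 l (2 * i) = i" "i < n" "2 * i < n" "star i = l + i" "star (l + i) = i" "l + i < n" "hpos 0 l i = 2 * i"
    using hord_even[of 0 l i] i n by (auto simp: st hstar_def hpos_def)
  have hp: "hpos 0 l (star x) < 2 * i \<longleftrightarrow> hpos 0 l x < 2 * i" if "x < n" for x
    using hpos_hstar[of x 0 l i] that n by (simp add: st)
  have "?O = ?W"
  proof (intro equalityI subsetI)
    fix w assume w: "w \<in> ?O"
    obtain g where g: "g \<in> iso" "w \<in> carrier_vec n" "\<And>r. r < n \<Longrightarrow> w $ r \<in> red 1 ` R" "\<And>r. r < n \<Longrightarrow> g $$ (r, i) - w $ r \<in> idl 1"
      by (rule orb_memD[OF w]) (use c in auto)
    have low: "w $ r \<in> idl 1" if r: "r < n" "hpos 0 l r < 2 * i" for r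
    proof -
      have "w $ star (star r) - e i (star (star r)) \<in> idl 1"
        using symplectic_orb_low[OF n st c(3) w, of "star r"] star_lt[OF r(1)] hp[OF r(1)] r(2) c(1) by simp
      moreover have "r \<noteq> i" using r c(7) by auto
      ultimately show ?thesis using star_star[OF r(1)] by (simp add: e_def)
    qed
    obtain x where x: "x < n" "g $$ (x, i) \<notin> idl 1" using column_primitive[OF g(1) c(2)] by blast
    then have wx: "w $ x \<notin> idl 1" using idl_add[OF g(4)[OF x(1)], of "w $ x"] by auto
    then have "x \<in> ?J" using low[OF x(1)] x(1) by (cases "hpos 0 l x < 2 * i") auto
    moreover have "w $ r \<in> (if r \<in> ?I then {red 1 0} else red 1 ` R)" if "r < n" for r
      using low[of r] red_zero_iff[OF g(3)[OF that]] g(3)[OF that] by auto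
    ultimately show "w \<in> ?W" using g(2) wx by blast
  next
    fix w assume w: "w \<in> ?W"
    have wc: "w \<in> carrier_vec n" using w by simp
    have wred: "w $ r \<in> red 1 ` R" if "r < n" for r
    proof -
      have "w $ r \<in> (if r \<in> ?I then {red 1 0} else red 1 ` R)" using w that by simp
      then show ?thesis using zero_mem by (auto split: if_splits)
    qed
    have low: "w $ r \<in> idl 1" if r: "r < n" "hpos 0 l r < 2 * i" for r
      using w r red_zero_iff[OF wred[OF r(1)]] by auto
    have wR: "vec_index w r \<in> R" if "r < n" for r using red_in_R[OF wred[OF that]] .
    have ne: "star x \<noteq> i" "star x \<noteq> l + i" if "x < n" "hpos 0 l x < 2 * i" for x
      using hp[OF that(1)] that c hp[OF c(2)] by (metis less_irrefl)+
    show "w \<in> ?O"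
    proof (rule symplectic_orb_memI[OF eps n st c(3) wc wred])
      show "w $ star x - e (hord 0 l (2 * i)) (star x) \<in> idl 1" if "x < n" "hpos 0 l x < 2 * i" for x
        using low[OF star_lt[OF that(1)]] hp[OF that(1)] that ne[OF that] c(1) by (simp add: e_def)
      show "unit (w $ star (hord 0 l (2 * i))) \<or> (\<exists>z. (\<forall>i<n. z i \<in> R) \<and> unit (z (star (hord 0 l (2 * i)))) \<and> unit (B (vec_index w) z) \<and>
        (\<forall>x<n. hpos 0 l x < 2 * i \<longrightarrow> z (star x) - e (hord 0 l (2 * i)) (star x) \<in> idl 1))"
        unfolding c(1) c(4)
      proof (cases "unit (w $ (l + i)) \<or> unit (w $ i)")
        case True
        \<comment> \<open>If w_i is a unit, e_(l+i) itself is an intermediate vector.\<close>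
        have "unit (B (vec_index w) (e (l + i)))" if "unit (w $ i)"
          unfolding B_e_right[OF c(6)] c(5) by (rule unit_mult[OF sg_unit[OF c(2)] that])
        then show "unit (w $ (l + i)) \<or> (\<exists>z. (\<forall>i<n. z i \<in> R) \<and> unit (z (l + i)) \<and> unit (B (vec_index w) z) \<and>
          (\<forall>x<n. hpos 0 l x < 2 * i \<longrightarrow> z (star x) - e i (star x) \<in> idl 1))"
          using True ne e_R unit_1 by (intro disj_imp[THEN iffD2] impI exI[of _ "e (l + i)"]) (auto simp: e_def)
      next
        case False
        then have nu: "w $ (l + i) \<in> idl 1" "w $ i \<in> idl 1" using unit_iff wR c by auto
        obtain a where a: "a < n" "2 * i \<le> hpos 0 l a" "w $ a \<notin> idl 1" using w by auto
        then have a': "a \<noteq> i" "a \<noteq> l + i" "unit (w $ a)" using nu unit_iff wR by auto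
        have b: "star a < n" "star (star a) = a" "star a \<noteq> l + i" using star_lt star_star a a' c by metis+
        \<comment> \<open>Some other entry w_a is a unit. Adding the partner of e_a contributes a
          unit to the pairing with w, while e_(l+i) contributes a multiple of
          \<open>\<pi>\<close>.\<close>
        let ?z = "\<lambda>k. e (l + i) k + 1 * e (star a) k"
        have "B (vec_index w) ?z = sg i * w $ i + 1 * (sg a * w $ a)"
          unfolding B_right B_e_right[OF c(6)] B_e_right[OF b(1)] c(5) b(2) ..
        moreover have "unit (sg i * w $ i + 1 * (sg a * w $ a))"
        proof (rule unit_cong[OF unit_mult[OF sg_unit[OF a(1)] a'(3)]])
          show "sg i * w $ i + 1 * (sg a * w $ a) \<in> R"
            using sg_R[OF c(2)] sg_R[OF a(1)] wR[OF c(2)] wR[OF a(1)] by (intro add_mem mult_mem one_mem)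
          have "sg i * w $ i \<in> idl 1" by (rule idl_mult_left[OF sg_R[OF c(2)] nu(2)])
          then show "sg a * w $ a - (sg i * w $ i + 1 * (sg a * w $ a)) \<in> idl 1" using idl_uminus by simp
        qed
        ultimately have "unit (B (vec_index w) ?z)" by simp
        moreover have "?z (star x) - e i (star x) \<in> idl 1" if x: "x < n" "hpos 0 l x < 2 * i" for x
        proof -
          have "star x \<noteq> star a" using hp[OF x(1)] hp[OF a(1)] x a by auto
          then show ?thesis using ne[OF x] by (simp add: e_def)
        qed
        moreover have "?z k \<in> R" for k by (intro add_mem mult_mem one_mem e_R)
        moreover have "unit (?z (l + i))" using b(3) unit_1 by (simp add: e_def)
        ultimately show "unit (w $ (l + i)) \<or> (\<exists>z. (\<forall>i<n. z i \<in> R) \<and> unit (z (l + i)) \<and> unit (B (vec_index w) z) \<and>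
          (\<forall>x<n. hpos 0 l x < 2 * i \<longrightarrow> z (star x) - e i (star x) \<in> idl 1))"
          by (intro disjI2 exI[of _ ?z]) blast
      qed
    qed
  qed
  moreover have "card ?W = q ^ card ({..<n} - ?I) - q ^ card ({..<n} - (?I \<union> ?J))"
    by (rule card_primitive) auto
  moreover have "{..<n} - (?I \<union> ?J) = {}" "{..<n} - ?I = ?J" by auto
  moreover have "card ?J = 2 * (l - i)" using card_hpos_ge[of "2 * i" 0 l] i n by simp
  ultimately show ?thesis by (simp only: card.empty power_0)
qed

text \<open>Besides the whole pairs, e_i itself is already fixed, which prescribes entry l + i to be
  1. The other 2(l - i) - 1 coordinates are free, and the vector is then automatically
  nonzero.\<close>

lemma card_symplectic_orb_odd:
  assumes eps: "\<epsilon> = - 1" and n: "n = 2 * l" and st: "\<And>x. star x = hstar 0 l x" and i: "i < l"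
  shows "card (matgrp.orb R \<pi> n iso (hord 0 l) (2 * i + 1)) = q ^ (2 * (l - i) - 1)"
proof -
  let ?j = "2 * i + 1"
  let ?O = "matgrp.orb R \<pi> n iso (hord 0 l) ?j"
  let ?S = "\<lambda>r. if hpos 0 l r < 2 * i then {red 1 0} else if r = l + i then {red 1 1} else red 1 ` R"
  let ?W = "{w :: 'k vec. w \<in> carrier_vec n \<and> (\<forall>r<n. w $ r \<in> ?S r)}"
  have c: "hord 0 l ?j = l + i" "i < n" "?j < n" "star i = l + i" "star (l + i) = i" "l + i < n" "hpos 0 l i = 2 * i" "hpos 0 l (l + i) = ?j"
    using hord_odd[of 0 l i] i n by (auto simp: st hstar_def hpos_def)
  have hp: "hpos 0 l (star x) < 2 * i \<longleftrightarrow> hpos 0 l x < 2 * i" if "x < n" for x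
    using hpos_hstar[of x 0 l i] that n by (simp add: st)
  have Sc: "x < n \<Longrightarrow> hpos 0 l x < ?j \<Longrightarrow> x = i \<or> hpos 0 l x < 2 * i" for x
    using hord_hpos[of x 0 l] hord_even[of 0 l i] n by (cases "hpos 0 l x = 2 * i") auto
  have "?O = ?W"
  proof (intro equalityI subsetI)
    fix w assume w: "w \<in> ?O"
    obtain g where g: "g \<in> iso" "w \<in> carrier_vec n" "\<And>r. r < n \<Longrightarrow> w $ r \<in> red 1 ` R"
      by (rule orb_memD[OF w]) (use c in auto)
    have "w $ r \<in> ?S r" if r: "r < n" for r
    proof -
      have *: "w $ r - e (l + i) r \<in> idl 1" if "hpos 0 l (star r) < ?j"
        using symplectic_orb_low[OF n st c(3) w star_lt[OF r] that] star_star[OF r] c(1) by simp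
      have "w $ r \<in> idl 1" if "hpos 0 l r < 2 * i"
        using * that hp[OF r] c(8) by (cases "r = l + i") (auto simp: e_def)
      moreover have "w $ r = red 1 1" if "r = l + i"
      proof -
        have "w $ r - 1 \<in> idl 1" using * that c(5,7) by (simp add: e_def)
        then have "red 1 (w $ r) = red 1 1" using red_eq_iff[OF red_in_R[OF g(3)[OF r]] one_mem] by simp
        then show ?thesis using red_fixed[OF g(3)[OF r]] by simp
      qed
      ultimately show ?thesis using red_zero_iff[OF g(3)[OF r]] g(3)[OF r] by auto
    qed
    then show "w \<in> ?W" using g(2) by blast
  next
    fix w assume w: "w \<in> ?W"
    have wc: "w \<in> carrier_vec n" using w by simp
    have wS: "w $ r \<in> ?S r" if "r < n" for r using w that by blast
    have wred: "w $ r \<in> red 1 ` R" if "r < n" for r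
      using wS[OF that] zero_mem one_mem by (auto split: if_splits)
    have low: "w $ r \<in> idl 1" if r: "r < n" "hpos 0 l r < 2 * i" for r
      using wS[OF r(1)] r red_zero_iff[OF wred[OF r(1)]] by simp
    have wR: "vec_index w r \<in> R" if "r < n" for r using red_in_R[OF wred[OF that]] .
    have w1: "w $ (l + i) - 1 \<in> idl 1"
      using wS[OF c(6)] c(8) red_cong[OF one_mem, of 1] idl_commute by simp
    have un: "unit (w $ (l + i))"
      by (rule unit_cong[OF unit_1 wR[OF c(6)]]) (use w1 idl_commute in blast)
    show "w \<in> ?O"
    proof (rule symplectic_orb_memI[OF eps n st c(3) wc wred])
      show "w $ star x - e (hord 0 l ?j) (star x) \<in> idl 1" if x: "x < n" "hpos 0 l x < ?j" for x
      proof (cases "x = i")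
        case True
        then show ?thesis unfolding c(1) using w1 c(4) by (simp add: e_def)
      next
        case False
        then have h: "hpos 0 l (star x) < 2 * i" using Sc[OF x] hp[OF x(1)] by simp
        then have "star x \<noteq> l + i" using c(8) by auto
        then show ?thesis unfolding c(1) using low[OF star_lt[OF x(1)] h] by (simp add: e_def)
      qed
      show "unit (w $ star (hord 0 l ?j)) \<or> (\<exists>z. (\<forall>i<n. z i \<in> R) \<and> unit (z (star (hord 0 l ?j))) \<and> unit (B (vec_index w) z) \<and>
        (\<forall>x<n. hpos 0 l x < ?j \<longrightarrow> z (star x) - e (hord 0 l ?j) (star x) \<in> idl 1))"
        unfolding c(1) c(5)
      proof (cases "unit (w $ i)")
        case False
        then have nu: "w $ i \<in> idl 1" using unit_iff wR c by auto
        \<comment> \<open>The pairing with w is dominated by the unit entry w_(l+i), and the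
          coordinate 1 at i pairs with e_(l+i).\<close>
        let ?z = "\<lambda>k. e (l + i) k + 1 * e i k"
        have "B (vec_index w) ?z = sg i * w $ i + 1 * (sg (l + i) * w $ (l + i))"
          unfolding B_right B_e_right[OF c(6)] B_e_right[OF c(2)] c(5) c(4) ..
        moreover have "unit (sg i * w $ i + 1 * (sg (l + i) * w $ (l + i)))"
        proof (rule unit_cong[OF unit_mult[OF sg_unit[OF c(6)] un]])
          show "sg i * w $ i + 1 * (sg (l + i) * w $ (l + i)) \<in> R"
            using sg_R[OF c(2)] sg_R[OF c(6)] wR[OF c(2)] wR[OF c(6)] by (intro add_mem mult_mem one_mem)
          have "sg i * w $ i \<in> idl 1" by (rule idl_mult_left[OF sg_R[OF c(2)] nu])
          then show "sg (l + i) * w $ (l + i) - (sg i * w $ i + 1 * (sg (l + i) * w $ (l + i))) \<in> idl 1" using idl_uminus by simp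
        qed
        ultimately have "unit (B (vec_index w) ?z)" by simp
        moreover have "?z (star x) - e (l + i) (star x) \<in> idl 1" if x: "x < n" "hpos 0 l x < ?j" for x
        proof -
          have "star x \<noteq> i" using star_eq_iff[OF x(1) c(2)] c(4) c(8) x(2) by auto
          then show ?thesis by (simp add: e_def)
        qed
        moreover have "?z k \<in> R" for k by (intro add_mem mult_mem one_mem e_R)
        moreover have "unit (?z i)" using unit_1 i by (simp add: e_def)
        ultimately show "unit (w $ i) \<or> (\<exists>z. (\<forall>i<n. z i \<in> R) \<and> unit (z i) \<and> unit (B (vec_index w) z) \<and>
          (\<forall>x<n. hpos 0 l x < ?j \<longrightarrow> z (star x) - e (l + i) (star x) \<in> idl 1))"
          by (intro disjI2 exI[of _ ?z]) blast
      qed blast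
    qed
  qed
  moreover have "card ?W = (\<Prod>r<n. card (?S r))"
  proof (rule card_vec_prod)
    show "finite (?S r)" for r by (simp add: red_1_card(2))
  qed
  moreover have "(\<Prod>r<n. card (?S r)) = (\<Prod>r<n. if r \<in> {r. r < n \<and> 2 * i \<le> hpos 0 l r} - {l + i} then q else 1)"
  proof (rule prod.cong[OF refl])
    fix r assume r: "r \<in> {..<n}"
    show "card (?S r) = (if r \<in> {r. r < n \<and> 2 * i \<le> hpos 0 l r} - {l + i} then q else 1)"
    proof (cases "hpos 0 l r < 2 * i")
      case False
      then show ?thesis using r red_1_card(1) by simp
    qed simp
  qed
  moreover have "\<dots> = q ^ card ({r. r < n \<and> 2 * i \<le> hpos 0 l r} - {l + i})"
  proof -
    have "{r. r < n \<and> 2 * i \<le> hpos 0 l r} - {l + i} \<subseteq> {..<n}" by auto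
    then show ?thesis by (simp only: prod.inter_restrict[symmetric, OF finite_lessThan] Int_absorb1 prod_constant)
  qed
  moreover have "card ({r. r < n \<and> 2 * i \<le> hpos 0 l r} - {l + i}) = 2 * (l - i) - 1"
    using card_hpos_ge[of "2 * i" 0 l] i n c(6,8) by (simp add: card_Diff_singleton)
  ultimately show ?thesis by (simp only:)
qed

lemma card_symplectic_residue:
  assumes eps: "\<epsilon> = - 1" and n: "n = 2 * l" and st: "\<And>x. star x = hstar 0 l x"
  shows "card (redm 1 ` iso) = (\<Prod>i<l. (q ^ (2 * (l - i)) - 1) * q ^ (2 * (l - i) - 1))"
proof -
  have "bij_betw (hord 0 l) {..<n} {..<n}" using hord_bij[of 0 l] n by simp
  then have "card (redm 1 ` iso) = (\<Prod>j<0 + 2 * l. card (matgrp.orb R \<pi> n iso (hord 0 l) j))"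
    using matgrp.card_residue_chain[OF iso_matgrp] n by simp
  also have "\<dots> = (\<Prod>i<l. (q ^ (2 * (l - i)) - 1) * q ^ (2 * (l - i) - 1))"
    unfolding prod_pairs
    using card_symplectic_orb_even[OF eps n st] card_symplectic_orb_odd[OF eps n st] by simp
  finally show ?thesis .
qed

end

subsection \<open>Counting solutions of diagonal quadratic equations\<close>

context dvr
begin

abbreviation T :: "'k set" where "T \<equiv> red 1 ` R"

lemma idl_cong_iff: "x - y \<in> idl M \<Longrightarrow> x \<in> idl M \<longleftrightarrow> y \<in> idl M"
  using idl_diff[of x M "x - y"] idl_add[of "x - y" M y] by auto

lemma T_R: "t \<in> T \<Longrightarrow> t \<in> R" using red_in_R .

text \<open>Solutions over the residue field of the diagonal quadratic equation, as functions with
  values in the representatives T; extensionality makes each solution a single function.\<close>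

definition qsol :: "(nat \<Rightarrow> 'k) \<Rightarrow> nat set \<Rightarrow> 'k \<Rightarrow> (nat \<Rightarrow> 'k) set" where
  "qsol a I d = {f \<in> PiE I (\<lambda>_. T). (\<Sum>i\<in>I. a i * f i ^ 2) - d \<in> idl 1}"

lemma finite_qsol: "finite I \<Longrightarrow> finite (qsol a I d)"
  unfolding qsol_def by (rule finite_subset[of _ "PiE I (\<lambda>_. T)"]) (auto intro: finite_PiE red_1_card(2))

lemma card_qsol_empty: "card (qsol a {} d) = (if d \<in> idl 1 then 1 else 0)"
  using idl_uminus[of d 1] idl_uminus[of "- d" 1] by (auto simp: qsol_def)

lemma card_qsol_insert:
  assumes "finite I" "j \<notin> I"
  shows "card (qsol a (insert j I) d) = (\<Sum>t\<in>T. card (qsol a I (d - a j * t ^ 2)))"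
proof -
  have s: "(\<Sum>i\<in>I. a i * (f(j := t)) i ^ 2) = (\<Sum>i\<in>I. a i * f i ^ 2)" for f t
    using assms(2) by (intro sum.cong) auto
  have e: "(\<Sum>i\<in>insert j I. a i * f i ^ 2) - d = (\<Sum>i\<in>I. a i * f i ^ 2) - (d - a j * f j ^ 2)" for f
    using assms by simp
  have "bij_betw (\<lambda>(t, f). f(j := t)) (SIGMA t:T. qsol a I (d - a j * t ^ 2)) (qsol a (insert j I) d)"
  proof (rule bij_betw_byWitness[where f' = "\<lambda>f. (f j, f(j := undefined))"])
    show "\<forall>p\<in>SIGMA t:T. qsol a I (d - a j * t ^ 2).
        (((\<lambda>(t, f). f(j := t)) p) j, ((\<lambda>(t, f). f(j := t)) p)(j := undefined)) = p"
    proof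
      fix p assume "p \<in> (SIGMA t:T. qsol a I (d - a j * t ^ 2))"
      then obtain t f where p: "p = (t, f)" "f \<in> PiE I (\<lambda>_. T)" by (auto simp: qsol_def)
      then have "f j = undefined" using assms(2) by auto
      then have "f(j := undefined) = f" by auto
      then show "(((\<lambda>(t, f). f(j := t)) p) j, ((\<lambda>(t, f). f(j := t)) p)(j := undefined)) = p" using p by simp
    qed
    show "\<forall>f\<in>qsol a (insert j I) d. (\<lambda>(t, f). f(j := t)) (f j, f(j := undefined)) = f" by simp
    show "(\<lambda>(t, f). f(j := t)) ` (SIGMA t:T. qsol a I (d - a j * t ^ 2)) \<subseteq> qsol a (insert j I) d"
    proof
      fix g assume "g \<in> (\<lambda>(t, f). f(j := t)) ` (SIGMA t:T. qsol a I (d - a j * t ^ 2))"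
      then obtain t f where g: "g = f(j := t)" "t \<in> T" "f \<in> PiE I (\<lambda>_. T)" "(\<Sum>i\<in>I. a i * f i ^ 2) - (d - a j * t ^ 2) \<in> idl 1"
        by (auto simp: qsol_def)
      have "g \<in> PiE (insert j I) (\<lambda>_. T)" unfolding g(1) by (rule PiE_fun_upd[OF g(2,3)])
      moreover have "(\<Sum>i\<in>insert j I. a i * g i ^ 2) - d \<in> idl 1" unfolding e using g s by simp
      ultimately show "g \<in> qsol a (insert j I) d" by (simp only: qsol_def mem_Collect_eq)
    qed
    show "(\<lambda>f. (f j, f(j := undefined))) ` qsol a (insert j I) d \<subseteq> (SIGMA t:T. qsol a I (d - a j * t ^ 2))"
    proof
      fix p assume "p \<in> (\<lambda>f. (f j, f(j := undefined))) ` qsol a (insert j I) d"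
      then obtain f where f: "p = (f j, f(j := undefined))" "f \<in> PiE (insert j I) (\<lambda>_. T)"
        "(\<Sum>i\<in>insert j I. a i * f i ^ 2) - d \<in> idl 1"
        unfolding qsol_def by blast
      have "f(j := undefined) \<in> PiE I (\<lambda>_. T)" using f(2) assms(2) by (auto simp: PiE_iff extensional_def)
      moreover have "f j \<in> T" by (rule PiE_mem[OF f(2)]) simp
      moreover have "(\<Sum>i\<in>I. a i * (f(j := undefined)) i ^ 2) - (d - a j * f j ^ 2) \<in> idl 1"
        using f(3) unfolding e s .
      ultimately show "p \<in> (SIGMA t:T. qsol a I (d - a j * t ^ 2))" unfolding f(1) qsol_def by blast
    qed
  qed
  from bij_betw_same_card[OF this] show ?thesis using finite_qsol[OF assms(1)] red_1_card(2) by (simp add: card_SigmaI)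
qed

lemma linear_count:
  assumes "unit \<alpha>" "\<beta> \<in> R" shows "(\<Sum>s\<in>T. if \<beta> - \<alpha> * s \<in> idl 1 then 1 else 0) = (1 :: nat)"
proof -
  define x where "x = \<beta> / \<alpha>"
  have x: "x \<in> R" "\<beta> = \<alpha> * x" using unit_divide_mem[OF assms(2,1)] unit_nz[OF assms(1)] by (auto simp: x_def)
  have "\<beta> - \<alpha> * s \<in> idl 1 \<longleftrightarrow> s = red 1 x" if s: "s \<in> T" for s
  proof -
    have "\<beta> - \<alpha> * s \<in> idl 1 \<longleftrightarrow> x - s \<in> idl 1"
      using idl_unit_cancel[OF assms(1), of "x - s" 1] idl_mult_left[OF unit_R[OF assms(1)], of "x - s" 1] x(2)
      by (auto simp: right_diff_distrib)
    also have "\<dots> \<longleftrightarrow> red 1 x = red 1 s" using red_eq_iff[OF x(1) T_R[OF s]] by simp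
    finally show ?thesis using red_fixed[OF s] by auto
  qed
  then have "(\<Sum>s\<in>T. if \<beta> - \<alpha> * s \<in> idl 1 then 1 else 0) = (\<Sum>s\<in>T. if s = red 1 x then 1 else 0 :: nat)"
    by (intro sum.cong) auto
  then show ?thesis using red_1_card(2) x(1) by simp
qed

lemma translate_bij: assumes s: "s \<in> R" shows "bij_betw (\<lambda>x. red 1 (x + s)) T T"
proof (rule bij_betw_byWitness[where f' = "\<lambda>x. red 1 (x - s)"])
  show "\<forall>x\<in>T. red 1 (red 1 (x + s) - s) = x"
  proof
    fix x assume x: "x \<in> T"
    have "x + s - red 1 (x + s) \<in> idl 1" by (rule red_cong[OF add_mem[OF T_R[OF x] s]])
    then have "red 1 (x + s) - s - x \<in> idl 1" using idl_uminus by (force simp: algebra_simps)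
    then have "red 1 (red 1 (x + s) - s) = red 1 x"
      using red_eq_iff[OF diff_mem[OF red_mem[OF add_mem[OF T_R[OF x] s]] s] T_R[OF x]] by simp
    then show "red 1 (red 1 (x + s) - s) = x" using red_fixed[OF x] by simp
  qed
  show "\<forall>x\<in>T. red 1 (red 1 (x - s) + s) = x"
  proof
    fix x assume x: "x \<in> T"
    have "x - s - red 1 (x - s) \<in> idl 1" by (rule red_cong[OF diff_mem[OF T_R[OF x] s]])
    then have "red 1 (x - s) + s - x \<in> idl 1" using idl_uminus by (force simp: algebra_simps)
    then have "red 1 (red 1 (x - s) + s) = red 1 x"
      using red_eq_iff[OF add_mem[OF red_mem[OF diff_mem[OF T_R[OF x] s]] s] T_R[OF x]] by simp
    then show "red 1 (red 1 (x - s) + s) = x" using red_fixed[OF x] by simp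
  qed
qed (use s add_mem diff_mem T_R in auto)

text \<open>Substituting \<open>t = x + s\<close> makes the equation linear in \<open>s\<close>.\<close>

lemma hyperbolic_count:
  assumes two: "unit 2" and a: "unit a" and d: "d \<in> R"
  shows "(\<Sum>t\<in>T. \<Sum>s\<in>T. if d - a * t ^ 2 + a * s ^ 2 \<in> idl 1 then 1 else 0) = q - 1 + (if d \<in> idl 1 then q else 0)"
proof -
  note aR = unit_R[OF a]
  have "(\<Sum>t\<in>T. \<Sum>s\<in>T. if d - a * t ^ 2 + a * s ^ 2 \<in> idl 1 then 1 else 0)
      = (\<Sum>s\<in>T. \<Sum>t\<in>T. if d - a * t ^ 2 + a * s ^ 2 \<in> idl 1 then 1 else 0 :: nat)" by (rule sum.swap)
  also have "\<dots> = (\<Sum>s\<in>T. \<Sum>x\<in>T. if (d - a * x ^ 2) - (2 * a * x) * s \<in> idl 1 then 1 else 0)"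
  proof (rule sum.cong[OF refl])
    fix s assume s: "s \<in> T"
    have "(\<Sum>t\<in>T. if d - a * t ^ 2 + a * s ^ 2 \<in> idl 1 then 1 else 0 :: nat)
        = (\<Sum>x\<in>T. if d - a * red 1 (x + s) ^ 2 + a * s ^ 2 \<in> idl 1 then 1 else 0)"
      by (rule sum.reindex_bij_betw[OF translate_bij[OF T_R[OF s]], symmetric])
    also have "\<dots> = (\<Sum>x\<in>T. if (d - a * x ^ 2) - (2 * a * x) * s \<in> idl 1 then 1 else 0)"
    proof (rule sum.cong[OF refl])
      fix x assume x: "x \<in> T"
      let ?y = "x + s" and ?z = "red 1 (x + s)"
      have yR: "?y \<in> R" by (rule add_mem[OF T_R[OF x] T_R[OF s]])
      have "?y * ?y - ?z * ?z \<in> idl 1" by (rule mult_cong[OF yR red_mem[OF yR] red_cong[OF yR] red_cong[OF yR]])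
      then have *: "a * (?y * ?y - ?z * ?z) \<in> idl 1" by (rule idl_mult_left[OF aR])
      have e: "(d - a * ?z ^ 2 + a * s ^ 2) - ((d - a * x ^ 2) - (2 * a * x) * s) = a * (?y * ?y - ?z * ?z)"
        by (simp add: power2_eq_square algebra_simps)
      have "d - a * ?z ^ 2 + a * s ^ 2 \<in> idl 1 \<longleftrightarrow> (d - a * x ^ 2) - (2 * a * x) * s \<in> idl 1"
        by (rule idl_cong_iff) (use * e in simp)
      then show "(if d - a * ?z ^ 2 + a * s ^ 2 \<in> idl 1 then 1 else 0 :: nat)
        = (if (d - a * x ^ 2) - (2 * a * x) * s \<in> idl 1 then 1 else 0)" by simp
    qed
    finally show "(\<Sum>t\<in>T. if d - a * t ^ 2 + a * s ^ 2 \<in> idl 1 then 1 else 0 :: nat)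
      = (\<Sum>x\<in>T. if (d - a * x ^ 2) - (2 * a * x) * s \<in> idl 1 then 1 else 0)" .
  qed
  also have "\<dots> = (\<Sum>x\<in>T. \<Sum>s\<in>T. if (d - a * x ^ 2) - (2 * a * x) * s \<in> idl 1 then 1 else 0)" by (rule sum.swap)
  \<comment> \<open>In the zero class of x the coefficient of s vanishes and either all s or none
    are solutions; for every other x exactly one s is.\<close>
  also have "\<dots> = (\<Sum>x\<in>T. if x = red 1 0 then (if d \<in> idl 1 then q else 0) else 1)"
  proof (rule sum.cong[OF refl])
    fix x assume x: "x \<in> T"
    show "(\<Sum>s\<in>T. if (d - a * x ^ 2) - (2 * a * x) * s \<in> idl 1 then 1 else 0) =
      (if x = red 1 0 then (if d \<in> idl 1 then q else 0) else 1)"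
    proof (cases "x = red 1 0")
      case True
      then have xi: "x \<in> idl 1" using red_zero_iff[OF x] by simp
      have "(d - a * x ^ 2) - (2 * a * x) * s \<in> idl 1 \<longleftrightarrow> d \<in> idl 1" if s: "s \<in> T" for s
      proof -
        have "a * (x + 2 * s) * x \<in> idl 1"
          using aR T_R[OF x] T_R[OF s] unit_R[OF two] xi by (intro idl_mult_left mult_mem add_mem)
        then have *: "a * x ^ 2 + (2 * a * x) * s \<in> idl 1" by (simp add: power2_eq_square algebra_simps)
        have e: "(d - a * x ^ 2) - (2 * a * x) * s = d - (a * x ^ 2 + (2 * a * x) * s)" by (simp add: algebra_simps)
        show ?thesis
        proof
          assume "(d - a * x ^ 2) - (2 * a * x) * s \<in> idl 1"
          from idl_add[OF this *] show "d \<in> idl 1" by (simp add: algebra_simps)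
        next
          assume "d \<in> idl 1"
          from idl_diff[OF this *] show "(d - a * x ^ 2) - (2 * a * x) * s \<in> idl 1" unfolding e .
        qed
      qed
      then have "(\<Sum>s\<in>T. if (d - a * x ^ 2) - (2 * a * x) * s \<in> idl 1 then 1 else 0) = (\<Sum>s\<in>T. if d \<in> idl 1 then 1 else 0 :: nat)"
        by (intro sum.cong) auto
      then show ?thesis using True red_1_card(1) by simp
    next
      case False
      then have "unit x" using red_zero_iff[OF x] unit_iff[OF T_R[OF x]] by simp
      then have "unit (2 * a * x)" using two a unit_mult by blast
      moreover have "d - a * x ^ 2 \<in> R" using d aR T_R[OF x] by (intro diff_mem mult_mem power_mem)
      ultimately show ?thesis using False linear_count by simp
    qed
  qed
  also have "\<dots> = (if d \<in> idl 1 then q else 0) + (\<Sum>x\<in>T - {red 1 0}. 1)"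
  proof -
    have "red 1 0 \<in> T" by (rule imageI[OF zero_mem])
    then show ?thesis
      by (subst sum.remove[OF red_1_card(2), of "red 1 0"]) (auto intro!: sum.cong)
  qed
  also have "(\<Sum>x\<in>T - {red 1 0}. 1) = q - 1"
    using red_1_card imageI[OF zero_mem, of "red 1"] by (simp add: card_Diff_singleton)
  finally show ?thesis by simp
qed

text \<open>1 - t^2 factors, the ideal is prime, and 1 and -1 are incongruent because 2 is a
  unit.\<close>

lemma square_root_count:
  assumes two: "unit 2" and a: "unit a"
  shows "(\<Sum>t\<in>T. if a - a * t ^ 2 \<in> idl 1 then 1 else 0) = (2 :: nat)"
proof -
  have mR: "- 1 \<in> R" by (rule uminus_mem[OF one_mem])
  have "a - a * t ^ 2 \<in> idl 1 \<longleftrightarrow> t \<in> {red 1 1, red 1 (- 1)}" if t: "t \<in> T" for t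
  proof -
    note tR = T_R[OF t]
    have e: "a - a * t ^ 2 = a * ((1 - t) * (- 1 - t) * - 1)" by (simp add: power2_eq_square algebra_simps)
    have "a - a * t ^ 2 \<in> idl 1 \<longleftrightarrow> (1 - t) * (- 1 - t) \<in> idl 1"
    proof
      assume "a - a * t ^ 2 \<in> idl 1"
      then have "(1 - t) * (- 1 - t) * - 1 \<in> idl 1" unfolding e by (rule idl_unit_cancel[OF a])
      then show "(1 - t) * (- 1 - t) \<in> idl 1" using idl_uminus by force
    next
      assume "(1 - t) * (- 1 - t) \<in> idl 1"
      from idl_mult_left[OF unit_R[OF a] idl_mult_right[OF this mR]] show "a - a * t ^ 2 \<in> idl 1" unfolding e .
    qed
    also have "\<dots> \<longleftrightarrow> 1 - t \<in> idl 1 \<or> - 1 - t \<in> idl 1"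
    proof
      assume "(1 - t) * (- 1 - t) \<in> idl 1"
      then show "1 - t \<in> idl 1 \<or> - 1 - t \<in> idl 1" by (rule idl_prime[OF diff_mem[OF one_mem tR] diff_mem[OF mR tR]])
    next
      assume "1 - t \<in> idl 1 \<or> - 1 - t \<in> idl 1"
      then show "(1 - t) * (- 1 - t) \<in> idl 1"
        using idl_mult_right[OF _ diff_mem[OF mR tR]] idl_mult_left[OF diff_mem[OF one_mem tR]] by fast
    qed
    also have "\<dots> \<longleftrightarrow> red 1 1 = red 1 t \<or> red 1 (- 1) = red 1 t"
      using red_eq_iff[OF one_mem tR] red_eq_iff[OF mR tR] by simp
    finally show ?thesis using red_fixed[OF t] by auto
  qed
  then have "(\<Sum>t\<in>T. if a - a * t ^ 2 \<in> idl 1 then 1 else 0) = (\<Sum>t\<in>T. if t \<in> {red 1 1, red 1 (- 1)} then 1 else 0 :: nat)"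
    by (intro sum.cong) auto
  also have "\<dots> = card (T \<inter> {red 1 1, red 1 (- 1)})"
    using sum.inter_restrict[OF red_1_card(2), of "\<lambda>_. 1 :: nat" "{red 1 1, red 1 (- 1)}"] by (simp only: card_eq_sum)
  also have "T \<inter> {red 1 1, red 1 (- 1)} = {red 1 1, red 1 (- 1)}" using one_mem mR by blast
  also have "red 1 1 \<noteq> red 1 (- 1)" using red_eq_iff[OF one_mem mR] unit_iff[OF unit_R[OF two]] two by simp
  then have "card {red 1 1, red 1 (- 1)} = 2" by simp
  finally show ?thesis .
qed

lemma card_qsol_two:
  assumes "finite I" "j \<notin> I" "j' \<notin> I" "j \<noteq> j'" and a: "a j' = - a j"
  shows "card (qsol a (insert j (insert j' I)) d) = (\<Sum>t\<in>T. \<Sum>s\<in>T. card (qsol a I (d - a j * t ^ 2 + a j * s ^ 2)))"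
proof -
  have "d - a j * t ^ 2 - a j' * s ^ 2 = d - a j * t ^ 2 + a j * s ^ 2" for s t using a by simp
  then show ?thesis using card_qsol_insert[of "insert j' I" j] card_qsol_insert[of I j'] assms by simp
qed

text \<open>The indices in the pairs from the i-th one on, that is, those still unconstrained when
  the columns of the earlier pairs are standard.\<close>

definition hpairs :: "nat \<Rightarrow> nat \<Rightarrow> nat \<Rightarrow> nat set" where
  "hpairs s l i = {x. x < s + 2 * l \<and> s + 2 * i \<le> hpos s l x}"

lemma hpairs_step:
  assumes "i < l"
  shows "hpairs s l i = insert (s + i) (insert (s + l + i) (hpairs s l (i + 1)))"
    "{x. x < s + 2 * l \<and> s + 2 * i + 1 \<le> hpos s l x} = insert (s + l + i) (hpairs s l (i + 1))"
    "s + i \<notin> hpairs s l (i + 1)" "s + l + i \<notin> hpairs s l (i + 1)" "s + i \<noteq> s + l + i"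
proof -
  show "hpairs s l i = insert (s + i) (insert (s + l + i) (hpairs s l (i + 1)))"
    using assms by (auto simp: hpairs_def hpos_def; presburger)
  show "{x. x < s + 2 * l \<and> s + 2 * i + 1 \<le> hpos s l x} = insert (s + l + i) (hpairs s l (i + 1))"
    using assms by (auto simp: hpairs_def hpos_def; presburger)
qed (use assms in \<open>auto simp: hpairs_def hpos_def\<close>)

lemma finite_hpairs: "finite (hpairs s l i)"
  by (rule finite_subset[of _ "{..<s + 2 * l}"]) (auto simp: hpairs_def)

text \<open>A sum of t hyperbolic planes takes a value d exactly q^(2t-1) - q^(t-1) times, plus q^t
  if d = 0. Multiplying by q and working in \<open>int\<close> removes negative exponents and
  truncation, so that the induction can start at t = 0 and strip one plane by
  \<open>hyperbolic_count\<close>.\<close>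

lemma card_qsol_hpairs:
  assumes two: "unit 2" and a: "\<And>i. i < l \<Longrightarrow> unit (a (s + i))" "\<And>i. i < l \<Longrightarrow> a (s + l + i) = - a (s + i)"
    and t: "t \<le> l" and d: "d \<in> R"
  shows "int q * int (card (qsol a (hpairs s l (l - t)) d)) = int q ^ (2 * t) - int q ^ t + (if d \<in> idl 1 then int q ^ (t + 1) else 0)"
  using t d
proof (induction t arbitrary: d)
  case 0
  have "hpairs s l l = {}" by (auto simp: hpairs_def hpos_def)
  then show ?case by (simp add: card_qsol_empty)
next
  case (Suc t)
  let ?i = "l - Suc t"
  have i: "?i < l" "?i + 1 = l - t" using Suc by auto
  note aR = unit_R[OF a(1)[OF i(1)]]
  have dR: "d - a (s + ?i) * x ^ 2 + a (s + ?i) * y ^ 2 \<in> R" if "x \<in> T" "y \<in> T" for x y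
    using aR T_R that Suc(3) by (intro add_mem diff_mem mult_mem power_mem) auto
  have "card (qsol a (hpairs s l ?i) d) =
      (\<Sum>x\<in>T. \<Sum>y\<in>T. card (qsol a (hpairs s l (l - t)) (d - a (s + ?i) * x ^ 2 + a (s + ?i) * y ^ 2)))"
    unfolding hpairs_step(1)[OF i(1)] i(2)[symmetric]
    by (rule card_qsol_two[where j = "s + ?i" and j' = "s + l + ?i", OF finite_hpairs hpairs_step(3,4,5)[OF i(1)] a(2)[OF i(1)]])
  then have "int q * int (card (qsol a (hpairs s l ?i) d)) =
      (\<Sum>x\<in>T. \<Sum>y\<in>T. int q * int (card (qsol a (hpairs s l (l - t)) (d - a (s + ?i) * x ^ 2 + a (s + ?i) * y ^ 2))))"
    by (simp only: of_nat_sum sum_distrib_left)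
  also have "\<dots> = (\<Sum>x\<in>T. \<Sum>y\<in>T. int q ^ (2 * t) - int q ^ t + int q ^ (t + 1) *
      int (if d - a (s + ?i) * x ^ 2 + a (s + ?i) * y ^ 2 \<in> idl 1 then 1 else 0))"
    by (intro sum.cong refl, subst Suc.IH) (use dR Suc(2) in auto)
  also have "\<dots> = int q ^ 2 * (int q ^ (2 * t) - int q ^ t) + int q ^ (t + 1) *
      int (\<Sum>x\<in>T. \<Sum>y\<in>T. if d - a (s + ?i) * x ^ 2 + a (s + ?i) * y ^ 2 \<in> idl 1 then 1 else 0)"
    by (simp only: sum.distrib sum_distrib_left[symmetric] of_nat_sum sum_constant red_1_card(1) power2_eq_square mult.assoc)
  also have "\<dots> = int q ^ 2 * (int q ^ (2 * t) - int q ^ t) + int q ^ (t + 1) * int (q - 1 + (if d \<in> idl 1 then q else 0))"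
    unfolding hyperbolic_count[OF two a(1)[OF i(1)] Suc(3)] ..
  also have "\<dots> = int q ^ (2 * Suc t) - int q ^ Suc t + (if d \<in> idl 1 then int q ^ (Suc t + 1) else 0)"
    using q_gt_1 by (simp add: of_nat_diff power_add power2_eq_square algebra_simps)
  finally show ?case .
qed

lemma card_qsol_hpairs_unit:
  assumes two: "unit 2" and a: "\<And>i. i < l \<Longrightarrow> unit (a (s + i))" "\<And>i. i < l \<Longrightarrow> a (s + l + i) = - a (s + i)"
    and i: "i < l" and d: "unit d"
  shows "card (qsol a (hpairs s l i) d) = q ^ (l - i - 1) * (q ^ (l - i) - 1)"
proof -
  obtain t where t: "l - i = Suc t" using i by (cases "l - i") auto
  have di: "d \<notin> idl 1" using unit_iff[OF unit_R[OF d]] d by simp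
  have "int q * int (card (qsol a (hpairs s l (l - Suc t)) d)) = int q ^ (2 * Suc t) - int q ^ Suc t"
    using card_qsol_hpairs[where a = a and s = s and l = l and t = "Suc t", OF two a _ unit_R[OF d]] di t i by simp
  also have "int q ^ (2 * Suc t) = int q ^ Suc t * int q ^ Suc t" by (simp only: mult_2 power_add)
  also have "int q ^ Suc t * int q ^ Suc t - int q ^ Suc t = int q * (int q ^ t * (int q ^ Suc t - 1))" by (simp add: algebra_simps)
  finally have *: "int q * int (card (qsol a (hpairs s l (l - Suc t)) d)) = int q * (int q ^ t * (int q ^ Suc t - 1))" .
  have li: "l - Suc t = i" "l - i - 1 = t" using t i by linarith+
  have "int q \<noteq> 0" using q_gt_1 by simp
  from mult_left_cancel[OF this, THEN iffD1, OF *]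
  have "int (card (qsol a (hpairs s l i) d)) = int q ^ t * (int q ^ Suc t - 1)" unfolding li .
  also have "\<dots> = int (q ^ t * (q ^ Suc t - 1))"
  proof -
    have "1 \<le> q ^ Suc t" by (rule one_le_power) (use q_gt_1 in simp)
    then show ?thesis by (simp only: of_nat_mult of_nat_power of_nat_diff of_nat_1)
  qed
  finally show ?thesis unfolding li(2) unfolding t by (simp only: of_nat_eq_iff)
qed

text \<open>Sum over the extra coordinate x: the value left for the planes is zero exactly for x = 1
  and x = -1, which turns - q^t into + q^t.\<close>

lemma card_qsol_insert_hpairs:
  assumes two: "unit 2" and a: "\<And>i. i < l \<Longrightarrow> unit (a (s + i))" "\<And>i. i < l \<Longrightarrow> a (s + l + i) = - a (s + i)"
    and i: "i \<le> l" and j: "j \<notin> hpairs s l i" "unit (a j)"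
  shows "card (qsol a (insert j (hpairs s l i)) (a j)) = q ^ (l - i) * (q ^ (l - i) + 1)"
proof -
  let ?t = "l - i"
  have W: "int q * int (card (qsol a (hpairs s l i) d)) = int q ^ (2 * ?t) - int q ^ ?t + int q ^ (?t + 1) * int (if d \<in> idl 1 then 1 else 0)"
    if "d \<in> R" for d
    using card_qsol_hpairs[where a = a and s = s and l = l and t = ?t, OF two a _ that] i by simp
  have "int q * int (card (qsol a (insert j (hpairs s l i)) (a j))) =
      (\<Sum>x\<in>T. int q * int (card (qsol a (hpairs s l i) (a j - a j * x ^ 2))))"
    unfolding card_qsol_insert[OF finite_hpairs j(1)] by (simp only: of_nat_sum sum_distrib_left)
  also have "\<dots> = (\<Sum>x\<in>T. int q ^ (2 * ?t) - int q ^ ?t + int q ^ (?t + 1) * int (if a j - a j * x ^ 2 \<in> idl 1 then 1 else 0))"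
    using unit_R[OF j(2)] T_R by (intro sum.cong refl W diff_mem mult_mem power_mem) auto
  also have "\<dots> = int q * (int q ^ (2 * ?t) - int q ^ ?t) + int q ^ (?t + 1) * int (\<Sum>x\<in>T. if a j - a j * x ^ 2 \<in> idl 1 then 1 else 0)"
    by (simp only: sum.distrib sum_distrib_left[symmetric] of_nat_sum sum_constant red_1_card(1))
  also have "int q ^ (2 * ?t) = int q ^ ?t * int q ^ ?t" by (simp only: mult_2 power_add)
  also have "int q * (int q ^ ?t * int q ^ ?t - int q ^ ?t) +
      int q ^ (?t + 1) * int (\<Sum>x\<in>T. if a j - a j * x ^ 2 \<in> idl 1 then 1 else 0) = int q * int (q ^ ?t * (q ^ ?t + 1))"
    unfolding square_root_count[OF two j(2)] of_nat_mult of_nat_power of_nat_add of_nat_1 power_add power_one_right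
    by (simp add: algebra_simps)
  finally have *: "int q * int (card (qsol a (insert j (hpairs s l i)) (a j))) = int q * int (q ^ ?t * (q ^ ?t + 1))" .
  have "int q \<noteq> 0" using q_gt_1 by simp
  from mult_left_cancel[OF this, THEN iffD1, OF *] show ?thesis by (simp only: of_nat_eq_iff)
qed

end

subsection \<open>The orthogonal group of a diagonal form over the residue field\<close>

context sform
begin

text \<open>The reflection along u adds -2 B(u,v)/B(u,u) times u to v; the coefficient is congruent
  to 1 in the first case and to 0 in the second.\<close>

lemma reflection_cong:
  assumes eps: "\<epsilon> = 1" and u: "\<And>i. i < n \<Longrightarrow> u i \<in> R" "unit (B u u)" and i: "i < n"
  shows "B u u + 2 * B u v \<in> idl 1 \<Longrightarrow> act (tau u (- 2 / B u u)) v i - (v i + u i) \<in> idl 1"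
    and "B u v \<in> idl 1 \<Longrightarrow> act (tau u (- 2 / B u u)) v i - v i \<in> idl 1"
proof -
  have cR: "1 / B u u \<in> R" "- 2 / B u u \<in> R"
    using unit_divide_mem[OF one_mem u(2)] unit_divide_mem[OF uminus_mem[OF unit_R[OF two]] u(2)] .
  have "act (tau u (- 2 / B u u)) v i - (v i + u i) = - (1 / B u u) * (B u u + 2 * B u v) * u i"
    unfolding act_tau[OF i] using unit_nz[OF u(2)] by (simp add: field_simps)
  then show "B u u + 2 * B u v \<in> idl 1 \<Longrightarrow> act (tau u (- 2 / B u u)) v i - (v i + u i) \<in> idl 1"
    using idl_mult_right[OF idl_mult_left[OF uminus_mem[OF cR(1)]] u(1)[OF i]] by simp
  show "B u v \<in> idl 1 \<Longrightarrow> act (tau u (- 2 / B u u)) v i - v i \<in> idl 1"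
    unfolding act_tau[OF i] using idl_mult_right[OF idl_mult_left[OF cR(2)] u(1)[OF i]] by simp
qed

text \<open>One of the vectors \<open>w - e c\<close> and \<open>w + e c\<close> has unit norm; the reflection along it, preceded in the
  second case by the reflection along \<open>e c\<close>, moves \<open>e c\<close> to \<open>w\<close>.\<close>

lemma diagonal_transitive:
  assumes eps: "\<epsilon> = 1" and st: "\<And>x. x < n \<Longrightarrow> star x = x" and c: "c < n" and wR: "\<And>i. i < n \<Longrightarrow> w i \<in> R"
    and N: "B w w - sg c \<in> idl 1" and F: "\<And>x. x \<in> F \<Longrightarrow> x < n \<and> x \<noteq> c \<and> w x \<in> idl 1"
  obtains g where "g \<in> iso" "\<And>i. i < n \<Longrightarrow> act g (e c) i - w i \<in> idl 1"
    "\<And>x i. x \<in> F \<Longrightarrow> i < n \<Longrightarrow> act g (e x) i - e x i \<in> idl 1"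
proof -
  let ?e = "e c"
  have Bs: "B ?e w = B w ?e" using B_sym[of ?e w] unfolding eps by simp
  have Bee: "B ?e ?e = sg c" using B_e_e[OF c c] st[OF c] by simp
  have Fe: "B ?e (e x) = 0" if "x \<in> F" for x using B_e_e[OF c, of x] F[OF that] st[OF c] by simp
  have Fw: "B w (e x) \<in> idl 1" if "x \<in> F" for x
    using idl_mult_left[OF sg_R, of x "w x" 1] F[OF that] B_e_right[of x w] st[of x] by simp
  let ?u = "\<lambda>i. w i + (- 1) * ?e i" and ?v = "\<lambda>i. w i + 1 * ?e i"
  have R: "?u i \<in> R" "?v i \<in> R" if "i < n" for i
    using add_mem[OF wR[OF that] mult_mem[OF uminus_mem[OF one_mem] e_R]] add_mem[OF wR[OF that] mult_mem[OF one_mem e_R]] .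
  have Bu: "B ?u ?u = B w w - 2 * B w ?e + sg c" "B ?v ?v = B w w + 2 * B w ?e + sg c"
    "B ?u ?e = B w ?e - sg c" "B ?v ?e = B w ?e + sg c"
    unfolding B_left B_right Bs Bee by (simp_all add: algebra_simps)
  \<comment> \<open>The two norms add up to 4 times \<open>sg c\<close> modulo \<open>\<pi>\<close>,
    a unit, so they are not both divisible by \<open>\<pi>\<close>.\<close>
  have "unit (B ?u ?u) \<or> unit (B ?v ?v)"
  proof (rule ccontr)
    assume "\<not> (unit (B ?u ?u) \<or> unit (B ?v ?v))"
    then have "B ?u ?u \<in> idl 1" "B ?v ?v \<in> idl 1" using unit_iff B_mem[of ?u ?u] B_mem[of ?v ?v] R by blast+
    then have "B ?u ?u + B ?v ?v - 2 * (B w w - sg c) \<in> idl 1"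
      using idl_mult_left[OF unit_R[OF two] N] by (intro idl_diff idl_add)
    moreover have "B ?u ?u + B ?v ?v - 2 * (B w w - sg c) = 2 * 2 * sg c" unfolding Bu by (simp add: algebra_simps)
    ultimately have "2 * 2 * sg c \<in> idl 1" by (simp only:)
    moreover have u4: "unit (2 * 2 * sg c)" using unit_mult[OF unit_mult[OF two two] sg_unit[OF c]] .
    ultimately show False using unit_iff[OF unit_R[OF u4]] by blast
  qed
  then show ?thesis
  proof
    assume un: "unit (B ?u ?u)"
    let ?g = "tau ?u (- 2 / B ?u ?u)"
    show ?thesis
    proof (rule that)
      show "?g \<in> iso" by (rule reflection_iso[OF eps R(1) un])
      have "B ?u ?u + 2 * B ?u ?e = B w w - sg c" unfolding Bu by (simp add: algebra_simps)
      then have "B ?u ?u + 2 * B ?u ?e \<in> idl 1" using N by (simp only:)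
      from reflection_cong(1)[OF eps R(1) un _ this] show "act ?g ?e i - w i \<in> idl 1" if "i < n" for i using that by simp
      show "act ?g (e x) i - e x i \<in> idl 1" if x: "x \<in> F" and i: "i < n" for x i
      proof (rule reflection_cong(2)[OF eps R(1) un i])
        show "B ?u (e x) \<in> idl 1" unfolding B_left Fe[OF x] using Fw[OF x] by simp
      qed
    qed
  next
    assume un: "unit (B ?v ?v)"
    let ?g = "tau ?v (- 2 / B ?v ?v)" and ?r = "tau ?e (- 2 / B ?e ?e)"
    have ue: "unit (B ?e ?e)" using sg_unit[OF c] Bee by simp
    have gr: "?g \<in> iso" "?r \<in> iso" using reflection_iso[OF eps R(2) un] reflection_iso[OF eps e_R ue] by blast+
    have re: "act ?r ?e i = 0 + (- 1) * ?e i" if "i < n" for i unfolding act_tau[OF that] using unit_nz[OF ue] by simp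
    have rx: "act ?r (e x) i = e x i" if "x \<in> F" "i < n" for x i unfolding act_tau[OF that(2)] Fe[OF that(1)] by simp
    have comp: "act (?g * ?r) y i = act ?g (act ?r y) i" if "i < n" for y i
      by (rule act_mult[OF iso_RM[OF gr(1)] iso_RM[OF gr(2)] that])
    show ?thesis
    proof (rule that)
      show "?g * ?r \<in> iso" using matgrp.G_mult[OF iso_matgrp gr] .
      show "act (?g * ?r) ?e i - w i \<in> idl 1" if i: "i < n" for i
      proof -
        \<comment> \<open>After the first reflection e_c has become -e_c, and adding the reflecting
          vector w + e_c gives w.\<close>
        let ?m = "\<lambda>i. 0 + (- 1) * ?e i"
        have m: "B ?v ?m = - B ?v ?e" unfolding B_right by (simp add: B_def)
        have "B ?v ?v + 2 * B ?v ?m = B w w - sg c" unfolding m Bu by (simp add: algebra_simps)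
        then have "B ?v ?v + 2 * B ?v ?m \<in> idl 1" using N by (simp only:)
        from reflection_cong(1)[OF eps R(2) un i this] have "act ?g ?m i - w i \<in> idl 1" by simp
        moreover have "act ?g (act ?r ?e) i = act ?g ?m i" by (rule act_eq) (rule re)
        ultimately show ?thesis unfolding comp[OF i] by simp
      qed
      show "act (?g * ?r) (e x) i - e x i \<in> idl 1" if x: "x \<in> F" and i: "i < n" for x i
      proof -
        have "act ?g (act ?r (e x)) i = act ?g (e x) i" by (rule act_eq) (rule rx[OF x])
        moreover have "act ?g (e x) i - e x i \<in> idl 1"
        proof (rule reflection_cong(2)[OF eps R(2) un i])
          show "B ?v (e x) \<in> idl 1" unfolding B_left Fe[OF x] using Fw[OF x] by simp
        qed
        ultimately show ?thesis unfolding comp[OF i] by simp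
      qed
    qed
  qed
qed

text \<open>Each index is its own partner, so every earlier column annihilates its own row. The
  remaining condition is the norm, and by \<open>diagonal_transitive\<close> it is
  sufficient.\<close>

lemma card_diagonal_orb:
  assumes eps: "\<epsilon> = 1" and st: "\<And>x. x < n \<Longrightarrow> star x = x" and bij: "bij_betw c {..<n} {..<n}" and j: "j < n"
    and I: "I \<subseteq> {..<n}" "{..<n} - I = c ` {..<j}"
  shows "card (matgrp.orb R \<pi> n iso c j) = card (qsol sg I (sg (c j)))"
proof -
  have cn: "c r < n" if "r < n" for r using bij_betwE[OF bij] that by auto
  have inj: "c r = c r' \<longleftrightarrow> r = r'" if "r < n" "r' < n" for r r'
    using bij that unfolding bij_betw_def inj_on_def by auto
  have cj: "c j \<in> I"
  proof (rule ccontr)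
    assume "c j \<notin> I"
    then have "c j \<in> c ` {..<j}" using cn[OF j] I(2) by blast
    then obtain r where "r < j" "c j = c r" by auto
    then show False using inj[of j r] j by simp
  qed
  let ?O = "matgrp.orb R \<pi> n iso c j"
  have Bww: "B w w' = (\<Sum>k<n. sg k * w k * w' k)" for w w' unfolding B_def using st by (intro sum.cong) auto
  have O: "w \<in> ?O \<longleftrightarrow> w \<in> carrier_vec n \<and> (\<forall>r<n. w $ r \<in> T) \<and> (\<forall>r\<in>{..<n} - I. w $ r \<in> idl 1) \<and> B (vec_index w) (vec_index w) - sg (c j) \<in> idl 1"
    for w :: "'k vec"
  proof
    assume w: "w \<in> ?O"
    obtain g where g: "g \<in> iso" "w \<in> carrier_vec n" "\<And>i. i < n \<Longrightarrow> w $ i \<in> red 1 ` R"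
      "\<And>i. i < n \<Longrightarrow> g $$ (i, c j) - w $ i \<in> idl 1"
      "\<And>s i. s < j \<Longrightarrow> i < n \<Longrightarrow> g $$ (i, c s) - 1\<^sub>m n $$ (i, c s) \<in> idl 1"
      by (rule orb_memD[OF w cn[OF j]]) blast
    have "w $ r \<in> idl 1" if "r \<in> {..<n} - I" for r
    proof -
      have "r \<in> c ` {..<j}" using that I(2) by blast
      then obtain s where s: "s < j" "r = c s" by auto
      have rn: "r < n" "s < n" using s j cn by auto
      have "g $$ (star r, c j) - 1\<^sub>m n $$ (star r, c j) \<in> idl 1"
        by (rule fixed_column[OF g(1) rn(1) cn[OF j]]) (use g(5)[OF s(1)] s(2) in simp)
      moreover have "r \<noteq> c j" using inj[OF rn(2) j] s by simp
      ultimately have "g $$ (r, c j) \<in> idl 1" using st[OF rn(1)] rn cn[OF j] by simp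
      from idl_diff[OF this g(4)[OF rn(1)]] show ?thesis by simp
    qed
    moreover have "B (vec_index w) (vec_index w) - sg (c j) \<in> idl 1"
    proof -
      have "B (cf g (c j)) (cf g (c j)) = sg (c j)" using g(1) cn[OF j] B_e_e[OF cn[OF j] cn[OF j]] st[OF cn[OF j]] by (simp add: iso_def)
      moreover have "B (vec_index w) (vec_index w) - B (cf g (c j)) (cf g (c j)) \<in> idl 1"
      proof (rule B_cong)
        show "vec_index w i \<in> R" if "i < n" for i using red_in_R[OF g(3)[OF that]] .
        show "cf g (c j) i \<in> R" if "i < n" for i using RM_entry[OF iso_RM[OF g(1)] that cn[OF j]] by (simp add: cf_def)
        show "vec_index w i - cf g (c j) i \<in> idl 1" if "i < n" for i using g(4)[OF that] idl_commute by (simp add: cf_def)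
        then show "vec_index w i - cf g (c j) i \<in> idl 1" if "i < n" for i using that .
      qed
      ultimately show ?thesis by simp
    qed
    ultimately show "w \<in> carrier_vec n \<and> (\<forall>r<n. w $ r \<in> T) \<and> (\<forall>r\<in>{..<n} - I. w $ r \<in> idl 1) \<and> B (vec_index w) (vec_index w) - sg (c j) \<in> idl 1"
      using g(2,3) by blast
  next
    assume w: "w \<in> carrier_vec n \<and> (\<forall>r<n. w $ r \<in> T) \<and> (\<forall>r\<in>{..<n} - I. w $ r \<in> idl 1) \<and> B (vec_index w) (vec_index w) - sg (c j) \<in> idl 1"
    have wR: "vec_index w i \<in> R" if "i < n" for i using w that red_in_R by blast
    have F: "x < n \<and> x \<noteq> c j \<and> vec_index w x \<in> idl 1" if "x \<in> c ` {..<j}" for x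
    proof -
      have "x \<in> {..<n} - I" using that I(2) by simp
      then show ?thesis using w cj by auto
    qed
    obtain g where g: "g \<in> iso" "\<And>i. i < n \<Longrightarrow> act g (e (c j)) i - vec_index w i \<in> idl 1"
      "\<And>x i. x \<in> c ` {..<j} \<Longrightarrow> i < n \<Longrightarrow> act g (e x) i - e x i \<in> idl 1"
      by (rule diagonal_transitive[where w = "vec_index w" and c = "c j" and F = "c ` {..<j}", OF eps st cn[OF j] wR _ F]) (use w in blast)+
    show "w \<in> ?O"
    proof (rule orb_memI[where g = g and c = c and j = j and w = w])
      show "c i < n" if "i < j" for i using that j cn by simp
      show "act g (e (c s)) i - e (c s) i \<in> idl 1" if "s < j" "i < n" for s i by (rule g(3)) (use that in auto)
    qed (use w g cn[OF j] in auto)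
  qed
  have z: "red 1 0 \<in> T" "red 1 0 \<in> idl 1" using red_zero_iff[of "red 1 0"] by auto
  have red0: "x = red 1 0" if "x \<in> T" "x \<in> idl 1" for x using red_zero_iff that by blast
  define V where "V f = vec n (\<lambda>i. if i \<in> I then f i else red 1 0)" for f
  have finI: "finite I" using I(1) finite_subset by blast
  have Bsum: "B w w - (\<Sum>i\<in>I. sg i * w i ^ 2) \<in> idl 1" if "\<And>r. r \<in> {..<n} - I \<Longrightarrow> w r \<in> idl 1" for w
  proof -
    have "B w w = (\<Sum>i\<in>{..<n} - I. sg i * w i * w i) + (\<Sum>i\<in>I. sg i * w i * w i)"
      unfolding Bww by (rule sum.subset_diff[OF I(1)]) simp
    moreover have "(\<Sum>i\<in>{..<n} - I. sg i * w i * w i) \<in> idl 1"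
      using that idl_R sg_R by (intro idl_sum idl_mult_left mult_mem) auto
    ultimately show ?thesis by (simp add: power2_eq_square mult.assoc)
  qed
  have "bij_betw (\<lambda>w. \<lambda>i\<in>I. vec_index w i) ?O (qsol sg I (sg (c j)))"
  proof (rule bij_betw_byWitness[where f' = V])
    show "\<forall>w\<in>?O. V (\<lambda>i\<in>I. vec_index w i) = w"
    proof
      fix w assume w: "w \<in> ?O"
      show "V (\<lambda>i\<in>I. vec_index w i) = w"
      proof (rule eq_vecI)
        fix i assume "i < dim_vec w"
        then have i: "i < n" using w[unfolded O] by auto
        show "V (\<lambda>i\<in>I. vec_index w i) $ i = w $ i"
        proof (cases "i \<in> I")
          case False
          then have "w $ i \<in> idl 1" "w $ i \<in> T" using w[unfolded O] i by blast+
          then show ?thesis using red0[of "w $ i"] False i by (simp add: V_def)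
        qed (use i in \<open>simp add: V_def\<close>)
      qed (use w[unfolded O] in \<open>auto simp: V_def\<close>)
    qed
    show "\<forall>f\<in>qsol sg I (sg (c j)). (\<lambda>i\<in>I. vec_index (V f) i) = f"
    proof
      fix f assume "f \<in> qsol sg I (sg (c j))"
      then have f: "f \<in> PiE I (\<lambda>_. T)" by (simp add: qsol_def)
      show "(\<lambda>i\<in>I. vec_index (V f) i) = f"
        by (rule ext) (use f I(1) in \<open>auto simp: V_def restrict_def PiE_iff extensional_def subset_iff\<close>)
    qed
    show "(\<lambda>w. \<lambda>i\<in>I. vec_index w i) ` ?O \<subseteq> qsol sg I (sg (c j))"
    proof
      fix f assume "f \<in> (\<lambda>w. \<lambda>i\<in>I. vec_index w i) ` ?O"
      then obtain w where w: "w \<in> ?O" "f = (\<lambda>i\<in>I. vec_index w i)" by blast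
      have "f \<in> PiE I (\<lambda>_. T)" unfolding w(2) using w(1)[unfolded O] I(1) by (auto simp: subset_iff)
      moreover have "(\<Sum>i\<in>I. sg i * f i ^ 2) = (\<Sum>i\<in>I. sg i * vec_index w i ^ 2)" by (intro sum.cong) (auto simp: w(2))
      moreover have "(\<Sum>i\<in>I. sg i * vec_index w i ^ 2) - sg (c j) \<in> idl 1"
        using Bsum[of "vec_index w"] w(1)[unfolded O] idl_commute idl_trans by blast
      ultimately show "f \<in> qsol sg I (sg (c j))" by (simp add: qsol_def)
    qed
    show "V ` qsol sg I (sg (c j)) \<subseteq> ?O"
    proof
      fix w assume "w \<in> V ` qsol sg I (sg (c j))"
      then obtain f where f: "w = V f" "f \<in> PiE I (\<lambda>_. T)" "(\<Sum>i\<in>I. sg i * f i ^ 2) - sg (c j) \<in> idl 1" by (auto simp: qsol_def)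
      have w: "w $ r = (if r \<in> I then f r else red 1 0)" if "r < n" for r using that f(1) by (simp add: V_def)
      have low: "w $ r \<in> idl 1" if "r \<in> {..<n} - I" for r using w[of r] z that by simp
      have "(\<Sum>i\<in>I. sg i * vec_index w i ^ 2) = (\<Sum>i\<in>I. sg i * f i ^ 2)" using w I(1) by (intro sum.cong) auto
      then have "B (vec_index w) (vec_index w) - sg (c j) \<in> idl 1" using Bsum[of "vec_index w", OF low] f(3) idl_trans by metis
      moreover have "w $ r \<in> T" if "r < n" for r using w[OF that] f(2) z by (auto simp: PiE_iff)
      moreover have "w \<in> carrier_vec n" by (simp add: f(1) V_def)
      ultimately show "w \<in> ?O" unfolding O using low by blast
    qed
  qed
  then show ?thesis by (rule bij_betw_same_card)
qed

text \<open>Taking an index directly before its partner of opposite norm leaves at each stage either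
  whole hyperbolic planes or planes plus one extra vector of the norm sought, the two cases counted
  above.\<close>

lemma card_diagonal_residue:
  assumes eps: "\<epsilon> = 1" and st: "\<And>x. x < n \<Longrightarrow> star x = x" and n: "n = s + 2 * l" and s: "s \<le> 1"
    and sgl: "\<And>i. i < l \<Longrightarrow> sg (s + l + i) = - sg (s + i)"
  shows "card (redm 1 ` iso) = (if s = 0 then 1 else q ^ l * (q ^ l + 1)) *
    (\<Prod>i<l. (q ^ (l - i - 1) * (q ^ (l - i) - 1)) * (q ^ (l - i - 1) * (q ^ (l - i - 1) + 1)))"
proof -
  have bij: "bij_betw (hord s l) {..<n} {..<n}" using hord_bij[of s l] n by simp
  have un: "unit (sg (s + i))" if "i < l" for i using sg_unit that n by simp
  have I: "card (matgrp.orb R \<pi> n iso (hord s l) j) = card (qsol sg {x. x < s + 2 * l \<and> j \<le> hpos s l x} (sg (hord s l j)))"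
    if j: "j < n" for j
  proof (rule card_diagonal_orb[OF eps st bij j])
    show "{x. x < s + 2 * l \<and> j \<le> hpos s l x} \<subseteq> {..<n}" using n by auto
    show "{..<n} - {x. x < s + 2 * l \<and> j \<le> hpos s l x} = hord s l ` {..<j}"
    proof (intro equalityI subsetI)
      fix x assume "x \<in> {..<n} - {x. x < s + 2 * l \<and> j \<le> hpos s l x}"
      then have "x < s + 2 * l" "hpos s l x < j" using n by auto
      then show "x \<in> hord s l ` {..<j}" using hord_hpos by (intro image_eqI[of _ _ "hpos s l x"]) auto
    next
      fix x assume "x \<in> hord s l ` {..<j}"
      then obtain r where r: "r < j" "x = hord s l r" by auto
      then show "x \<in> {..<n} - {x. x < s + 2 * l \<and> j \<le> hpos s l x}"
        using hord_lt[of r s l] hpos_hord[of r s l] j n by auto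
    qed
  qed
  have ev: "card (matgrp.orb R \<pi> n iso (hord s l) (s + 2 * i)) = q ^ (l - i - 1) * (q ^ (l - i) - 1)" if "i < l" for i
    using I[of "s + 2 * i"] card_qsol_hpairs_unit[where a = sg and s = s, OF two un sgl that un[OF that]] that n
    by (simp add: hpairs_def hord_even)
  have od: "card (matgrp.orb R \<pi> n iso (hord s l) (s + 2 * i + 1)) = q ^ (l - i - 1) * (q ^ (l - i - 1) + 1)" if i: "i < l" for i
  proof -
    have "unit (sg (s + l + i))" using sg_unit i n by simp
    then have "card (qsol sg (insert (s + l + i) (hpairs s l (i + 1))) (sg (s + l + i))) = q ^ (l - (i + 1)) * (q ^ (l - (i + 1)) + 1)"
      using i by (intro card_qsol_insert_hpairs[OF two un sgl _ hpairs_step(4)[OF i]]) auto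
    then show ?thesis using I[of "s + 2 * i + 1"] i n hord_odd[of s l i] hpairs_step(2)[OF i, of s] by simp
  qed
  have fx: "(\<Prod>j<s. card (matgrp.orb R \<pi> n iso (hord s l) j)) = (if s = 0 then 1 else q ^ l * (q ^ l + 1))"
  proof (cases "s = 0")
    case False
    then have s1: "s = 1" using s by simp
    have h: "hord s l 0 = 0" using s1 by (simp add: hord_def)
    have "{x. x < s + 2 * l \<and> 0 \<le> hpos s l x} = insert 0 (hpairs s l 0)" using s1 by (auto simp: hpairs_def hpos_def)
    moreover have "card (qsol sg (insert 0 (hpairs s l 0)) (sg 0)) = q ^ (l - 0) * (q ^ (l - 0) + 1)"
      using sg_unit[of 0] n s1 by (intro card_qsol_insert_hpairs[OF two un sgl]) (auto simp: hpairs_def hpos_def)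
    ultimately have "card (matgrp.orb R \<pi> n iso (hord s l) 0) = q ^ l * (q ^ l + 1)" using I[of 0] h n s1 by simp
    moreover have "{..<s} = {0}" using s1 by auto
    ultimately show ?thesis using False by simp
  qed simp
  have "card (redm 1 ` iso) = (\<Prod>j<s + 2 * l. card (matgrp.orb R \<pi> n iso (hord s l) j))"
    using matgrp.card_residue_chain[OF iso_matgrp bij] n by simp
  then show ?thesis unfolding prod_pairs fx using ev od by simp
qed

end

subsection \<open>The split orthogonal group over the residue field\<close>

lemma sandwich_mat:
  fixes P P' x :: "'a::semiring_1 mat"
  assumes "P \<in> carrier_mat n n" "P' \<in> carrier_mat n n" "P * P' = 1\<^sub>m n" "x \<in> carrier_mat n n"
  shows "P * (P' * x * P) * P' = x"
proof -
  have c: "x * P \<in> carrier_mat n n" using assms by simp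
  have "P * (P' * x * P) = P * (P' * (x * P))" by (simp only: assoc_mult_mat[OF assms(2,4,1)])
  also have "\<dots> = P * P' * (x * P)" by (rule assoc_mult_mat[symmetric, OF assms(1,2) c])
  also have "\<dots> = x * P" unfolding assms(3) by (rule left_mult_one_mat[OF c])
  finally have "P * (P' * x * P) * P' = x * P * P'" by (simp only:)
  also have "\<dots> = x * (P * P')" by (rule assoc_mult_mat[OF assms(4,1,2)])
  also have "\<dots> = x" unfolding assms(3) by (rule right_mult_one_mat[OF assms(4)])
  finally show ?thesis .
qed

context dvr
begin

text \<open>Conjugation by an integral matrix with integral inverse respects congruences in both
  directions.\<close>

lemma card_redm_change_basis:
  assumes P: "P \<in> RM n" "P' \<in> RM n" "P * P' = 1\<^sub>m n" "P' * P = 1\<^sub>m n" and A: "A \<subseteq> RM n" and C: "C \<subseteq> RM n"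
    and AC: "\<And>x. x \<in> A \<Longrightarrow> P' * x * P \<in> C" and CA: "\<And>y. y \<in> C \<Longrightarrow> P * y * P' \<in> A"
  shows "card (redm M ` A) = card (redm M ` C)"
proof (rule card_image_eqI[where h = "\<lambda>x. P' * x * P"])
  show "P' * x * P \<in> C" if "x \<in> A" for x using AC[OF that] .
  show "\<exists>x\<in>A. redm M (P' * x * P) = redm M y" if y: "y \<in> C" for y
  proof -
    have "P' * (P * y * P') * P = y" by (rule sandwich_mat) (use P y C RM_carrier in auto)
    then show ?thesis using CA[OF y] by (intro bexI[of _ "P * y * P'"]) auto
  qed
  show "redm M x = redm M y \<longleftrightarrow> redm M (P' * x * P) = redm M (P' * y * P)" if "x \<in> A" "y \<in> A" for x y
  proof -
    have R: "x \<in> RM n" "y \<in> RM n" using that A by auto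
    have m: "mcong n M (S * x * S') (S * y * S')"
      if "mcong n M x y" "S \<in> RM n" "S' \<in> RM n" "x \<in> RM n" "y \<in> RM n" for x y S S'
      using that RM_mult RM_carrier by (intro mcong_mult mcong_refl) auto
    have "mcong n M x y \<longleftrightarrow> mcong n M (P' * x * P) (P' * y * P)"
    proof
      show "mcong n M x y \<Longrightarrow> mcong n M (P' * x * P) (P' * y * P)" using m P R by blast
    next
      assume xy: "mcong n M (P' * x * P) (P' * y * P)"
      have RR: "P' * z * P \<in> RM n" if "z \<in> RM n" for z using RM_mult[OF RM_mult[OF P(2) that] P(1)] .
      have m': "mcong n M (P * (P' * x * P) * P') (P * (P' * y * P) * P')" by (rule m[OF xy P(1,2) RR[OF R(1)] RR[OF R(2)]])
      have z: "P * (P' * z * P) * P' = z" if "z \<in> RM n" for z by (rule sandwich_mat) (use P that RM_carrier in auto)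
      show "mcong n M x y" using m' unfolding z[OF R(1)] z[OF R(2)] .
    qed
    then show ?thesis using redm_eq_iff[OF R] redm_eq_iff[of "P' * x * P" n "P' * y * P"] RM_mult P R by simp
  qed
qed

end

context sform
begin

text \<open>P is an isometry from the new form to B, so conjugation by P identifies the two
  groups.\<close>

lemma card_isometric_forms:
  fixes star' sg'
  assumes F: "sform R \<pi> q n star' sg' \<epsilon>'"
    and P: "P \<in> RM n" "P' \<in> RM n" "P * P' = 1\<^sub>m n" "P' * P = 1\<^sub>m n"
    and B: "\<And>u v. sform.B n star' sg' u v = B (act P u) (act P v)"
  shows "card (redm M ` iso) = card (redm M ` sform.iso R n star' sg')"
proof -
  interpret F: sform R \<pi> q n star' sg' \<epsilon>' by (rule F)
  have one: "act (1\<^sub>m n) u i = u i" if "i < n" for u i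
  proof -
    have "act (1\<^sub>m n) u i = (\<Sum>j<n. if j = i then u i else 0)" unfolding act_def by (intro sum.cong) (use that in auto)
    then show ?thesis using that by simp
  qed
  have comp3: "act (S * x * S') u i = act S (act x (act S' u)) i"
    if "S \<in> RM n" "x \<in> RM n" "S' \<in> RM n" "i < n" for S x S' u i
  proof -
    have "act (S * x * S') u i = act (S * x) (act S' u) i" by (rule act_mult[OF RM_mult[OF that(1,2)] that(3,4)])
    also have "\<dots> = act S (act x (act S' u)) i" by (rule act_mult[OF that(1,2,4)])
    finally show ?thesis .
  qed
  have PP': "act P (act P' u) i = u i" "act P' (act P u) i = u i" if "i < n" for u i
    using act_mult[OF P(1,2) that, of u] act_mult[OF P(2,1) that, of u] P(3,4) one[OF that, of u] by simp_all
  show ?thesis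
  proof (rule card_redm_change_basis[OF P])
    show "iso \<subseteq> RM n" "F.iso \<subseteq> RM n" using iso_RM F.iso_RM by auto
    show "P' * x * P \<in> F.iso" if x: "x \<in> iso" for x
    proof -
      have xR: "x \<in> RM n" using iso_RM[OF x] .
      have "F.B (act (P' * x * P) u) (act (P' * x * P) v) = F.B u v" for u v
      proof -
        have a: "act P (act (P' * x * P) u) i = act x (act P u) i" if i: "i < n" for u i
        proof -
          have "act P (act (P' * x * P) u) i = act P (act P' (act x (act P u))) i"
            by (rule act_eq) (rule comp3[OF P(2) xR P(1)])
          then show ?thesis using PP'(1)[OF i] by simp
        qed
        have "F.B (act (P' * x * P) u) (act (P' * x * P) v) = B (act x (act P u)) (act x (act P v))"
          unfolding B by (rule B_eq) (use a in auto)
        also have "\<dots> = F.B u v" unfolding B_act[OF x] B ..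
        finally show ?thesis .
      qed
      moreover have "P' * x * P \<in> RM n" using RM_mult P xR by blast
      ultimately show ?thesis unfolding F.iso_iff_act by blast
    qed
    show "P * y * P' \<in> iso" if y: "y \<in> F.iso" for y
    proof -
      have yR: "y \<in> RM n" using F.iso_RM[OF y] .
      have "B (act (P * y * P') u) (act (P * y * P') v) = B u v" for u v
      proof -
        have "B (act (P * y * P') u) (act (P * y * P') v) = B (act P (act y (act P' u))) (act P (act y (act P' v)))"
          by (rule B_eq) (use comp3[OF P(1) yR P(2)] in auto)
        also have "\<dots> = F.B (act y (act P' u)) (act y (act P' v))" unfolding B ..
        also have "\<dots> = F.B (act P' u) (act P' v)" by (rule F.B_act[OF y])
        also have "\<dots> = B (act P (act P' u)) (act P (act P' v))" unfolding B ..
        also have "\<dots> = B u v" by (rule B_eq) (use PP' in auto)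
        finally show ?thesis .
      qed
      moreover have "P * y * P' \<in> RM n" using RM_mult P yR by blast
      ultimately show ?thesis unfolding iso_iff_act by blast
    qed
  qed
qed

text \<open>The basis \<open>e i + e (star i), e i - e (star i)\<close> diagonalises the split form, with norms \<open>2\<close> and \<open>- 2\<close>.\<close>

lemma card_orthogonal_residue:
  assumes eps: "\<epsilon> = 1" and st: "\<And>x. star x = hstar s l x" and n: "n = s + 2 * l" and s: "s \<le> 1"
    and sg1: "\<And>i. i < n \<Longrightarrow> sg i = 1"
  shows "card (redm 1 ` iso) = (if s = 0 then 1 else q ^ l * (q ^ l + 1)) *
    (\<Prod>i<l. (q ^ (l - i - 1) * (q ^ (l - i) - 1)) * (q ^ (l - i - 1) * (q ^ (l - i - 1) + 1)))"
proof -
  define \<eta> where "\<eta> i = (if i < s + l then 1 else - 1 :: 'k)" for i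
  define \<tau> where "\<tau> i = (if i < s then 0 else 1 :: 'k)" for i
  define N where "N i = (if i < s then 1 else inverse 2 :: 'k)" for i
  define sgD where "sgD i = (if i < s then 1 else if i < s + l then 2 else - 2 :: 'k)" for i
  have uD: "unit (sgD i)" for i using two unit_uminus[OF two] unit_1 by (simp add: sgD_def)
  interpret F: sform R \<pi> q n "\<lambda>i. i" sgD 1 by unfold_locales (use uD two in auto)
  \<comment> \<open>This map squares to 2 on the paired coordinates and to 1 on a fixed one, hence
    the factor N in the inverse matrix.\<close>
  define p where "p u i = \<eta> i * u i + \<tau> i * u (star i)" for u i
  define P where "P = mat n n (\<lambda>(i, j). (if j = i then \<eta> i else 0) + (if j = star i then \<tau> i else 0))"
  define P' where "P' = mat n n (\<lambda>(i, j). N i * ((if j = i then \<eta> i else 0) + (if j = star i then \<tau> i else 0)))"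
  have ent: "\<eta> i \<in> R" "\<tau> i \<in> R" "N i \<in> R" for i
    using one_mem uminus_mem[OF one_mem] unit_inv[OF two] by (auto simp: \<eta>_def \<tau>_def N_def)
  have PR: "P \<in> RM n" "P' \<in> RM n" using ent add_mem mult_mem by (auto simp: RM_def P_def P'_def)
  have actP: "act P u i = p u i" "act P' u i = N i * p u i" if i: "i < n" for u i
  proof -
    have "act P u i = (\<Sum>j<n. (if j = i then \<eta> i * u i else 0) + (if j = star i then \<tau> i * u (star i) else 0))"
      unfolding act_def by (intro sum.cong) (use i in \<open>auto simp: P_def algebra_simps\<close>)
    then show "act P u i = p u i" using i star_lt[OF i] by (simp add: sum.distrib p_def)
    have "act P' u i = (\<Sum>j<n. (if j = i then N i * (\<eta> i * u i) else 0) + (if j = star i then N i * (\<tau> i * u (star i)) else 0))"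
      unfolding act_def by (intro sum.cong) (use i in \<open>auto simp: P'_def algebra_simps\<close>)
    then show "act P' u i = N i * p u i" using i star_lt[OF i] by (simp add: sum.distrib p_def algebra_simps)
  qed
  have rel: "N (star i) = N i" "\<tau> (star i) = \<tau> i" "i < s \<Longrightarrow> star i = i" "\<not> i < s \<Longrightarrow> \<eta> (star i) = - \<eta> i" "\<eta> i * \<eta> i = 1"
    if "i < n" for i
    using that n by (auto simp: st hstar_def N_def \<tau>_def \<eta>_def)
  have tw: "inverse 2 * 2 = (1 :: 'k)" using unit_nz[OF two] by simp
  have inv: "N i * p (p u) i = u i" if i: "i < n" for u i
  proof (cases "i < s")
    case True
    then show ?thesis using rel(3,5)[OF i] by (simp add: p_def \<tau>_def N_def flip: mult.assoc)
  next
    case False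
    have "p (p u) i = \<eta> i * (\<eta> i * u i + u (star i)) + (- \<eta> i * u (star i) + u i)"
      using False rel(2,4)[OF i] star_star[OF i] by (simp add: p_def \<tau>_def)
    also have "\<dots> = 2 * u i" using rel(5)[OF i] by (simp add: distrib_left flip: mult.assoc)
    finally show ?thesis using False tw by (simp add: N_def flip: mult.assoc)
  qed
  have inv': "p (\<lambda>k. N k * p u k) i = u i" if i: "i < n" for u i
    using inv[OF i, of u] rel(1)[OF i] by (simp add: p_def algebra_simps)
  have pe: "p u i = p v i" if "\<And>k. k < n \<Longrightarrow> u k = v k" "i < n" for u v i
    using that star_lt by (simp add: p_def)
  have mat_eqI: "x * y = 1\<^sub>m n" if x: "x \<in> RM n" "y \<in> RM n" and xy: "\<And>u i. i < n \<Longrightarrow> act x (act y u) i = u i" for x y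
  proof (rule eq_matI)
    fix i j assume "i < dim_row (1\<^sub>m n :: 'k mat)" "j < dim_col (1\<^sub>m n :: 'k mat)"
    then have ij: "i < n" "j < n" by auto
    have "(x * y) $$ (i, j) = act (x * y) (e j) i" using act_e[OF ij(2)] by (simp add: cf_def)
    also have "\<dots> = e j i" using act_mult[OF x ij(1)] xy[OF ij(1)] by simp
    finally show "(x * y) $$ (i, j) = 1\<^sub>m n $$ (i, j)" using ij by (simp add: e_def)
  qed (use RM_carrier[OF x(1)] RM_carrier[OF x(2)] in auto)
  have PP: "P * P' = 1\<^sub>m n" "P' * P = 1\<^sub>m n"
  proof (rule mat_eqI[OF PR])
    show "act P (act P' u) i = u i" if "i < n" for u i
      unfolding actP(1)[OF that] using pe[OF actP(2) that] inv'[OF that] by simp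
    show "P' * P = 1\<^sub>m n"
    proof (rule mat_eqI[OF PR(2,1)])
      show "act P' (act P u) i = u i" if "i < n" for u i
        unfolding actP(2)[OF that] using pe[OF actP(1) that] inv[OF that] by simp
    qed
  qed
  have "F.B u v = B (act P u) (act P v)" for u v
  proof -
    let ?c = "\<lambda>k. \<eta> k * \<eta> (star k) * u k * v (star k) + \<eta> k * \<tau> k * u k * v k"
    let ?d = "\<lambda>k. \<tau> k * \<tau> k * u (star k) * v k + \<tau> k * \<eta> (star k) * u (star k) * v (star k)"
    have "B (act P u) (act P v) = (\<Sum>k<n. p u k * p v (star k))"
      unfolding B_def by (intro sum.cong) (use actP(1) sg1 star_lt in auto)
    also have "\<dots> = (\<Sum>k<n. ?c k + ?d k)"
      by (intro sum.cong) (use rel(2) star_star in \<open>auto simp: p_def algebra_simps\<close>)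
    also have "\<dots> = (\<Sum>k<n. ?c k) + (\<Sum>k<n. ?d k)" by (rule sum.distrib)
    \<comment> \<open>After reindexing by \<open>star\<close>, the mixed terms u_k v_(star k) cancel
      on pairs and the diagonal terms double.\<close>
    also have "(\<Sum>k<n. ?d k) = (\<Sum>k<n. \<tau> k * \<tau> k * u k * v (star k) + \<tau> k * \<eta> k * u k * v k)"
      by (rule sum.reindex_bij_witness[of _ star star]) (use star_lt star_star rel(2) in auto)
    also have "(\<Sum>k<n. ?c k) + \<dots> = (\<Sum>k<n. sgD k * u k * v k)"
      unfolding sum.distrib[symmetric]
    proof (rule sum.cong[OF refl])
      fix k assume "k \<in> {..<n}"
      then have k: "k < n" by simp
      show "?c k + (\<tau> k * \<tau> k * u k * v (star k) + \<tau> k * \<eta> k * u k * v k) = sgD k * u k * v k"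
      proof (cases "k < s")
        case True
        then show ?thesis using rel(3,5)[OF k] by (simp add: \<tau>_def sgD_def)
      next
        case False
        then have "?c k + (\<tau> k * \<tau> k * u k * v (star k) + \<tau> k * \<eta> k * u k * v k) = 2 * \<eta> k * u k * v k"
          using rel(4,5)[OF k] by (simp add: \<tau>_def)
        then show ?thesis using False by (simp add: \<eta>_def sgD_def)
      qed
    qed
    finally show ?thesis by (simp add: F.B_def)
  qed
  then have "card (redm 1 ` iso) = card (redm 1 ` F.iso)"
    by (rule card_isometric_forms[OF F.sform_axioms PR PP])
  also have "\<dots> = (if s = 0 then 1 else q ^ l * (q ^ l + 1)) *
    (\<Prod>i<l. (q ^ (l - i - 1) * (q ^ (l - i) - 1)) * (q ^ (l - i - 1) * (q ^ (l - i - 1) + 1)))"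
    by (rule F.card_diagonal_residue[OF refl _ n s]) (auto simp: sgD_def)
  finally show ?thesis .
qed

text \<open>Multiplication by \<open>\<rho>\<close> matches the two determinant classes, and their
  residues are disjoint because 1 and -1 are incongruent.\<close>

lemma card_SOg_residue:
  assumes rho: "\<rho> \<in> iso" "det \<rho> = - 1" shows "card (redm 1 ` iso) = 2 * card (redm 1 ` SOg)"
proof -
  interpret G: matgrp R \<pi> q n iso by (rule iso_matgrp)
  let ?O = "{x \<in> iso. det x = - 1}"
  have un: "iso = SOg \<union> ?O" using det_iso by (auto simp: SOg_def)
  have "card (redm 1 ` SOg) = card (redm 1 ` ?O)"
  proof (rule card_image_eqI[where h = "\<lambda>x. \<rho> * x"])
    show "\<rho> * x \<in> ?O" if "x \<in> SOg" for x
      using that rho G.G_mult G.G_carrier det_mult[of \<rho> n x] by (simp add: SOg_def)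
    show "\<exists>x\<in>SOg. redm 1 (\<rho> * x) = redm 1 y" if y: "y \<in> ?O" for y
    proof -
      obtain r where r: "r \<in> iso" "\<rho> * r = 1\<^sub>m n" "r * \<rho> = 1\<^sub>m n" using G.G_inv[OF rho(1)] by blast
      have c: "\<rho> \<in> carrier_mat n n" "r \<in> carrier_mat n n" "y \<in> carrier_mat n n" using rho r y G.G_carrier by auto
      have "det \<rho> * det r = 1" using det_mult[OF c(1,2)] r(2) by simp
      then have "det r = - 1" using rho(2) by (metis minus_mult_left mult_1 minus_equation_iff)
      then have "r * y \<in> SOg" using y r G.G_mult det_mult[OF c(2,3)] by (simp add: SOg_def)
      moreover have "\<rho> * (r * y) = y" using assoc_mult_mat[OF c(1,2,3)] r(2) c(3) by simp
      ultimately show ?thesis by (intro bexI[of _ "r * y"]) auto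
    qed
    show "redm 1 x = redm 1 y \<longleftrightarrow> redm 1 (\<rho> * x) = redm 1 (\<rho> * y)" if "x \<in> SOg" "y \<in> SOg" for x y
    proof -
      have xy: "x \<in> iso" "y \<in> iso" using that by (auto simp: SOg_def)
      then have R: "x \<in> RM n" "y \<in> RM n" "\<rho> * x \<in> RM n" "\<rho> * y \<in> RM n" "\<rho> \<in> RM n" using iso_RM G.G_mult rho by auto
      have "mcong n 1 (\<rho> * x) (\<rho> * y)" if "mcong n 1 x y" using that R RM_carrier by (intro mcong_mult mcong_refl) auto
      then show ?thesis using redm_eq_iff[OF R(1,2)] redm_eq_iff[OF R(3,4)] G.mcong_left_cancel[OF rho(1) R(1,2)] by blast
    qed
  qed
  moreover have "redm 1 ` SOg \<inter> redm 1 ` ?O = {}"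
  proof (rule ccontr)
    assume "redm 1 ` SOg \<inter> redm 1 ` ?O \<noteq> {}"
    then obtain x y where xy: "x \<in> SOg" "y \<in> ?O" "redm 1 x = redm 1 y" by auto
    then have R: "x \<in> RM n" "y \<in> RM n" using iso_RM by (auto simp: SOg_def)
    have "det x - det y \<in> idl 1" using det_cong[OF R] redm_eq_iff[OF R] xy(3) by simp
    then have "2 \<in> idl 1" using xy by (simp add: SOg_def)
    then show False using unit_iff[OF unit_R[OF two]] two by simp
  qed
  moreover have "finite (redm 1 ` SOg)" "finite (redm 1 ` ?O)"
    using redm_finite[of SOg n 1] redm_finite[of ?O n 1] iso_RM by (auto simp: SOg_def subset_iff)
  moreover have "redm 1 ` iso = redm 1 ` SOg \<union> redm 1 ` ?O" using un by (metis image_Un)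
  ultimately show ?thesis by (simp add: card_Un_disjoint)
qed

end

section \<open>Self-similarity of the classical groups\<close>

context dvr
begin

text \<open>The weight is k at index 0 and 0 elsewhere. Elementary matrices move e_0 to e_0 + t e_r,
  so \<open>two_translates_eigen\<close> makes every basis vector an eigenvector with the same
  eigenvalue \<open>\<mu>\<close>; then \<open>\<mu>\<close> to the power l + 1 is the determinant
  1.\<close>

lemma special_linear_self_similar:
  assumes l: "l \<ge> 1" and m: "m \<ge> 1" and k: "k \<ge> 1" and two: "unit 2" and un: "unit (of_nat (l + 1))"
  shows "self_similar_of_index (matgrp.GG (l + 1) (SLR (l + 1)))
    (card (redm 1 ` SLR (l + 1)) * q ^ ((m - 1) * (l\<^sup>2 + 2 * l) + l * k))"
proof -
  define n where "n = l + 1"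
  define h where "h i = (if i = 0 then k else 0)" for i :: nat
  have n0: "0 < n" by (simp add: n_def)
  interpret G: matgrp R \<pi> q n "SLR n" by (rule SLR_matgrp)
  interpret G: matgrp_conj R \<pi> q n "SLR n" h m
  proof
    show "conj n h x \<in> SLR n" if "x \<in> SLR n" "conj n h x \<in> RM n" for x
      using that det_conj[OF G.G_carrier[OF that(1)]] by (simp add: SLR_def)
  qed (rule m)
  define M where "M = m + k"
  obtain \<delta> where \<delta>: "\<delta> * card (redm M ` G.D) = card (redm M ` SLR n)" "self_similar_of_index G.GG \<delta>"
  proof (rule G.self_similar[where M = M and K = k])
    show "h i \<le> k" for i by (simp add: h_def)
    show "m + k \<le> M" by (simp add: M_def)
    fix x assume x: "x \<in> G.D" and zero: "\<And>g g' i j. \<lbrakk>g \<in> SLR n; g' \<in> SLR n; g * g' = 1\<^sub>m n; g' * g = 1\<^sub>m n; i < n; j < n; h i < h j\<rbrakk>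
      \<Longrightarrow> (g' * x * g) $$ (i, j) = 0"
    have xG: "x \<in> SLR n" using x by (simp add: G.D_def)
    have eig: "\<exists>\<mu>. \<forall>i<n. (x * g) $$ (i, 0) = \<mu> * g $$ (i, 0)" if g: "g \<in> SLR n" for g
    proof -
      obtain g' where g': "g' \<in> SLR n" "g * g' = 1\<^sub>m n" "g' * g = 1\<^sub>m n" using G.G_inv g by blast
      have c: "g \<in> carrier_mat n n" "g' \<in> carrier_mat n n" "x \<in> carrier_mat n n" using G.G_carrier g g' xG by auto
      let ?y = "g' * x * g"
      have yG: "?y \<in> SLR n" using G.G_mult g g' xG by blast
      have "g * ?y = g * (g' * (x * g))" using assoc_mult_mat[OF c(2) c(3) c(1)] by simp
      also have "\<dots> = g * g' * (x * g)" by (rule assoc_mult_mat[symmetric, OF c(1) c(2)]) (use c in auto)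
      also have "\<dots> = x * g" unfolding g'(2) using c by simp
      finally have gy: "g * ?y = x * g" .
      have z: "?y $$ (i, 0) = 0" if "i < n" "i \<noteq> 0" for i
        by (rule zero[OF g g'(1) g'(2) g'(3) that(1) n0]) (use that k in \<open>simp add: h_def\<close>)
      have "(x * g) $$ (i, 0) = ?y $$ (0, 0) * g $$ (i, 0)" if i: "i < n" for i
      proof -
        have "(x * g) $$ (i, 0) = (\<Sum>r<n. g $$ (i, r) * ?y $$ (r, 0))"
          unfolding gy[symmetric] by (rule mat_mult_index[OF c(1) G.G_carrier[OF yG] i n0])
        also have "\<dots> = (\<Sum>r<n. if r = 0 then g $$ (i, 0) * ?y $$ (0, 0) else 0)"
          by (intro sum.cong) (use z in auto)
        finally show ?thesis using n0 by simp
      qed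
      then show ?thesis by blast
    qed
    have xc: "x \<in> carrier_mat n n" using G.G_carrier[OF xG] .
    obtain \<mu> where \<mu>: "\<And>i. i < n \<Longrightarrow> x $$ (i, 0) = \<mu> * (if i = 0 then 1 else 0)"
    proof -
      obtain \<mu> where "\<forall>i<n. (x * 1\<^sub>m n) $$ (i, 0) = \<mu> * 1\<^sub>m n $$ (i, 0)" using eig[OF G.G_one] by blast
      then show ?thesis using that[of \<mu>] xc n0 by simp
    qed
    have col: "x $$ (i, r) = \<mu> * (if i = r then 1 else 0)" if i: "i < n" and r: "r < n" "r \<noteq> 0" for i r
    proof -
      have ex: "\<exists>\<nu>. \<forall>i<n. x $$ (i, 0) + t * x $$ (i, r) = \<nu> * ((if i = 0 then 1 else 0) + t * (if i = r then 1 else 0))"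
        if t: "t \<in> R" for t
      proof -
        let ?g = "addrow_mat n t r 0"
        have "?g $$ (i, j) \<in> R" if "i < n" "j < n" for i j using that t one_mem add_mem by (auto simp: addrow_mat_def)
        then have g: "?g \<in> SLR n" using det_addrow_mat[of r 0 n t] r by (simp add: SLR_def RM_def)
        have g0: "?g $$ (i, 0) = (if i = 0 then 1 else 0) + t * (if i = r then 1 else 0)" if "i < n" for i
          using that n0 r by (auto simp: addrow_mat_def)
        have "(x * ?g) $$ (i, 0) = x $$ (i, 0) + t * x $$ (i, r)" if i: "i < n" for i
        proof -
          have "(x * ?g) $$ (i, 0) = (\<Sum>s<n. x $$ (i, s) * ?g $$ (s, 0))"
            by (rule mat_mult_index[OF xc G.G_carrier[OF g] i n0])
          also have "\<dots> = (\<Sum>s<n. (if s = 0 then x $$ (i, 0) else 0) + (if s = r then t * x $$ (i, r) else 0))"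
            by (intro sum.cong) (use g0 r in \<open>auto simp: algebra_simps\<close>)
          finally show ?thesis using n0 r by (simp add: sum.distrib)
        qed
        then show ?thesis using eig[OF g] g0 by simp
      qed
      obtain \<nu>1 where n1: "\<forall>i<n. x $$ (i, 0) + 1 * x $$ (i, r) = \<nu>1 * ((if i = 0 then 1 else 0) + 1 * (if i = r then 1 else 0))"
        using ex[OF one_mem] by blast
      obtain \<nu>2 where n2: "\<forall>i<n. x $$ (i, 0) + - 1 * x $$ (i, r) = \<nu>2 * ((if i = 0 then 1 else 0) + - 1 * (if i = r then 1 else 0))"
        using ex[OF uminus_mem[OF one_mem]] by blast
      show ?thesis
      proof (rule two_translates_eigen[where v = "\<lambda>i. if i = 0 then 1 else 0" and u = "\<lambda>i. if i = r then 1 else 0" and t = 1 and n = n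
            and i = r and j = 0 and Av = "\<lambda>i. x $$ (i, 0)" and Au = "\<lambda>i. x $$ (i, r)" and \<mu> = \<nu>1 and \<nu> = \<nu>2 and \<kappa> = \<mu> and k = i])
        show "x $$ (k, 0) - 1 * x $$ (k, r) = \<nu>2 * ((if k = 0 then 1 else 0) - 1 * (if k = r then 1 else 0))" if "k < n" for k
          using n2[rule_format, OF that] by simp
        show "x $$ (k, 0) = \<mu> * (if k = 0 then 1 else 0)" if "k < n" for k by (rule \<mu>[OF that])
        show "x $$ (k, 0) + 1 * x $$ (k, r) = \<nu>1 * ((if k = 0 then 1 else 0) + 1 * (if k = r then 1 else 0))" if "k < n" for k
          by (rule n1[rule_format, OF that])
        show "(2 :: 'k) \<noteq> 0" by (rule unit_nz[OF two])
        show "r < n" "0 < n" "i < n" by (rule r n0 i)+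
      qed (use r in simp_all)
    qed
    have xs: "x = \<mu> \<cdot>\<^sub>m 1\<^sub>m n"
    proof (rule eq_matI)
      fix i j assume "i < dim_row (\<mu> \<cdot>\<^sub>m 1\<^sub>m n)" "j < dim_col (\<mu> \<cdot>\<^sub>m 1\<^sub>m n)"
      then have ij: "i < n" "j < n" by auto
      show "x $$ (i, j) = (\<mu> \<cdot>\<^sub>m 1\<^sub>m n) $$ (i, j)" using \<mu>[OF ij(1)] col[OF ij] ij by (cases "j = 0") auto
    qed (use xc in auto)
    have "\<mu> ^ n = 1" using xG unfolding SLR_def xs by simp
    moreover have "x $$ (0, 0) - 1\<^sub>m n $$ (0, 0) \<in> idl m" using x n0 unfolding G.D_def mcong_def by blast
    then have "\<mu> - 1 \<in> idl 1" using \<mu>[OF n0] n0 idl_mono[OF m] by simp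
    ultimately have "\<mu> = 1" using unipotent_root_of_unity un by (simp add: n_def)
    then show "x = 1\<^sub>m n" unfolding xs by (intro eq_matI) auto
  qed
  define lev where "lev i j = m + (h j - h i)" for i j
  \<comment> \<open>The full extra divisibility is demanded exactly in the l entries of column 0
    below the diagonal; every other entry has k steps left up to M.\<close>
  have lev: "M - lev i j = (if j = 0 \<and> i \<noteq> 0 then 0 else k)" "m \<le> lev i j" "lev i j \<le> M" for i j
    by (auto simp: lev_def h_def M_def)
  have M: "m \<le> M" "1 \<le> M" "M - m = k" using m by (auto simp: M_def)
  have "G.D = {x \<in> SLR n. \<forall>i<n. \<forall>j<n. x $$ (i, j) - 1\<^sub>m n $$ (i, j) \<in> idl (lev i j)}"
    unfolding lev_def using G.D_iff by blast
  moreover have "card (redm M ` {x \<in> SLR n. \<forall>i<n. \<forall>j<n. x $$ (i, j) - 1\<^sub>m n $$ (i, j) \<in> idl (lev i j)}) * q ^ (M - m)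
      = (\<Prod>i<n. \<Prod>j<n. q ^ (M - lev i j))"
  proof (rule card_SLR_level)
    show "n \<ge> 1" using n0 by simp
    show "m \<le> lev i j \<and> lev i j \<le> M" for i j using lev(2,3) by blast
    show "lev 0 0 = m" by (simp add: lev_def)
  qed (use m M in auto)
  ultimately have "card (redm M ` G.D) * q ^ k = (\<Prod>i<n. \<Prod>j<n. q ^ (M - lev i j))" unfolding M(3) by (simp only:)
  also have "\<dots> = (\<Prod>i<Suc l. \<Prod>j<Suc l. q ^ (if j = 0 \<and> i \<noteq> 0 then 0 else k))"
    unfolding lev(1) n_def Suc_eq_plus1 ..
  also have "\<dots> = (\<Prod>i<Suc l. q ^ ((if i = 0 then k else 0) + k * l))"
  proof (rule prod.cong[OF refl])
    fix i :: nat
    show "(\<Prod>j<Suc l. q ^ (if j = 0 \<and> i \<noteq> 0 then 0 else k)) = q ^ ((if i = 0 then k else 0) + k * l)"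
      unfolding prod.lessThan_Suc_shift by (simp add: power_add flip: power_mult)
  qed
  also have "\<dots> = q ^ (k + k * l + k * l * l)"
    unfolding prod.lessThan_Suc_shift by (simp add: power_add flip: power_mult)
  finally have cD: "card (redm M ` G.D) * q ^ k = q ^ (k + k * l + k * l * l)" .
  have G1: "G.G1 = {x \<in> SLR n. \<forall>i<n. \<forall>j<n. x $$ (i, j) - 1\<^sub>m n $$ (i, j) \<in> idl 1}"
    by (auto simp: G.G1_def mcong_def)
  have "card (redm M ` G.G1) * q ^ (M - 1) = (\<Prod>i<n. \<Prod>j<n. q ^ (M - 1))"
    unfolding G1
  proof (rule card_SLR_level[where lev = "\<lambda>i j. 1" and m = 1])
    show "n \<ge> 1" using n0 by simp
  qed (use M in auto)
  also have "\<dots> = q ^ ((M - 1) * (l + 1) * (l + 1))"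
    unfolding prod_constant card_lessThan n_def by (simp only: power_mult)
  finally have c1: "card (redm M ` G.G1) * q ^ (M - 1) = q ^ ((M - 1) * (l + 1) * (l + 1))" .
  let ?c = "card (redm 1 ` SLR n)"
  obtain a where a: "m = Suc a" using m by (cases m) auto
  have "\<delta> * q ^ (k + k * l + k * l * l + (M - 1)) = \<delta> * card (redm M ` G.D) * q ^ k * q ^ (M - 1)"
    unfolding power_add[of q "k + k * l + k * l * l"] cD[symmetric] by (simp only: mult.assoc)
  also have "\<dots> = ?c * (card (redm M ` G.G1) * q ^ (M - 1)) * q ^ k"
    unfolding \<delta>(1) G.card_residue_split[OF M(2)] by (simp only: mult_ac)
  also have "\<dots> = ?c * q ^ ((M - 1) * (l + 1) * (l + 1) + k)" unfolding c1 by (simp only: power_add mult.assoc)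
  also have "(M - 1) * (l + 1) * (l + 1) + k = ((m - 1) * (l\<^sup>2 + 2 * l) + l * k) + (k + k * l + k * l * l + (M - 1))"
    by (simp add: M_def a algebra_simps power2_eq_square)
  finally have *: "\<delta> * q ^ (k + k * l + k * l * l + (M - 1)) =
      ?c * q ^ ((m - 1) * (l\<^sup>2 + 2 * l) + l * k) * q ^ (k + k * l + k * l * l + (M - 1))"
    by (simp only: power_add mult.assoc)
  have "q ^ (k + k * l + k * l * l + (M - 1)) \<noteq> 0" using q_gt_1 by simp
  from mult_right_cancel[OF this, THEN iffD1, OF *]
  have "\<delta> = ?c * q ^ ((m - 1) * (l\<^sup>2 + 2 * l) + l * k)" .
  then show ?thesis using \<delta>(2) by (simp add: n_def)
qed

end

context sform
begin

lemma symplectic_self_similar: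
  assumes "\<epsilon> = - 1" "i0 < n" "star i0 \<noteq> i0" "m \<ge> 1" "k \<ge> 1"
  shows "self_similar_of_index (matgrp.GG n iso) (card (redm 1 ` iso) * q ^ ((m - 1) * card Fr + wsum k))"
proof (rule form_self_similar[OF iso_matgrp _ _ _ assms(2-5)])
  show "x = 1\<^sub>m n" if "x \<in> iso" "mcong n 1 x (1\<^sub>m n)"
    "\<And>g. g \<in> iso \<Longrightarrow> \<exists>\<mu>. \<forall>i<n. act x (cf g i0) i = \<mu> * cf g i0 i" for x
    by (rule symplectic_core[OF assms(1) that(1,2) assms(2,3) that(3)])
qed auto

lemma orthogonal_self_similar:
  assumes "\<epsilon> = 1" "\<And>i. i < n \<Longrightarrow> sg i = 1" "i0 < n" "star i0 \<noteq> i0" "n \<ge> 3" "m \<ge> 1" "k \<ge> 1"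
    and rho: "\<rho> \<in> iso" "det \<rho> = - 1" "\<And>i. i < n \<Longrightarrow> cf \<rho> i0 i = e i0 i"
  shows "self_similar_of_index (matgrp.GG n SOg) (card (redm 1 ` SOg) * q ^ ((m - 1) * card Fr + wsum k))"
proof (rule form_self_similar[OF SOg_matgrp _ near_SOg _ assms(3,4,6,7)])
  show "SOg \<subseteq> iso" by (auto simp: SOg_def)
  show "conj n h x \<in> SOg" if "x \<in> SOg" "conj n h x \<in> iso" for x h
    using that det_conj[of x n h] RM_carrier[OF iso_RM] by (simp add: SOg_def)
  show "x = 1\<^sub>m n" if "x \<in> iso" "mcong n 1 x (1\<^sub>m n)"
    "\<And>g. g \<in> SOg \<Longrightarrow> \<exists>\<mu>. \<forall>i<n. act x (cf g i0) i = \<mu> * cf g i0 i" for x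
    by (rule orthogonal_core[OF assms(1,2) that(1,2) assms(3,4,5) rho that(3)])
qed

text \<open>Exchanging a basis vector with its partner supplies an isometry of determinant -1 in
  even dimension.\<close>

lemma swap_iso:
  assumes a: "a < n" "star a \<noteq> a" and sg1: "\<And>i. i < n \<Longrightarrow> sg i = 1"
  shows "swaprows_mat n a (star a) \<in> iso"
proof -
  let ?s = "\<lambda>j. if j = a then star a else if j = star a then a else j"
  have sa: "star a < n" "star (star a) = a" using star_lt star_star a by auto
  have cfs: "cf (swaprows_mat n a (star a)) j i = e (?s j) i" if "i < n" "j < n" for i j
    using that by (auto simp: cf_def e_def swaprows_mat_def)
  have sn: "?s j < n" if "j < n" for j using that a sa by auto
  have "swaprows_mat n a (star a) \<in> RM n" using one_mem by (auto simp: RM_def swaprows_mat_def)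
  moreover have "B (cf (swaprows_mat n a (star a)) i) (cf (swaprows_mat n a (star a)) j) = B (e i) (e j)" if ij: "i < n" "j < n" for i j
  proof -
    have "B (cf (swaprows_mat n a (star a)) i) (cf (swaprows_mat n a (star a)) j) = B (e (?s i)) (e (?s j))"
      by (rule B_eq) (use cfs ij in auto)
    also have "\<dots> = B (e i) (e j)"
    proof -
      have si: "star i = a \<longleftrightarrow> i = star a" "star i = star a \<longleftrightarrow> i = a"
        using star_eq_iff[OF ij(1) a(1)] star_eq_iff[OF ij(1) sa(1)] sa(2) by auto
      have "?s j = star (?s i) \<longleftrightarrow> j = star i"
      proof (cases "i = a \<or> i = star a")
        case True
        then show ?thesis using sa a by auto
      next
        case False
        then show ?thesis using si by auto
      qed
      then show ?thesis
        unfolding B_e_e[OF sn[OF ij(1)] sn[OF ij(2)]] B_e_e[OF ij] sg1[OF sn[OF ij(1)]] sg1[OF ij(1)] by (simp only:)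
    qed
    finally show ?thesis .
  qed
  ultimately show ?thesis by (simp add: iso_def)
qed

text \<open>Negating a basis vector that is its own partner plays the same part in odd
  dimension.\<close>

lemma negate_iso:
  assumes a: "a < n" "star a = a" shows "multrow_mat n a (- 1) \<in> iso"
proof -
  let ?c = "\<lambda>j. if j = a then - 1 else 1 :: 'k"
  have cfs: "cf (multrow_mat n a (- 1)) j i = 0 + ?c j * e j i" if "i < n" "j < n" for i j
    using that by (auto simp: cf_def e_def multrow_mat_def)
  have "multrow_mat n a (- 1) \<in> RM n" using one_mem uminus_mem[OF one_mem] by (auto simp: RM_def multrow_mat_def)
  moreover have "B (cf (multrow_mat n a (- 1)) i) (cf (multrow_mat n a (- 1)) j) = B (e i) (e j)" if ij: "i < n" "j < n" for i j
  proof -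
    have "B (cf (multrow_mat n a (- 1)) i) (cf (multrow_mat n a (- 1)) j) = B (\<lambda>k. 0 + ?c i * e i k) (\<lambda>k. 0 + ?c j * e j k)"
      by (rule B_eq) (use cfs ij in auto)
    also have "\<dots> = ?c i * (?c j * B (e i) (e j))" unfolding B_left B_right by (simp add: B_def)
    also have "\<dots> = B (e i) (e j)" unfolding B_e_e[OF ij] using star_eq_iff[OF ij(1) a(1)] a by auto
    finally show ?thesis .
  qed
  ultimately show ?thesis by (simp add: iso_def)
qed

end

subsection \<open>The orders of the residue groups\<close>

lemma prod_from_1: "(\<Prod>i=1..l. F i) = (\<Prod>i<l. F (Suc i))" for F :: "nat \<Rightarrow> 'a::comm_monoid_mult"
  by (simp only: One_nat_def prod.atLeast1_atMost_eq)

lemma prod_reverse: "(\<Prod>i<l. F (l - i)) = (\<Prod>i<l. F (Suc i))" for F :: "nat \<Rightarrow> 'a::comm_monoid_mult"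
proof -
  have "(\<Prod>i<l. F (l - i)) = (\<Prod>i<l. F (Suc (l - Suc i)))" by (intro prod.cong) (auto simp: Suc_diff_Suc)
  also have "\<dots> = (\<Prod>i<l. F (Suc i))" by (rule prod.nat_diff_reindex[of "\<lambda>i. F (Suc i)"])
  finally show ?thesis .
qed

text \<open>Each factor q^(l+1) - q^j is q^(l+1) (1 - q^(j-l-1)). The factor with exponent 1 equals
  q - 1 up to q, which removes the determinants.\<close>

lemma special_linear_order:
  assumes q: "q > 1" and c: "(\<Prod>j<l + 1. q ^ (l + 1) - q ^ j) = c * (q - 1)"
  shows "real c = real q ^ (l\<^sup>2 + 2 * l) * (\<Prod>i=1..l. 1 - 1 / real q ^ (i + 1))"
proof -
  let ?f = "\<lambda>i. 1 - 1 / real q ^ i"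
  have q0: "real q > 0" "real q - 1 \<noteq> 0" using q by auto
  have "real c * (real q - 1) = real (\<Prod>j<l + 1. q ^ (l + 1) - q ^ j)" unfolding c using q by (simp add: of_nat_diff)
  also have "\<dots> = (\<Prod>j<l + 1. real q ^ (l + 1) * ?f (l + 1 - j))"
    unfolding of_nat_prod
  proof (rule prod.cong[OF refl])
    fix j assume j: "j \<in> {..<l + 1}"
    have le: "q ^ j \<le> q ^ (l + 1)" by (rule power_increasing) (use q j in auto)
    have "l + 1 - j + j = l + 1" using j by simp
    then have e: "real q ^ (l + 1) = real q ^ (l + 1 - j) * real q ^ j" by (metis power_add)
    have nz: "real q ^ (l + 1 - j) \<noteq> 0" using q0 by simp
    have "real (q ^ (l + 1) - q ^ j) = real q ^ (l + 1) - real q ^ j" by (simp only: of_nat_diff[OF le] of_nat_power)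
    also have "\<dots> = real q ^ (l + 1) * ?f (l + 1 - j)" unfolding e using nz by (simp add: right_diff_distrib)
    finally show "real (q ^ (l + 1) - q ^ j) = real q ^ (l + 1) * ?f (l + 1 - j)" .
  qed
  also have "\<dots> = (real q ^ (l + 1)) ^ (l + 1) * (\<Prod>i<l + 1. ?f (Suc i))"
    unfolding prod.distrib prod_reverse[of ?f] prod_constant card_lessThan ..
  also have "(\<Prod>i<l + 1. ?f (Suc i)) = (1 - 1 / real q) * (\<Prod>i=1..l. 1 - 1 / real q ^ (i + 1))"
    unfolding prod_from_1 Suc_eq_plus1[symmetric] prod.lessThan_Suc_shift by simp
  also have "(real q ^ (l + 1)) ^ (l + 1) = real q ^ (l\<^sup>2 + 2 * l) * real q"
  proof -
    have "(real q ^ (l + 1)) ^ (l + 1) = real q ^ ((l + 1) * (l + 1))" by (rule power_mult[symmetric])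
    also have "(l + 1) * (l + 1) = l\<^sup>2 + 2 * l + 1" by (simp add: power2_eq_square add_mult_distrib add_mult_distrib2)
    also have "real q ^ (l\<^sup>2 + 2 * l + 1) = real q ^ (l\<^sup>2 + 2 * l) * real q"
      unfolding power_add[of "real q" "l\<^sup>2 + 2 * l" 1] power_one_right ..
    finally show ?thesis .
  qed
  finally have *: "real c * (real q - 1) =
      (real q ^ (l\<^sup>2 + 2 * l) * (\<Prod>i=1..l. 1 - 1 / real q ^ (i + 1))) * (real q * (1 - 1 / real q))"
    by (simp only: mult_ac)
  have h: "real q * (1 - 1 / real q) = real q - 1" using q0 by (simp add: right_diff_distrib)
  show ?thesis by (rule mult_right_cancel[OF q0(2), THEN iffD1, OF *[unfolded h]])
qed

lemma symplectic_order:
  assumes q: "q > 1"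
  shows "real (\<Prod>i<l. (q ^ (2 * (l - i)) - 1) * q ^ (2 * (l - i) - 1)) =
    real q ^ (2 * l\<^sup>2 + l) * (\<Prod>i=1..l. 1 - 1 / real q ^ (2 * i))"
  unfolding prod_reverse[of "\<lambda>i. (q ^ (2 * i) - 1) * q ^ (2 * i - 1)"] prod_from_1
proof (induction l)
  case (Suc l)
  have g: "x - 1 = x * (1 - 1 / x)" if "x \<noteq> 0" for x :: real using that by (simp add: right_diff_distrib)
  have a1: "real (q ^ (2 * Suc l) - 1) = real q ^ (2 * Suc l) * (1 - 1 / real q ^ (2 * Suc l))"
  proof -
    have "1 \<le> q ^ (2 * Suc l)" by (rule one_le_power) (use q in simp)
    then have "real (q ^ (2 * Suc l) - 1) = real q ^ (2 * Suc l) - 1" by (simp only: of_nat_diff of_nat_power of_nat_1)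
    also have "\<dots> = real q ^ (2 * Suc l) * (1 - 1 / real q ^ (2 * Suc l))" by (rule g) (use q in simp)
    finally show ?thesis .
  qed
  have a2: "real q ^ (2 * (Suc l)\<^sup>2 + Suc l) = real q ^ (2 * l\<^sup>2 + l) * (real q ^ (2 * Suc l) * real q ^ (2 * Suc l - 1))"
  proof -
    have "2 * (Suc l)\<^sup>2 + Suc l = (2 * l\<^sup>2 + l) + (2 * Suc l + (2 * Suc l - 1))" by (simp add: power2_eq_square)
    then show ?thesis by (metis power_add)
  qed
  have "real (\<Prod>i<Suc l. (q ^ (2 * Suc i) - 1) * q ^ (2 * Suc i - 1)) =
      real (\<Prod>i<l. (q ^ (2 * Suc i) - 1) * q ^ (2 * Suc i - 1)) * (real (q ^ (2 * Suc l) - 1) * real q ^ (2 * Suc l - 1))"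
    by (simp only: prod.lessThan_Suc of_nat_mult of_nat_power)
  also have "\<dots> = real q ^ (2 * (Suc l)\<^sup>2 + Suc l) * ((\<Prod>i<l. 1 - 1 / real q ^ (2 * Suc i)) * (1 - 1 / real q ^ (2 * Suc l)))"
    unfolding Suc a1 a2 by (simp only: mult_ac)
  finally show ?case by (simp only: prod.lessThan_Suc)
qed simp

text \<open>The left side counts the full orthogonal group, hence the 2 in front of the order of SO.
  The induction trades (1 - 1/q^l)(q^l + 1) for the factor at 2l.\<close>

lemma orthogonal_order:
  assumes q: "q > 1" and l: "l \<ge> 1"
  shows "real (\<Prod>i<l. (q ^ (l - i - 1) * (q ^ (l - i) - 1)) * (q ^ (l - i - 1) * (q ^ (l - i - 1) + 1))) =
    2 * (real q ^ (2 * l\<^sup>2 - l) * (1 - 1 / real q ^ l) * (\<Prod>i=1..l-1. 1 - 1 / real q ^ (2 * i)))"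
  unfolding prod_reverse[of "\<lambda>i. (q ^ (i - 1) * (q ^ i - 1)) * (q ^ (i - 1) * (q ^ (i - 1) + 1))"] prod_from_1
  using l
proof (induction l rule: nat_induct_at_least)
  case base
  show ?case using q by (simp add: of_nat_diff right_diff_distrib One_nat_def)
next
  case (Suc l)
  define x where "x = real q ^ l"
  obtain b where b: "l = Suc b" using Suc(1) by (cases l) auto
  have q0: "real q > 0" using q by auto
  have x0: "x > 0" using q0 by (simp add: x_def)
  have "1 \<le> q ^ Suc l" by (rule one_le_power) (use q in simp)
  then have "real (q ^ Suc l - 1) = real q ^ Suc l - 1" by (simp only: of_nat_diff of_nat_power of_nat_1)
  then have s: "real (q ^ Suc l - 1) = real q * x - 1" by (simp add: x_def)
  have "2 * (Suc l)\<^sup>2 - Suc l = (2 * l\<^sup>2 - l) + (l + l + l + l + 1)"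
  proof -
    have "l \<le> 2 * l\<^sup>2" using Suc(1) by (simp add: power2_eq_square)
    moreover have "2 * (Suc l)\<^sup>2 = 2 * l\<^sup>2 + 4 * l + 2" by (simp add: power2_eq_square)
    ultimately show ?thesis by linarith
  qed
  then have e: "real q ^ (2 * (Suc l)\<^sup>2 - Suc l) = real q ^ (2 * l\<^sup>2 - l) * (x * x * x * x * real q)"
    by (simp only: power_add x_def power_one_right)
  have p: "(\<Prod>i<Suc l - 1. 1 - 1 / real q ^ (2 * Suc i)) = (\<Prod>i<l - 1. 1 - 1 / real q ^ (2 * Suc i)) * (1 - 1 / real q ^ (2 * l))"
    unfolding b by (simp only: diff_Suc_1 prod.lessThan_Suc)
  have y: "real q ^ (2 * l) = x * x" by (simp only: x_def mult_2 power_add)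
  have z: "real q ^ Suc l = real q * x" by (simp add: x_def)
  have h: "(1 - 1 / x) * x = x - 1" "x * real q * (1 - 1 / (real q * x)) = real q * x - 1" "x * x * (1 - 1 / (x * x)) = x * x - 1"
    using x0 q0 by (simp_all add: right_diff_distrib left_diff_distrib)
  have "(1 - 1 / x) * ((x * (real q * x - 1)) * (x * (x + 1))) = ((1 - 1 / x) * x) * ((real q * x - 1) * (x * (x + 1)))"
    by (simp only: mult_ac)
  also have "\<dots> = x * (real q * x - 1) * (x * x - 1)" unfolding h by (simp add: algebra_simps)
  also have "\<dots> = x * (x * real q * (1 - 1 / (real q * x))) * (x * x * (1 - 1 / (x * x)))" unfolding h ..
  also have "\<dots> = (x * x * x * x * real q) * (1 - 1 / (real q * x)) * (1 - 1 / (x * x))" by (simp only: mult_ac)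
  finally have *: "(1 - 1 / x) * ((x * (real q * x - 1)) * (x * (x + 1))) =
      (x * x * x * x * real q) * (1 - 1 / (real q * x)) * (1 - 1 / (x * x))" .
  let ?F = "\<lambda>i. (q ^ (Suc i - 1) * (q ^ Suc i - 1)) * (q ^ (Suc i - 1) * (q ^ (Suc i - 1) + 1))"
  have "real (?F l) = (x * (real q * x - 1)) * (x * (x + 1))"
    unfolding of_nat_mult diff_Suc_1 s by (simp add: x_def)
  then have "real (\<Prod>i<Suc l. ?F i) =
      2 * (real q ^ (2 * l\<^sup>2 - l) * (1 - 1 / x) * (\<Prod>i<l - 1. 1 - 1 / real q ^ (2 * Suc i))) * ((x * (real q * x - 1)) * (x * (x + 1)))"
    unfolding prod.lessThan_Suc of_nat_mult[of "\<Prod>i<l. ?F i"] Suc(2) x_def[symmetric] by (simp only:)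
  also have "\<dots> = 2 * (real q ^ (2 * l\<^sup>2 - l) * ((1 - 1 / x) * ((x * (real q * x - 1)) * (x * (x + 1)))) * (\<Prod>i<l - 1. 1 - 1 / real q ^ (2 * Suc i)))"
    by (simp only: mult_ac)
  also have "\<dots> = 2 * (real q ^ (2 * (Suc l)\<^sup>2 - Suc l) * (1 - 1 / real q ^ Suc l) * (\<Prod>i<Suc l - 1. 1 - 1 / real q ^ (2 * Suc i)))"
    unfolding * e p y z by (simp only: mult_ac)
  finally show ?case .
qed

subsection \<open>The index of the virtual endomorphism\<close>

text \<open>F is the dimension: the order of the residue group contributes the missing q^F that
  turns (m - 1) F into m F.\<close>

lemma index_combine:
  assumes c: "real c = real q ^ F * P" and m: "m \<ge> 1"
  shows "real (c * q ^ ((m - 1) * F + w)) = real q ^ (w + F * m) * P"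
proof -
  obtain a where a: "m = Suc a" using m by (cases m) auto
  have "w + F * m = F + ((m - 1) * F + w)" using a by simp
  then show ?thesis by (simp only: of_nat_mult of_nat_power c power_add mult_ac)
qed

context dvr
begin

lemma special_linear_index:
  assumes "l \<ge> 1" "m \<ge> 1" "k \<ge> 1" "unit 2" "unit (of_nat (l + 1))"
  shows "\<exists>\<delta>. real \<delta> = real q ^ (l * k + (l\<^sup>2 + 2 * l) * m) * (\<Prod>i=1..l. 1 - 1 / real q ^ (i + 1))
    \<and> self_similar_of_index (SL (l + 1) R) \<delta>"
proof -
  have eq: "SL (l + 1) R = matgrp.GG (l + 1) (SLR (l + 1))"
    unfolding SL_def matgrp.GG_def[OF SLR_matgrp] unfolding SLR_def RM_iff_elements by (simp only: conj_assoc)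
  have c: "real (card (redm 1 ` SLR (l + 1))) = real q ^ (l\<^sup>2 + 2 * l) * (\<Prod>i=1..l. 1 - 1 / real q ^ (i + 1))"
    by (rule special_linear_order[OF q_gt_1 card_SLR_residue]) simp
  show ?thesis
    unfolding eq by (intro exI conjI, rule index_combine[OF c assms(2)], rule special_linear_self_similar[OF assms])
qed

lemma symplectic_index:
  assumes l: "l \<ge> 1" and "m \<ge> 1" "k \<ge> 1" "unit 2"
  shows "\<exists>\<delta>. real \<delta> = real q ^ (2 * l * k + (2 * l\<^sup>2 + l) * m) * (\<Prod>i=1..l. 1 - 1 / real q ^ (2 * i))
    \<and> self_similar_of_index (Sp_even l R) \<delta>"
proof -
  define sg where "sg i = (if i < l then 1 else - 1 :: 'k)" for i
  interpret S: sform R \<pi> q "2 * l" "hstar 0 l" sg "- 1"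
    by unfold_locales (use unit_1 unit_uminus[OF unit_1] assms(4) in \<open>auto simp: hstar_def sg_def\<close>)
  \<comment> \<open>Decides the test \<open>\<epsilon> = 1\<close> in \<open>Fr\<close> and
    \<open>wsum\<close>.\<close>
  have neg: "- 1 \<noteq> (1 :: 'k)"
  proof
    assume "- 1 = (1 :: 'k)"
    then have "1 + 1 = (0 :: 'k)" by (metis add.right_inverse)
    then show False using unit_nz[OF assms(4)] by simp
  qed
  have gram: "S.gram = sp_form l"
    by (rule eq_matI) (use l in \<open>auto simp: S.gram_def sp_form_def hstar_def sg_def\<close>)
  have "x \<in> S.iso \<longleftrightarrow> x \<in> carrier_mat (2 * l) (2 * l) \<and> elements_mat x \<subseteq> R \<and> transpose_mat x * sp_form l * x = sp_form l" for x
    unfolding S.iso_iff_gram RM_iff_elements gram by (simp only: conj_assoc)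
  then have "{x \<in> carrier_mat (2 * l) (2 * l). elements_mat x \<subseteq> R \<and> transpose_mat x * sp_form l * x = sp_form l} = S.iso"
    by blast
  then have eq: "Sp_even l R = matgrp.GG (2 * l) S.iso"
    unfolding Sp_even_def matgrp.GG_def[OF S.iso_matgrp] by (simp only:)
  have ss: "self_similar_of_index (matgrp.GG (2 * l) S.iso) (card (redm 1 ` S.iso) * q ^ ((m - 1) * card S.Fr + S.wsum k))"
    by (rule S.symplectic_self_similar[where ?i0.0 = 0]) (use assms in \<open>auto simp: hstar_def\<close>)
  have Fr: "card S.Fr = 2 * l\<^sup>2 + l"
  proof -
    obtain a where a: "l = Suc a" using l by (cases l) auto
    have "2 * l - 1 = 2 * a + 1" using a by simp
    then have "2 * card S.Fr = 2 * l * (2 * a + 1) + 2 * (2 * l)" using S.card_Fr neg by (simp only: if_False)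
    then have "2 * card S.Fr = 2 * (2 * l\<^sup>2 + l)" unfolding a by (simp add: power2_eq_square algebra_simps)
    then show ?thesis by simp
  qed
  have w: "S.wsum k = 2 * l * k"
  proof -
    have "S.wsum k = (2 * l - 2) * k + 2 * k" unfolding S.wsum_def using neg by (simp only: if_False)
    also have "\<dots> = (2 * l - 2 + 2) * k" by (simp only: distrib_right)
    also have "2 * l - 2 + 2 = 2 * l" using l by simp
    finally show ?thesis .
  qed
  have "card (redm 1 ` S.iso) = (\<Prod>i<l. (q ^ (2 * (l - i)) - 1) * q ^ (2 * (l - i) - 1))"
    by (rule S.card_symplectic_residue) auto
  then have c: "real (card (redm 1 ` S.iso)) = real q ^ (2 * l\<^sup>2 + l) * (\<Prod>i=1..l. 1 - 1 / real q ^ (2 * i))"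
    using symplectic_order[OF q_gt_1] by (simp only:)
  show ?thesis
    unfolding eq by (intro exI conjI, rule index_combine[OF c assms(2)], rule ss[unfolded Fr w])
qed

lemma even_orthogonal_index:
  assumes l: "l \<ge> 2" and "m \<ge> 1" "k \<ge> 1" "unit 2"
  shows "\<exists>\<delta>. real \<delta> = real q ^ ((2 * l - 2) * k + (2 * l\<^sup>2 - l) * m) * (1 - 1 / real q ^ l) * (\<Prod>i=1..l-1. 1 - 1 / real q ^ (2 * i))
    \<and> self_similar_of_index (SO_even l R) \<delta>"
proof -
  interpret S: sform R \<pi> q "2 * l" "hstar 0 l" "\<lambda>i. 1" 1
    by unfold_locales (use unit_1 assms(4) in \<open>auto simp: hstar_def\<close>)
  have gram: "S.gram = so_even_form l"
    by (rule eq_matI) (use l in \<open>auto simp: S.gram_def so_even_form_def hstar_def\<close>)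
  have cS: "carrier (SL (2 * l) R) = {x \<in> carrier_mat (2 * l) (2 * l). elements_mat x \<subseteq> R \<and> det x = 1}" by (simp add: SL_def)
  have "x \<in> S.iso \<longleftrightarrow> x \<in> carrier_mat (2 * l) (2 * l) \<and> elements_mat x \<subseteq> R \<and> transpose_mat x * so_even_form l * x = so_even_form l" for x
    unfolding S.iso_iff_gram RM_iff_elements gram by (simp only: conj_assoc)
  then have "{x \<in> carrier (SL (2 * l) R). transpose_mat x * so_even_form l * x = so_even_form l} = S.SOg"
    unfolding cS S.SOg_def by blast
  then have "SO_even l R = (SL (2 * l) R)\<lparr>carrier := S.SOg\<rparr>" unfolding SO_even_def by (simp only:)
  then have eq: "SO_even l R = matgrp.GG (2 * l) S.SOg" by (simp add: SL_def matgrp.GG_def[OF S.SOg_matgrp])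
  \<comment> \<open>Index 1 and its partner are swapped, so that e_0, the vector translated by the
    group, stays fixed; this is where l is at least 2.\<close>
  let ?\<rho> = "swaprows_mat (2 * l) 1 (hstar 0 l 1) :: 'k mat"
  have rho: "?\<rho> \<in> S.iso" "det ?\<rho> = - 1"
  proof -
    show "?\<rho> \<in> S.iso" by (rule S.swap_iso) (use l in \<open>auto simp: hstar_def\<close>)
    show "det ?\<rho> = - 1" by (rule det_swaprows_mat) (use l in \<open>auto simp: hstar_def\<close>)
  qed
  have ss: "self_similar_of_index (matgrp.GG (2 * l) S.SOg) (card (redm 1 ` S.SOg) * q ^ ((m - 1) * card S.Fr + S.wsum k))"
  proof (rule S.orthogonal_self_similar[where ?i0.0 = 0 and \<rho> = ?\<rho>])
    show "S.cf ?\<rho> 0 i = S.e 0 i" if "i < 2 * l" for i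
      using that l by (auto simp: S.cf_def S.e_def swaprows_mat_def hstar_def)
    show "?\<rho> \<in> S.iso" "det ?\<rho> = - 1" by (rule rho)+
  qed (use assms in \<open>auto simp: hstar_def\<close>)
  have Fr: "card S.Fr = 2 * l\<^sup>2 - l"
  proof -
    obtain a where a: "l = Suc a" using l by (cases l) auto
    have "2 * l - 1 = 2 * a + 1" using a by simp
    then have "2 * card S.Fr = 2 * l * (2 * a + 1)" using S.card_Fr by simp
    then have "2 * card S.Fr + 2 * l = 2 * (2 * l\<^sup>2)" unfolding a by (simp add: power2_eq_square algebra_simps)
    then show ?thesis by linarith
  qed
  have w: "S.wsum k = (2 * l - 2) * k" by (simp add: S.wsum_def)
  have c: "real (card (redm 1 ` S.SOg)) = real q ^ (2 * l\<^sup>2 - l) * ((1 - 1 / real q ^ l) * (\<Prod>i=1..l-1. 1 - 1 / real q ^ (2 * i)))"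
  proof -
    have h: "card (redm 1 ` S.iso) = 2 * card (redm 1 ` S.SOg)" by (rule S.card_SOg_residue[OF rho])
    have "card (redm 1 ` S.iso) = (\<Prod>i<l. (q ^ (l - i - 1) * (q ^ (l - i) - 1)) * (q ^ (l - i - 1) * (q ^ (l - i - 1) + 1)))"
      using S.card_orthogonal_residue[where s = 0 and l = l] by simp
    then have "real (2 * card (redm 1 ` S.SOg)) = 2 * (real q ^ (2 * l\<^sup>2 - l) * (1 - 1 / real q ^ l) * (\<Prod>i=1..l-1. 1 - 1 / real q ^ (2 * i)))"
      using orthogonal_order[OF q_gt_1, of l] l h by simp
    then show ?thesis by simp
  qed
  show ?thesis
    unfolding eq mult.assoc[of "real q ^ ((2 * l - 2) * k + (2 * l\<^sup>2 - l) * m)"]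
    by (intro exI conjI, rule index_combine[OF c assms(2)], rule ss[unfolded Fr w])
qed

lemma odd_orthogonal_index:
  assumes l: "l \<ge> 1" and "m \<ge> 1" "k \<ge> 1" "unit 2"
  shows "\<exists>\<delta>. real \<delta> = real q ^ ((2 * l - 1) * k + (2 * l\<^sup>2 + l) * m) * (\<Prod>i=1..l. 1 - 1 / real q ^ (2 * i))
    \<and> self_similar_of_index (SO_odd l R) \<delta>"
proof -
  let ?n = "2 * l + 1"
  interpret S: sform R \<pi> q ?n "hstar 1 l" "\<lambda>i. 1" 1
    by unfold_locales (use unit_1 assms(4) in \<open>auto simp: hstar_def\<close>)
  have gram: "S.gram = so_odd_form l"
  proof (rule eq_matI)
    fix i j assume "i < dim_row (so_odd_form l :: 'k mat)" "j < dim_col (so_odd_form l :: 'k mat)"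
    then have ij: "i < 2 * l + 1" "j < 2 * l + 1" by (auto simp: so_odd_form_def so_even_form_def)
    have f: "so_odd_form l $$ (i, j) = (if i = 0 then (if j = 0 then 1 else 0) else if j = 0 then 0
        else if i - 1 < l then (if j - 1 = i - 1 + l then 1 else 0) else if j - 1 + l = i - 1 then 1 else 0 :: 'k)"
      using ij by (auto simp: so_odd_form_def so_even_form_def)
    show "S.gram $$ (i, j) = so_odd_form l $$ (i, j)"
      unfolding f using ij l by (auto simp: S.gram_def hstar_def)
  qed (auto simp: S.gram_def so_odd_form_def so_even_form_def)
  have cS: "carrier (SL ?n R) = {x \<in> carrier_mat ?n ?n. elements_mat x \<subseteq> R \<and> det x = 1}" by (simp add: SL_def)
  have "x \<in> S.iso \<longleftrightarrow> x \<in> carrier_mat ?n ?n \<and> elements_mat x \<subseteq> R \<and> transpose_mat x * so_odd_form l * x = so_odd_form l" for x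
    unfolding S.iso_iff_gram RM_iff_elements gram by (simp only: conj_assoc)
  then have "{x \<in> carrier (SL ?n R). transpose_mat x * so_odd_form l * x = so_odd_form l} = S.SOg"
    unfolding cS S.SOg_def by blast
  then have "SO_odd l R = (SL ?n R)\<lparr>carrier := S.SOg\<rparr>" unfolding SO_odd_def by (simp only:)
  then have eq: "SO_odd l R = matgrp.GG ?n S.SOg" by (simp add: SL_def matgrp.GG_def[OF S.SOg_matgrp])
  \<comment> \<open>The fixed index 0 is negated, and the similitude is centred at index 1 instead
    of 0.\<close>
  let ?\<rho> = "multrow_mat ?n 0 (- 1) :: 'k mat"
  have rho: "?\<rho> \<in> S.iso" "det ?\<rho> = - 1"
  proof -
    show "?\<rho> \<in> S.iso" by (rule S.negate_iso) (auto simp: hstar_def)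
    show "det ?\<rho> = - 1" by (rule det_multrow_mat) simp
  qed
  have ss: "self_similar_of_index (matgrp.GG ?n S.SOg) (card (redm 1 ` S.SOg) * q ^ ((m - 1) * card S.Fr + S.wsum k))"
  proof (rule S.orthogonal_self_similar[where ?i0.0 = 1 and \<rho> = ?\<rho>])
    show "S.cf ?\<rho> 1 i = S.e 1 i" if "i < ?n" for i
      using that l by (auto simp: S.cf_def S.e_def multrow_mat_def)
    show "?\<rho> \<in> S.iso" "det ?\<rho> = - 1" by (rule rho)+
  qed (use assms in \<open>auto simp: hstar_def\<close>)
  have Fr: "card S.Fr = 2 * l\<^sup>2 + l" using S.card_Fr by (simp add: power2_eq_square algebra_simps)
  have w: "S.wsum k = (2 * l - 1) * k" unfolding S.wsum_def by (simp add: One_nat_def)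
  have c: "real (card (redm 1 ` S.SOg)) = real q ^ (2 * l\<^sup>2 + l) * (\<Prod>i=1..l. 1 - 1 / real q ^ (2 * i))"
  proof -
    define x where "x = real q ^ l"
    define P where "P = (\<Prod>i=1..l-1. 1 - 1 / real q ^ (2 * i))"
    define A where "A = real q ^ (2 * l\<^sup>2 - l)"
    define Z where "Z = (\<Prod>i<l. (q ^ (l - i - 1) * (q ^ (l - i) - 1)) * (q ^ (l - i - 1) * (q ^ (l - i - 1) + 1)))"
    have x0: "x > 0" using q_gt_1 by (simp add: x_def)
    have "card (redm 1 ` S.iso) = q ^ l * (q ^ l + 1) * Z"
      unfolding Z_def using S.card_orthogonal_residue[where s = 1 and l = l] by simp
    then have "2 * card (redm 1 ` S.SOg) = q ^ l * (q ^ l + 1) * Z" using S.card_SOg_residue[OF rho] by simp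
    then have "real (2 * card (redm 1 ` S.SOg)) = real (q ^ l * (q ^ l + 1)) * real Z" by (simp only: of_nat_mult)
    also have "real Z = 2 * (A * (1 - 1 / x) * P)"
      unfolding Z_def A_def x_def P_def by (rule orthogonal_order[OF q_gt_1 l])
    also have "real (q ^ l * (q ^ l + 1)) = x * (x + 1)" by (simp add: x_def)
    finally have "2 * real (card (redm 1 ` S.SOg)) = x * (x + 1) * (2 * (A * (1 - 1 / x) * P))" by simp
    also have "\<dots> = 2 * (A * (x * (x + 1) * (1 - 1 / x)) * P)" by (simp only: mult_ac)
    finally have "real (card (redm 1 ` S.SOg)) = A * (x * (x + 1) * (1 - 1 / x)) * P" by linarith
    \<comment> \<open>The column of the extra vector contributes x (x + 1); together with 1 - 1/q^l
      it becomes the last factor 1 - 1/q^(2l).\<close>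
    also have "x * (x + 1) * (1 - 1 / x) = x * x * (1 - 1 / (x * x))" using x0 by (simp add: field_simps)
    also have "A * (x * x * (1 - 1 / (x * x))) * P = A * (x * x) * (P * (1 - 1 / (x * x)))" by (simp only: mult_ac)
    also have "x * x = real q ^ (2 * l)" by (simp only: x_def mult_2 power_add)
    also have "A * real q ^ (2 * l) = real q ^ (2 * l\<^sup>2 - l + 2 * l)" by (simp only: A_def power_add)
    also have "2 * l\<^sup>2 - l + 2 * l = 2 * l\<^sup>2 + l"
    proof -
      have "l \<le> 2 * l\<^sup>2" using l by (simp add: power2_eq_square)
      then show ?thesis by linarith
    qed
    also have "P * (1 - 1 / real q ^ (2 * l)) = (\<Prod>i=1..l. 1 - 1 / real q ^ (2 * i))"
    proof -
      obtain a where "l = Suc a" using l by (cases l) auto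
      then show ?thesis unfolding P_def prod_from_1 by (simp only: diff_Suc_1 prod.lessThan_Suc)
    qed
    finally show ?thesis .
  qed
  show ?thesis
    unfolding eq by (intro exI conjI, rule index_combine[OF c assms(2)], rule ss[unfolded Fr w])
qed

end

theorem theorem1:
  fixes p d e f q l k m :: nat
    and \<iota> :: "(nat \<Rightarrow> rat) set \<Rightarrow> 'k::field"
    and R P :: "'k set"
  assumes "Factorial_Ring.prime p"
    and "padic_extension_of_degree p \<iota> d"
    and "R = integers_of p \<iota>"
    and "maximalideal P (integer_ring p \<iota>)"
    and "is_ramification_index p \<iota> P e"
    and "is_inertia_degree p \<iota> P f"
    and "q = p ^ f"
    and "l \<ge> 1" and "k \<ge> 1" and "m \<ge> 1" and "m \<ge> e"
  shows
    "((l^2 + 2*l) * d \<le> p \<longrightarrow>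
       (\<exists>\<delta>. real \<delta> = real q ^ (l*k + (l^2 + 2*l)*m) * (\<Prod>i=1..l. 1 - 1 / real q ^ (i+1))
          \<and> self_similar_of_index (SL (l+1) R) \<delta>)) \<and>
     ((2*l^2 + l) * d \<le> p \<longrightarrow>
       (\<exists>\<delta>. real \<delta> = real q ^ (2*l*k + (2*l^2 + l)*m) * (\<Prod>i=1..l. 1 - 1 / real q ^ (2*i))
          \<and> self_similar_of_index (Sp_even l R) \<delta>)) \<and>
     (l \<ge> 2 \<and> (2*l^2 - l) * d \<le> p \<longrightarrow>
       (\<exists>\<delta>. real \<delta> = real q ^ ((2*l - 2)*k + (2*l^2 - l)*m) * (1 - 1 / real q ^ l)
                 * (\<Prod>i=1..l-1. 1 - 1 / real q ^ (2*i))
          \<and> self_similar_of_index (SO_even l R) \<delta>)) \<and>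
     ((2*l^2 + l) * d \<le> p \<longrightarrow>
       (\<exists>\<delta>. real \<delta> = real q ^ ((2*l - 1)*k + (2*l^2 + l)*m) * (\<Prod>i=1..l. 1 - 1 / real q ^ (2*i))
          \<and> self_similar_of_index (SO_odd l R) \<delta>))"
proof -
  obtain \<pi> where \<pi>: "dvr (integers_of p \<iota>) \<pi> (p ^ f)"
    "\<And>j. 0 < j \<Longrightarrow> j < p \<Longrightarrow> of_nat j \<noteq> (0 :: 'k) \<and> inverse (of_nat j) \<in> integers_of p \<iota>"
    by (rule integers_dvr[OF assms(1,2,4,5,6)]) blast
  have dvr: "dvr R \<pi> q" using \<pi>(1) assms(3,7) by simp
  have inv: "of_nat j \<noteq> (0 :: 'k) \<and> inverse (of_nat j) \<in> R" if "0 < j" "j < p" for j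
    using \<pi>(2)[OF that] assms(3) by simp
  interpret dvr R \<pi> q by (rule dvr)
  have nat_R: "of_nat j \<in> R" for j by (induction j) (auto intro: add_mem one_mem)
  have unit_nat: "unit (of_nat j)" if "0 < j" "j < p" for j using inv[OF that] nat_R by (simp add: unit_def)
  \<comment> \<open>Dimension 0 would make the field trivial. With d at least 1 the bounds on
    dimension times d bound the dimension itself by p.\<close>
  have d: "d \<ge> 1"
  proof (rule ccontr)
    interpret T: ring "ring_of_type_algebra :: 'k ring" by (rule ring_from_type_algebra)
    assume "\<not> d \<ge> 1"
    then have "d = 0" by simp
    then have "T.dimension 0 (\<iota> ` carrier (Qp p)) UNIV" using assms(2) by (simp add: padic_extension_of_degree_def)
    then have "(UNIV :: 'k set) = {0}" by (cases rule: T.dimension.cases) (auto simp: ring_of_type_algebra_def)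
    then show False by (metis UNIV_I singletonD zero_neq_one)
  qed
  have le: "x \<le> p" if "x * d \<le> p" for x :: nat
    using order.trans[OF mult_le_mono2[OF d, of x] that] by simp
  have l2: "l \<le> l ^ 2" using assms(8) by (simp add: power2_eq_square)
  \<comment> \<open>The bounds give 3 \<le> p in all four cases and l + 1 < p in the first, so 2 and
    l + 1 are units.\<close>
  have two: "unit 2" if "3 \<le> p" using unit_nat[of 2] that by simp
  have un: "unit (of_nat (l + 1))" if "l ^ 2 + 2 * l \<le> p" by (rule unit_nat) (use that l2 assms(8) in linarith)+
  show ?thesis
  proof (intro conjI impI)
    assume "(l^2 + 2*l) * d \<le> p"
    then have b: "l^2 + 2*l \<le> p" by (rule le)
    then have "3 \<le> p" using l2 assms(8) by linarith
    then show "\<exists>\<delta>. real \<delta> = real q ^ (l*k + (l^2 + 2*l)*m) * (\<Prod>i=1..l. 1 - 1 / real q ^ (i+1))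
          \<and> self_similar_of_index (SL (l+1) R) \<delta>"
      using special_linear_index[OF assms(8,10,9) two un[OF b]] by blast
  next
    assume "(2*l^2 + l) * d \<le> p"
    then have "2*l^2 + l \<le> p" by (rule le)
    then have "3 \<le> p" using l2 assms(8) by linarith
    then show "\<exists>\<delta>. real \<delta> = real q ^ (2*l*k + (2*l^2 + l)*m) * (\<Prod>i=1..l. 1 - 1 / real q ^ (2*i))
          \<and> self_similar_of_index (Sp_even l R) \<delta>"
      "\<exists>\<delta>. real \<delta> = real q ^ ((2*l - 1)*k + (2*l^2 + l)*m) * (\<Prod>i=1..l. 1 - 1 / real q ^ (2*i))
          \<and> self_similar_of_index (SO_odd l R) \<delta>"
      using symplectic_index[OF assms(8,10,9) two] odd_orthogonal_index[OF assms(8,10,9) two] by blast+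
  next
    assume h: "l \<ge> 2 \<and> (2*l^2 - l) * d \<le> p"
    then have "2*l^2 - l \<le> p" using le by blast
    moreover have "2 * l \<le> l^2" using h by (simp add: power2_eq_square)
    ultimately have "3 \<le> p" using h by linarith
    then show "\<exists>\<delta>. real \<delta> = real q ^ ((2*l - 2)*k + (2*l^2 - l)*m) * (1 - 1 / real q ^ l)
                 * (\<Prod>i=1..l-1. 1 - 1 / real q ^ (2*i))
          \<and> self_similar_of_index (SO_even l R) \<delta>"
      using even_orthogonal_index[OF _ assms(10,9) two] h by blast
  qed
qed

end
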